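(* Let $n\ge3$ and $C_A\ge1$. There exist positive constants $C_3=C_3(n,C_A)$, $\epsilon_3=\epsilon_3(n,C_A)$, $\delta_0=\delta_0(n,C_A)$ and $L=L(n,C_A)<1$ with the following properties. Let $r>0$, $E\in\mathcal{A}(C_A,13r)$ and $x_0\in\partial E$ with $e_n(x_0,13r)\le\epsilon_3$. Put $M=C(x_0,r)\cap\partial E$ and $M_0=\{y\in M:\sup_{0<s<8r}e_n(y,s)<\delta_0\}$. Then there exists a function $u:\mathbb{R}^{n-1}\to\mathbb{R}$ with $\operatorname{Lip}(u)\le L$ and $$\sup_{\mathbb{R}^{n-1}}\frac{|u|}{r}\le C_3\,e_n(x_0,13r)^{\frac1{2(n-1)}}$$ such that $M_0\subset M\cap\Gamma$, where $\Gamma=x_0+\{(z,u(z)):z\in D_r\}$. Furthermore, $$\frac{\mathcal{H}^{n-1}(M\,\Delta\,\Gamma)}{r^{n-1}}\le C_3\,e_n(x_0,13r),\qquad \frac1{r^{n-1}}\int_{D_r}|\nabla'u|^2\le C_3\,e_n(x_0,13r),$$ and, for all $x\in M$, $$\big|q(x-x_0)-u(p(x-x_0))\big|\le 2L\operatorname{dist}\big(p(x-x_0),p(M_0-x_0)\big).$$ In fact the functions $u_\pm$ on $D_r$ defined by $u_\pm=u$ on $p(M_0-x_0)$ and, for $z\in D_r\setminus p(M_0-x_0)$, $$u_+(z)=\inf_{y\in p(M_0-x_0)}\big(u(y)+L|z-y|\big),\qquad u_-(z)=\sup_{y\in p(M_0-x_0)}\big(u(y)-L|z-y|\big)$$ are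 Lipschitz and satisfy $u_-(p(x-x_0))\le q(x-x_0)\le u_+(p(x-x_0))$ for all $x\in M$.
   Context: Write points of $\mathbb{R}^n$ as $x=(p(x),q(x))$ with $q(x)=\langle x,e_n\rangle$ and $p(x)=x-q(x)e_n$ identified with an element of $\mathbb{R}^{n-1}$. $C(x,r)=\{y:|q(x-y)|<r,\ |p(x-y)|<r\}$ and $D_r=\{z\in\mathbb{R}^{n-1}:|z|<r\}$. $\nabla'$ is the gradient in $\mathbb{R}^{n-1}$. For a set $E\subset\mathbb{R}^n$ of locally finite perimeter, $\mu_E$ is its Gauss–Green measure, $|\mu_E|$ its total variation, $\partial^*E$ its reduced boundary, and $\nu_E$ the measure-theoretic outer unit normal. $\mathcal{A}(C_A,r_0)$ is the class of sets $E$ of locally finite perimeter with $\partial E=\operatorname{spt}\mu_E$ and $C_A^{-1}r^{n-1}\le|\mu_E|(B(x,r))\le C_Ar^{n-1}$ for all $x\in\operatorname{spt}\mu_E$, $0<r<r_0$. The cylindrical excess in direction $e_n$ is $$e_n(x,r)=\frac1{r^{n-1}}\int_{C(x,r)\cap\partial^*E}\frac{|\nu_E-e_n|^2}{2}\,d\mathcal{H}^{n-1}.$$ *)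

theory Defs
  imports "HOL-Analysis.Analysis"
begin

text \<open>
  \<open>\<real>\<^sup>n\<close> is modelled as \<open>'a \<times> real\<close> with \<open>'a\<close> a Euclidean space of dimension \<open>n - 1\<close>. The norm of
  the product type is the Euclidean one, \<open>fst\<close> is \<open>p\<close>, \<open>snd\<close> is \<open>q\<close> and \<open>(0, 1)\<close> is \<open>e\<^sub>n\<close>.
\<close>

section \<open>Hausdorff measure\<close>

text \<open>
  Normalised so that the \<open>k\<close>-dimensional measure agrees with Lebesgue measure on \<open>k\<close>-planes.
  The library has \<open>0 ^ 0 = 1\<close>, so empty members of a cover are given weight \<open>0\<close> explicitly.
\<close>

definition hausdorff_pre :: "nat \<Rightarrow> real \<Rightarrow> 'a::metric_space set \<Rightarrow> ennreal" where
  "hausdorff_pre k \<delta> A =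
     (INF F \<in> {F :: nat \<Rightarrow> 'a set. A \<subseteq> (\<Union>i. F i) \<and> (\<forall>i. bounded (F i) \<and> diameter (F i) < \<delta>)}.
        \<Sum>i. if F i = {} then 0
             else ennreal (unit_ball_vol (real k) * (diameter (F i) / 2) ^ k))"

definition hausdorff :: "nat \<Rightarrow> 'a::metric_space set \<Rightarrow> ennreal" where
  "hausdorff k A = (SUP \<delta> \<in> {0<..}. hausdorff_pre k \<delta> A)"

text \<open>
  \<^const>\<open>hausdorff\<close> is a metric outer measure, hence by Caratheodory's criterion a measure on the
  Borel sets, so the following has \<open>hausdorff k A\<close> as its value on every Borel set \<open>A\<close>.
\<close>

definition hausdorff_borel :: "nat \<Rightarrow> 'a::metric_space measure" where
  "hausdorff_borel k = measure_of UNIV (sets borel) (hausdorff k)"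

section \<open>Sets of locally finite perimeter\<close>

definition C1_compact_support :: "('a::euclidean_space \<Rightarrow> 'a) \<Rightarrow> bool" where
  "C1_compact_support T \<longleftrightarrow>
     (\<exists>T' :: 'a \<Rightarrow> 'a \<Rightarrow>\<^sub>L 'a. (\<forall>x. (T has_derivative blinfun_apply (T' x)) (at x)) \<and> continuous_on UNIV T')
     \<and> compact (closure {x. T x \<noteq> 0})"

definition divergence :: "('a::euclidean_space \<Rightarrow> 'a) \<Rightarrow> 'a \<Rightarrow> real" where
  "divergence T x = (\<Sum>b\<in>Basis. frechet_derivative T (at x) b \<bullet> b)"

text \<open>
  A vector-valued Radon measure \<open>\<mu>\<close> is given by its polar decomposition: its total variation
  \<open>M = |\<mu>|\<close>, a Radon measure, and a Borel density \<open>\<sigma>\<close> with \<open>|\<sigma>| = 1\<close> \<open>M\<close>-a.e., so that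
  \<open>\<mu> = \<sigma> M\<close>. The last clause is the Gauss--Green formula
  \<open>\<integral>\<^sub>E div T = \<integral> T \<cdot> d\<mu>\<close>, with the sign for which \<open>\<sigma>\<close> points out of \<open>E\<close>.
\<close>

definition gauss_green_pair :: "'a::euclidean_space set \<Rightarrow> 'a measure \<Rightarrow> ('a \<Rightarrow> 'a) \<Rightarrow> bool" where
  "gauss_green_pair E M \<sigma> \<longleftrightarrow>
     sets M = sets borel \<and>
     (\<forall>K. compact K \<longrightarrow> emeasure M K < \<infinity>) \<and>
     \<sigma> \<in> borel_measurable borel \<and>
     (AE x in M. norm (\<sigma> x) = 1) \<and>
     (\<forall>T. C1_compact_support T \<longrightarrow>
        (LINT x:E|lebesgue. divergence T x) = (LINT x|M. T x \<bullet> \<sigma> x))"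

definition locally_finite_perimeter :: "'a::euclidean_space set \<Rightarrow> bool" where
  "locally_finite_perimeter E \<longleftrightarrow> E \<in> sets lebesgue \<and> (\<exists>M \<sigma>. gauss_green_pair E M \<sigma>)"

text \<open>
  For \<open>E\<close> of locally finite perimeter, \<open>M\<close> is unique and \<open>\<sigma>\<close> is unique \<open>M\<close>-a.e., so neither the
  total variation \<open>perimeter_measure E\<close>, nor the values \<open>gauss_green E B\<close> of \<open>\<mu>\<^sub>E\<close> on bounded Borel
  sets \<open>B\<close>, nor anything defined from them below depends on the choice.
\<close>

definition gauss_green_polar :: "'a::euclidean_space set \<Rightarrow> 'a measure \<times> ('a \<Rightarrow> 'a)" where
  "gauss_green_polar E = (SOME (M, \<sigma>). gauss_green_pair E M \<sigma>)"

definition perimeter_measure :: "'a::euclidean_space set \<Rightarrow> 'a measure" where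
  "perimeter_measure E = fst (gauss_green_polar E)"

definition gauss_green :: "'a::euclidean_space set \<Rightarrow> 'a set \<Rightarrow> 'a" where
  "gauss_green E B = (LINT x:B|perimeter_measure E. snd (gauss_green_polar E) x)"

definition spt_perimeter :: "'a::euclidean_space set \<Rightarrow> 'a set" where
  "spt_perimeter E = {x. \<forall>r>0. emeasure (perimeter_measure E) (ball x r) > 0}"

definition gauss_green_ratio :: "'a::euclidean_space set \<Rightarrow> 'a \<Rightarrow> real \<Rightarrow> 'a" where
  "gauss_green_ratio E x r = gauss_green E (ball x r) /\<^sub>R measure (perimeter_measure E) (ball x r)"

definition reduced_boundary :: "'a::euclidean_space set \<Rightarrow> 'a set" where
  "reduced_boundary E =
     {x \<in> spt_perimeter E. \<exists>\<nu>. norm \<nu> = 1 \<and> (gauss_green_ratio E x \<longlongrightarrow> \<nu>) (at_right 0)}"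

definition outer_normal :: "'a::euclidean_space set \<Rightarrow> 'a \<Rightarrow> 'a" where
  "outer_normal E x = Lim (at_right 0) (gauss_green_ratio E x)"

definition ahlfors_class :: "real \<Rightarrow> real \<Rightarrow> 'a::euclidean_space set set" where
  "ahlfors_class C r\<^sub>0 =
     {E. locally_finite_perimeter E \<and> frontier E = spt_perimeter E \<and>
         (\<forall>x \<in> spt_perimeter E. \<forall>r. 0 < r \<and> r < r\<^sub>0 \<longrightarrow>
            ennreal (inverse C * r ^ (DIM('a) - 1)) \<le> emeasure (perimeter_measure E) (ball x r) \<and>
            emeasure (perimeter_measure E) (ball x r) \<le> ennreal (C * r ^ (DIM('a) - 1)))}"

section \<open>Cylindrical excess\<close>

definition cylinder :: "'a::euclidean_space \<times> real \<Rightarrow> real \<Rightarrow> ('a \<times> real) set" where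
  "cylinder x r = {y. \<bar>snd (x - y)\<bar> < r \<and> norm (fst (x - y)) < r}"

text \<open>Here \<open>DIM('a) = n - 1\<close>.\<close>

definition excess :: "('a::euclidean_space \<times> real) set \<Rightarrow> 'a \<times> real \<Rightarrow> real \<Rightarrow> ennreal" where
  "excess E x r =
     (\<integral>\<^sup>+ y \<in> cylinder x r \<inter> reduced_boundary E.
        ennreal ((norm (outer_normal E y - (0, 1)))\<^sup>2 / 2) \<partial>hausdorff_borel DIM('a))
     / ennreal (r ^ DIM('a))"

section \<open>Gradient\<close>

text \<open>
  For Lipschitz \<open>u\<close> this is the classical gradient at almost every point by Rademacher's theorem;
  the arbitrary value elsewhere does not affect integrals.
\<close>

definition gradient :: "('a::euclidean_space \<Rightarrow> real) \<Rightarrow> 'a \<Rightarrow> 'a" where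
  "gradient u z = (THE D. GDERIV u z :> D)"

end

theory Submission
  imports Defs
begin

text \<open>
  Write \<open>k = n - 1\<close>. By the Ahlfors bounds \<open>|\<mu>\<^sub>E|\<close> is at most a multiple of \<open>\<H>\<^sup>k\<close> on the
  boundary, so the excess controls the \<open>|\<mu>\<^sub>E|\<close>-integral of the tilt \<open>1 - \<nu>\<^sub>E \<sqdot> e\<^sub>n\<close>. Testing
  Gauss--Green with a horizontal field whose divergence concentrates at a point shows that boundary
  points at different heights in a cylinder of small excess would carry too much mass in a slab:
  the boundary is flat there, with \<open>E\<close> below and its complement above. At a good point this holds on
  all scales, which gives a cone condition of slope \<open>1/2\<close> between points of \<open>M\<close> and of \<open>M\<^sub>0\<close>;
  hence \<open>M\<^sub>0\<close> is a Lipschitz graph, and \<open>u\<close> is its McShane extension. Bad points are centres of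
  small cylinders of large excess, and a Vitali covering bounds both their \<open>\<H>\<^sup>k\<close>-measure
  and their shadow in \<open>\<real>\<^sup>k\<close> by the excess.

  For the gradient, let \<open>u\<close> be differentiable with gradient \<open>a\<close> at a density point of the good
  set. Gauss--Green with a bump of radius \<open>s\<close> times the direction \<open>a\<close> compares \<open>s\<^sup>k |a|\<^sup>2\<close>
  with the tilt over the ball of radius \<open>s\<close>; Fatou and Fubini integrate this. Finally an
  oscillation \<open>h\<close> of the \<open>1/2\<close>-Lipschitz function \<open>u\<close> persists on balls of radius \<open>h/4\<close>, so the
  gradient bound gives \<open>h\<^sup>k\<^sup>+\<^sup>2 \<le> C e r\<^sup>k\<^sup>+\<^sup>2\<close>, and \<open>k + 2 \<le> 2 k\<close>, \<open>e \<le> 1\<close> give the height bound.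
\<close>

section \<open>Hausdorff measure is a Borel measure\<close>

text \<open>Reduced boundary and outer normal enter the excess without any measurability, so its
  integral is treated as a lower integral: only monotonicity and superadditivity are used. The
  excess controls the tilt by a one-sided comparison: |mu_E| is bounded by a multiple of Hausdorff
  measure, and |mu_E|-almost every boundary point is a Lebesgue point of the density, hence lies in
  the reduced boundary. The radii fit together as follows. Flatness at scale s uses the tilt in a
  cylinder of radius 4 s and mass bounds up to radius 6 s. Two points of M are less than 2 r apart
  horizontally and vertically, so scales s < 2 r suffice; they account for the 8 r in M_0 and stay
  below 13 r. The height bound also needs an anchor: x_0 is a boundary point at height 0, so |u(0)|
  is at most the distance from 0 to the projection of M_0, and a ball of that radius lies in the
  small shadow of the bad points. These estimates hold only over D_r, so u is finally clipped at the
  height bound to make it bounded everywhere.\<close>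

lemma ennreal_SUP_add_SUP_le:
  fixes f g :: "'i \<Rightarrow> ennreal"
  assumes "\<And>i j. i \<in> I \<Longrightarrow> j \<in> J \<Longrightarrow> f i + g j \<le> c" "I \<noteq> {}" "J \<noteq> {}"
  shows "(SUP i\<in>I. f i) + (SUP j\<in>J. g j) \<le> c"
proof -
  have "(SUP i\<in>I. f i) + (SUP j\<in>J. g j) = (SUP i\<in>I. SUP j\<in>J. f i + g j)"
    unfolding ennreal_SUP_add_left[OF assms(2), symmetric] ennreal_SUP_add_right[OF assms(3)]
    by (rule refl SUP_commute)
  also have "\<dots> \<le> c" using assms(1) by (intro SUP_least) auto
  finally show ?thesis .
qed

lemma ennreal_suminf_tail_tendsto_0:
  fixes f :: "nat \<Rightarrow> ennreal"
  assumes "(\<Sum>i. f i) \<noteq> top"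
  shows "(\<lambda>n. \<Sum>i. f (i + n)) \<longlonglongrightarrow> 0"
proof -
  define g where "g i = enn2real (f i)" for i
  have fg: "f i = ennreal (g i)" for i
    using assms ennreal_suminf_lessD[of f top i] by (auto simp: g_def less_top)
  have s: "summable g"
  proof (rule summable_suminf_not_top)
    show "(\<Sum>i. ennreal (g i)) \<noteq> top" using assms unfolding fg .
  qed (simp add: g_def)
  have "(\<lambda>n. ennreal (\<Sum>i. g (i + n))) \<longlonglongrightarrow> ennreal 0"
    by (intro tendsto_ennrealI suminf_exist_split2 s)
  also have "(\<lambda>n. ennreal (\<Sum>i. g (i + n))) = (\<lambda>n. \<Sum>i. f (i + n))"
    unfolding fg by (intro ext suminf_ennreal2[symmetric] summable_ignore_initial_segment s) (simp add: g_def)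
  finally show ?thesis by simp
qed

section \<open>Caratheodory's criterion for metric outer measures\<close>

locale metric_outer_measure =
  fixes f :: "'a::metric_space set \<Rightarrow> ennreal"
  assumes empty: "f {} = 0"
    and mono: "\<And>A B. A \<subseteq> B \<Longrightarrow> f A \<le> f B"
    and subadd: "\<And>A :: nat \<Rightarrow> 'a set. f (\<Union>i. A i) \<le> (\<Sum>i. f (A i))"
    and metric: "\<And>d A B. 0 < d \<Longrightarrow> (\<And>a b. a \<in> A \<Longrightarrow> b \<in> B \<Longrightarrow> d \<le> dist a b) \<Longrightarrow> f A + f B \<le> f (A \<union> B)"
begin

lemma subadd_Un: "f (A \<union> B) \<le> f A + f B"
proof -
  have "f (\<Union>i. (if i = 0 then A else if i = Suc 0 then B else {})) \<le> (\<Sum>i. f (if i = 0 then A else if i = Suc 0 then B else {}))"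
    by (rule subadd)
  also have "\<dots> = (\<Sum>i\<in>{0, Suc 0}. f (if i = 0 then A else if i = Suc 0 then B else {}))"
    by (rule suminf_finite) (auto simp: empty)
  also have "\<dots> = f A + f B" by simp
  also have "(\<Union>i. (if i = 0 then A else if i = Suc 0 then B else {})) = A \<union> B"
    by (auto split: if_splits)
  finally show ?thesis .
qed

lemma outer_measure_space_UNIV: "outer_measure_space UNIV f"
  by (auto simp: outer_measure_space_def positive_def increasing_def countably_subadditive_def empty
      intro: mono subadd)

text \<open>The points of X at distance at least 1/(n+1) from C are separated from X \<inter> C, so
  \<open>metric\<close> adds the two values. What is missing lies in the shells \<open>D i\<close>
  near C. Every second shell is separated from the earlier ones, so for finite f X the values of the
  shells are summable and their tail vanishes.\<close>

lemma closed_in_lambda_system: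
  assumes "closed C" "C \<noteq> {}"
  shows "f (X \<inter> C) + f (X - C) \<le> f X"
proof (cases "f X = top")
  case False
  define Y where "Y n = {x \<in> X. 1 / real (Suc n) \<le> infdist x C}" for n
  have Ymono: "Y m \<subseteq> Y n" if "m \<le> n" for m n
  proof -
    have "1 / real (Suc n) \<le> 1 / real (Suc m)" using that by (simp add: frac_le)
    then show ?thesis by (auto simp: Y_def)
  qed
  have YX: "Y n \<subseteq> X - C" for n by (auto simp: Y_def)
  have step: "f (X \<inter> C) + f (Y n) \<le> f X" for n
  proof -
    have "f (X \<inter> C) + f (Y n) \<le> f ((X \<inter> C) \<union> Y n)"
    proof (rule metric[of "1 / real (Suc n)"])
      fix a b assume "a \<in> X \<inter> C" "b \<in> Y n"
      then show "1 / real (Suc n) \<le> dist a b"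
        using infdist_le[of a C b] by (auto simp: Y_def dist_commute)
    qed simp
    also have "\<dots> \<le> f X" by (rule mono) (auto simp: Y_def)
    finally show ?thesis .
  qed
  define D where "D n = Y (Suc n) - Y n" for n
  \<comment> \<open>\<open>infdist\<close> to C is 1-Lipschitz, so a drop from at least 1/(n+1) to
    below 1/(m+1) forces a positive distance.\<close>
  have sep: "f (A \<union> D m) \<ge> f A + f (D m)" if "A \<subseteq> Y n" "n < m" for A n m
  proof (rule metric)
    show "0 < 1 / real (Suc n) - 1 / real (Suc m)" using that by (simp add: frac_less2)
    fix a b assume a: "a \<in> A" and b: "b \<in> D m"
    have "1 / real (Suc n) \<le> infdist a C" using a that by (auto simp: Y_def)
    moreover have "infdist b C < 1 / real (Suc m)" using b by (auto simp: Y_def D_def)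
    moreover have "infdist a C \<le> infdist b C + dist a b" by (rule infdist_triangle)
    ultimately show "1 / real (Suc n) - 1 / real (Suc m) \<le> dist a b" by linarith
  qed
  \<comment> \<open>Adjacent shells may touch; the parity p selects every second one, to which
    \<open>sep\<close> applies.\<close>
  have alt: "(\<Sum>i<N. f (D (2 * i + p))) \<le> f ((\<Union>i<N. D (2 * i + p)))" for N p
  proof (induction N)
    case (Suc N)
    have "(\<Sum>i<Suc N. f (D (2 * i + p))) \<le> f ((\<Union>i<N. D (2 * i + p))) + f (D (2 * N + p))"
      using Suc by (simp add: add_right_mono)
    also have "\<dots> \<le> f ((\<Union>i<N. D (2 * i + p)) \<union> D (2 * N + p))"
    proof (cases "N = 0")
      case False
      have "(\<Union>i<N. D (2 * i + p)) \<subseteq> Y (2 * (N - 1) + p + 1)"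
      proof
        fix x assume "x \<in> (\<Union>i<N. D (2 * i + p))"
        then obtain i where i: "i < N" "x \<in> Y (Suc (2 * i + p))" by (auto simp: D_def)
        moreover have "Suc (2 * i + p) \<le> 2 * (N - 1) + p + 1" using i by auto
        ultimately show "x \<in> Y (2 * (N - 1) + p + 1)" using Ymono by blast
      qed
      moreover have "2 * (N - 1) + p + 1 < 2 * N + p" using False by auto
      ultimately show ?thesis by (rule sep)
    qed (simp add: empty)
    also have "(\<Union>i<N. D (2 * i + p)) \<union> D (2 * N + p) = (\<Union>i<Suc N. D (2 * i + p))"
      by (auto simp: lessThan_Suc)
    finally show ?case .
  qed simp
  have altX: "(\<Sum>i. f (D (2 * i + p))) \<le> f X" for p
  proof (rule suminf_le_const)
    show "(\<Sum>i<N. f (D (2 * i + p))) \<le> f X" for N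
      using alt[where N=N and p=p] by (rule order_trans) (intro mono, auto simp: D_def Y_def)
  qed auto
  have fin: "(\<Sum>i. f (D i)) \<noteq> top"
  proof -
    have "(\<Sum>i<N. f (D i)) \<le> f X + f X" for N
    proof -
      have "(\<Sum>i<N. f (D i)) \<le> (\<Sum>i<2*N. f (D i))" by (intro sum_mono2) auto
      also have "\<dots> = (\<Sum>i<N. f (D (2*i+0))) + (\<Sum>i<N. f (D (2*i+1)))"
        by (induction N) (auto simp: ac_simps)
      also have "\<dots> \<le> (\<Sum>i. f (D (2*i+0))) + (\<Sum>i. f (D (2*i+1)))"
        by (intro add_mono sum_le_suminf) auto
      also have "\<dots> \<le> f X + f X" by (intro add_mono altX)
      finally show ?thesis .
    qed
    then have "(\<Sum>i. f (D i)) \<le> f X + f X" by (intro suminf_le_const) auto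
    then show ?thesis using False by (metis ennreal_add_eq_top top.extremum_unique)
  qed
  have cover: "X - C \<subseteq> Y n \<union> (\<Union>i. D (i + n))" for n
  proof
    fix x assume x: "x \<in> X - C"
    then have "0 < infdist x C" using assms
      by (metis DiffD2 in_closed_iff_infdist_zero infdist_nonneg less_eq_real_def)
    then obtain m where "inverse (real (Suc m)) < infdist x C" using reals_Archimedean by blast
    then have "\<exists>m. x \<in> Y m" using x by (auto simp: Y_def inverse_eq_divide intro!: exI[of _ m])
    then obtain l where l: "x \<in> Y l" "\<And>j. j < l \<Longrightarrow> x \<notin> Y j" using exists_least_iff[of "\<lambda>m. x \<in> Y m"] by blast
    show "x \<in> Y n \<union> (\<Union>i. D (i + n))"
    proof (cases "l \<le> n")
      case True then show ?thesis using Ymono l by blast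
    next
      case F: False
      then have "x \<in> D ((l - 1 - n) + n)" using l by (auto simp: D_def)
      then show ?thesis by blast
    qed
  qed
  have "f (X \<inter> C) + f (X - C) \<le> f X + (\<Sum>i. f (D (i + n)))" for n
  proof -
    have "f (X - C) \<le> f (Y n \<union> (\<Union>i. D (i + n)))" by (intro mono cover)
    also have "\<dots> \<le> f (Y n) + f (\<Union>i. D (i + n))" by (rule subadd_Un)
    also have "\<dots> \<le> f (Y n) + (\<Sum>i. f (D (i + n)))" by (intro add_left_mono subadd)
    finally have "f (X \<inter> C) + f (X - C) \<le> f (X \<inter> C) + (f (Y n) + (\<Sum>i. f (D (i + n))))"
      by (rule add_left_mono)
    also have "\<dots> \<le> f X + (\<Sum>i. f (D (i + n)))" using step[of n] by (simp add: add.assoc[symmetric] add_right_mono)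
    finally show ?thesis .
  qed
  moreover have "(\<lambda>n. f X + (\<Sum>i. f (D (i + n)))) \<longlonglongrightarrow> f X + 0"
    by (intro tendsto_add tendsto_const ennreal_suminf_tail_tendsto_0 fin)
  ultimately show ?thesis
    by (intro LIMSEQ_le_const[of _ "f X"]) auto
qed simp

lemma borel_subset_lambda_system: "sets borel \<subseteq> lambda_system UNIV UNIV f"
proof -
  interpret L: sigma_algebra UNIV "lambda_system UNIV UNIV f"
  proof -
    interpret U: sigma_algebra UNIV "UNIV :: 'a set set"
      using sigma_algebra_Pow[of "UNIV :: 'a set"] by simp
    show "sigma_algebra UNIV (lambda_system UNIV UNIV f)"
      using U.caratheodory_lemma[OF outer_measure_space_UNIV] by (simp add: measure_space_def)
  qed
  have closed: "C \<in> lambda_system UNIV UNIV f" if "closed C" for C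
  proof (cases "C = {}")
    case False
    have "f (X \<inter> C) + f (X - C) = f X" for X
    proof (rule antisym)
      have "f X = f (X \<inter> C \<union> (X - C))" by (simp add: Int_Diff_Un)
      then show "f X \<le> f (X \<inter> C) + f (X - C)" using subadd_Un[of "X \<inter> C" "X - C"] by simp
    qed (rule closed_in_lambda_system[OF that False])
    moreover have "(UNIV - C) \<inter> X = X - C" for X by auto
    ultimately show ?thesis unfolding lambda_system_def by (simp add: Int_commute[of C])
  qed auto
  have "sets (borel :: 'a measure) = sigma_sets UNIV {S. closed S}"
    by (simp add: borel_eq_closed)
  also have "\<dots> \<subseteq> lambda_system UNIV UNIV f"
    by (rule L.sigma_sets_subset) (use closed in auto)
  finally show ?thesis .
qed

lemma measure_space_borel: "measure_space UNIV (sets borel) f"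
proof -
  interpret U: sigma_algebra UNIV "UNIV :: 'a set set"
    using sigma_algebra_Pow[of "UNIV :: 'a set"] by simp
  have ms: "measure_space UNIV (lambda_system UNIV UNIV f) f"
    by (rule U.caratheodory_lemma[OF outer_measure_space_UNIV])
  show ?thesis
    unfolding measure_space_def
  proof (intro conjI)
    show "sigma_algebra UNIV (sets (borel :: 'a measure))"
      using sets.sigma_algebra_axioms[of "borel :: 'a measure"] by simp
    show "positive (sets borel) f" by (simp add: positive_def empty)
    show "countably_additive (sets borel) f"
      using ms borel_subset_lambda_system
      unfolding measure_space_def countably_additive_def by blast
  qed
qed

end

subsection \<open>The Hausdorff outer measure\<close>

definition hausdorff_weight :: "nat \<Rightarrow> 'a::metric_space set \<Rightarrow> ennreal" where
  "hausdorff_weight k F = (if F = {} then 0 else ennreal (unit_ball_vol (real k) * (diameter F / 2) ^ k))"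

definition fine_cover :: "real \<Rightarrow> 'a::metric_space set \<Rightarrow> (nat \<Rightarrow> 'a set) \<Rightarrow> bool" where
  "fine_cover \<delta> A F \<longleftrightarrow> A \<subseteq> (\<Union>i. F i) \<and> (\<forall>i. bounded (F i) \<and> diameter (F i) < \<delta>)"

lemma hausdorff_pre_eq:
  "hausdorff_pre k \<delta> A = (INF F \<in> {F. fine_cover \<delta> A F}. \<Sum>i. hausdorff_weight k (F i))"
  by (simp add: hausdorff_pre_def fine_cover_def hausdorff_weight_def)

lemma hausdorff_pre_le: "fine_cover \<delta> A F \<Longrightarrow> hausdorff_pre k \<delta> A \<le> (\<Sum>i. hausdorff_weight k (F i))"
  unfolding hausdorff_pre_eq by (rule INF_lower) simp

lemma hausdorff_pre_ge:
  "(\<And>F. fine_cover \<delta> A F \<Longrightarrow> c \<le> (\<Sum>i. hausdorff_weight k (F i))) \<Longrightarrow> c \<le> hausdorff_pre k \<delta> A"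
  unfolding hausdorff_pre_eq by (rule INF_greatest) simp

lemma hausdorff_pre_mono: "A \<subseteq> B \<Longrightarrow> \<delta>' \<le> \<delta> \<Longrightarrow> hausdorff_pre k \<delta> A \<le> hausdorff_pre k \<delta>' B"
proof (rule hausdorff_pre_ge, rule hausdorff_pre_le)
  assume *: "A \<subseteq> B" "\<delta>' \<le> \<delta>"
  fix F assume "fine_cover \<delta>' B F"
  then show "fine_cover \<delta> A F"
    using * unfolding fine_cover_def by (meson order_trans less_le_trans)
qed

lemma hausdorff_pre_empty: "0 < \<delta> \<Longrightarrow> hausdorff_pre k \<delta> {} = 0"
  using hausdorff_pre_le[of \<delta> "{}" "\<lambda>_. {}" k]
  by (simp add: fine_cover_def hausdorff_weight_def diameter_empty)

lemma hausdorff_pre_subadd: "hausdorff_pre k \<delta> (\<Union>i. A i) \<le> (\<Sum>i. hausdorff_pre k \<delta> (A i))"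
proof (cases "(\<Sum>i. hausdorff_pre k \<delta> (A i)) = top")
  case False
  show ?thesis
  proof (rule ennreal_le_epsilon)
    fix e :: real assume e: "0 < e"
    have fin: "hausdorff_pre k \<delta> (A i) < top" for i
      using False ennreal_suminf_lessD[of "\<lambda>i. hausdorff_pre k \<delta> (A i)" top i] by (auto simp: less_top)
    have "\<exists>F. fine_cover \<delta> (A i) F \<and> (\<Sum>j. hausdorff_weight k (F j)) < hausdorff_pre k \<delta> (A i) + ennreal (e * (1/2)^Suc i)" for i
    proof -
      have "hausdorff_pre k \<delta> (A i) < hausdorff_pre k \<delta> (A i) + ennreal (e * (1/2)^Suc i)"
        using fin[of i] e by (cases "hausdorff_pre k \<delta> (A i)") (auto simp: ennreal_plus[symmetric] ennreal_less_iff simp del: ennreal_plus)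
      then show ?thesis
        unfolding hausdorff_pre_eq[of k \<delta> "A i"] INF_less_iff by auto
    qed
    then obtain F where F: "fine_cover \<delta> (A i) (F i)"
      "(\<Sum>j. hausdorff_weight k (F i j)) < hausdorff_pre k \<delta> (A i) + ennreal (e * (1/2)^Suc i)" for i
      by metis
    define G where "G n = (case prod_decode n of (i, j) \<Rightarrow> F i j)" for n
    have "fine_cover \<delta> (\<Union>i. A i) G"
      unfolding fine_cover_def
    proof (intro conjI allI subsetI)
      fix x assume "x \<in> (\<Union>i. A i)"
      then obtain i j where "x \<in> F i j" using F(1) unfolding fine_cover_def by blast
      then have "x \<in> G (prod_encode (i, j))" by (simp add: G_def)
      then show "x \<in> (\<Union>n. G n)" by blast
    qed (use F(1) in \<open>auto simp: G_def fine_cover_def split: prod.split\<close>)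
    then have "hausdorff_pre k \<delta> (\<Union>i. A i) \<le> (\<Sum>n. hausdorff_weight k (G n))" by (rule hausdorff_pre_le)
    also have "\<dots> = (\<Sum>n. case prod_decode n of (i, j) \<Rightarrow> hausdorff_weight k (F i j))"
      by (simp add: G_def split_beta)
    also have "\<dots> = (\<Sum>i. \<Sum>j. hausdorff_weight k (F i j))"
      using suminf_ennreal_2dimen[of "\<lambda>i. \<Sum>j. hausdorff_weight k (F i j)" "\<lambda>(i, j). hausdorff_weight k (F i j)"]
      by (simp add: split_beta)
    also have "\<dots> \<le> (\<Sum>i. hausdorff_pre k \<delta> (A i) + ennreal (e * (1/2)^Suc i))"
      using F(2) by (intro suminf_le) (auto intro: less_imp_le)
    also have "\<dots> = (\<Sum>i. hausdorff_pre k \<delta> (A i)) + (\<Sum>i. ennreal (e * (1/2)^Suc i))"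
      by (intro suminf_add[symmetric]) auto
    also have "(\<Sum>i. ennreal (e * (1/2)^Suc i)) = ennreal e"
      using sums_mult[OF power_half_series, of e] e by (intro suminf_ennreal_eq) auto
    finally show "hausdorff_pre k \<delta> (\<Union>i. A i) \<le> (\<Sum>i. hausdorff_pre k \<delta> (A i)) + ennreal e" .
  qed
qed simp

text \<open>A covering set of diameter below \<delta> \<le> d cannot meet both sets, so a cover of
  the union splits into covers of the two. Discarded members become the empty set, of weight
  0.\<close>

lemma hausdorff_pre_separated:
  assumes "\<delta> \<le> d" "0 < \<delta>" "\<And>a b. a \<in> A \<Longrightarrow> b \<in> B \<Longrightarrow> d \<le> dist a b"
  shows "hausdorff_pre k \<delta> A + hausdorff_pre k \<delta> B \<le> hausdorff_pre k \<delta> (A \<union> B)"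
proof (rule hausdorff_pre_ge)
  fix F assume F: "fine_cover \<delta> (A \<union> B) F"
  define FA where "FA i = (if F i \<inter> A = {} then {} else F i)" for i
  define FB where "FB i = (if F i \<inter> B = {} then {} else F i)" for i
  have disj: "F i \<inter> A = {} \<or> F i \<inter> B = {}" for i
  proof (rule ccontr)
    assume "\<not> ?thesis"
    then obtain a b where ab: "a \<in> F i" "a \<in> A" "b \<in> F i" "b \<in> B" by blast
    then have "dist a b \<le> diameter (F i)" using F by (auto simp: fine_cover_def intro: diameter_bounded_bound)
    moreover have "diameter (F i) < \<delta>" using F by (simp add: fine_cover_def)
    moreover have "d \<le> dist a b" using ab assms(3) by blast
    ultimately show False using assms(1) by linarith
  qed
  have "fine_cover \<delta> A FA" "fine_cover \<delta> B FB"
    using F assms(2) by (auto simp: fine_cover_def FA_def FB_def diameter_empty, blast+)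
  then have "hausdorff_pre k \<delta> A + hausdorff_pre k \<delta> B
    \<le> (\<Sum>i. hausdorff_weight k (FA i)) + (\<Sum>i. hausdorff_weight k (FB i))"
    by (intro add_mono hausdorff_pre_le)
  also have "\<dots> = (\<Sum>i. hausdorff_weight k (FA i) + hausdorff_weight k (FB i))"
    by (intro suminf_add) auto
  also have "\<dots> \<le> (\<Sum>i. hausdorff_weight k (F i))"
    using disj by (intro suminf_le) (auto simp: FA_def FB_def hausdorff_weight_def)
  finally show "hausdorff_pre k \<delta> A + hausdorff_pre k \<delta> B \<le> (\<Sum>i. hausdorff_weight k (F i))" .
qed

lemma hausdorff_pre_le_hausdorff: "0 < \<delta> \<Longrightarrow> hausdorff_pre k \<delta> A \<le> hausdorff k A"
  unfolding hausdorff_def by (rule SUP_upper) simp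

lemma hausdorff_le: "(\<And>\<delta>. 0 < \<delta> \<Longrightarrow> hausdorff_pre k \<delta> A \<le> c) \<Longrightarrow> hausdorff k A \<le> c"
  unfolding hausdorff_def by (rule SUP_least) simp

lemma metric_outer_measure_hausdorff: "metric_outer_measure (hausdorff k :: 'a::metric_space set \<Rightarrow> ennreal)"
proof
  show "hausdorff k ({} :: 'a set) = 0"
    using hausdorff_le[of k "{}" 0] by (simp add: hausdorff_pre_empty)
  show "hausdorff k A \<le> hausdorff k B" if "A \<subseteq> B" for A B :: "'a set"
    by (rule hausdorff_le, rule order_trans[OF hausdorff_pre_mono hausdorff_pre_le_hausdorff])
      (use that in auto)
  show "hausdorff k (\<Union>i. A i) \<le> (\<Sum>i. hausdorff k (A i))" for A :: "nat \<Rightarrow> 'a set"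
    by (rule hausdorff_le, rule order_trans[OF hausdorff_pre_subadd])
      (auto intro!: suminf_le hausdorff_pre_le_hausdorff)
  fix d :: real and A B :: "'a set"
  assume d: "0 < d" "\<And>a b. a \<in> A \<Longrightarrow> b \<in> B \<Longrightarrow> d \<le> dist a b"
  show "hausdorff k A + hausdorff k B \<le> hausdorff k (A \<union> B)"
    unfolding hausdorff_def[of k A] hausdorff_def[of k B]
  proof (rule ennreal_SUP_add_SUP_le)
    fix i j :: real assume ij: "i \<in> {0<..}" "j \<in> {0<..}"
    \<comment> \<open>The premeasure grows as the scale shrinks, so both suprema can be tested at
      one scale below the separation d.\<close>
    define \<delta> where "\<delta> = min d (min i j)"
    have \<delta>: "\<delta> \<le> d" "0 < \<delta>" "\<delta> \<le> i" "\<delta> \<le> j" using d ij by (auto simp: \<delta>_def)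
    have "hausdorff_pre k i A + hausdorff_pre k j B \<le> hausdorff_pre k \<delta> A + hausdorff_pre k \<delta> B"
      using \<delta> by (intro add_mono hausdorff_pre_mono) auto
    also have "\<dots> \<le> hausdorff_pre k \<delta> (A \<union> B)" by (rule hausdorff_pre_separated[OF \<delta>(1,2) d(2)])
    also have "\<dots> \<le> hausdorff k (A \<union> B)" by (rule hausdorff_pre_le_hausdorff[OF \<delta>(2)])
    finally show "hausdorff_pre k i A + hausdorff_pre k j B \<le> hausdorff k (A \<union> B)" .
  qed auto
qed

interpretation hausdorff: metric_outer_measure "hausdorff k"
  by (rule metric_outer_measure_hausdorff)

lemma sets_hausdorff_borel [simp, measurable_cong]: "sets (hausdorff_borel k) = sets borel"
  by (simp add: hausdorff_borel_def sets.sigma_sets_eq[of borel, simplified])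

lemma space_hausdorff_borel [simp]: "space (hausdorff_borel k) = UNIV"
  by (simp add: hausdorff_borel_def)

lemma emeasure_hausdorff_borel:
  assumes "A \<in> sets borel" shows "emeasure (hausdorff_borel k) A = hausdorff k A"
  unfolding hausdorff_borel_def
proof (rule emeasure_measure_of_sigma)
  show "sigma_algebra UNIV (sets (borel :: 'a measure))"
    using sets.sigma_algebra_axioms[of "borel :: 'a measure"] by simp
qed (use hausdorff.measure_space_borel[of k] assms in \<open>auto simp: measure_space_def\<close>)

text \<open>No measurability is assumed: \<open>nn_integral\<close> is then the lower integral.\<close>

lemma nn_integral_superadditive:
  "(\<integral>\<^sup>+x. f x \<partial>M) + (\<integral>\<^sup>+x. g x \<partial>M) \<le> (\<integral>\<^sup>+x. f x + g x \<partial>M)"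
proof -
  have ne: "{g. simple_function M g \<and> g \<le> h} \<noteq> {}" for h :: "'a \<Rightarrow> ennreal"
    by (auto intro!: exI[of _ "\<lambda>_. 0"] simp: le_fun_def)
  show ?thesis
    unfolding nn_integral_def[of M f] nn_integral_def[of M g]
  proof (rule ennreal_SUP_add_SUP_le)
    fix s t assume st: "s \<in> {h. simple_function M h \<and> h \<le> f}" "t \<in> {h. simple_function M h \<and> h \<le> g}"
    have "integral\<^sup>S M s + integral\<^sup>S M t = integral\<^sup>S M (\<lambda>x. s x + t x)"
      using st by (simp add: simple_integral_add)
    also have "\<dots> \<le> (\<integral>\<^sup>+x. f x + g x \<partial>M)"
      unfolding nn_integral_def using st
      by (intro SUP_upper) (auto simp: le_fun_def intro: add_mono)
    finally show "integral\<^sup>S M s + integral\<^sup>S M t \<le> (\<integral>\<^sup>+x. f x + g x \<partial>M)" .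
  qed (use ne in auto)
qed

text \<open>Superadditivity leaves only this inequality for arbitrary f. It is applied to the excess
  integrand over disjoint cylinders.\<close>

lemma nn_integral_disjoint_UN_le:
  fixes A :: "nat \<Rightarrow> 'a set"
  assumes "disjoint_family A" "(\<Union>i. A i) \<subseteq> B"
  shows "(\<Sum>i. \<integral>\<^sup>+x\<in>A i. f x \<partial>M) \<le> (\<integral>\<^sup>+x\<in>B. f x \<partial>M)"
proof (rule suminf_le_const)
  fix n
  have "(\<Sum>i<n. \<integral>\<^sup>+x\<in>A i. f x \<partial>M) \<le> (\<integral>\<^sup>+x\<in>(\<Union>i<n. A i). f x \<partial>M)"
  proof (induction n)
    case (Suc n)
    have d: "A n \<inter> (\<Union>i<n. A i) = {}"
    proof -
      have "A n \<inter> A i = {}" if "i < n" for i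
        using assms(1) that unfolding disjoint_family_on_def by auto
      then show ?thesis by blast
    qed
    have "(\<Sum>i<Suc n. \<integral>\<^sup>+x\<in>A i. f x \<partial>M) \<le>
      (\<integral>\<^sup>+x\<in>(\<Union>i<n. A i). f x \<partial>M) + (\<integral>\<^sup>+x\<in>A n. f x \<partial>M)"
      using Suc by (auto intro: add_right_mono)
    also have "\<dots> \<le> (\<integral>\<^sup>+x. f x * indicator (\<Union>i<n. A i) x + f x * indicator (A n) x \<partial>M)"
      by (rule nn_integral_superadditive)
    also have "\<dots> = (\<integral>\<^sup>+x\<in>(\<Union>i<Suc n. A i). f x \<partial>M)"
      using d by (intro nn_integral_cong) (auto simp: indicator_def lessThan_Suc)
    finally show ?case .
  qed simp
  also have "\<dots> \<le> (\<integral>\<^sup>+x\<in>B. f x \<partial>M)"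
    using assms(2) by (intro nn_integral_mono) (auto simp: indicator_def)
  finally show "(\<Sum>i<n. \<integral>\<^sup>+x\<in>A i. f x \<partial>M) \<le> (\<integral>\<^sup>+x\<in>B. f x \<partial>M)" .
qed simp

section \<open>Vitali coverings and density points\<close>

text \<open>The countable disjoint subfamily is indexed by a set N of naturals, so that covering
  estimates become series whose terms are set to 0 off N.\<close>

lemma Vitali_balls_sequence:
  fixes a :: "'i \<Rightarrow> 'b::euclidean_space"
  assumes "S \<subseteq> (\<Union>i\<in>K. ball (a i) (r i))" "\<And>i. i \<in> K \<Longrightarrow> 0 < r i \<and> r i \<le> B"
  obtains c :: "nat \<Rightarrow> 'i" and N where "\<And>n. n \<in> N \<Longrightarrow> c n \<in> K"
    "disjoint_family_on (\<lambda>n. ball (a (c n)) (r (c n))) N"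
    "S \<subseteq> (\<Union>n\<in>N. ball (a (c n)) (5 * r (c n)))"
proof -
  obtain C where C: "countable C" "C \<subseteq> K"
     "pairwise (\<lambda>i j. disjnt (ball (a i) (r i)) (ball (a j) (r j))) C"
     "S \<subseteq> (\<Union>i\<in>C. ball (a i) (5 * r i))"
    by (rule Vitali_covering_lemma_balls[OF assms])
  define N where "N = to_nat_on C ` C"
  define c where "c = from_nat_into C"
  have cN: "c (to_nat_on C i) = i" if "i \<in> C" for i
    using C(1) that by (simp add: c_def)
  show ?thesis
  proof
    show "c n \<in> K" if "n \<in> N" for n using that cN C(2) by (auto simp: N_def)
    show "disjoint_family_on (\<lambda>n. ball (a (c n)) (r (c n))) N"
      unfolding disjoint_family_on_def
    proof (intro ballI impI)
      fix m n assume "m \<in> N" "n \<in> N" "m \<noteq> n"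
      then obtain i j where "i \<in> C" "j \<in> C" "i \<noteq> j" "c m = i" "c n = j"
        using cN by (auto simp: N_def)
      then show "ball (a (c m)) (r (c m)) \<inter> ball (a (c n)) (r (c n)) = {}"
        using C(3) by (auto simp: pairwise_def disjnt_def)
    qed
    show "S \<subseteq> (\<Union>n\<in>N. ball (a (c n)) (5 * r (c n)))"
    proof
      fix x assume "x \<in> S"
      then obtain i where "i \<in> C" "x \<in> ball (a i) (5 * r i)" using C(4) by blast
      then show "x \<in> (\<Union>n\<in>N. ball (a (c n)) (5 * r (c n)))"
        by (intro UN_I[of "to_nat_on C i"]) (auto simp: cN N_def)
    qed
  qed
qed

text \<open>The factor 5 is the enlargement in the Vitali covering. Doubling is asked only at
  centres in S because |mu_E| has its two-sided bounds only at boundary points; the other instance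
  is Lebesgue measure.\<close>

locale doubling_measure =
  fixes M :: "'b::euclidean_space measure" and S :: "'b set" and K r\<^sub>0 :: real
  assumes sets_M [measurable_cong, simp]: "sets M = sets borel"
    and finite_compact: "compact C \<Longrightarrow> emeasure M C < \<infinity>"
    and K_pos: "0 < K" and r0_pos: "0 < r\<^sub>0"
    and doubling: "x \<in> S \<Longrightarrow> 0 < s \<Longrightarrow> s < r\<^sub>0 \<Longrightarrow>
      emeasure M (ball x (5 * s)) \<le> ennreal K * emeasure M (ball x s)"
begin

lemma space_M [simp]: "space M = UNIV"
  using sets_eq_imp_space_eq[OF sets_M] by simp

lemma finite_ball: "emeasure M (ball x s) < \<infinity>"
  by (rule le_less_trans[OF emeasure_mono finite_compact[of "cball x s"]]) auto

text \<open>Among the given balls a disjoint family is selected whose 5-fold enlargements cover N: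
  disjointness bounds the \<nu>-masses by that of U, doubling bounds the enlargements. The open W
  stands in for N, which may fail to be measurable.\<close>

lemma weak_type_bound:
  fixes \<nu> :: "'b measure"
  assumes "sets \<nu> = sets borel" "0 < t" "N \<subseteq> S"
    and N: "\<And>x. x \<in> N \<Longrightarrow> \<exists>s>0. s < r\<^sub>0 \<and> ball x s \<subseteq> U \<and> ennreal t * emeasure M (ball x s) \<le> emeasure \<nu> (ball x s)"
    and "U \<in> sets borel"
  obtains W where "open W" "N \<subseteq> W" "ennreal t * emeasure M W \<le> ennreal K * emeasure \<nu> U"
proof -
  obtain s where s: "\<And>x. x \<in> N \<Longrightarrow> 0 < s x \<and> s x < r\<^sub>0 \<and> ball x (s x) \<subseteq> U \<and>
      ennreal t * emeasure M (ball x (s x)) \<le> emeasure \<nu> (ball x (s x))"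
    using N by metis
  obtain c I where c: "\<And>n. n \<in> (I::nat set) \<Longrightarrow> c n \<in> N"
    "disjoint_family_on (\<lambda>n. ball (c n) (s (c n))) I"
    "N \<subseteq> (\<Union>n\<in>I. ball (c n) (5 * s (c n)))"
  proof (rule Vitali_balls_sequence[where S=N and K=N and a="\<lambda>x. x" and r=s and B=r\<^sub>0])
    show "N \<subseteq> (\<Union>i\<in>N. ball i (s i))" using s by force
  qed (use s in \<open>auto intro: less_imp_le\<close>)
  define B where "B n = (if n \<in> I then ball (c n) (s (c n)) else {})" for n
  define W where "W = (\<Union>n\<in>I. ball (c n) (5 * s (c n)))"
  have "ennreal t * emeasure M W = ennreal t * emeasure M (\<Union>n. if n \<in> I then ball (c n) (5 * s (c n)) else {})"
  proof -
    have "W = (\<Union>n. if n \<in> I then ball (c n) (5 * s (c n)) else {})"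
      unfolding W_def by (auto split: if_splits)
    then show ?thesis by simp
  qed
  also have "\<dots> \<le> ennreal t * (\<Sum>n. emeasure M (if n \<in> I then ball (c n) (5 * s (c n)) else {}))"
    by (intro mult_left_mono emeasure_subadditive_countably) auto
  also have "\<dots> \<le> ennreal t * (\<Sum>n. ennreal K * emeasure M (B n))"
    using assms(3) c(1) s by (intro mult_left_mono suminf_le) (auto simp: B_def intro!: doubling)
  also have "\<dots> = ennreal K * (\<Sum>n. ennreal t * emeasure M (B n))"
    by (simp add: ac_simps)
  also have "\<dots> \<le> ennreal K * (\<Sum>n. emeasure \<nu> (B n))"
    using c(1) s by (intro mult_left_mono suminf_le) (auto simp: B_def)
  also have "(\<Sum>n. emeasure \<nu> (B n)) = emeasure \<nu> (\<Union>n. B n)"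
    using c(2) assms(1) by (intro suminf_emeasure) (auto simp: B_def disjoint_family_on_def)
  also have "ennreal K * \<dots> \<le> ennreal K * emeasure \<nu> U"
  proof -
    have "B n \<subseteq> U" for n using c(1)[of n] s[of "c n"] by (simp add: B_def)
    then show ?thesis using assms(1,5) by (intro mult_left_mono emeasure_mono) auto
  qed
  finally show ?thesis
    using c(3) by (intro that[of W]) (auto simp: W_def)
qed

text \<open>Approximate A from inside by a compact C. A point outside A has a ball that avoids C, so
  there A has only the mass of A - C, which is as small as desired; the weak type bound then makes
  the set of points with positive upper density null.\<close>

lemma density_zero_outside:
  assumes A: "A \<in> sets borel"
  shows "AE x in M. x \<in> S - A \<longrightarrow>
    (\<forall>\<epsilon>>0. \<exists>d>0. \<forall>s. 0 < s \<and> s < d \<longrightarrow> emeasure M (A \<inter> ball x s) \<le> ennreal \<epsilon> * emeasure M (ball x s))"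
proof -
  \<comment> \<open>Exceptional points, split by a level 1/(j+1) of the upper density and by a bound
    R on the norm.\<close>
  define N where "N j R = {x \<in> S - A. norm x < real R \<and>
    (\<forall>d>0. \<exists>s>0. s < d \<and> ennreal (1 / real (Suc j)) * emeasure M (ball x s) < emeasure M (A \<inter> ball x s))}" for j R
  have null: "\<exists>Z\<in>null_sets M. N j R \<subseteq> Z" for j R
  proof -
    define U where "U = ball (0::'b) (real R + 1)"
    have Ub: "U \<in> sets borel" by (simp add: U_def)
    define t where "t = 1 / real (Suc j)"
    have t: "0 < t" by (simp add: t_def)
    have "\<exists>W. open W \<and> N j R \<subseteq> W \<and> ennreal t * emeasure M W \<le> ennreal K * ennreal e" if e: "e > 0" for e
    proof -
      \<comment> \<open>The restriction to the bounded set U is finite, as inner regularity by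
        compact sets requires.\<close>
      define M1 where "M1 = density M (indicator U)"
      have M1: "emeasure M1 X = emeasure M (U \<inter> X)" if "X \<in> sets borel" for X
        using that Ub by (simp add: M1_def emeasure_restricted)
      have setsM1: "sets M1 = sets borel" by (simp add: M1_def)
      have "emeasure M1 (space M1) \<noteq> \<infinity>"
        using finite_ball[of 0 "real R + 1"] M1[of UNIV] by (simp add: M1_def U_def)
      then have "emeasure M1 A = (SUP K \<in> {K. K \<subseteq> A \<and> compact K}. emeasure M1 K)"
        by (intro inner_regular A setsM1) auto
      moreover have "emeasure M1 A < \<infinity>"
        using finite_ball[of 0 "real R + 1"] A
        by (simp add: M1) (metis Int_lower1 U_def Ub emeasure_mono le_less_trans sets_M)
      ultimately obtain C where C: "C \<subseteq> A" "compact C" "emeasure M1 A < emeasure M1 C + ennreal e"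
      proof -
        have "\<exists>C\<in>{K. K \<subseteq> A \<and> compact K}. emeasure M1 A < emeasure M1 C + ennreal e"
          by (rule SUP_approx_ennreal[OF e _ \<open>emeasure M1 A = _\<close>]) (use \<open>emeasure M1 A < \<infinity>\<close> in auto)
        then show thesis using that by blast
      qed
      define \<nu> where "\<nu> = density M (indicator (U \<inter> (A - C)))"
      have Cb: "C \<in> sets borel" using C(2) by (simp add: borel_compact)
      have \<nu>: "emeasure \<nu> X = emeasure M (U \<inter> (A - C) \<inter> X)" if "X \<in> sets borel" for X
        using that Ub A Cb by (simp add: \<nu>_def emeasure_restricted)
      have \<nu>U: "emeasure \<nu> U \<le> ennreal e"
      proof -
        have "emeasure \<nu> U = emeasure M1 (A - C)" using Ub A Cb by (simp add: \<nu> M1 Int_ac)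
        also have "\<dots> = emeasure M1 A - emeasure M1 C"
          using C Cb A \<open>emeasure M1 A < \<infinity>\<close> setsM1
          by (intro emeasure_Diff) (auto simp: top_unique less_top[symmetric] dest: emeasure_mono[of C A M1])
        also have "\<dots> \<le> ennreal e"
        proof -
          have "emeasure M1 A \<noteq> top" using \<open>emeasure M1 A < \<infinity>\<close> by (simp add: less_top)
          then show ?thesis using C(3) by (simp add: ennreal_minus_le_iff less_imp_le)
        qed
        finally show ?thesis .
      qed
      obtain W where W: "open W" "N j R \<subseteq> W" "ennreal t * emeasure M W \<le> ennreal K * emeasure \<nu> U"
      proof (rule weak_type_bound[of \<nu> t "N j R" U])
        fix x assume x: "x \<in> N j R"
        then have "x \<in> U - C" using C(1) by (auto simp: N_def U_def)
        moreover have "open (U - C)" using C(2) by (simp add: U_def open_Diff compact_imp_closed)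
        ultimately obtain d where d: "d > 0" "ball x d \<subseteq> U - C" using open_contains_ball by blast
        have "\<forall>d>0. \<exists>s>0. s < d \<and> ennreal t * emeasure M (ball x s) < emeasure M (A \<inter> ball x s)"
          using x by (simp add: N_def t_def)
        moreover have "0 < min d r\<^sub>0" using d(1) r0_pos by simp
        ultimately obtain s where s: "s > 0" "s < min d r\<^sub>0" "ennreal t * emeasure M (ball x s) < emeasure M (A \<inter> ball x s)"
          by blast
        have "ball x s \<subseteq> ball x d" using s(2) by (intro subset_ball) simp
        then have "ball x s \<subseteq> U - C" using d(2) by blast
        then have "A \<inter> ball x s = U \<inter> (A - C) \<inter> ball x s" by blast
        then show "\<exists>s>0. s < r\<^sub>0 \<and> ball x s \<subseteq> U \<and> ennreal t * emeasure M (ball x s) \<le> emeasure \<nu> (ball x s)"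
          using s \<open>ball x s \<subseteq> U - C\<close> by (intro exI[of _ s]) (auto simp: \<nu>)
      qed (use t Ub in \<open>auto simp: \<nu>_def N_def\<close>)
      have "ennreal t * emeasure M W \<le> ennreal K * ennreal e"
        using W(3) \<nu>U by (meson mult_left_mono order_trans zero_le)
      then show ?thesis using W by blast
    qed
    then have "\<exists>W. open W \<and> N j R \<subseteq> W \<and> ennreal t * emeasure M W \<le> ennreal K * ennreal (1 / real (Suc m))" for m
      by simp
    then obtain W where W: "open (W m)" "N j R \<subseteq> W m"
      "ennreal t * emeasure M (W m) \<le> ennreal K * ennreal (1 / real (Suc m))" for m by metis
    define Z where "Z = (\<Inter>m. W m)"
    have Zb: "Z \<in> sets borel" using W(1) by (auto simp: Z_def)
    have "ennreal t * emeasure M Z \<le> ennreal (K / real (Suc m))" for m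
    proof -
      have "ennreal t * emeasure M Z \<le> ennreal t * emeasure M (W m)"
        using W(1) by (intro mult_left_mono emeasure_mono) (auto simp: Z_def)
      also have "\<dots> \<le> ennreal (K / real (Suc m))"
        using W(3)[of m] K_pos by (simp add: ennreal_mult[symmetric])
      finally show ?thesis .
    qed
    moreover have "(\<lambda>m. ennreal (K / real (Suc m))) \<longlonglongrightarrow> ennreal 0"
      by (intro tendsto_ennrealI LIMSEQ_Suc[OF lim_const_over_n])
    ultimately have "ennreal t * emeasure M Z \<le> 0"
      by (intro LIMSEQ_le_const[where X="\<lambda>m. ennreal (K / real (Suc m))"]) auto
    then have "Z \<in> null_sets M" using t Zb by (auto simp: null_sets_def)
    moreover have "N j R \<subseteq> Z" using W(2) by (auto simp: Z_def)
    ultimately show ?thesis by blast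
  qed
  then obtain Z where Z: "Z j R \<in> null_sets M" "N j R \<subseteq> Z j R" for j R by metis
  have "(\<Union>j R. Z j R) \<in> null_sets M" using Z(1) by auto
  moreover have "x \<in> (\<Union>j R. Z j R)" if x: "x \<in> S - A"
    and bad: "\<not> (\<forall>\<epsilon>>0. \<exists>d>0. \<forall>s. 0 < s \<and> s < d \<longrightarrow> emeasure M (A \<inter> ball x s) \<le> ennreal \<epsilon> * emeasure M (ball x s))" for x
  proof -
    obtain \<epsilon> where e: "\<epsilon> > 0" "\<And>d. d > 0 \<Longrightarrow> \<exists>s. 0 < s \<and> s < d \<and> ennreal \<epsilon> * emeasure M (ball x s) < emeasure M (A \<inter> ball x s)"
      using bad by (meson linorder_not_le)
    obtain j where j: "1 / real (Suc j) < \<epsilon>" using e(1) reals_Archimedean by (auto simp: inverse_eq_divide)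
    obtain R :: nat where "norm x < real R" using reals_Archimedean2 by blast
    moreover have "\<exists>s>0. s < d \<and> ennreal (1 / real (Suc j)) * emeasure M (ball x s) < emeasure M (A \<inter> ball x s)" if "d > 0" for d
    proof -
      have "ennreal (1 / real (Suc j)) * emeasure M (ball x s) \<le> ennreal \<epsilon> * emeasure M (ball x s)" for s
        using j by (intro mult_right_mono ennreal_leI) auto
      then show ?thesis using e(2)[OF that] by (meson le_less_trans)
    qed
    ultimately have "x \<in> N j R" using x by (auto simp: N_def)
    then show ?thesis using Z(2) by blast
  qed
  ultimately show ?thesis by (intro AE_I'[of "\<Union>j R. Z j R"]) blast+
qed

text \<open>Countably many sets suffice: for c in a dense set, \<open>A c j\<close> is where g is
  not close to c. If g x is close to c, then x lies outside \<open>A c j\<close>, so that set has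
  density 0 at x; off it g is close to g x, and on it the bound B is enough.\<close>

theorem Lebesgue_points:
  fixes g :: "'b \<Rightarrow> 'c::euclidean_space"
  assumes g[measurable]: "g \<in> borel_measurable borel" and bd: "\<And>x. norm (g x) \<le> B"
  shows "AE x in M. x \<in> S \<longrightarrow>
    (\<forall>\<epsilon>>0. \<exists>d>0. \<forall>s. 0 < s \<and> s < d \<longrightarrow>
       (\<integral>\<^sup>+y\<in>ball x s. ennreal (norm (g y - g x)) \<partial>M) \<le> ennreal \<epsilon> * emeasure M (ball x s))"
proof -
  obtain D :: "'c set" where D: "countable D" "\<And>X. open X \<Longrightarrow> X \<noteq> {} \<Longrightarrow> \<exists>d\<in>D. d \<in> X"
    using countable_dense_setE by metis
  define A where "A c j = {y. 1 / real (Suc j) \<le> dist c (g y)}" for c j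
  have Ab: "A c j \<in> sets borel" for c j by (simp add: A_def)
  have "AE x in M. \<forall>c\<in>D. \<forall>j. x \<in> S - A c j \<longrightarrow> (\<forall>\<epsilon>>0. \<exists>d>0. \<forall>s. 0 < s \<and> s < d \<longrightarrow>
      emeasure M (A c j \<inter> ball x s) \<le> ennreal \<epsilon> * emeasure M (ball x s))"
    unfolding AE_ball_countable[OF D(1)] AE_all_countable
    by (intro ballI allI density_zero_outside Ab)
  then show ?thesis
  proof (eventually_elim, intro impI allI)
    fix x \<epsilon> assume x: "\<forall>c\<in>D. \<forall>j. x \<in> S - A c j \<longrightarrow> (\<forall>\<epsilon>>0. \<exists>d>0. \<forall>s. 0 < s \<and> s < d \<longrightarrow>
      emeasure M (A c j \<inter> ball x s) \<le> ennreal \<epsilon> * emeasure M (ball x s))" and "x \<in> S" and e: "(0::real) < \<epsilon>"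
    have B0: "0 \<le> B" using bd[of x] norm_ge_zero order_trans by blast
    obtain j where j: "1 / real (Suc j) < \<epsilon> / 4" using e reals_Archimedean[of "\<epsilon>/4"] by (auto simp: inverse_eq_divide)
    obtain c where c: "c \<in> D" "dist (g x) c < 1 / real (Suc j)"
      using D(2)[of "ball (g x) (1 / real (Suc j))"] by auto
    then have "x \<in> S - A c j" using \<open>x \<in> S\<close> by (auto simp: A_def dist_commute)
    \<comment> \<open>Makes the contribution 2 B \<eta> of the far set at most \<epsilon>/2.\<close>
    define \<eta> where "\<eta> = \<epsilon> / (4 * (B + 1))"
    have "\<eta> > 0" using e B0 by (simp add: \<eta>_def)
    then obtain d where d: "d > 0" "\<And>s. 0 < s \<Longrightarrow> s < d \<Longrightarrow>
      emeasure M (A c j \<inter> ball x s) \<le> ennreal \<eta> * emeasure M (ball x s)"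
      using x c(1) \<open>x \<in> S - A c j\<close> by meson
    have "(\<integral>\<^sup>+y\<in>ball x s. ennreal (norm (g y - g x)) \<partial>M) \<le> ennreal \<epsilon> * emeasure M (ball x s)" if s: "0 < s" "s < d" for s
    proof -
      have pw: "ennreal (norm (g y - g x)) * indicator (ball x s) y \<le>
        ennreal (\<epsilon> / 2) * indicator (ball x s) y + ennreal (2 * B) * indicator (A c j \<inter> ball x s) y" for y
      proof (cases "y \<in> ball x s")
        case True
        show ?thesis
        proof (cases "y \<in> A c j")
          case F: True
          have "norm (g y - g x) \<le> 2 * B" using bd[of x] bd[of y] norm_triangle_ineq4[of "g y" "g x"] by linarith
          then show ?thesis using True F by (simp add: ennreal_leI add_increasing)
        next
          case F: False
          have "dist (g y) (g x) \<le> dist c (g y) + dist (g x) c" by (metis add.commute dist_commute dist_triangle)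
          also have "\<dots> \<le> \<epsilon> / 2" using F c(2) j by (simp add: A_def)
          finally show ?thesis using True F by (simp add: ennreal_leI dist_norm)
        qed
      qed simp
      have "(\<integral>\<^sup>+y\<in>ball x s. ennreal (norm (g y - g x)) \<partial>M) \<le>
        (\<integral>\<^sup>+y. ennreal (\<epsilon> / 2) * indicator (ball x s) y + ennreal (2 * B) * indicator (A c j \<inter> ball x s) y \<partial>M)"
        by (intro nn_integral_mono pw)
      also have "\<dots> = ennreal (\<epsilon> / 2) * emeasure M (ball x s) + ennreal (2 * B) * emeasure M (A c j \<inter> ball x s)"
      proof -
        have [measurable]: "A c j \<in> sets M" "ball x s \<in> sets M" using Ab[of c j] by auto
        show ?thesis by (simp add: nn_integral_add nn_integral_cmult_indicator)
      qed
      also have "\<dots> \<le> ennreal (\<epsilon> / 2) * emeasure M (ball x s) + ennreal (2 * B) * (ennreal \<eta> * emeasure M (ball x s))"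
        by (intro add_left_mono mult_left_mono d(2) s) auto
      also have "\<dots> = ennreal (\<epsilon> / 2 + 2 * B * \<eta>) * emeasure M (ball x s)"
        using e B0 \<open>\<eta> > 0\<close> by (simp add: ennreal_mult ring_distribs ennreal_plus mult.assoc)
      also have "\<dots> \<le> ennreal \<epsilon> * emeasure M (ball x s)"
        using e B0 by (intro mult_right_mono ennreal_leI) (auto simp: \<eta>_def field_simps)
      finally show ?thesis .
    qed
    then show "\<exists>d>0. \<forall>s. 0 < s \<and> s < d \<longrightarrow>
       (\<integral>\<^sup>+y\<in>ball x s. ennreal (norm (g y - g x)) \<partial>M) \<le> ennreal \<epsilon> * emeasure M (ball x s)"
      using d(1) by blast
  qed
qed

end

lemma doubling_measure_lborel:
  "doubling_measure (lborel :: 'b::euclidean_space measure) UNIV (5 ^ DIM('b)) 1"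
proof
  show "emeasure lborel (ball x (5 * s)) \<le> ennreal (5 ^ DIM('b)) * emeasure lborel (ball x s)"
    if "0 < s" for x :: 'b and s
    using that by (simp add: emeasure_ball ennreal_mult[symmetric] power_mult_distrib mult_ac)
qed (use emeasure_compact_finite in \<open>auto simp: infinity_ennreal_def\<close>)

interpretation lborel_doubling: doubling_measure "lborel :: 'b::euclidean_space measure" UNIV "5 ^ DIM('b)" 1
  by (rule doubling_measure_lborel)

section \<open>Rademacher's theorem\<close>

text \<open>The translates of N by t v, 0 \<le> t \<le> 1, all have the measure of N; by Fubini
  their average is an integral over lines of sections that vanish. No choice of coordinates along v
  is involved.\<close>

lemma lborel_AE_line:
  fixes N :: "'b::euclidean_space set"
  assumes N[measurable]: "N \<in> sets borel" and line: "\<And>y. AE t in lborel. y + t *\<^sub>R v \<notin> N"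
  shows "AE y in lborel. y \<notin> N"
proof -
  have [measurable]: "(\<lambda>(y, t::real). y + t *\<^sub>R v) \<in> borel_measurable (lborel \<Otimes>\<^sub>M lborel)" by measurable
  have "(\<integral>\<^sup>+t. (\<integral>\<^sup>+y. indicator N (y + t *\<^sub>R v) * indicator {0..1} t \<partial>lborel) \<partial>(lborel :: real measure))
    = (\<integral>\<^sup>+y. (\<integral>\<^sup>+t. indicator N (y + t *\<^sub>R v) * indicator {0..1} t \<partial>(lborel :: real measure)) \<partial>lborel)"
    by (rule lborel_pair.Fubini') measurable
  also have "\<dots> = (\<integral>\<^sup>+(y::'b). 0 \<partial>lborel)"
  proof (rule nn_integral_cong)
    fix y :: 'b
    show "(\<integral>\<^sup>+t. indicator N (y + t *\<^sub>R v) * indicator {0..1} t \<partial>(lborel :: real measure)) = 0"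
    proof -
      have "(\<integral>\<^sup>+t. indicator N (y + t *\<^sub>R v) * indicator {0..1} t \<partial>(lborel :: real measure)) = (\<integral>\<^sup>+(t::real). 0 \<partial>lborel)"
        by (intro nn_integral_cong_AE eventually_mono[OF line[of y]]) auto
      then show ?thesis by simp
    qed
  qed
  finally have z: "(\<integral>\<^sup>+t. (\<integral>\<^sup>+y. indicator N (y + t *\<^sub>R v) * indicator {0..1} t \<partial>lborel) \<partial>(lborel :: real measure)) = 0"
    by simp
  have "(\<integral>\<^sup>+y. indicator N (y + t *\<^sub>R v) * indicator {0..1} t \<partial>lborel) = emeasure lborel N * indicator {0..1} t" for t :: real
  proof -
    have "(\<integral>\<^sup>+y. indicator N (y + t *\<^sub>R v) \<partial>lborel) = (\<integral>\<^sup>+y. indicator N y \<partial>distr lborel borel ((+) (t *\<^sub>R v)))"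
      by (subst nn_integral_distr) (auto simp: add.commute)
    also have "\<dots> = emeasure lborel N" by (simp add: lborel_distr_plus)
    finally show ?thesis by (simp add: nn_integral_multc)
  qed
  then have "emeasure lborel N * emeasure lborel {0..1::real} = 0"
    using z by (simp add: nn_integral_cmult_indicator)
  then have "N \<in> null_sets lborel" by (auto simp: null_sets_def)
  then show ?thesis by (rule AE_not_in)
qed

text \<open>Adding (L + 1) x turns f into an increasing bi-Lipschitz bijection F. The measure with
  increments of F is absolutely continuous, and at a Lebesgue point of its density F is
  differentiable.\<close>

lemma lipschitz_AE_differentiable_real:
  fixes f :: "real \<Rightarrow> real"
  assumes f: "L-lipschitz_on UNIV f"
  shows "AE x in lborel. \<exists>D. (f has_real_derivative D) (at x)"
proof -
  have L0: "0 \<le> L" using f by (rule lipschitz_on_nonneg)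
  have fL: "\<bar>f a - f b\<bar> \<le> L * \<bar>a - b\<bar>" for a b
    using lipschitz_onD[OF f, of a b] by (simp add: dist_real_def)
  define F where "F x = f x + (L + 1) * x" for x
  define C where "C = 2 * L + 1"
  have C0: "0 < C" using L0 by (simp add: C_def)
  have Flow: "b - a \<le> F b - F a" and Fup: "F b - F a \<le> C * (b - a)" if "a \<le> b" for a b
    using fL[of b a] that by (auto simp: F_def C_def algebra_simps abs_le_iff)
  have Fmono: "F a < F b \<longleftrightarrow> a < b" for a b
    using Flow[of a b] Flow[of b a] by (cases "a < b") (auto simp: not_less)
  have Finj: "inj F"
  proof (rule injI)
    fix a b assume "F a = F b"
    then show "a = b" using Fmono[of a b] Fmono[of b a] by linarith
  qed
  have Fcont: "continuous_on UNIV F"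
    unfolding F_def by (intro continuous_intros lipschitz_on_continuous_on[OF f])
  have Fsurj: "surj F"
  proof -
    have "\<exists>x. F x = y" for y
    proof -
      have "F (- \<bar>y - F 0\<bar>) \<le> y" using Flow[of "- \<bar>y - F 0\<bar>" 0] by auto
      moreover have "y \<le> F \<bar>y - F 0\<bar>" using Flow[of 0 "\<bar>y - F 0\<bar>"] by auto
      ultimately show ?thesis
        using IVT'[of F "- \<bar>y - F 0\<bar>" y "\<bar>y - F 0\<bar>"] continuous_on_subset[OF Fcont] by auto
    qed
    then show ?thesis by (metis surjI)
  qed
  define G where "G = inv F"
  have FG: "F (G y) = y" for y using Fsurj by (simp add: G_def surj_f_inv_f)
  have GF: "G (F x) = x" for x using Finj by (simp add: G_def)
  have "mono G"
  proof (rule monoI)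
    fix a b :: real assume "a \<le> b"
    then show "G a \<le> G b" using Fmono[of "G b" "G a"] by (simp add: FG)
  qed
  then have Gm[measurable]: "G \<in> borel_measurable borel" by (rule borel_measurable_mono)
  have GA: "G -` A = F ` A" for A
  proof (intro set_eqI iffI)
    show "y \<in> F ` A" if "y \<in> G -` A" for y using that FG[of y] by (metis image_eqI vimageE)
    show "y \<in> G -` A" if "y \<in> F ` A" for y using that GF by auto
  qed
  \<comment> \<open>The measure of A is the length of F(A), since G inverts F.\<close>
  define \<nu> where "\<nu> = distr lborel borel G"
  have \<nu>: "emeasure \<nu> A = emeasure lborel (F ` A)" if "A \<in> sets borel" for A
    using that GA[of A] by (simp add: \<nu>_def emeasure_distr)
  have \<nu>_int: "emeasure \<nu> {a<..<b} = ennreal (F b - F a)" if "a \<le> b" for a b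
  proof -
    have "F ` {a<..<b} = {F a<..<F b}"
    proof (intro set_eqI iffI)
      fix y assume y: "y \<in> {F a<..<F b}"
      then have "G y \<in> {a<..<b}" using Fmono[of a "G y"] Fmono[of "G y" b] by (simp add: FG)
      then show "y \<in> F ` {a<..<b}" using FG[of y] by (metis image_eqI)
    qed (auto simp: Fmono)
    then show ?thesis using \<nu>[of "{a<..<b}"] Flow[OF that] that by simp
  qed
  \<comment> \<open>Lipschitz maps send null sets to null sets.\<close>
  have ac: "absolutely_continuous lborel \<nu>"
    unfolding absolutely_continuous_def
  proof
    fix A assume A: "A \<in> null_sets (lborel :: real measure)"
    then have "negligible A"
      by (simp add: negligible_iff_null_sets null_sets_completionI)
    then have "negligible (F ` A)"
    proof (rule negligible_locally_Lipschitz_image[rotated])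
      fix x assume "x \<in> A"
      have "norm (F y - F x) \<le> C * norm (y - x)" for y
        using Fup[of x y] Fup[of y x] Flow[of x y] Flow[of y x] by (cases "x \<le> y") auto
      then show "\<exists>T B. open T \<and> x \<in> T \<and> (\<forall>y\<in>A \<inter> T. norm (F y - F x) \<le> B * norm (y - x))"
        by (intro exI[of _ UNIV] exI[of _ C]) auto
    qed simp
    moreover have "F ` A \<in> sets lborel" using measurable_sets_borel[OF Gm, of A] A GA[of A] by (simp add: null_sets_def)
    ultimately have "F ` A \<in> null_sets lborel"
      by (simp add: negligible_iff_null_sets null_sets_completion_iff)
    then show "A \<in> null_sets \<nu>" using A \<nu>[of A] by (auto simp: null_sets_def \<nu>_def)
  qed
  obtain g where g[measurable]: "g \<in> borel_measurable lborel" and gd: "density lborel g = \<nu>"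
    using sigma_finite_measure.Radon_Nikodym[OF sigma_finite_lborel ac] by (auto simp: \<nu>_def)
  have gb: "g \<in> borel_measurable borel" using g by simp
  \<comment> \<open>\<open>Lebesgue_points\<close> asks for a bounded function. At a density point
    of the set where g exceeds some C' > C, short intervals would have more mass than the Lipschitz
    constant C of F allows.\<close>
  have "AE x in lborel. \<forall>m. g x \<le> ennreal (C + 1 / real (Suc m))"
    unfolding AE_all_countable
  proof
    fix m :: nat
    define C' where "C' = C + 1 / real (Suc m)"
    have C': "C < C'" by (simp add: C'_def)
    define A where "A = {x. g x \<le> ennreal C'}"
    have A[measurable]: "A \<in> sets borel" using gb by (simp add: A_def)
    have "AE x in lborel. x \<in> UNIV - A \<longrightarrow>
      (\<forall>\<epsilon>>0. \<exists>d>0. \<forall>s. 0 < s \<and> s < d \<longrightarrow> emeasure lborel (A \<inter> ball x s) \<le> ennreal \<epsilon> * emeasure lborel (ball x s))"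
      by (rule lborel_doubling.density_zero_outside[OF A])
    then show "AE x in lborel. g x \<le> ennreal (C + 1 / real (Suc m))"
    proof eventually_elim
      fix x assume x: "x \<in> UNIV - A \<longrightarrow>
      (\<forall>\<epsilon>>0. \<exists>d>0. \<forall>s. 0 < s \<and> s < d \<longrightarrow> emeasure lborel (A \<inter> ball x s) \<le> ennreal \<epsilon> * emeasure lborel (ball x s))"
      show "g x \<le> ennreal (C + 1 / real (Suc m))"
      proof (rule ccontr)
        assume "\<not> g x \<le> ennreal (C + 1 / real (Suc m))"
        then have "x \<in> UNIV - A" by (simp add: A_def C'_def)
        \<comment> \<open>Makes C' (1 - \<epsilon>) the midpoint of C and C'.\<close>
        define \<epsilon> where "\<epsilon> = (C' - C) / (2 * C')"
        have e: "0 < \<epsilon>" "\<epsilon> < 1" "C' * (1 - \<epsilon>) > C" using C' C0 by (auto simp: \<epsilon>_def field_simps)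
        obtain s where s: "s > 0" "emeasure lborel (A \<inter> ball x s) \<le> ennreal \<epsilon> * emeasure lborel (ball x s)"
        proof -
          obtain d where "d > 0" "\<forall>s. 0 < s \<and> s < d \<longrightarrow> emeasure lborel (A \<inter> ball x s) \<le> ennreal \<epsilon> * emeasure lborel (ball x s)"
            using x \<open>x \<in> UNIV - A\<close> e(1) by blast
          then show ?thesis using that[of "d/2"] by auto
        qed
        have eb: "emeasure lborel (ball x s) = ennreal (2 * s)" using s(1) by (simp add: ball_eq_greaterThanLessThan)
        have split: "ennreal (2 * s) = emeasure lborel (A \<inter> ball x s) + emeasure lborel (ball x s - A)"
          unfolding eb[symmetric] by (subst plus_emeasure) (auto intro!: arg_cong[where f="emeasure lborel"])
        have "emeasure lborel (A \<inter> ball x s) \<le> ennreal (\<epsilon> * (2 * s))"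
          using s e by (simp add: eb ennreal_mult)
        then have low: "ennreal ((1 - \<epsilon>) * (2 * s)) \<le> emeasure lborel (ball x s - A)"
          using split e s by (cases "emeasure lborel (A \<inter> ball x s)"; cases "emeasure lborel (ball x s - A)")
            (auto simp: ennreal_plus[symmetric] algebra_simps simp del: ennreal_plus)
        have "ennreal C' * ennreal ((1 - \<epsilon>) * (2 * s)) \<le> ennreal C' * emeasure lborel (ball x s - A)"
          by (intro mult_left_mono low) auto
        also have "\<dots> = (\<integral>\<^sup>+y. ennreal C' * indicator (ball x s - A) y \<partial>lborel)"
          by (subst nn_integral_cmult_indicator) auto
        also have "\<dots> \<le> (\<integral>\<^sup>+y. g y * indicator (ball x s) y \<partial>lborel)"
          by (intro nn_integral_mono) (auto simp: indicator_def A_def)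
        also have "\<dots> = emeasure \<nu> (ball x s)" by (simp add: gd[symmetric] emeasure_density)
        also have "\<dots> = ennreal (F (x + s) - F (x - s))"
          using \<nu>_int[of "x - s" "x + s"] s(1) by (simp add: ball_eq_greaterThanLessThan)
        also have "\<dots> \<le> ennreal (C * (2 * s))"
          using Fup[of "x - s" "x + s"] s(1) by (intro ennreal_leI) auto
        finally have "C' * ((1 - \<epsilon>) * (2 * s)) \<le> C * (2 * s)"
          using C' C0 e s by (simp add: ennreal_mult[symmetric])
        moreover have "0 < (C' * (1 - \<epsilon>) - C) * (2 * s)" using e(3) s(1) by simp
        ultimately show False by (simp add: algebra_simps)
      qed
    qed
  qed
  then have gC: "AE x in lborel. g x \<le> ennreal (C + 1)"
  proof eventually_elim
    fix x assume "\<forall>m. g x \<le> ennreal (C + 1 / real (Suc m))"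
    from spec[OF this, of 0] show "g x \<le> ennreal (C + 1)" by simp
  qed
  \<comment> \<open>A version of the density that is finite and bounded everywhere.\<close>
  define h where "h x = min (enn2real (g x)) (C + 1)" for x
  have h[measurable]: "h \<in> borel_measurable borel" unfolding h_def using gb by measurable
  have h0: "0 \<le> h x" "h x \<le> C + 1" for x using C0 by (auto simp: h_def)
  have gh: "AE x in lborel. g x = ennreal (h x)"
    using gC
  proof eventually_elim
    fix x assume a: "g x \<le> ennreal (C + 1)"
    then obtain r where r: "g x = ennreal r" "0 \<le> r" by (cases "g x") (auto simp: top_unique)
    then have "r \<le> C + 1" using a C0 by (simp del: ennreal_plus)
    then show "g x = ennreal (h x)" using r by (simp add: h_def)
  qed
  have finI: "emeasure lborel {a<..<b} < \<infinity>" for a b :: real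
    by (intro emeasure_bounded_finite) simp
  have int_h: "set_integrable lborel {a<..<b} h" for a b
    unfolding set_integrable_def
    by (rule integrableI_bounded_set_indicator[where B="C+1"]) (use h0 finI in auto)
  have Fh: "F b - F a = (LINT x:{a<..<b}|lborel. h x)" if "a \<le> b" for a b
  proof -
    have "ennreal (F b - F a) = (\<integral>\<^sup>+x. g x * indicator {a<..<b} x \<partial>lborel)"
      using \<nu>_int[OF that] by (simp add: gd[symmetric] emeasure_density)
    also have "\<dots> = (\<integral>\<^sup>+x. ennreal (indicator {a<..<b} x *\<^sub>R h x) \<partial>lborel)"
      using gh by (intro nn_integral_cong_AE) (auto simp: indicator_def elim: eventually_mono)
    also have "\<dots> = ennreal (LINT x:{a<..<b}|lborel. h x)"
      unfolding set_lebesgue_integral_def using int_h[of a b] h0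
      by (intro nn_integral_eq_integral) (auto simp: set_integrable_def)
    finally show ?thesis
      using Flow[OF that] that h0 by (subst (asm) ennreal_inj)
        (auto simp: set_lebesgue_integral_def intro!: integral_nonneg_AE)
  qed
  have "AE x in lborel. x \<in> UNIV \<longrightarrow>
    (\<forall>\<epsilon>>0. \<exists>d>0. \<forall>s. 0 < s \<and> s < d \<longrightarrow>
       (\<integral>\<^sup>+y\<in>ball x s. ennreal (norm (h y - h x)) \<partial>lborel) \<le> ennreal \<epsilon> * emeasure lborel (ball x s))"
    by (rule lborel_doubling.Lebesgue_points[where B="C+1"]) (use h0 in \<open>auto simp: abs_le_iff\<close>)
  then show ?thesis
  proof eventually_elim
    fix x assume x: "x \<in> UNIV \<longrightarrow> (\<forall>\<epsilon>>0. \<exists>d>0. \<forall>s. 0 < s \<and> s < d \<longrightarrow>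
       (\<integral>\<^sup>+y\<in>ball x s. ennreal (norm (h y - h x)) \<partial>lborel) \<le> ennreal \<epsilon> * emeasure lborel (ball x s))"
    \<comment> \<open>A one-sided interval at x is compared with the symmetric ball containing it,
      at the cost of a factor 2.\<close>
    have key: "\<bar>F b - F a - (b - a) * h x\<bar> \<le> \<epsilon> * (2 * s)"
      if ab: "a \<le> b" "{a<..<b} \<subseteq> ball x s" "0 < s" "0 < \<epsilon>" and
        *: "(\<integral>\<^sup>+y\<in>ball x s. ennreal (norm (h y - h x)) \<partial>lborel) \<le> ennreal \<epsilon> * emeasure lborel (ball x s)" for a b \<epsilon> s
    proof -
      have ic: "set_integrable lborel {a<..<b} (\<lambda>y. h x)"
        unfolding set_integrable_def using finI[of a b] by (simp add: integrable_real_indicator)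
      have "F b - F a - (b - a) * h x = (LINT y:{a<..<b}|lborel. h y - h x)"
        using set_integral_diff(2)[OF int_h[of a b] ic] ab(1) by (simp add: Fh set_lebesgue_integral_def)
      also have "\<bar>\<dots>\<bar> \<le> (LINT y:{a<..<b}|lborel. \<bar>h y - h x\<bar>)"
        using set_integral_norm_bound[OF set_integral_diff(1)[OF int_h[of a b] ic]] by simp
      also have "ennreal (LINT y:{a<..<b}|lborel. \<bar>h y - h x\<bar>) =
        (\<integral>\<^sup>+y. ennreal (indicator {a<..<b} y *\<^sub>R \<bar>h y - h x\<bar>) \<partial>lborel)"
        unfolding set_lebesgue_integral_def
        using set_integrable_abs[OF set_integral_diff(1)[OF int_h[of a b] ic]]
        by (intro nn_integral_eq_integral[symmetric]) (auto simp: set_integrable_def)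
      then have "ennreal (LINT y:{a<..<b}|lborel. \<bar>h y - h x\<bar>) \<le>
        (\<integral>\<^sup>+y\<in>ball x s. ennreal (norm (h y - h x)) \<partial>lborel)"
        using ab(2) by (auto intro!: nn_integral_mono simp: indicator_def split: if_splits)
      then have "ennreal (LINT y:{a<..<b}|lborel. \<bar>h y - h x\<bar>) \<le> ennreal (\<epsilon> * (2 * s))"
        using * ab(3,4) by (simp add: ball_eq_greaterThanLessThan ennreal_mult)
      then have "(LINT y:{a<..<b}|lborel. \<bar>h y - h x\<bar>) \<le> \<epsilon> * (2 * s)"
        using ab(3,4) by (subst (asm) ennreal_le_iff) auto
      finally show ?thesis .
    qed
    have "(F has_real_derivative h x) (at x)"
      unfolding DERIV_def LIM_eq
    proof (intro allI impI)
      fix e :: real assume e: "0 < e"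
      then obtain d where d: "d > 0" "\<And>s. 0 < s \<Longrightarrow> s < d \<Longrightarrow>
       (\<integral>\<^sup>+y\<in>ball x s. ennreal (norm (h y - h x)) \<partial>lborel) \<le> ennreal (e/4) * emeasure lborel (ball x s)"
        using x by (metis UNIV_I divide_pos_pos zero_less_numeral)
      have "norm ((F (x + t) - F x) / t - h x) < e" if t: "t \<noteq> 0" "\<bar>t\<bar> < d" for t
      proof -
        have "\<bar>F (x + t) - F x - t * h x\<bar> \<le> e / 4 * (2 * \<bar>t\<bar>)"
        proof (cases "t > 0")
          case True
          have "{x<..<x + t} \<subseteq> ball x t" by (auto simp: dist_real_def)
          then show ?thesis using key[of x "x + t" t "e/4"] d(2)[of t] t e True by simp
        next
          case False
          have "{x + t<..<x} \<subseteq> ball x (- t)" by (auto simp: dist_real_def)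
          then have "\<bar>F x - F (x + t) - (x - (x + t)) * h x\<bar> \<le> e / 4 * (2 * - t)"
            using key[of "x + t" x "- t" "e/4"] d(2)[of "-t"] t e False by simp
          moreover have "F x - F (x + t) - (x - (x + t)) * h x = - (F (x + t) - F x - t * h x)"
            by simp
          ultimately show ?thesis using False by (simp only: abs_minus_cancel) simp
        qed
        then have "\<bar>F (x + t) - F x - t * h x\<bar> / \<bar>t\<bar> \<le> e / 2" using t by (simp add: divide_le_eq)
        moreover have "\<bar>(F (x + t) - F x) / t - h x\<bar> = \<bar>F (x + t) - F x - t * h x\<bar> / \<bar>t\<bar>"
        proof -
          have "(F (x + t) - F x) / t - h x = (F (x + t) - F x - t * h x) / t"
            using t by (simp add: diff_divide_distrib)
          then show ?thesis by (simp only: abs_divide)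
        qed
        ultimately show ?thesis using e unfolding real_norm_def by linarith
      qed
      then show "\<exists>s>0. \<forall>t. t \<noteq> 0 \<and> norm (t - 0) < s \<longrightarrow> norm ((F (x + t) - F x) / t - h x) < e"
        using d(1) by (intro exI[of _ d]) auto
    qed
    then have "((\<lambda>y. F y - (L + 1) * y) has_real_derivative (h x - (L + 1))) (at x)"
      by (auto intro!: derivative_eq_intros)
    then show "\<exists>D. (f has_real_derivative D) (at x)" by (auto simp: F_def)
  qed
qed

section \<open>Directional derivatives of Lipschitz functions\<close>

definition dir_quot :: "('b::euclidean_space \<Rightarrow> real) \<Rightarrow> 'b \<Rightarrow> real \<Rightarrow> 'b \<Rightarrow> real" where
  "dir_quot f v t y = (f (y + t *\<^sub>R v) - f y) / t"

definition has_dir_deriv :: "('b::euclidean_space \<Rightarrow> real) \<Rightarrow> 'b \<Rightarrow> 'b \<Rightarrow> real \<Rightarrow> bool" where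
  "has_dir_deriv f v y D \<longleftrightarrow> ((\<lambda>t. dir_quot f v t y) \<longlongrightarrow> D) (at 0)"

text \<open>The limit along the single sequence 1/(n+1) is measurable outright, and it is the
  directional derivative wherever that exists.\<close>

definition dir_deriv :: "('b::euclidean_space \<Rightarrow> real) \<Rightarrow> 'b \<Rightarrow> 'b \<Rightarrow> real" where
  "dir_deriv f v y = lim (\<lambda>n. dir_quot f v (1 / real (Suc n)) y)"

lemma inverse_Suc_at_0: "filterlim (\<lambda>n. 1 / real (Suc n)) (at 0) sequentially"
  unfolding filterlim_at
  using LIMSEQ_Suc[OF lim_const_over_n[of "1::real"]] by (auto simp del: of_nat_Suc)

lemma has_dir_deriv_dir_deriv: "has_dir_deriv f v y D \<Longrightarrow> dir_deriv f v y = D"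
  unfolding dir_deriv_def has_dir_deriv_def
  by (rule limI) (rule filterlim_compose[OF _ inverse_Suc_at_0])

lemma has_dir_deriv_iff_DERIV:
  "has_dir_deriv f v (y + t *\<^sub>R v) D \<longleftrightarrow> ((\<lambda>s. f (y + s *\<^sub>R v)) has_real_derivative D) (at t)"
  by (simp add: has_dir_deriv_def DERIV_def dir_quot_def scaleR_add_left add.assoc)

text \<open>A Cauchy criterion over rational increments has only countable quantifiers, so the set
  where the derivative exists is Borel. Continuity of f extends it from rational to real
  increments.\<close>

lemma has_dir_deriv_Cauchy_iff:
  assumes "continuous_on UNIV f"
  shows "(\<exists>D. has_dir_deriv f v y D) \<longleftrightarrow>
    (\<forall>n::nat. \<exists>m::nat. \<forall>p q::rat. p \<noteq> 0 \<and> q \<noteq> 0 \<and> \<bar>p\<bar> < 1 / of_nat (Suc m) \<and> \<bar>q\<bar> < 1 / of_nat (Suc m) \<longrightarrow>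
      \<bar>dir_quot f v (of_rat p) y - dir_quot f v (of_rat q) y\<bar> \<le> 1 / real (Suc n))" (is "?L \<longleftrightarrow> ?R")
proof
  assume ?L
  then obtain D where D: "((\<lambda>t. dir_quot f v t y) \<longlongrightarrow> D) (at 0)" by (auto simp: has_dir_deriv_def)
  show ?R
  proof
    fix n :: nat
    have "0 < 1 / real (Suc n) / 2" by simp
    then obtain d where d: "d > 0" "\<And>t. t \<noteq> 0 \<Longrightarrow> \<bar>t\<bar> < d \<Longrightarrow> \<bar>dir_quot f v t y - D\<bar> < 1 / real (Suc n) / 2"
      using D unfolding LIM_eq by (metis diff_zero real_norm_def)
    obtain m where m: "1 / real (Suc m) < d" using reals_Archimedean[OF d(1)] by (auto simp: inverse_eq_divide)
    show "\<exists>m::nat. \<forall>p q::rat. p \<noteq> 0 \<and> q \<noteq> 0 \<and> \<bar>p\<bar> < 1 / of_nat (Suc m) \<and> \<bar>q\<bar> < 1 / of_nat (Suc m) \<longrightarrow>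
      \<bar>dir_quot f v (of_rat p) y - dir_quot f v (of_rat q) y\<bar> \<le> 1 / real (Suc n)"
    proof (intro exI[of _ m] allI impI)
      fix p q :: rat assume pq: "p \<noteq> 0 \<and> q \<noteq> 0 \<and> \<bar>p\<bar> < 1 / of_nat (Suc m) \<and> \<bar>q\<bar> < 1 / of_nat (Suc m)"
      have *: "\<bar>real_of_rat x\<bar> < d" if "\<bar>x\<bar> < 1 / of_nat (Suc m)" for x :: rat
      proof -
        have "real_of_rat \<bar>x\<bar> < real_of_rat (1 / of_nat (Suc m))" using that by (simp only: of_rat_less)
        then show ?thesis using m by (simp add: of_rat_divide of_rat_add)
      qed
      have "\<bar>dir_quot f v (of_rat p) y - D\<bar> < 1 / real (Suc n) / 2" "\<bar>dir_quot f v (of_rat q) y - D\<bar> < 1 / real (Suc n) / 2"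
      proof -
        have "real_of_rat p \<noteq> 0" "real_of_rat q \<noteq> 0" using pq by auto
        then show "\<bar>dir_quot f v (of_rat p) y - D\<bar> < 1 / real (Suc n) / 2" "\<bar>dir_quot f v (of_rat q) y - D\<bar> < 1 / real (Suc n) / 2"
          using d(2) * pq by blast+
      qed
      then show "\<bar>dir_quot f v (of_rat p) y - dir_quot f v (of_rat q) y\<bar> \<le> 1 / real (Suc n)"
      proof -
        define e where "e = 1 / real (Suc n)"
        assume "\<bar>dir_quot f v (of_rat p) y - D\<bar> < 1 / real (Suc n) / 2" "\<bar>dir_quot f v (of_rat q) y - D\<bar> < 1 / real (Suc n) / 2"
        then show "\<bar>dir_quot f v (of_rat p) y - dir_quot f v (of_rat q) y\<bar> \<le> 1 / real (Suc n)"
          unfolding e_def[symmetric] by linarith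
      qed
    qed
  qed
next
  assume R: ?R
  have cont: "isCont (\<lambda>t. dir_quot f v t y) t" if "t \<noteq> 0" for t
  proof -
    have "continuous_on UNIV (\<lambda>t. f (y + t *\<^sub>R v))"
      by (rule continuous_on_compose2[OF assms]) (auto intro!: continuous_intros)
    then have "isCont (\<lambda>t. f (y + t *\<^sub>R v)) t" by (simp add: continuous_on_eq_continuous_at)
    then show ?thesis unfolding dir_quot_def using that by (intro continuous_intros)
  qed
  have seq: "\<exists>p. (\<forall>n. p n \<noteq> (0::rat)) \<and> (\<lambda>n. real_of_rat (p n)) \<longlonglongrightarrow> t" if "t \<noteq> 0" for t :: real
  proof -
    have "\<exists>q::rat. q \<noteq> 0 \<and> \<bar>of_rat q - t\<bar> < 1 / real (Suc n)" for n
    proof -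
      have "\<exists>q. t < of_rat q \<and> of_rat q < min (t + 1 / real (Suc n)) (if t < 0 then 0 else t + 1)"
        using that by (intro of_rat_dense) auto
      then obtain q where "t < of_rat q" "of_rat q < min (t + 1 / real (Suc n)) (if t < 0 then 0 else t + 1)" by blast
      then show ?thesis using that by (intro exI[of _ q]) (auto split: if_splits)
    qed
    then obtain p :: "nat \<Rightarrow> rat" where p: "\<And>n. p n \<noteq> 0" "\<And>n. \<bar>of_rat (p n) - t\<bar> < 1 / real (Suc n)" by metis
    have "(\<lambda>n. real_of_rat (p n) - t) \<longlonglongrightarrow> 0"
      by (rule Lim_null_comparison[OF _ LIMSEQ_Suc[OF lim_const_over_n[of 1]]])
        (use less_imp_le[OF p(2)] in \<open>simp del: of_nat_Suc\<close>)
    then have "(\<lambda>n. real_of_rat (p n)) \<longlonglongrightarrow> t" by (simp add: LIM_zero_iff)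
    then show ?thesis using p(1) by blast
  qed
  have real: "\<exists>d>0. \<forall>s t. s \<noteq> 0 \<and> t \<noteq> 0 \<and> \<bar>s\<bar> < d \<and> \<bar>t\<bar> < d \<longrightarrow> \<bar>dir_quot f v s y - dir_quot f v t y\<bar> \<le> 1 / real (Suc n)" for n
  proof -
    obtain m :: nat where m: "\<And>p q::rat. p \<noteq> 0 \<Longrightarrow> q \<noteq> 0 \<Longrightarrow> \<bar>p\<bar> < 1 / of_nat (Suc m) \<Longrightarrow> \<bar>q\<bar> < 1 / of_nat (Suc m) \<Longrightarrow>
      \<bar>dir_quot f v (of_rat p) y - dir_quot f v (of_rat q) y\<bar> \<le> 1 / real (Suc n)"
      using R by meson
    have ab: "\<bar>x\<bar> < 1 / of_nat (Suc m)" if "\<bar>real_of_rat x\<bar> < 1 / real (Suc m)" for x :: rat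
    proof -
      have "real_of_rat \<bar>x\<bar> < real_of_rat (1 / of_nat (Suc m))" using that by (simp add: of_rat_divide of_rat_add)
      then show ?thesis by (simp only: of_rat_less)
    qed
    have "\<bar>dir_quot f v s y - dir_quot f v t y\<bar> \<le> 1 / real (Suc n)"
      if st: "s \<noteq> 0" "t \<noteq> 0" "\<bar>s\<bar> < 1 / real (Suc m)" "\<bar>t\<bar> < 1 / real (Suc m)" for s t
    proof -
      obtain p q :: "nat \<Rightarrow> rat" where p: "\<And>n. p n \<noteq> 0" "(\<lambda>n. real_of_rat (p n)) \<longlonglongrightarrow> s"
        and q: "\<And>n. q n \<noteq> 0" "(\<lambda>n. real_of_rat (q n)) \<longlonglongrightarrow> t" using seq st(1,2) by metis
      have "(\<lambda>i. \<bar>dir_quot f v (of_rat (p i)) y - dir_quot f v (of_rat (q i)) y\<bar>) \<longlonglongrightarrow> \<bar>dir_quot f v s y - dir_quot f v t y\<bar>"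
        by (intro tendsto_intros isCont_tendsto_compose[OF cont] p q st)
      moreover have "\<forall>\<^sub>F i in sequentially. \<bar>dir_quot f v (of_rat (p i)) y - dir_quot f v (of_rat (q i)) y\<bar> \<le> 1 / real (Suc n)"
        using order_tendstoD(2)[OF tendsto_rabs[OF p(2)] st(3)] order_tendstoD(2)[OF tendsto_rabs[OF q(2)] st(4)]
        by eventually_elim (intro m p q ab)
      ultimately show ?thesis by (rule tendsto_upperbound) simp
    qed
    then show ?thesis by (intro exI[of _ "1 / real (Suc m)"]) simp
  qed
  have "Cauchy (\<lambda>n. dir_quot f v (1 / real (Suc n)) y)"
  proof (rule metric_CauchyI)
    fix e :: real assume "0 < e"
    then obtain n where n: "1 / real (Suc n) < e" using reals_Archimedean by (auto simp: inverse_eq_divide)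
    obtain d where d: "d > 0" "\<And>s t. s \<noteq> 0 \<and> t \<noteq> 0 \<and> \<bar>s\<bar> < d \<and> \<bar>t\<bar> < d \<Longrightarrow> \<bar>dir_quot f v s y - dir_quot f v t y\<bar> \<le> 1 / real (Suc n)"
      using real by blast
    obtain N where N: "1 / real (Suc N) < d" using reals_Archimedean[OF d(1)] by (auto simp: inverse_eq_divide)
    have "1 / real (Suc i) < d" if "i \<ge> N" for i
      using N that frac_le[of 1 1 "real (Suc N)" "real (Suc i)"] by linarith
    then have "dist (dir_quot f v (1 / real (Suc i)) y) (dir_quot f v (1 / real (Suc j)) y) < e" if "i \<ge> N" "j \<ge> N" for i j
      using d(2)[of "1 / real (Suc i)" "1 / real (Suc j)"] n that by (simp add: dist_real_def)
    then show "\<exists>N. \<forall>i\<ge>N. \<forall>j\<ge>N. dist (dir_quot f v (1 / real (Suc i)) y) (dir_quot f v (1 / real (Suc j)) y) < e"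
      by blast
  qed
  then obtain D where D: "(\<lambda>n. dir_quot f v (1 / real (Suc n)) y) \<longlonglongrightarrow> D"
    using Cauchy_convergent_iff convergent_def by blast
  have "((\<lambda>t. dir_quot f v t y) \<longlongrightarrow> D) (at 0)"
    unfolding LIM_eq
  proof (intro allI impI)
    fix e :: real assume "0 < e"
    then obtain n where n: "1 / real (Suc n) < e" using reals_Archimedean by (auto simp: inverse_eq_divide)
    obtain d where d: "d > 0" "\<And>s t. s \<noteq> 0 \<and> t \<noteq> 0 \<and> \<bar>s\<bar> < d \<and> \<bar>t\<bar> < d \<Longrightarrow> \<bar>dir_quot f v s y - dir_quot f v t y\<bar> \<le> 1 / real (Suc n)"
      using real by blast
    have "\<bar>dir_quot f v s y - D\<bar> \<le> 1 / real (Suc n)" if s: "s \<noteq> 0" "\<bar>s\<bar> < d" for s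
    proof (rule tendsto_upperbound)
      show "(\<lambda>i. \<bar>dir_quot f v s y - dir_quot f v (1 / real (Suc i)) y\<bar>) \<longlonglongrightarrow> \<bar>dir_quot f v s y - D\<bar>"
        by (intro tendsto_intros D)
      have "(\<lambda>n. 1 / real (Suc n)) \<longlonglongrightarrow> 0" by (rule LIMSEQ_Suc[OF lim_const_over_n])
      from order_tendstoD(2)[OF this d(1)]
      show "\<forall>\<^sub>F i in sequentially. \<bar>dir_quot f v s y - dir_quot f v (1 / real (Suc i)) y\<bar> \<le> 1 / real (Suc n)"
        by eventually_elim (use d s in auto)
    qed simp
    then show "\<exists>s>0. \<forall>x. x \<noteq> 0 \<and> norm (x - 0) < s \<longrightarrow> norm (dir_quot f v x y - D) < e"
      using d(1) n by (intro exI[of _ d]) force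
  qed
  then show ?L by (auto simp: has_dir_deriv_def)
qed

locale lipschitz_fun =
  fixes f :: "'b::euclidean_space \<Rightarrow> real" and L :: real
  assumes lip: "L-lipschitz_on UNIV f"
begin

lemma L_nonneg: "0 \<le> L" using lip by (rule lipschitz_on_nonneg)

lemma lipD: "\<bar>f x - f y\<bar> \<le> L * norm (x - y)"
  using lipschitz_onD[OF lip, of x y] by (simp add: dist_norm)

lemma cont: "continuous_on UNIV f" using lip by (rule lipschitz_on_continuous_on)

lemma f_measurable [measurable]: "f \<in> borel_measurable borel"
  using cont by (rule borel_measurable_continuous_onI)

lemma dir_quot_measurable [measurable]: "dir_quot f v t \<in> borel_measurable borel"
  unfolding dir_quot_def by measurable

lemma dir_deriv_measurable [measurable]: "dir_deriv f v \<in> borel_measurable borel"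
  unfolding dir_deriv_def by measurable

lemma dir_quot_bound: "\<bar>dir_quot f v t y\<bar> \<le> L * norm v"
  using lipD[of "y + t *\<^sub>R v" y] L_nonneg
  by (cases "t = 0") (auto simp: dir_quot_def abs_divide divide_le_eq mult_ac)

text \<open>On every line in direction v the one-dimensional result applies;
  \<open>lborel_AE_line\<close> lifts it to the whole space.\<close>

lemma AE_has_dir_deriv: "AE y in lborel. has_dir_deriv f v y (dir_deriv f v y)"
proof -
  define N where "N = {y. \<not> (\<exists>D. has_dir_deriv f v y D)}"
  have "{y. \<forall>n::nat. \<exists>m::nat. \<forall>p q::rat. p \<noteq> 0 \<and> q \<noteq> 0 \<and> \<bar>p\<bar> < 1 / of_nat (Suc m) \<and> \<bar>q\<bar> < 1 / of_nat (Suc m) \<longrightarrow>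
      \<bar>dir_quot f v (of_rat p) y - dir_quot f v (of_rat q) y\<bar> \<le> 1 / real (Suc n)} \<in> sets borel"
    by measurable
  then have "- {y. (\<exists>D. has_dir_deriv f v y D)} \<in> sets borel"
    unfolding has_dir_deriv_Cauchy_iff[OF cont] by (rule borel_comp)
  moreover have "N = - {y. (\<exists>D. has_dir_deriv f v y D)}" by (auto simp: N_def)
  ultimately have Nb: "N \<in> sets borel" by simp
  have "AE y in lborel. y \<notin> N"
  proof (rule lborel_AE_line[OF Nb])
    fix y
    have "(L * norm v)-lipschitz_on UNIV (\<lambda>t. f (y + t *\<^sub>R v))"
    proof (rule lipschitz_onI)
      fix s t :: real
      have "\<bar>f (y + s *\<^sub>R v) - f (y + t *\<^sub>R v)\<bar> \<le> L * norm ((s - t) *\<^sub>R v)"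
        using lipD[of "y + s *\<^sub>R v" "y + t *\<^sub>R v"] by (simp add: scaleR_diff_left)
      then show "dist (f (y + s *\<^sub>R v)) (f (y + t *\<^sub>R v)) \<le> L * norm v * dist s t"
        by (simp add: dist_real_def mult_ac)
    qed (simp add: L_nonneg)
    from lipschitz_AE_differentiable_real[OF this]
    show "AE t in lborel. y + t *\<^sub>R v \<notin> N"
      by eventually_elim (auto simp: N_def has_dir_deriv_iff_DERIV)
  qed
  then show ?thesis
    by eventually_elim (auto simp: N_def dest: has_dir_deriv_dir_deriv)
qed

lemma dir_deriv_bound: "has_dir_deriv f v y D \<Longrightarrow> \<bar>D\<bar> \<le> L * norm v"
  unfolding has_dir_deriv_def
  by (rule tendsto_upperbound[OF tendsto_rabs]) (auto simp: dir_quot_bound)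

text \<open>Linearity in the direction: integrated over a ball, the second difference
  \<open>f (y + hv + hw) - f (y + hv) - f (y + hw) + f y\<close> is \<open>o h\<close> because translating the ball
  by \<open>hv\<close> changes it by a set of small measure.\<close>

lemma integral_dir_deriv_add:
  "(LINT y:ball c r|lborel. dir_deriv f (v + w) y - dir_deriv f v y - dir_deriv f w y) = 0"
proof -
  define B where "B = ball c r"
  have Bb[measurable]: "B \<in> sets borel" by (simp add: B_def)
  have Bfin: "emeasure lborel B < \<infinity>" unfolding B_def by (rule emeasure_lborel_ball_finite)
  define h where "h n = 1 / real (Suc n)" for n
  have h0: "h n \<noteq> 0" for n by (simp add: h_def)
  have hlim: "h \<longlonglongrightarrow> 0" unfolding h_def by (rule LIMSEQ_Suc[OF lim_const_over_n])
  define q where "q n y = dir_quot f (v + w) (h n) y - dir_quot f v (h n) y - dir_quot f w (h n) y" for n y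
  have [measurable]: "q n \<in> borel_measurable borel" for n unfolding q_def by measurable
  have lim1: "(\<lambda>n. LINT y|lborel. indicator B y *\<^sub>R q n y) \<longlonglongrightarrow>
    (LINT y|lborel. indicator B y *\<^sub>R (dir_deriv f (v + w) y - dir_deriv f v y - dir_deriv f w y))"
  proof (rule integral_dominated_convergence[where w="\<lambda>y. indicator B y * (L * norm (v + w) + L * norm v + L * norm w)"])
    show "integrable lborel (\<lambda>y. indicator B y * (L * norm (v + w) + L * norm v + L * norm w))"
      using Bfin by (intro integrable_mult_left integrable_real_indicator) auto
    show "AE y in lborel. (\<lambda>n. indicator B y *\<^sub>R q n y) \<longlonglongrightarrow>
       indicator B y *\<^sub>R (dir_deriv f (v + w) y - dir_deriv f v y - dir_deriv f w y)"
      using AE_has_dir_deriv[of "v + w"] AE_has_dir_deriv[of v] AE_has_dir_deriv[of w]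
    proof eventually_elim
      fix y assume *: "has_dir_deriv f (v + w) y (dir_deriv f (v + w) y)" "has_dir_deriv f v y (dir_deriv f v y)"
        "has_dir_deriv f w y (dir_deriv f w y)"
      have "(\<lambda>n. dir_quot f x (h n) y) \<longlonglongrightarrow> dir_deriv f x y" if "has_dir_deriv f x y (dir_deriv f x y)" for x
        using that unfolding has_dir_deriv_def h_def by (rule filterlim_compose[OF _ inverse_Suc_at_0])
      then show "(\<lambda>n. indicator B y *\<^sub>R q n y) \<longlonglongrightarrow>
       indicator B y *\<^sub>R (dir_deriv f (v + w) y - dir_deriv f v y - dir_deriv f w y)"
        unfolding q_def using * by (intro tendsto_intros) auto
    qed
    show "AE y in lborel. norm (indicator B y *\<^sub>R q n y) \<le> indicator B y * (L * norm (v + w) + L * norm v + L * norm w)" for n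
    proof (rule AE_I2)
      fix y
      have "\<bar>q n y\<bar> \<le> L * norm (v + w) + L * norm v + L * norm w"
        using dir_quot_bound[of "v + w" "h n" y] dir_quot_bound[of v "h n" y] dir_quot_bound[of w "h n" y]
        unfolding q_def by linarith
      then show "norm (indicator B y *\<^sub>R q n y) \<le> indicator B y * (L * norm (v + w) + L * norm v + L * norm w)"
        by (simp add: indicator_def)
    qed
  qed measurable
  \<comment> \<open>The second difference is the change of the quotient in direction w under
    translation by h v.\<close>
  have qeq: "q n y = dir_quot f w (h n) (y + h n *\<^sub>R v) - dir_quot f w (h n) y" for n y
    using h0[of n] by (simp add: q_def dir_quot_def scaleR_add_right add.assoc diff_divide_distrib)
  have int_p: "integrable lborel (\<lambda>y. indicator A y * dir_quot f w t y)" if "A \<in> sets borel" "emeasure lborel A < \<infinity>" for A t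
  proof -
    have "set_integrable lborel A (\<lambda>y. dir_quot f w t y)"
      unfolding set_integrable_def
      by (rule integrableI_bounded_set_indicator[where B="L * norm w"]) (use that dir_quot_bound in auto)
    then show ?thesis by (simp add: set_integrable_def)
  qed
  \<comment> \<open>A change of variables moves the translation from the quotient to the ball,
    leaving a difference of two indicators.\<close>
  have int_eq: "(LINT y|lborel. indicator B y *\<^sub>R q n y) =
      (LINT y|lborel. (indicator B (y - h n *\<^sub>R v) - indicator B y) * dir_quot f w (h n) y)" for n
  proof -
    define A where "A = {y. y - h n *\<^sub>R v \<in> B}"
    have A: "A = ball (c + h n *\<^sub>R v) r" by (auto simp: A_def B_def dist_norm algebra_simps)
    have iA: "indicator B (y - h n *\<^sub>R v) = (indicator A y :: real)" for y by (simp add: A_def indicator_def)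
    have tr: "(LINT y|lborel. indicator A y * dir_quot f w (h n) y) =
      (LINT y|lborel. indicator B y * dir_quot f w (h n) (y + h n *\<^sub>R v))"
    proof -
      have "(LINT y|lborel. indicator A y * dir_quot f w (h n) y) =
        (LINT y|distr lborel borel ((+) (h n *\<^sub>R v)). indicator A y * dir_quot f w (h n) y)"
        by (simp add: lborel_distr_plus)
      also have "\<dots> = (LINT y|lborel. indicator A (h n *\<^sub>R v + y) * dir_quot f w (h n) (h n *\<^sub>R v + y))"
      proof (rule integral_distr)
        have [measurable]: "A \<in> sets borel" by (simp add: A)
        show "(\<lambda>y. indicator A y * dir_quot f w (h n) y) \<in> borel_measurable borel" by measurable
      qed measurable
      also have "\<dots> = (LINT y|lborel. indicator B y * dir_quot f w (h n) (y + h n *\<^sub>R v))"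
        by (intro Bochner_Integration.integral_cong) (auto simp: A_def indicator_def add.commute)
      finally show ?thesis .
    qed
    have intA: "integrable lborel (\<lambda>y. indicator A y * dir_quot f w (h n) y)"
      by (rule int_p) (auto simp: A emeasure_lborel_ball_finite[unfolded infinity_ennreal_def])
    have intB: "integrable lborel (\<lambda>y. indicator B y * dir_quot f w (h n) y)"
      by (rule int_p) (use Bfin in auto)
    have intT: "integrable lborel (\<lambda>y. indicator B y * dir_quot f w (h n) (y + h n *\<^sub>R v))"
    proof -
      have "set_integrable lborel B (\<lambda>y. dir_quot f w (h n) (y + h n *\<^sub>R v))"
        unfolding set_integrable_def
        by (rule integrableI_bounded_set_indicator[where B="L * norm w"]) (use Bfin dir_quot_bound in auto)
      then show ?thesis by (simp add: set_integrable_def)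
    qed
    have "(LINT y|lborel. indicator B y *\<^sub>R q n y) =
      (LINT y|lborel. indicator B y * dir_quot f w (h n) (y + h n *\<^sub>R v) - indicator B y * dir_quot f w (h n) y)"
      by (simp add: qeq right_diff_distrib)
    also have "\<dots> = (LINT y|lborel. indicator A y * dir_quot f w (h n) y) - (LINT y|lborel. indicator B y * dir_quot f w (h n) y)"
      using intT intB by (simp add: tr)
    also have "\<dots> = (LINT y|lborel. indicator A y * dir_quot f w (h n) y - indicator B y * dir_quot f w (h n) y)"
      using intA intB by simp
    finally show ?thesis by (simp add: iA left_diff_distrib)
  qed
  have lim2: "(\<lambda>n. LINT y|lborel. (indicator B (y - h n *\<^sub>R v) - indicator B y) * dir_quot f w (h n) y) \<longlonglongrightarrow> (LINT y|(lborel::'b measure). 0)"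
  proof (rule integral_dominated_convergence[where w="\<lambda>y. indicator (ball c (r + norm v)) y * (2 * (L * norm w))"])
    show "integrable lborel (\<lambda>y. indicator (ball c (r + norm v)) y * (2 * (L * norm w)))"
      using emeasure_lborel_ball_finite by (intro integrable_mult_left integrable_real_indicator) auto
    have hb: "0 \<le> h n" "h n \<le> 1" for n by (auto simp: h_def)
    show "AE y in lborel. norm ((indicator B (y - h n *\<^sub>R v) - indicator B y) * dir_quot f w (h n) y)
       \<le> indicator (ball c (r + norm v)) y * (2 * (L * norm w))" for n
    proof (rule AE_I2)
      fix y
      have nh: "norm (h n *\<^sub>R v) \<le> norm v" using hb[of n] by (simp add: mult_left_le_one_le)
      have i1: "y \<in> ball c (r + norm v)" if "y - h n *\<^sub>R v \<in> B"
      proof -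
        have "dist c y \<le> dist c (y - h n *\<^sub>R v) + dist (y - h n *\<^sub>R v) y" by (rule dist_triangle)
        also have "\<dots> < r + norm v" using that nh by (simp add: B_def dist_norm)
        finally show ?thesis by simp
      qed
      have i2: "y \<in> ball c (r + norm v)" if "y \<in> B"
      proof -
        have "dist c y < r" using that by (simp add: B_def)
        then have "dist c y < r + norm v" using norm_ge_zero[of v] by linarith
        then show ?thesis by simp
      qed
      have "\<bar>indicator B (y - h n *\<^sub>R v) - indicator B y\<bar> \<le> (indicator (ball c (r + norm v)) y :: real)"
        using i1 i2 by (auto simp: indicator_def)
      then have "\<bar>indicator B (y - h n *\<^sub>R v) - indicator B y\<bar> * \<bar>dir_quot f w (h n) y\<bar> \<le>
        indicator (ball c (r + norm v)) y * (L * norm w)"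
        by (intro mult_mono dir_quot_bound) auto
      also have "\<dots> \<le> indicator (ball c (r + norm v)) y * (2 * (L * norm w))"
        using L_nonneg by (intro mult_left_mono) auto
      finally show "norm ((indicator B (y - h n *\<^sub>R v) - indicator B y) * dir_quot f w (h n) y)
       \<le> indicator (ball c (r + norm v)) y * (2 * (L * norm w))"
        by (simp add: abs_mult)
    qed
    \<comment> \<open>Off the bounding sphere, which is null, the two indicators agree for large
      n.\<close>
    have "AE y in lborel. y \<notin> sphere c r"
    proof -
      have "sphere c r \<in> null_sets lborel"
        using negligible_sphere[of c r] by (auto simp: negligible_iff_null_sets null_sets_completion_iff)
      then show ?thesis by (rule AE_not_in)
    qed
    then show "AE y in lborel. (\<lambda>n. (indicator B (y - h n *\<^sub>R v) - indicator B y) * dir_quot f w (h n) y) \<longlonglongrightarrow> 0"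
    proof eventually_elim
      fix y assume y: "y \<notin> sphere c r"
      have "(\<lambda>n. y - h n *\<^sub>R v) \<longlonglongrightarrow> y - 0 *\<^sub>R v" by (intro tendsto_intros hlim)
      then have lim: "(\<lambda>n. dist c (y - h n *\<^sub>R v)) \<longlonglongrightarrow> dist c y" by (intro tendsto_intros) simp
      have "\<forall>\<^sub>F n in sequentially. (indicator B (y - h n *\<^sub>R v) :: real) = indicator B y"
      proof (cases "dist c y < r")
        case True
        show ?thesis using order_tendstoD(2)[OF lim True] by eventually_elim (use True in \<open>auto simp: B_def indicator_def\<close>)
      next
        case False
        then have "r < dist c y" using y by auto
        from order_tendstoD(1)[OF lim this] show ?thesis
          by eventually_elim (use False in \<open>auto simp: B_def indicator_def\<close>)
      qed
      then show "(\<lambda>n. (indicator B (y - h n *\<^sub>R v) - indicator B y) * dir_quot f w (h n) y) \<longlonglongrightarrow> 0"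
        by (intro tendsto_eventually) (auto elim: eventually_mono)
    qed
  qed measurable
  show ?thesis
    using LIMSEQ_unique[OF lim1 lim2[folded int_eq]] by (simp add: set_lebesgue_integral_def B_def)
qed

text \<open>The defect of additivity has integral 0 over every ball, so it vanishes at its Lebesgue
  points. The clipped function g agrees with it almost everywhere and is bounded everywhere.\<close>

lemma AE_dir_deriv_add: "AE y in lborel. dir_deriv f (v + w) y = dir_deriv f v y + dir_deriv f w y"
proof -
  define C where "C = L * norm (v + w) + L * norm v + L * norm w"
  have C0: "0 \<le> C" using L_nonneg by (simp add: C_def)
  define \<phi> where "\<phi> y = dir_deriv f (v + w) y - dir_deriv f v y - dir_deriv f w y" for y
  define g where "g y = max (- C) (min C (\<phi> y))" for y
  have [measurable]: "\<phi> \<in> borel_measurable borel" "g \<in> borel_measurable borel" unfolding g_def \<phi>_def by measurable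
  have gphi: "AE y in lborel. g y = \<phi> y"
    using AE_has_dir_deriv[of "v + w"] AE_has_dir_deriv[of v] AE_has_dir_deriv[of w]
  proof eventually_elim
    case (elim y)
    then have "\<bar>\<phi> y\<bar> \<le> C"
      using elim[THEN dir_deriv_bound] unfolding \<phi>_def C_def by linarith
    then show ?case by (auto simp: g_def)
  qed
  have g0: "(LINT y:ball c r|lborel. g y) = 0" for c r
  proof -
    have "(LINT y:ball c r|lborel. g y) = (LINT y:ball c r|lborel. \<phi> y)"
    proof -
      have [measurable]: "ball c r \<in> sets borel" by simp
      show ?thesis unfolding set_lebesgue_integral_def
      proof (rule integral_cong_AE)
        show "AE x in lborel. indicator (ball c r) x *\<^sub>R g x = indicator (ball c r) x *\<^sub>R \<phi> x"
          using gphi by eventually_elim simp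
      qed measurable
    qed
    then show ?thesis using integral_dir_deriv_add[of c r v w] by (simp add: \<phi>_def)
  qed
  have gb: "norm (g y) \<le> C" for y using C0 by (auto simp: g_def)
  have ig: "set_integrable lborel (ball c r) g" for c r
    unfolding set_integrable_def
    by (rule integrableI_bounded_set_indicator[where B=C]) (use gb emeasure_lborel_ball_finite in auto)
  have "AE x in lborel. x \<in> UNIV \<longrightarrow> (\<forall>\<epsilon>>0. \<exists>d>0. \<forall>s. 0 < s \<and> s < d \<longrightarrow>
       (\<integral>\<^sup>+y\<in>ball x s. ennreal (norm (g y - g x)) \<partial>lborel) \<le> ennreal \<epsilon> * emeasure lborel (ball x s))"
    by (rule lborel_doubling.Lebesgue_points[OF _ gb]) measurable
  with gphi show ?thesis
  proof eventually_elim
    case (elim x)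
    have "\<bar>g x\<bar> \<le> \<epsilon>" if e: "\<epsilon> > 0" for \<epsilon>
    proof -
      obtain d where d: "d > 0" "\<And>s. 0 < s \<Longrightarrow> s < d \<Longrightarrow>
       (\<integral>\<^sup>+y\<in>ball x s. ennreal (norm (g y - g x)) \<partial>lborel) \<le> ennreal \<epsilon> * emeasure lborel (ball x s)"
        using elim(2) e by blast
      define s where "s = d / 2"
      have s: "0 < s" "s < d" using d(1) by (auto simp: s_def)
      define m where "m = measure lborel (ball x s)"
      have m: "emeasure lborel (ball x s) = ennreal m"
        unfolding m_def using emeasure_lborel_ball_finite[of x s] by (intro emeasure_eq_ennreal_measure) auto
      have m0: "0 < m"
      proof -
        have "0 < emeasure lborel (ball x s)" using s by (simp add: emeasure_ball)
        then show ?thesis by (simp add: m)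
      qed
      have ic: "set_integrable lborel (ball x s) (\<lambda>y. g x)"
        unfolding set_integrable_def using emeasure_lborel_ball_finite[of x s]
        by (intro integrable_scaleR_left integrable_real_indicator) auto
      have "(LINT y:ball x s|lborel. g y - g x) = - (m * g x)"
        using set_integral_diff(2)[OF ig[of x s] ic] g0[of x s]
        by (simp add: set_lebesgue_integral_def m_def)
      then have "m * \<bar>g x\<bar> = \<bar>LINT y:ball x s|lborel. g y - g x\<bar>" using m0 by (simp add: abs_mult)
      also have "\<dots> \<le> (LINT y:ball x s|lborel. \<bar>g y - g x\<bar>)"
        using set_integral_norm_bound[OF set_integral_diff(1)[OF ig[of x s] ic]] by simp
      also have "\<dots> \<le> \<epsilon> * m"
      proof -
        have "ennreal (LINT y:ball x s|lborel. \<bar>g y - g x\<bar>) =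
          (\<integral>\<^sup>+y. ennreal (indicator (ball x s) y *\<^sub>R \<bar>g y - g x\<bar>) \<partial>lborel)"
          unfolding set_lebesgue_integral_def
          using set_integrable_abs[OF set_integral_diff(1)[OF ig[of x s] ic]]
          by (intro nn_integral_eq_integral[symmetric]) (auto simp: set_integrable_def)
        also have "\<dots> = (\<integral>\<^sup>+y\<in>ball x s. ennreal (norm (g y - g x)) \<partial>lborel)"
          by (intro nn_integral_cong) (auto simp: indicator_def)
        also have "\<dots> \<le> ennreal (\<epsilon> * m)" using d(2)[OF s] e m0 by (simp add: m ennreal_mult)
        finally show ?thesis using e m0 by (subst (asm) ennreal_le_iff) auto
      qed
      finally show ?thesis using m0 by (simp add: mult.commute)
    qed
    then have "g x = 0" by (metis abs_ge_zero abs_zero dense_ge dual_order.antisym abs_eq_0)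
    then show ?case using elim(1) by (simp add: \<phi>_def)
  qed
qed

lemma dir_deriv_scaleR:
  assumes "has_dir_deriv f v y D"
  shows "has_dir_deriv f (c *\<^sub>R v) y (c * D)"
proof (cases "c = 0")
  case False
  have "filterlim (\<lambda>t. t * c) (at 0) (at 0)"
    unfolding filterlim_at using False
    by (auto intro!: tendsto_eq_intros eventually_at_topological[THEN iffD2] exI[of _ UNIV])
  then have "((\<lambda>t. dir_quot f v (t * c) y) \<longlongrightarrow> D) (at 0)"
    using assms unfolding has_dir_deriv_def by (rule filterlim_compose[rotated])
  then have "((\<lambda>t. c * dir_quot f v (t * c) y) \<longlongrightarrow> c * D) (at 0)" by (rule tendsto_mult_left)
  then show ?thesis using False by (simp add: has_dir_deriv_def dir_quot_def)
qed (simp add: has_dir_deriv_def dir_quot_def)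

text \<open>For almost every y the directional derivatives exist and are additive on the countable
  group Q of rational vectors, hence on Q they are given by a gradient G. The Lipschitz bound
  extends this from finitely many directions in Q to all directions uniformly.\<close>

theorem Rademacher: "AE y in lborel. \<exists>G. GDERIV f y :> G"
proof -
  define Q where "Q = {v::'b. \<forall>b\<in>Basis. v \<bullet> b \<in> \<rat>}"
  have Qc: "countable Q"
  proof -
    have "Q \<subseteq> (\<lambda>g. \<Sum>b\<in>Basis. g b *\<^sub>R b) ` (Pi\<^sub>E Basis (\<lambda>_. \<rat>))"
    proof
      fix v assume "v \<in> Q"
      then have "(\<lambda>b\<in>Basis. v \<bullet> b) \<in> Pi\<^sub>E Basis (\<lambda>_. \<rat>)" by (auto simp: Q_def)
      moreover have "v = (\<Sum>b\<in>Basis. (\<lambda>b\<in>Basis. v \<bullet> b) b *\<^sub>R b)" by (simp add: euclidean_representation)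
      ultimately show "v \<in> (\<lambda>g. \<Sum>b\<in>Basis. g b *\<^sub>R b) ` (Pi\<^sub>E Basis (\<lambda>_. \<rat>))" by (intro image_eqI)
    qed
    moreover have "countable (Pi\<^sub>E (Basis::'b set) (\<lambda>_. \<rat> :: real set))"
      by (intro countable_PiE) (auto simp: countable_rat)
    ultimately show ?thesis by (meson countable_image countable_subset)
  qed
  have Qdense: "\<exists>v\<in>Q. norm (w - v) < e" if e: "e > 0" for w e
  proof -
    define e' where "e' = e / (2 * real DIM('b))"
    have e': "0 < e'" using e by (simp add: e'_def)
    have "\<exists>q\<in>\<rat>. \<bar>w \<bullet> b - q\<bar> < e'" for b
    proof -
      obtain q where "q \<in> \<rat>" "w \<bullet> b < q" "q < w \<bullet> b + e'" using Rats_dense_in_real[of "w \<bullet> b" "w \<bullet> b + e'"] e' by auto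
      then show ?thesis by (intro bexI[of _ q]) auto
    qed
    then obtain q where q: "\<And>b. q b \<in> \<rat>" "\<And>b. \<bar>w \<bullet> b - q b\<bar> < e'" by metis
    define v where "v = (\<Sum>b\<in>Basis. q b *\<^sub>R b)"
    have vb: "v \<bullet> b = q b" if "b \<in> Basis" for b using that by (simp add: v_def inner_sum_left inner_Basis if_distrib cong: if_cong)
    have "norm (w - v) \<le> (\<Sum>b\<in>Basis. \<bar>(w - v) \<bullet> b\<bar>)" by (rule norm_le_l1)
    also have "\<dots> \<le> (\<Sum>b\<in>(Basis::'b set). e')"
      using q(2) by (intro sum_mono) (auto simp: inner_diff_left vb less_imp_le)
    also have "\<dots> < e" using e by (simp add: e'_def)
    finally show ?thesis using q(1) vb by (intro bexI[of _ v]) (auto simp: Q_def)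
  qed
  have Qadd: "v + w \<in> Q" if "v \<in> Q" "w \<in> Q" for v w using that by (auto simp: Q_def inner_add_left)
  have "AE y in lborel. (\<forall>v\<in>Q. has_dir_deriv f v y (dir_deriv f v y)) \<and>
     (\<forall>v\<in>Q. \<forall>w\<in>Q. dir_deriv f (v + w) y = dir_deriv f v y + dir_deriv f w y)"
    by (intro AE_conjI AE_ball_countable[OF Qc, THEN iffD2] ballI AE_has_dir_deriv AE_dir_deriv_add)
  then show ?thesis
  proof eventually_elim
    fix y assume y: "(\<forall>v\<in>Q. has_dir_deriv f v y (dir_deriv f v y)) \<and>
     (\<forall>v\<in>Q. \<forall>w\<in>Q. dir_deriv f (v + w) y = dir_deriv f v y + dir_deriv f w y)"
    define D where "D v = dir_deriv f v y" for v
    have D0: "D 0 = 0" by (rule has_dir_deriv_dir_deriv[of f 0 y 0, folded D_def]) (simp add: has_dir_deriv_def dir_quot_def)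
    have Dadd: "D (v + w) = D v + D w" if "v \<in> Q" "w \<in> Q" for v w using y that by (simp add: D_def)
    define G where "G = (\<Sum>b\<in>Basis. D b *\<^sub>R b)"
    have DG: "D v = v \<bullet> G" if v: "v \<in> Q" for v
    proof -
      have BQ: "b \<in> Q" if "b \<in> Basis" for b using that by (auto simp: Q_def inner_Basis)
      have scQ: "(v \<bullet> b) *\<^sub>R b \<in> Q" if "b \<in> Basis" for b
        using that v by (auto simp: Q_def inner_Basis)
      have "(\<Sum>b\<in>B. (v \<bullet> b) *\<^sub>R b) \<in> Q \<and> D (\<Sum>b\<in>B. (v \<bullet> b) *\<^sub>R b) = (\<Sum>b\<in>B. (v \<bullet> b) * D b)" if "finite B" "B \<subseteq> Basis" for B
        using that
      proof (induction B)
        case empty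
        then show ?case using D0 by (simp add: Q_def)
      next
        case (insert b B)
        have "D ((v \<bullet> b) *\<^sub>R b) = (v \<bullet> b) * D b"
          unfolding D_def by (rule has_dir_deriv_dir_deriv, rule dir_deriv_scaleR) (use y BQ insert in auto)
        moreover have "(\<Sum>b\<in>B. (v \<bullet> b) *\<^sub>R b) \<in> Q" "D (\<Sum>b\<in>B. (v \<bullet> b) *\<^sub>R b) = (\<Sum>b\<in>B. (v \<bullet> b) * D b)"
          using insert by auto
        ultimately show ?case
          using insert.hyps insert.prems Dadd[of "(v \<bullet> b) *\<^sub>R b" "\<Sum>b\<in>B. (v \<bullet> b) *\<^sub>R b"] scQ[of b]
          by (simp add: Qadd)
      qed
      from this[of Basis] have "D v = (\<Sum>b\<in>Basis. (v \<bullet> b) * D b)" by (simp add: euclidean_representation)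
      also have "\<dots> = v \<bullet> G" by (simp add: G_def inner_sum_right mult.commute)
      finally show ?thesis .
    qed
    have "GDERIV f y :> G"
      unfolding gderiv_def has_derivative_at_alt
    proof (intro conjI allI impI)
      show "bounded_linear (\<lambda>h. h \<bullet> G)" by (rule bounded_linear_inner_left)
      fix e :: real assume e: "0 < e"
      \<comment> \<open>The factor 1 + L + |G| collects three errors: of the difference quotient,
        and of changing the direction in f and in the linear part.\<close>
      define \<eta> where "\<eta> = e / (1 + L + norm G + 1)"
      have den: "0 < 1 + L + norm G + 1" using L_nonneg norm_ge_zero[of G] by linarith
      have \<eta>: "0 < \<eta>" "\<eta> * (1 + L + norm G) \<le> e"
        using e den L_nonneg by (auto simp: \<eta>_def divide_le_eq mult_left_mono)
      \<comment> \<open>By compactness finitely many vectors of Q form an \<eta>-net of the unit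
        sphere, so one radius works for all of them.\<close>
      have "compact (sphere (0::'b) 1)" by simp
      moreover have "sphere (0::'b) 1 \<subseteq> (\<Union>v\<in>Q. ball v \<eta>)"
        using Qdense[OF \<eta>(1)] by (auto simp: dist_norm norm_minus_commute)
      ultimately obtain V where V: "V \<subseteq> Q" "finite V" "sphere (0::'b) 1 \<subseteq> (\<Union>v\<in>V. ball v \<eta>)"
        by (elim compactE_image[where C=Q and f="\<lambda>v. ball v \<eta>"]) auto
      have "\<exists>d>0. \<forall>t. t \<noteq> 0 \<and> \<bar>t\<bar> < d \<longrightarrow> \<bar>dir_quot f v t y - v \<bullet> G\<bar> < \<eta>" if "v \<in> V" for v
      proof -
        have "((\<lambda>t. dir_quot f v t y) \<longlongrightarrow> v \<bullet> G) (at 0)"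
        proof -
          have "v \<in> Q" using that V(1) by blast
          then have "has_dir_deriv f v y (D v)" using y by (simp add: D_def)
          then show ?thesis by (simp add: has_dir_deriv_def DG[OF \<open>v \<in> Q\<close>])
        qed
        then show ?thesis using \<eta>(1) by (auto simp: LIM_eq)
      qed
      then obtain d where d: "\<And>v. v \<in> V \<Longrightarrow> d v > 0"
        "\<And>v t. v \<in> V \<Longrightarrow> t \<noteq> 0 \<Longrightarrow> \<bar>t\<bar> < d v \<Longrightarrow> \<bar>dir_quot f v t y - v \<bullet> G\<bar> < \<eta>" by metis
      define m where "m = Min (insert 1 (d ` V))"
      have m: "0 < m" "\<And>v. v \<in> V \<Longrightarrow> m \<le> d v" using V(2) d(1) by (auto simp: m_def)
      have "norm (f x - f y - (x - y) \<bullet> G) \<le> e * norm (x - y)" if x: "norm (x - y) < m" for x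
      proof (cases "x = y")
        case False
        define t where "t = norm (x - y)"
        have t: "0 < t" using False by (simp add: t_def)
        define w where "w = (x - y) /\<^sub>R t"
        have xw: "x = y + t *\<^sub>R w" using t by (simp add: w_def)
        have "norm w = 1" using t by (simp add: w_def t_def)
        then obtain v where v: "v \<in> V" "norm (w - v) < \<eta>"
          using V(3) by (force simp: dist_norm norm_minus_commute)
        have 1: "\<bar>f (y + t *\<^sub>R v) - f y - t * (v \<bullet> G)\<bar> \<le> \<eta> * t"
        proof -
          have "\<bar>dir_quot f v t y - v \<bullet> G\<bar> < \<eta>" using d(2)[OF v(1), of t] m(2)[OF v(1)] t x by (simp add: t_def)
          moreover have "f (y + t *\<^sub>R v) - f y - t * (v \<bullet> G) = (dir_quot f v t y - v \<bullet> G) * t"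
            using t by (simp add: dir_quot_def field_simps)
          ultimately show ?thesis using t by (simp add: abs_mult)
        qed
        have 2: "\<bar>f x - f (y + t *\<^sub>R v)\<bar> \<le> L * (t * \<eta>)"
        proof -
          have "\<bar>f x - f (y + t *\<^sub>R v)\<bar> \<le> L * norm (t *\<^sub>R (w - v))"
            using lipD[of x "y + t *\<^sub>R v"] by (simp add: xw scaleR_diff_right)
          also have "\<dots> \<le> L * (t * \<eta>)" using v(2) t L_nonneg by (intro mult_left_mono) auto
          finally show ?thesis .
        qed
        have 3: "\<bar>t * (v \<bullet> G) - (x - y) \<bullet> G\<bar> \<le> t * \<eta> * norm G"
        proof -
          have "t * (v \<bullet> G) - (x - y) \<bullet> G = - (t * ((w - v) \<bullet> G))" by (simp add: xw inner_diff_left algebra_simps)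
          also have "\<bar>\<dots>\<bar> \<le> t * (norm (w - v) * norm G)"
            using t Cauchy_Schwarz_ineq2[of "w - v" G] by (simp add: abs_mult)
          also have "\<dots> \<le> t * (\<eta> * norm G)" using v(2) t by (intro mult_left_mono mult_right_mono) auto
          finally show ?thesis by (simp add: mult.assoc)
        qed
        have "\<bar>f x - f y - (x - y) \<bullet> G\<bar> \<le> \<eta> * t + L * (t * \<eta>) + t * \<eta> * norm G"
          using 1 2 3 by linarith
        also have "\<dots> = \<eta> * (1 + L + norm G) * t" by (simp add: algebra_simps)
        also have "\<dots> \<le> e * t" using \<eta>(2) t by (intro mult_right_mono) auto
        finally show ?thesis by (simp add: t_def)
      qed simp
      then show "\<exists>d>0. \<forall>x. norm (x - y) < d \<longrightarrow> norm (f x - f y - (x - y) \<bullet> G) \<le> e * norm (x - y)"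
        using m(1) by blast
    qed
    then show "\<exists>G. GDERIV f y :> G" by blast
  qed
qed

lemma gradient_unique: "GDERIV f y :> G \<Longrightarrow> gradient f y = G"
proof -
  assume G: "GDERIV f y :> G"
  have "G' = G" if "GDERIV f y :> G'" for G'
  proof -
    have "(\<lambda>h. h \<bullet> G') = (\<lambda>h. h \<bullet> G)"
      using G that unfolding gderiv_def by (metis has_derivative_unique)
    then have "(G' - G) \<bullet> (G' - G) = 0" by (metis (no_types) inner_diff_right right_minus_eq)
    then show ?thesis by simp
  qed
  then show "gradient f y = G" unfolding gradient_def using G by blast
qed

end

section \<open>Ahlfors regular sets of finite perimeter\<close>

locale ahlfors =
  fixes E :: "('a::euclidean_space \<times> real) set" and C r\<^sub>0 :: real
  assumes E: "E \<in> ahlfors_class C r\<^sub>0" and C: "1 \<le> C" and r0: "0 < r\<^sub>0"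
begin

abbreviation "M \<equiv> perimeter_measure E"
abbreviation "S \<equiv> frontier E"

lemma pair: "gauss_green_pair E M (snd (gauss_green_polar E))"
proof -
  have "\<exists>N \<sigma>. gauss_green_pair E N \<sigma>" using E by (simp add: ahlfors_class_def locally_finite_perimeter_def)
  then obtain N \<sigma> where "case_prod (gauss_green_pair E) (N, \<sigma>)" by auto
  then have "case_prod (gauss_green_pair E) (gauss_green_polar E)"
    unfolding gauss_green_polar_def by (rule someI)
  then show ?thesis by (simp add: perimeter_measure_def split_beta)
qed

lemma sets_M [measurable_cong, simp]: "sets M = sets borel"
  using pair by (simp add: gauss_green_pair_def)

lemma space_M [simp]: "space M = UNIV"
  using sets_eq_imp_space_eq[OF sets_M] by simp

lemma M_compact: "compact A \<Longrightarrow> emeasure M A < \<infinity>"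
  using pair by (simp add: gauss_green_pair_def)

lemma M_bounded: "bounded A \<Longrightarrow> emeasure M A < \<infinity>"
proof -
  assume "bounded A"
  then obtain r where "A \<subseteq> ball 0 r" using bounded_subset_ballD[of A 0] by blast
  then have "emeasure M A \<le> emeasure M (cball 0 r)" by (intro emeasure_mono) auto
  also have "\<dots> < \<infinity>" by (intro M_compact) auto
  finally show ?thesis .
qed

lemma S_eq: "S = spt_perimeter E" using E by (simp add: ahlfors_class_def)

lemma S_borel [measurable]: "S \<in> sets borel" by simp

lemma lower: "x \<in> S \<Longrightarrow> 0 < s \<Longrightarrow> s < r\<^sub>0 \<Longrightarrow> ennreal (s ^ DIM('a) / C) \<le> emeasure M (ball x s)"
  using E by (simp add: ahlfors_class_def S_eq divide_inverse mult.commute)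

lemma upper: "x \<in> S \<Longrightarrow> 0 < s \<Longrightarrow> s < r\<^sub>0 \<Longrightarrow> emeasure M (ball x s) \<le> ennreal (C * s ^ DIM('a))"
  using E by (simp add: ahlfors_class_def S_eq)

text \<open>Null balls cover the complement of the support, and by Lindelof countably many of them
  do.\<close>

lemma M_off_spt: "emeasure M (- S) = 0"
proof -
  define F where "F = {ball x s | x s. emeasure M (ball x s) = 0}"
  have "- S = \<Union>F"
  proof (intro set_eqI iffI)
    fix x assume "x \<in> - S"
    then obtain s where "s > 0" "emeasure M (ball x s) = 0"
      by (auto simp: S_eq spt_perimeter_def zero_less_iff_neq_zero)
    then have "ball x s \<in> F" "x \<in> ball x s" unfolding F_def by (blast, simp)
    then show "x \<in> \<Union>F" by blast
  next
    fix x assume "x \<in> \<Union>F"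
    then obtain y s where ys: "x \<in> ball y s" "emeasure M (ball y s) = 0" by (auto simp: F_def)
    then obtain d where d: "d > 0" "ball x d \<subseteq> ball y s" using open_contains_ball open_ball by blast
    then have "emeasure M (ball x d) = 0" using ys(2) emeasure_mono[of "ball x d" "ball y s" M] by simp
    then show "x \<in> - S" using d(1) by (auto simp: S_eq spt_perimeter_def)
  qed
  moreover obtain F' where F': "F' \<subseteq> F" "countable F'" "\<Union>F' = \<Union>F"
    by (rule Lindelof[of F]) (auto simp: F_def)
  moreover have "\<Union>F' \<in> null_sets M"
    using F' by (intro null_sets_UN'[of F' "\<lambda>x. x", simplified]) (auto simp: F_def null_sets_def)
  ultimately show ?thesis by (auto simp: null_sets_def)
qed

lemma AE_S: "AE x in M. x \<in> S"
  using M_off_spt by (intro AE_I[of _ _ "- S"]) auto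

text \<open>Disjoint \<delta>-balls about boundary points each carry mass at least \<delta>^k/C
  inside U. The series is the number of balls times \<delta>^k, written so that it makes sense
  before finiteness is known.\<close>

lemma packing:
  assumes "A \<subseteq> S" "0 < \<delta>" "\<delta> < r\<^sub>0" "\<And>x. x \<in> A \<Longrightarrow> ball x \<delta> \<subseteq> U" "U \<in> sets borel"
  shows "\<exists>c I. (\<forall>n\<in>(I::nat set). c n \<in> A) \<and> A \<subseteq> (\<Union>n\<in>I. ball (c n) (5 * \<delta>)) \<and>
    (\<Sum>n. if n \<in> I then ennreal (\<delta> ^ DIM('a)) else 0) \<le> ennreal C * emeasure M U"
proof -
  obtain c I where c: "\<And>n. n \<in> (I::nat set) \<Longrightarrow> c n \<in> A" "disjoint_family_on (\<lambda>n. ball (c n) \<delta>) I"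
    "A \<subseteq> (\<Union>n\<in>I. ball (c n) (5 * \<delta>))"
    by (rule Vitali_balls_sequence[where S=A and K=A and a="\<lambda>x. x" and r="\<lambda>_. \<delta>" and B=\<delta>]) (use assms(2) in auto)
  define B where "B n = (if n \<in> I then ball (c n) \<delta> else {})" for n
  have C0: "0 < C" using C by simp
  have BU: "B n \<subseteq> U" for n using c(1)[of n] assms(4) by (auto simp: B_def split: if_splits)
  have "(if n \<in> I then ennreal (\<delta> ^ DIM('a)) else 0) \<le> ennreal C * emeasure M (B n)" for n
  proof (cases "n \<in> I")
    case True
    have "ennreal C * ennreal (\<delta> ^ DIM('a) / C) \<le> ennreal C * emeasure M (B n)"
      using lower[of "c n" \<delta>] c(1)[OF True] assms(1,2,3) True by (intro mult_left_mono) (auto simp: B_def)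
    then show ?thesis using C0 True assms(2) by (simp add: ennreal_mult[symmetric])
  qed simp
  then have "(\<Sum>n. if n \<in> I then ennreal (\<delta> ^ DIM('a)) else 0) \<le> (\<Sum>n. ennreal C * emeasure M (B n))"
    by (intro suminf_le) auto
  also have "\<dots> = ennreal C * (\<Sum>n. emeasure M (B n))" by simp
  also have "(\<Sum>n. emeasure M (B n)) = emeasure M (\<Union>n. B n)"
    using c(2) by (intro suminf_emeasure) (auto simp: B_def disjoint_family_on_def)
  also have "ennreal C * \<dots> \<le> ennreal C * emeasure M U"
  proof -
    have "(\<Union>n. B n) \<subseteq> U" using BU by blast
    then show ?thesis using assms(5) by (intro mult_left_mono emeasure_mono) auto
  qed
  finally show ?thesis using c(1,3) by blast
qed

text \<open>The packed balls reach outside A, so the mass is that of a neighbourhood U of thickness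
  d.\<close>

lemma hausdorff_le_M:
  assumes "A \<subseteq> S" "0 < d" "\<And>x. x \<in> A \<Longrightarrow> ball x d \<subseteq> U" "U \<in> sets borel"
  shows "hausdorff DIM('a) A \<le> ennreal (unit_ball_vol (real DIM('a)) * 5 ^ DIM('a) * C) * emeasure M U"
proof (rule hausdorff_le)
  fix \<eta> :: real assume \<eta>: "0 < \<eta>"
  define \<omega> where "\<omega> = unit_ball_vol (real DIM('a))"
  have \<omega>: "0 \<le> \<omega>" by (simp add: \<omega>_def)
  \<comment> \<open>The covering balls have radius 5 \<delta> and diameter 10 \<delta>, which must
    stay below \<eta>.\<close>
  define \<delta> where "\<delta> = min (\<eta> / 20) (min d (r\<^sub>0 / 2))"
  have \<delta>: "0 < \<delta>" "\<delta> < r\<^sub>0" "\<delta> \<le> d" "10 * \<delta> < \<eta>" using \<eta> assms(2) r0 by (auto simp: \<delta>_def min_def)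
  have bd: "ball x \<delta> \<subseteq> U" if "x \<in> A" for x
    using assms(3)[OF that] subset_ball[OF \<delta>(3), of x] by blast
  obtain I c where c: "A \<subseteq> (\<Union>n\<in>I. ball (c n) (5 * \<delta>))"
    "(\<Sum>n. if n \<in> (I::nat set) then ennreal (\<delta> ^ DIM('a)) else 0) \<le> ennreal C * emeasure M U"
    using packing[of A \<delta> U, OF assms(1) \<delta>(1,2) bd assms(4)] by auto
  define F where "F n = (if n \<in> I then ball (c n) (5 * \<delta>) else {})" for n
  have "fine_cover \<eta> A F"
    unfolding fine_cover_def
  proof (intro conjI allI)
    show "A \<subseteq> (\<Union>n. F n)"
    proof
      fix x assume "x \<in> A"
      then obtain n where "n \<in> I" "x \<in> ball (c n) (5 * \<delta>)" using c(1) by blast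
      then show "x \<in> (\<Union>n. F n)" by (intro UN_I[of n]) (auto simp: F_def)
    qed
    show "bounded (F n)" for n by (simp add: F_def)
    show "diameter (F n) < \<eta>" for n using \<delta>(1,4) \<eta> by (simp add: F_def)
  qed
  then have "hausdorff_pre DIM('a) \<eta> A \<le> (\<Sum>n. hausdorff_weight DIM('a) (F n))" by (rule hausdorff_pre_le)
  also have "\<dots> \<le> (\<Sum>n. ennreal (\<omega> * 5 ^ DIM('a)) * (if n \<in> I then ennreal (\<delta> ^ DIM('a)) else 0))"
  proof (intro suminf_le)
    fix n
    show "hausdorff_weight DIM('a) (F n) \<le> ennreal (\<omega> * 5 ^ DIM('a)) * (if n \<in> I then ennreal (\<delta> ^ DIM('a)) else 0)"
      using \<delta>(1) \<omega> by (auto simp: hausdorff_weight_def F_def \<omega>_def[symmetric] ennreal_mult[symmetric] power_mult_distrib mult_ac)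
  qed auto
  also have "\<dots> = ennreal (\<omega> * 5 ^ DIM('a)) * (\<Sum>n. if n \<in> I then ennreal (\<delta> ^ DIM('a)) else 0)" by simp
  also have "\<dots> \<le> ennreal (\<omega> * 5 ^ DIM('a)) * (ennreal C * emeasure M U)" by (intro mult_left_mono c(2)) auto
  also have "\<dots> = ennreal (\<omega> * 5 ^ DIM('a) * C) * emeasure M U"
    using \<omega> C by (simp add: ennreal_mult mult.assoc)
  finally show "hausdorff_pre DIM('a) \<eta> A \<le> ennreal (unit_ball_vol (real DIM('a)) * 5 ^ DIM('a) * C) * emeasure M U"
    by (simp add: \<omega>_def)
qed

text \<open>A covering by balls of radius 5 \<delta> has order \<delta>^(-k) members, each of volume
  of order \<delta>^(k+1), so the total volume is of order \<delta>. This allows E, which is only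
  Lebesgue measurable, to be replaced by its open interior.\<close>

lemma frontier_null: "S \<in> null_sets lborel"
proof -
  define \<omega> where "\<omega> = unit_ball_vol (real (DIM('a \<times> real)))"
  have "S \<inter> cball 0 (real R) \<in> null_sets lborel" for R
  proof -
    define A where "A = S \<inter> cball 0 (real R)"
    have [measurable]: "A \<in> sets borel" unfolding A_def by simp
    define U where "U = (ball 0 (real R + r\<^sub>0) :: ('a \<times> real) set)"
    define m where "m = measure M U"
    have m: "emeasure M U = ennreal m"
      unfolding m_def using M_bounded[of U] by (intro emeasure_eq_ennreal_measure) (auto simp: U_def)
    define K where "K = \<omega> * 5 ^ Suc DIM('a) * C * m"
    have K0: "0 \<le> \<omega>" "0 \<le> m" by (auto simp: \<omega>_def m_def)
    have "emeasure lborel A \<le> ennreal (K * \<delta>)" if \<delta>: "0 < \<delta>" "\<delta> < r\<^sub>0" for \<delta>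
    proof -
      have bd: "ball x \<delta> \<subseteq> U" if "x \<in> A" for x
      proof
        fix y assume "y \<in> ball x \<delta>"
        then have "dist 0 y < real R + r\<^sub>0"
          using that \<delta> dist_triangle[of 0 y x] by (auto simp: A_def)
        then show "y \<in> U" by (simp add: U_def)
      qed
      have "A \<subseteq> S" "U \<in> sets borel" by (auto simp: A_def U_def)
      then obtain I c where c: "A \<subseteq> (\<Union>n\<in>I. ball (c n) (5 * \<delta>))"
        "(\<Sum>n. if n \<in> (I::nat set) then ennreal (\<delta> ^ DIM('a)) else 0) \<le> ennreal C * emeasure M U"
        using packing[of A \<delta> U, OF _ \<delta> bd] by auto
      define F where "F n = (if n \<in> I then ball (c n) (5 * \<delta>) else {})" for n
      have "A \<subseteq> (\<Union>n. F n)"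
      proof
        fix x assume "x \<in> A"
        then obtain n where "n \<in> I" "x \<in> ball (c n) (5 * \<delta>)" using c(1) by blast
        then show "x \<in> (\<Union>n. F n)" by (intro UN_I[of n]) (auto simp: F_def)
      qed
      then have "emeasure lborel A \<le> emeasure lborel (\<Union>n. F n)"
        by (intro emeasure_mono) (auto simp: F_def)
      also have "\<dots> \<le> (\<Sum>n. emeasure lborel (F n))"
        by (intro emeasure_subadditive_countably) (auto simp: F_def)
      also have "\<dots> \<le> (\<Sum>n. ennreal (\<omega> * 5 ^ Suc DIM('a) * \<delta>) * (if n \<in> I then ennreal (\<delta> ^ DIM('a)) else 0))"
      proof (intro suminf_le)
        fix n
        show "emeasure lborel (F n) \<le> ennreal (\<omega> * 5 ^ Suc DIM('a) * \<delta>) * (if n \<in> I then ennreal (\<delta> ^ DIM('a)) else 0)"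
          using \<delta>(1) K0 by (auto simp: F_def emeasure_ball \<omega>_def ennreal_mult[symmetric] power_mult_distrib mult_ac)
      qed auto
      also have "\<dots> \<le> ennreal (\<omega> * 5 ^ Suc DIM('a) * \<delta>) * (ennreal C * emeasure M U)"
        using c(2) by (subst ennreal_suminf_cmult) (intro mult_left_mono, auto)
      also have "\<dots> = ennreal (K * \<delta>)"
        using K0 \<delta>(1) C by (simp add: m K_def ennreal_mult[symmetric] mult_ac)
      finally show ?thesis .
    qed
    then have ev: "\<forall>\<^sub>F \<delta> in at_right 0. emeasure lborel A \<le> ennreal (K * \<delta>)"
      unfolding eventually_at_right_field using r0 by blast
    have "((\<lambda>\<delta>. ennreal (K * \<delta>)) \<longlongrightarrow> ennreal (K * 0)) (at_right 0)"
      by (intro tendsto_ennrealI tendsto_intros)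
    from tendsto_lowerbound[OF this ev] have "emeasure lborel A = 0" by simp
    then show ?thesis by (auto simp: null_sets_def A_def)
  qed
  then have "(\<Union>R. S \<inter> cball 0 (real R)) \<in> null_sets lborel" by (intro null_sets_UN)
  moreover have "S = (\<Union>R. S \<inter> cball 0 (real R))"
    using real_arch_simple by (auto simp: dist_norm)
  ultimately show ?thesis by simp
qed

definition MH_const :: real where "MH_const = C * 4 ^ DIM('a) / unit_ball_vol (real DIM('a))"

lemma MH_const_pos: "0 < MH_const" using C by (simp add: MH_const_def)

text \<open>A covering set of diameter d > 0 that meets the boundary lies in a ball of radius 2 d
  about a boundary point, of mass at most C (2 d)^k. Comparing with its weight gives
  \<open>MH_const\<close>.\<close>

lemma M_le_hausdorff:
  assumes A: "A \<in> sets borel"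
  shows "emeasure M A \<le> ennreal MH_const * hausdorff DIM('a) A"
proof -
  define \<omega> where "\<omega> = unit_ball_vol (real DIM('a))"
  have \<omega>: "0 < \<omega>" by (simp add: \<omega>_def)
  have C0: "0 < C" using C by simp
  have MS: "emeasure M A = emeasure M (A \<inter> S)"
    using AE_S A by (intro emeasure_eq_AE) auto
  \<comment> \<open>Covering sets of diameter 0 have weight 0, so single points must be null; this
    holds as k is positive.\<close>
  have pt: "emeasure M {x} = 0" if "x \<in> S" for x
  proof -
    have "emeasure M {x} \<le> ennreal (C * s ^ DIM('a))" if "0 < s" "s < r\<^sub>0" for s
    proof -
      have "emeasure M {x} \<le> emeasure M (ball x s)" using that by (intro emeasure_mono) auto
      also have "\<dots> \<le> ennreal (C * s ^ DIM('a))" using that by (intro upper \<open>x \<in> S\<close>)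
      finally show ?thesis .
    qed
    then have ev: "\<forall>\<^sub>F s in at_right 0. emeasure M {x} \<le> ennreal (C * s ^ DIM('a))"
      unfolding eventually_at_right_field using r0 by blast
    have "((\<lambda>s. ennreal (C * s ^ DIM('a))) \<longlongrightarrow> ennreal (C * 0 ^ DIM('a))) (at_right 0)"
      by (intro tendsto_ennrealI tendsto_intros)
    from tendsto_lowerbound[OF this ev] show ?thesis by (simp add: zero_power)
  qed
  have "emeasure M A \<le> ennreal MH_const * (\<Sum>i. hausdorff_weight DIM('a) (F i))" if F: "fine_cover (r\<^sub>0 / 2) A F" for F
  proof -
    define x where "x i = (SOME y. y \<in> F i \<inter> (A \<inter> S))" for i
    define B where "B i = (if F i \<inter> (A \<inter> S) = {} then {} else cball (x i) (diameter (F i)))" for i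
    have x: "x i \<in> F i \<inter> (A \<inter> S)" if "F i \<inter> (A \<inter> S) \<noteq> {}" for i
    proof -
      have "\<exists>y. y \<in> F i \<inter> (A \<inter> S)" using that by blast
      then show ?thesis unfolding x_def by (rule someI_ex)
    qed
    have cov: "A \<inter> S \<subseteq> (\<Union>i. B i)"
    proof
      fix y assume y: "y \<in> A \<inter> S"
      then obtain i where i: "y \<in> F i" using F by (auto simp: fine_cover_def)
      then have ne: "F i \<inter> (A \<inter> S) \<noteq> {}" using y by blast
      have "dist (x i) y \<le> diameter (F i)"
        using F i x[OF ne] by (auto simp: fine_cover_def intro!: diameter_bounded_bound)
      then show "y \<in> (\<Union>i. B i)" using ne by (auto simp: B_def intro!: exI[of _ i])
    qed
    have Bi: "emeasure M (B i) \<le> ennreal MH_const * hausdorff_weight DIM('a) (F i)" for i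
    proof (cases "F i \<inter> (A \<inter> S) = {}")
      case False
      define d where "d = diameter (F i)"
      have d: "0 \<le> d" "d < r\<^sub>0 / 2" using F by (auto simp: d_def fine_cover_def diameter_ge_0)
      show ?thesis
      proof (cases "d = 0")
        case True
        then have "B i = {x i}" using False by (simp add: B_def d_def)
        then show ?thesis using pt[of "x i"] x[OF False] by simp
      next
        case F': False
        then have d': "0 < d" using d by simp
        have "emeasure M (B i) \<le> emeasure M (ball (x i) (2 * d))"
          using False d' by (intro emeasure_mono) (auto simp: B_def d_def)
        also have "\<dots> \<le> ennreal (C * (2 * d) ^ DIM('a))" using x[OF False] d d' by (intro upper) auto
        also have "C * (2 * d) ^ DIM('a) = MH_const * (\<omega> * (d / 2) ^ DIM('a))"
        proof -
          have "(2 * d) ^ DIM('a) = 4 ^ DIM('a) * (d / 2) ^ DIM('a)"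
            unfolding power_mult_distrib[symmetric] by simp
          then show ?thesis using \<omega> by (simp add: MH_const_def \<omega>_def[symmetric])
        qed
        also have "ennreal \<dots> = ennreal MH_const * hausdorff_weight DIM('a) (F i)"
          using False MH_const_pos \<omega> d by (auto simp: hausdorff_weight_def \<omega>_def d_def ennreal_mult[symmetric])
        finally show ?thesis .
      qed
    qed (simp add: B_def)
    have "emeasure M A \<le> emeasure M (\<Union>i. B i)"
      unfolding MS by (intro emeasure_mono cov) (auto simp: B_def)
    also have "\<dots> \<le> (\<Sum>i. emeasure M (B i))" by (intro emeasure_subadditive_countably) (auto simp: B_def)
    also have "\<dots> \<le> (\<Sum>i. ennreal MH_const * hausdorff_weight DIM('a) (F i))" by (intro suminf_le Bi) auto
    finally show ?thesis by simp
  qed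
  then have "emeasure M A / ennreal MH_const \<le> hausdorff_pre DIM('a) (r\<^sub>0 / 2) A"
    using MH_const_pos by (intro hausdorff_pre_ge) (simp add: divide_le_posI_ennreal mult.commute)
  also have "\<dots> \<le> hausdorff DIM('a) A" using r0 by (intro hausdorff_pre_le_hausdorff) simp
  finally have "ennreal MH_const * (emeasure M A / ennreal MH_const) \<le> ennreal MH_const * hausdorff DIM('a) A"
    by (rule mult_left_mono) simp
  moreover have "ennreal MH_const * (emeasure M A / ennreal MH_const) = emeasure M A"
    using ennreal_mult_divide_eq[of "ennreal MH_const" "emeasure M A"] MH_const_pos
    by (simp add: ennreal_times_divide mult.commute)
  ultimately show ?thesis by simp
qed

lemma nn_integral_M_le:
  assumes [measurable]: "f \<in> borel_measurable borel"
  shows "(\<integral>\<^sup>+x. f x \<partial>M) \<le> ennreal MH_const * (\<integral>\<^sup>+x. f x \<partial>hausdorff_borel DIM('a))"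
proof -
  have "M \<le> scale_measure MH_const (hausdorff_borel DIM('a))"
  proof -
    have "emeasure M A \<le> emeasure (scale_measure MH_const (hausdorff_borel DIM('a))) A" for A
    proof (cases "A \<in> sets borel")
      case True
      then show ?thesis using M_le_hausdorff[OF True] by (simp add: emeasure_hausdorff_borel)
    qed (simp add: emeasure_notin_sets)
    then show ?thesis by (simp add: le_measure_iff le_fun_def space_scale_measure)
  qed
  then have "(\<integral>\<^sup>+x. f x \<partial>M) \<le> (\<integral>\<^sup>+x. f x \<partial>scale_measure MH_const (hausdorff_borel DIM('a)))"
    by (intro nn_integral_mono_measure) auto
  also have "\<dots> = ennreal MH_const * (\<integral>\<^sup>+x. f x \<partial>hausdorff_borel DIM('a))"
    by (intro nn_integral_scale_measure) measurable
  finally show ?thesis .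
qed

end

subsection \<open>Test functions\<close>

text \<open>The gradient is an explicit second argument, so products and compositions of test
  functions come with their derivatives.\<close>

definition C1c :: "('b::euclidean_space \<Rightarrow> real) \<Rightarrow> ('b \<Rightarrow> 'b) \<Rightarrow> bool" where
  "C1c f g \<longleftrightarrow> (\<forall>x. GDERIV f x :> g x) \<and> continuous_on UNIV g \<and> (\<exists>R. \<forall>x. R < norm x \<longrightarrow> f x = 0)"

lemma C1cI: "(\<And>x. GDERIV f x :> g x) \<Longrightarrow> continuous_on UNIV g \<Longrightarrow> (\<And>x. R < norm x \<Longrightarrow> f x = 0) \<Longrightarrow> C1c f g"
  by (auto simp: C1c_def)

lemma C1c_deriv: "C1c f g \<Longrightarrow> (f has_derivative (\<lambda>h. h \<bullet> g x)) (at x)"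
  unfolding C1c_def gderiv_def by blast

lemma C1c_continuous: "C1c f g \<Longrightarrow> continuous_on UNIV f"
  unfolding C1c_def gderiv_def
  by (meson UNIV_I continuous_at_imp_continuous_on has_derivative_continuous)

lemma C1c_measurable: "C1c f g \<Longrightarrow> f \<in> borel_measurable borel" "C1c f g \<Longrightarrow> g \<in> borel_measurable borel"
  using C1c_continuous by (auto simp: C1c_def intro: borel_measurable_continuous_onI)

lemma C1c_support:
  assumes "C1c f g" obtains R B where "0 < R" "0 \<le> B" "\<And>x. R < norm x \<Longrightarrow> f x = 0" "\<And>x. R < norm x \<Longrightarrow> g x = 0"
    "\<And>x. norm (g x) \<le> B" "\<And>x. \<bar>f x\<bar> \<le> B"
proof -
  obtain R0 where R0: "\<And>x. R0 < norm x \<Longrightarrow> f x = 0" using assms by (auto simp: C1c_def)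
  define R where "R = max R0 1"
  have R: "f x = 0" if "R < norm x" for x using R0 that by (auto simp: R_def)
  have gR: "g x = 0" if "R < norm x" for x
  proof -
    have "open {x::'a. R < norm x}" by (intro open_Collect_less continuous_intros)
    then have "(f has_derivative (\<lambda>h. 0)) (at x)"
      using R that has_derivative_transform_within_open[OF has_derivative_const[of "0::real" "at x"], of "{x. R < norm x}" f]
      by auto
    moreover have "(f has_derivative (\<lambda>h. h \<bullet> g x)) (at x)" by (rule C1c_deriv[OF assms])
    ultimately have "(\<lambda>h. h \<bullet> g x) = (\<lambda>h. 0)" using has_derivative_unique by blast
    then have "g x \<bullet> g x = 0" by (rule fun_cong)
    then show ?thesis by simp
  qed
  have cg: "continuous_on UNIV g" using assms by (simp add: C1c_def)
  have "bounded (g ` cball 0 R)" "bounded (f ` cball 0 R)"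
    by (intro compact_imp_bounded compact_continuous_image continuous_on_subset[OF cg] continuous_on_subset[OF C1c_continuous[OF assms]]; simp)+
  then obtain B1 B2 where B12: "\<forall>y\<in>g ` cball 0 R. norm y \<le> B1" "\<forall>y\<in>f ` cball 0 R. norm y \<le> B2"
    unfolding bounded_iff by blast
  have B: "norm (g x) \<le> B1" "\<bar>f x\<bar> \<le> B2" if "x \<in> cball 0 R" for x using B12 that by auto
  define B where "B = max 0 (max B1 B2)"
  have "norm (g x) \<le> B \<and> \<bar>f x\<bar> \<le> B" for x
    using B[of x] gR[of x] R[of x] by (cases "R < norm x") (auto simp: B_def)
  then show ?thesis using R gR by (intro that[of R B]) (auto simp: R_def B_def)
qed

lemma integrable_bounded_support:
  fixes f :: "'b::euclidean_space \<Rightarrow> 'c::{banach, second_countable_topology}"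
  assumes "f \<in> borel_measurable N" "\<And>x. norm (f x) \<le> B" "\<And>x. x \<notin> A \<Longrightarrow> f x = 0" "A \<in> sets N" "emeasure N A < \<infinity>"
  shows "integrable N f"
proof -
  have "integrable N (\<lambda>x. indicator A x *\<^sub>R f x)"
    by (rule integrableI_bounded_set_indicator[where B=B]) (use assms in auto)
  moreover have "(\<lambda>x. indicator A x *\<^sub>R f x) = f" using assms(3) by (auto simp: indicator_def)
  ultimately show ?thesis by simp
qed

lemma C1c_lipschitz:
  assumes "C1c f g" "\<And>x. norm (g x) \<le> B" shows "lipschitz_fun f B"
proof
  have "0 \<le> B" using assms(2) norm_ge_zero order_trans by blast
  have "norm (f x - f y) \<le> B * norm (x - y)" for x y
  proof (rule differentiable_bound[where S=UNIV and f'="\<lambda>x h. h \<bullet> g x"])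
    show "onorm (\<lambda>h. h \<bullet> g x) \<le> B" for x
      using assms(2)[of x] by (intro onorm_le) (metis Cauchy_Schwarz_ineq2 mult.commute mult_right_mono norm_ge_zero order_trans real_norm_def)
  qed (use C1c_deriv[OF assms(1)] has_derivative_at_withinI in auto)
  then show "B-lipschitz_on UNIV f" using \<open>0 \<le> B\<close> by (intro lipschitz_onI) (auto simp: dist_norm)
qed

text \<open>Difference quotients integrate to 0 by translation invariance, and they converge
  boundedly within a fixed ball.\<close>

lemma C1c_integral_0:
  assumes "C1c f g"
  shows "(LINT x|lborel. g x \<bullet> b) = 0"
proof -
  obtain R B where RB: "0 < R" "0 \<le> B" "\<And>x. R < norm x \<Longrightarrow> f x = 0" "\<And>x. norm (g x) \<le> B" "\<And>x. \<bar>f x\<bar> \<le> B"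
    using C1c_support[OF assms] by metis
  interpret lipschitz_fun f B by (rule C1c_lipschitz[OF assms RB(4)])
  define h where "h n = 1 / real (Suc n)" for n
  have h: "0 < h n" "h n \<le> 1" for n by (auto simp: h_def)
  have supp: "f (x + h n *\<^sub>R b) = 0" if "x \<notin> ball 0 (R + norm b + 1)" for x n
  proof (rule RB(3))
    have "norm (h n *\<^sub>R b) \<le> norm b" using h[of n] by (simp add: mult_left_le_one_le)
    moreover have "R + norm b + 1 \<le> norm x" using that by (simp add: dist_norm)
    ultimately show "R < norm (x + h n *\<^sub>R b)" using norm_diff_ineq[of x "h n *\<^sub>R b"] by linarith
  qed
  have int: "integrable lborel f"
    using RB(3,5) f_measurable emeasure_lborel_cball_finite by (intro integrable_bounded_support[where A="cball 0 R" and B=B]) (auto simp: dist_norm)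
  have int': "integrable lborel (\<lambda>x. f (x + c))" "(LINT x|lborel. f (x + c)) = (LINT x|lborel. f x)" for c
  proof -
    show "integrable lborel (\<lambda>x. f (x + c))"
      using integrable_distr[of "(+) c" lborel borel f] int by (simp add: lborel_distr_plus add.commute)
    show "(LINT x|lborel. f (x + c)) = (LINT x|lborel. f x)"
      using integral_distr[of "(+) c" lborel borel f] by (simp add: lborel_distr_plus add.commute)
  qed
  have z: "(LINT x|lborel. dir_quot f b (h n) x) = 0" for n
    using int int' by (simp add: dir_quot_def)
  have "(\<lambda>n. LINT x|lborel. dir_quot f b (h n) x) \<longlonglongrightarrow> (LINT x|lborel. g x \<bullet> b)"
  proof (rule integral_dominated_convergence[where w="\<lambda>x. indicator (ball 0 (R + norm b + 1)) x * (B * norm b)"])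
    show "integrable lborel (\<lambda>x::'a. indicator (ball 0 (R + norm b + 1)) x * (B * norm b))"
      using emeasure_lborel_ball_finite by (intro integrable_mult_left integrable_real_indicator) auto
    show "AE x in lborel. (\<lambda>n. dir_quot f b (h n) x) \<longlonglongrightarrow> g x \<bullet> b"
    proof (rule AE_I2)
      fix x
      have "(f has_derivative (\<lambda>h. h \<bullet> g x)) (at (x + 0 *\<^sub>R b))" using C1c_deriv[OF assms, of x] by simp
      moreover have "((\<lambda>t. x + t *\<^sub>R b) has_derivative (\<lambda>t. t *\<^sub>R b)) (at 0)"
        by (auto intro!: derivative_eq_intros)
      ultimately have "((\<lambda>t. f (x + t *\<^sub>R b)) has_derivative (\<lambda>t. (t *\<^sub>R b) \<bullet> g x)) (at 0)"
        by (rule has_derivative_compose[rotated])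
      then have "((\<lambda>t. f (x + t *\<^sub>R b)) has_real_derivative (b \<bullet> g x)) (at 0)"
        unfolding has_field_derivative_def by (rule has_derivative_eq_rhs) auto
      then have "has_dir_deriv f b (x + 0 *\<^sub>R b) (b \<bullet> g x)" by (simp only: has_dir_deriv_iff_DERIV)
      then have "((\<lambda>t. dir_quot f b t x) \<longlongrightarrow> g x \<bullet> b) (at 0)" by (simp add: has_dir_deriv_def inner_commute)
      then show "(\<lambda>n. dir_quot f b (h n) x) \<longlonglongrightarrow> g x \<bullet> b"
        unfolding h_def by (rule filterlim_compose[OF _ inverse_Suc_at_0])
    qed
    show "AE x in lborel. norm (dir_quot f b (h n) x) \<le> indicator (ball 0 (R + norm b + 1)) x * (B * norm b)" for n
    proof (rule AE_I2)
      fix x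
      show "norm (dir_quot f b (h n) x) \<le> indicator (ball 0 (R + norm b + 1)) x * (B * norm b)"
      proof (cases "x \<in> ball 0 (R + norm b + 1)")
        case True
        then show ?thesis using dir_quot_bound[of b "h n" x] by simp
      next
        case False
        then have "R + norm b + 1 \<le> norm x" by (simp add: dist_norm)
        then have "f x = 0" using norm_ge_zero[of b] by (intro RB(3)) linarith
        then show ?thesis using supp[OF False, of n] False by (simp add: dir_quot_def)
      qed
    qed
    show "(\<lambda>x. g x \<bullet> b) \<in> borel_measurable lborel" using C1c_measurable(2)[OF assms] by measurable
  qed measurable
  then show ?thesis unfolding z using LIMSEQ_unique tendsto_const by blast
qed

lemma C1c_prod:
  fixes \<phi> :: "'a::euclidean_space \<Rightarrow> real" and \<psi> \<psi>' :: "real \<Rightarrow> real"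
  assumes "C1c \<phi> \<phi>'" "C1c \<psi> \<psi>'"
  shows "C1c (\<lambda>x. \<phi> (fst x) * \<psi> (snd x)) (\<lambda>x. (\<psi> (snd x) *\<^sub>R \<phi>' (fst x), \<phi> (fst x) * \<psi>' (snd x)))"
proof -
  obtain R1 R2 where R: "\<And>z. R1 < norm z \<Longrightarrow> \<phi> z = 0" "\<And>t. R2 < norm t \<Longrightarrow> \<psi> t = 0"
    using assms by (auto simp: C1c_def)
  show ?thesis
  proof (rule C1cI[where R="\<bar>R1\<bar> + \<bar>R2\<bar>"])
    fix x :: "'a \<times> real"
    note assms[THEN C1c_deriv]
    then have "((\<lambda>x. \<phi> (fst x)) has_derivative (\<lambda>h. fst h \<bullet> \<phi>' (fst x))) (at x)"
      "((\<lambda>x. \<psi> (snd x)) has_derivative (\<lambda>h. snd h \<bullet> \<psi>' (snd x))) (at x)"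
      by (auto intro: has_derivative_compose[OF has_derivative_fst[OF has_derivative_ident]]
        has_derivative_compose[OF has_derivative_snd[OF has_derivative_ident]])
    from has_derivative_mult[OF this]
    show "GDERIV (\<lambda>x. \<phi> (fst x) * \<psi> (snd x)) x :> (\<psi> (snd x) *\<^sub>R \<phi>' (fst x), \<phi> (fst x) * \<psi>' (snd x))"
      unfolding gderiv_def by (rule has_derivative_eq_rhs) (auto simp: inner_prod_def algebra_simps)
  next
    have c: "continuous_on UNIV \<phi>'" "continuous_on UNIV \<psi>'" using assms by (auto simp: C1c_def)
    have c': "continuous_on UNIV (\<lambda>x::'a \<times> real. \<phi>' (fst x))" "continuous_on UNIV (\<lambda>x::'a \<times> real. \<psi>' (snd x))"
      "continuous_on UNIV (\<lambda>x::'a \<times> real. \<phi> (fst x))" "continuous_on UNIV (\<lambda>x::'a \<times> real. \<psi> (snd x))"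
      using c assms[THEN C1c_continuous]
      by (auto intro!: continuous_on_compose2[of UNIV _ UNIV fst] continuous_on_compose2[of UNIV _ UNIV snd] continuous_intros)
    show "continuous_on UNIV (\<lambda>x. (\<psi> (snd x) *\<^sub>R \<phi>' (fst x), \<phi> (fst x) * \<psi>' (snd x)))"
      by (intro continuous_intros c')
  next
    fix x :: "'a \<times> real" assume "\<bar>R1\<bar> + \<bar>R2\<bar> < norm x"
    moreover have "norm x \<le> norm (fst x) + norm (snd x)" by (metis norm_Pair_le prod.collapse)
    ultimately have "R1 < norm (fst x) \<or> R2 < norm (snd x)" by linarith
    then show "\<phi> (fst x) * \<psi> (snd x) = 0" using R by auto
  qed
qed

lemma cylinder_open: "open (cylinder x s)"
  unfolding cylinder_def by (intro open_Collect_conj open_Collect_less continuous_intros)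

lemma cylinder_borel [measurable]: "cylinder x s \<in> sets borel"
  by (rule borel_open[OF cylinder_open])

lemma norm_le_fst_snd: "norm (x::'a::real_normed_vector \<times> real) \<le> norm (fst x) + \<bar>snd x\<bar>"
  by (metis norm_Pair_le prod.collapse real_norm_def)

lemma cylinder_subset_ball: "cylinder x s \<subseteq> ball x (2 * s)"
proof
  fix y assume "y \<in> cylinder x s"
  then show "y \<in> ball x (2 * s)"
    using norm_le_fst_snd[of "x - y"] by (auto simp: cylinder_def dist_norm)
qed

lemma bounded_cylinder [simp]: "bounded (cylinder x s)"
  by (rule bounded_subset[OF bounded_ball cylinder_subset_ball])

subsection \<open>The unit normal and the tilt measure\<close>

context ahlfors
begin

text \<open>A version of the density of \<open>\<mu>\<^sub>E\<close> that has norm \<open>1\<close> everywhere.\<close>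

definition nu :: "'a \<times> real \<Rightarrow> 'a \<times> real" where
  "nu x = (if norm (snd (gauss_green_polar E) x) = 1 then snd (gauss_green_polar E) x else (0, 1))"

text \<open>Equal to |nu - e_n|^2 / 2, the integrand of the excess, because \<open>nu\<close> is a
  unit vector.\<close>

definition tilt :: "'a \<times> real \<Rightarrow> real" where
  "tilt x = 1 - snd (nu x)"

text \<open>The excess without normalisation, with |mu_E| in place of Hausdorff measure and defined
  on sets.\<close>

definition kap :: "('a \<times> real) set \<Rightarrow> real" where
  "kap A = (LINT x:A|M. tilt x)"

lemma nu_measurable [measurable]: "nu \<in> borel_measurable borel"
proof -
  have [measurable]: "snd (gauss_green_polar E) \<in> borel_measurable borel"
    using pair by (simp add: gauss_green_pair_def)
  then have "(\<lambda>x. norm (snd (gauss_green_polar E) x)) \<in> borel_measurable borel"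
    by (rule measurable_compose[OF _ borel_measurable_continuous_onI[OF continuous_on_norm_id]])
  then have "{x \<in> space borel. norm (snd (gauss_green_polar E) x) = 1} \<in> sets borel"
    by (rule borel_measurable_eq[OF _ borel_measurable_const])
  then show ?thesis unfolding nu_def by (intro measurable_If \<open>snd _ \<in> _\<close>) auto
qed

lemma nu_components_measurable [measurable]:
  "(\<lambda>x. fst (nu x)) \<in> borel_measurable borel" "(\<lambda>x. snd (nu x)) \<in> borel_measurable borel"
  by (intro measurable_compose[OF nu_measurable] borel_measurable_continuous_onI continuous_intros)+

lemma norm_nu [simp]: "norm (nu x) = 1" by (simp add: nu_def norm_Pair)

lemma AE_nu: "AE x in M. snd (gauss_green_polar E) x = nu x"
proof -
  have "AE x in M. norm (snd (gauss_green_polar E) x) = 1" using pair by (simp add: gauss_green_pair_def)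
  then show ?thesis by eventually_elim (simp add: nu_def)
qed

lemma fst_snd_nu: "(norm (fst (nu x)))\<^sup>2 + (snd (nu x))\<^sup>2 = 1"
  using norm_nu[of x] by (cases "nu x") (simp add: norm_Pair real_sqrt_eq_1_iff)

lemma snd_nu_bound: "\<bar>snd (nu x)\<bar> \<le> 1"
  using fst_snd_nu[of x] by (metis abs_square_le_1 le_add_same_cancel2 zero_le_power2)

lemma tilt_bounds: "0 \<le> tilt x" "tilt x \<le> 2"
  using snd_nu_bound[of x] by (auto simp: tilt_def)

lemma tilt_measurable [measurable]: "tilt \<in> borel_measurable borel"
  unfolding tilt_def by measurable

lemma tilt_eq: "(norm (nu x - (0, 1)))\<^sup>2 / 2 = tilt x"
proof -
  have "(norm (nu x - (0, 1)))\<^sup>2 = (norm (fst (nu x)))\<^sup>2 + (snd (nu x) - 1)\<^sup>2"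
    by (cases "nu x") (simp add: norm_Pair)
  also have "\<dots> = 2 * tilt x" using fst_snd_nu[of x] by (simp add: tilt_def power2_eq_square algebra_simps)
  finally show ?thesis by simp
qed

lemma fst_nu_tilt: "(norm (fst (nu x)))\<^sup>2 \<le> 2 * tilt x"
proof -
  have "2 * tilt x - (norm (fst (nu x)))\<^sup>2 = (1 - snd (nu x))\<^sup>2"
    using fst_snd_nu[of x] by (simp add: tilt_def power2_eq_square algebra_simps)
  then show ?thesis by (metis diff_ge_0_iff_ge zero_le_power2)
qed

text \<open>The horizontal part of the normal is only of the order of the square root of the tilt.
  Young's inequality makes it linear in the tilt at the price \<theta>/2 per unit of mass; \<theta>
  is chosen in each application.\<close>

lemma fst_nu_le: "0 < \<theta> \<Longrightarrow> norm (fst (nu x)) \<le> \<theta> / 2 + tilt x / \<theta>"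
proof -
  assume t: "0 < \<theta>"
  define a where "a = norm (fst (nu x))"
  have "0 \<le> (a - \<theta>)\<^sup>2" by simp
  then have "2 * a * \<theta> \<le> \<theta>\<^sup>2 + a\<^sup>2" by (simp add: power2_eq_square algebra_simps)
  also have "\<dots> \<le> \<theta>\<^sup>2 + 2 * tilt x" using fst_nu_tilt[of x] by (simp add: a_def)
  finally have "a \<le> (\<theta>\<^sup>2 + 2 * tilt x) / (2 * \<theta>)" using t by (simp add: field_simps)
  also have "\<dots> = \<theta> / 2 + tilt x / \<theta>" using t by (simp add: field_simps power2_eq_square)
  finally show ?thesis by (simp add: a_def)
qed

lemma integrable_M:
  fixes f :: "'a \<times> real \<Rightarrow> 'c::euclidean_space"
  assumes "f \<in> borel_measurable borel" "\<And>x. norm (f x) \<le> B" "\<And>x. x \<notin> A \<Longrightarrow> f x = 0" "bounded A" "A \<in> sets borel"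
  shows "integrable M f"
  by (rule integrable_bounded_support[where A=A and B=B]) (use assms M_bounded in auto)

lemma set_integrable_tilt: "bounded A \<Longrightarrow> A \<in> sets borel \<Longrightarrow> integrable M (\<lambda>x. indicator A x * tilt x)"
  by (rule integrable_M[where A=A and B=2]) (use tilt_bounds in \<open>auto simp: indicator_def\<close>)

lemma kap_nonneg: "0 \<le> kap A"
  unfolding kap_def set_lebesgue_integral_def
  by (intro Bochner_Integration.integral_nonneg) (simp add: tilt_bounds)

lemma kap_mono: "A \<subseteq> B \<Longrightarrow> bounded B \<Longrightarrow> A \<in> sets borel \<Longrightarrow> B \<in> sets borel \<Longrightarrow> kap A \<le> kap B"
  unfolding kap_def set_lebesgue_integral_def real_scaleR_def
  by (intro integral_mono set_integrable_tilt mult_right_mono)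
    (auto simp: tilt_bounds indicator_def bounded_subset)

lemma ennreal_kap: "bounded A \<Longrightarrow> A \<in> sets borel \<Longrightarrow> ennreal (kap A) = (\<integral>\<^sup>+x\<in>A. ennreal (tilt x) \<partial>M)"
proof -
  assume A: "bounded A" "A \<in> sets borel"
  have "(\<integral>\<^sup>+x. ennreal (indicator A x * tilt x) \<partial>M) = ennreal (LINT x|M. indicator A x * tilt x)"
    by (intro nn_integral_eq_integral set_integrable_tilt A) (simp add: tilt_bounds)
  moreover have "(\<integral>\<^sup>+x. ennreal (indicator A x * tilt x) \<partial>M) = (\<integral>\<^sup>+x\<in>A. ennreal (tilt x) \<partial>M)"
    by (intro nn_integral_cong) (auto simp: indicator_def)
  ultimately show ?thesis by (simp add: kap_def set_lebesgue_integral_def)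
qed

lemma vertical_est:
  assumes f: "f \<in> borel_measurable borel" "\<And>x. \<bar>f x\<bar> \<le> B" "\<And>x. x \<notin> A \<Longrightarrow> f x = 0"
    and A: "bounded A" "A \<in> sets borel"
  shows "\<bar>(LINT x|M. f x * snd (nu x)) - (LINT x|M. f x)\<bar> \<le> B * kap A"
proof -
  note [measurable] = f(1)
  have i1: "integrable M f" by (rule integrable_M[where A=A and B=B]) (use f A in auto)
  have i2: "integrable M (\<lambda>x. f x * snd (nu x))"
  proof (rule integrable_M[where A=A and B=B])
    show "norm (f x * snd (nu x)) \<le> B" for x
      using mult_mono[OF f(2)[of x] snd_nu_bound[of x]] f(2)[of x] by (simp add: abs_mult)
  qed (use f A in auto)
  have "(LINT x|M. f x * snd (nu x)) - (LINT x|M. f x) = - (LINT x|M. f x * tilt x)"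
    using i1 i2 by (simp add: tilt_def algebra_simps)
  also have "\<bar>\<dots>\<bar> \<le> (LINT x|M. \<bar>f x * tilt x\<bar>)" by simp
  also have "\<dots> \<le> (LINT x|M. B * (indicator A x * tilt x))"
  proof (rule integral_mono)
    show "integrable M (\<lambda>x. \<bar>f x * tilt x\<bar>)"
      using i1 i2 by (simp add: tilt_def algebra_simps)
    show "integrable M (\<lambda>x. B * (indicator A x * tilt x))" using set_integrable_tilt[OF A] by simp
    show "\<bar>f x * tilt x\<bar> \<le> B * (indicator A x * tilt x)" for x
      using f(2)[of x] f(3)[of x] tilt_bounds[of x] by (cases "x \<in> A") (auto simp: abs_mult mult_right_mono)
  qed
  finally show ?thesis by (simp add: kap_def set_lebesgue_integral_def)
qed

lemma horizontal_est:
  assumes f: "f \<in> borel_measurable borel" "\<And>x. norm (f x) \<le> B" "\<And>x. x \<notin> A \<Longrightarrow> f x = 0"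
    and A: "bounded A" "A \<in> sets borel" and \<theta>: "0 < \<theta>"
  shows "\<bar>LINT x|M. f x \<bullet> fst (nu x)\<bar> \<le> B * (\<theta> / 2 * measure M A + kap A / \<theta>)"
proof -
  note [measurable] = f(1)
  have B: "0 \<le> B" using f(2) norm_ge_zero order_trans by blast
  have bd: "\<bar>f x \<bullet> fst (nu x)\<bar> \<le> B * (indicator A x * (\<theta> / 2) + indicator A x * tilt x / \<theta>)" for x
  proof (cases "x \<in> A")
    case True
    have "\<bar>f x \<bullet> fst (nu x)\<bar> \<le> norm (f x) * norm (fst (nu x))" by (rule Cauchy_Schwarz_ineq2)
    also have "\<dots> \<le> B * (\<theta> / 2 + tilt x / \<theta>)" by (intro mult_mono f fst_nu_le \<theta> B) simp
    finally show ?thesis using True by simp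
  qed (simp add: f(3))
  have i: "integrable M (\<lambda>x. indicator A x * (\<theta> / 2) + indicator A x * tilt x / \<theta>)"
    using set_integrable_tilt[OF A] M_bounded[OF A(1)] A(2) by simp
  have "\<bar>LINT x|M. f x \<bullet> fst (nu x)\<bar> \<le> (LINT x|M. \<bar>f x \<bullet> fst (nu x)\<bar>)" by simp
  also have "\<dots> \<le> (LINT x|M. B * (indicator A x * (\<theta> / 2) + indicator A x * tilt x / \<theta>))"
  proof (rule integral_mono[OF _ _ bd])
    show i2: "integrable M (\<lambda>x. B * (indicator A x * (\<theta> / 2) + indicator A x * tilt x / \<theta>))" using i by simp
    show "integrable M (\<lambda>x. \<bar>f x \<bullet> fst (nu x)\<bar>)"
      by (rule Bochner_Integration.integrable_bound[OF i2]) (use bd B \<theta> tilt_bounds in \<open>auto intro!: AE_I2 simp: abs_mult\<close>)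
  qed
  also have "\<dots> = B * (\<theta> / 2 * measure M A + kap A / \<theta>)"
    using set_integrable_tilt[OF A] M_bounded[OF A(1)] A(2)
    by (simp add: kap_def set_lebesgue_integral_def mult.commute)
  finally show ?thesis .
qed

text \<open>The field f b has divergence g \<bullet> b. The frontier is Lebesgue null and the
  interior is Borel, so the integral over E moves from \<open>lebesgue\<close> to
  \<open>lborel\<close>.\<close>

lemma Gauss_Green:
  assumes f: "C1c f g"
  shows "(LINT x|lborel. indicator (interior E) x * (g x \<bullet> b)) = (LINT x|M. f x * (b \<bullet> nu x))"
proof -
  define T where "T x = f x *\<^sub>R b" for x
  define T' where "T' x = blinfun_scaleR_left b o\<^sub>L blinfun_inner_left (g x)" for x
  have T': "(T has_derivative blinfun_apply (T' x)) (at x)" for x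
  proof -
    have "(f has_derivative (\<lambda>h. h \<bullet> g x)) (at x)" by (rule C1c_deriv[OF f])
    then have "(T has_derivative (\<lambda>h. (h \<bullet> g x) *\<^sub>R b)) (at x)" unfolding T_def by (intro derivative_intros)
    moreover have "blinfun_apply (T' x) = (\<lambda>h. (h \<bullet> g x) *\<^sub>R b)" by (rule ext) (simp add: T'_def)
    ultimately show ?thesis by simp
  qed
  have T'c: "continuous_on UNIV T'"
    unfolding T'_def using f by (intro continuous_intros) (auto simp: C1c_def)
  obtain R where R: "\<And>x. R < norm x \<Longrightarrow> f x = 0" using f by (auto simp: C1c_def)
  have "bounded {x. T x \<noteq> 0}"
  proof (rule bounded_subset[of "cball 0 R"])
    show "{x. T x \<noteq> 0} \<subseteq> cball 0 R" using R by (force simp: T_def)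
  qed simp
  then have "compact (closure {x. T x \<noteq> 0})" by (simp add: compact_closure)
  then have "C1_compact_support T" unfolding C1_compact_support_def using T' T'c by blast
  then have GG: "(LINT x:E|lebesgue. divergence T x) = (LINT x|M. T x \<bullet> snd (gauss_green_polar E) x)"
    using pair by (simp add: gauss_green_pair_def)
  have div: "divergence T x = g x \<bullet> b" for x
  proof -
    have "frechet_derivative T (at x) = blinfun_apply (T' x)" using frechet_derivative_at[OF T'] by simp
    then have "divergence T x = (\<Sum>i\<in>Basis. (g x \<bullet> i) * (b \<bullet> i))"
      by (simp add: divergence_def T'_def inner_commute)
    then show ?thesis by (simp add: euclidean_inner[of "g x" b])
  qed
  have [measurable]: "g \<in> borel_measurable borel" "f \<in> borel_measurable borel" using C1c_measurable[OF f] by auto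
  have El: "E \<in> sets lebesgue" using E by (simp add: ahlfors_class_def locally_finite_perimeter_def)
  have "AE x in lborel. x \<notin> S" using frontier_null by (rule AE_not_in)
  then have aeS: "AE x in lebesgue. x \<notin> S" by (simp add: AE_completion)
  have gl: "(\<lambda>x. g x \<bullet> b) \<in> borel_measurable lebesgue" by (intro measurable_completion) measurable
  have "(LINT x:E|lebesgue. divergence T x) = (LINT x|lebesgue. indicator (interior E) x * (g x \<bullet> b))"
    unfolding set_lebesgue_integral_def div real_scaleR_def
  proof (rule integral_cong_AE)
    show "AE x in lebesgue. indicator E x * (g x \<bullet> b) = indicator (interior E) x * (g x \<bullet> b)"
      using aeS
    proof eventually_elim
      fix x assume "x \<notin> S"
      then have "x \<in> E \<longleftrightarrow> x \<in> interior E" using closure_subset[of E] interior_subset[of E] by (auto simp: frontier_def)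
      then show "indicator E x * (g x \<bullet> b) = indicator (interior E) x * (g x \<bullet> b)" by (simp add: indicator_def)
    qed
    show "(\<lambda>x. indicator E x * (g x \<bullet> b)) \<in> borel_measurable lebesgue"
      using El gl by (intro borel_measurable_times borel_measurable_indicator)
    have "interior E \<in> sets lebesgue" by simp
    then show "(\<lambda>x. indicator (interior E) x * (g x \<bullet> b)) \<in> borel_measurable lebesgue"
      using gl by (intro borel_measurable_times borel_measurable_indicator)
  qed
  also have "\<dots> = (LINT x|lborel. indicator (interior E) x * (g x \<bullet> b))"
    by (intro integral_completion) measurable
  finally have "(LINT x|lborel. indicator (interior E) x * (g x \<bullet> b)) = (LINT x|M. T x \<bullet> snd (gauss_green_polar E) x)"
    using GG by simp
  also have "\<dots> = (LINT x|M. f x * (b \<bullet> nu x))"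
  proof (rule integral_cong_AE)
    show "AE x in M. T x \<bullet> snd (gauss_green_polar E) x = f x * (b \<bullet> nu x)"
      using AE_nu by eventually_elim (simp add: T_def)
    have [measurable]: "snd (gauss_green_polar E) \<in> borel_measurable borel"
      using pair by (simp add: gauss_green_pair_def)
    show "(\<lambda>x. T x \<bullet> snd (gauss_green_polar E) x) \<in> borel_measurable M" unfolding T_def by measurable
  qed measurable
  finally show ?thesis .
qed

lemma Gauss_Green_vertical:
  assumes "C1c \<phi> \<phi>'" "C1c \<psi> \<psi>'"
  shows "(LINT x|lborel. indicator (interior E) x * (\<phi> (fst x) * \<psi>' (snd x))) = (LINT x|M. \<phi> (fst x) * \<psi> (snd x) * snd (nu x))"
  using Gauss_Green[OF C1c_prod[OF assms], of "(0, 1)"] by (simp add: inner_prod_def)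

lemma Gauss_Green_horizontal:
  assumes "C1c \<phi> \<phi>'" "C1c \<psi> \<psi>'"
  shows "(LINT x|lborel. indicator (interior E) x * (\<psi> (snd x) * (\<phi>' (fst x) \<bullet> v))) = (LINT x|M. \<phi> (fst x) * \<psi> (snd x) * (v \<bullet> fst (nu x)))"
  using Gauss_Green[OF C1c_prod[OF assms], of "(v, 0)"] by (simp add: inner_prod_def)

subsection \<open>Excess controls tilt\<close>

lemma doubling_M: "doubling_measure M S (C\<^sup>2 * 5 ^ DIM('a)) (r\<^sub>0 / 5)"
proof
  show "emeasure M (ball x (5 * s)) \<le> ennreal (C\<^sup>2 * 5 ^ DIM('a)) * emeasure M (ball x s)"
    if "x \<in> S" "0 < s" "s < r\<^sub>0 / 5" for x s
  proof -
    have C0: "0 < C" using C by simp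
    have "emeasure M (ball x (5 * s)) \<le> ennreal (C * (5 * s) ^ DIM('a))" using that by (intro upper) auto
    also have "C * (5 * s) ^ DIM('a) = C\<^sup>2 * 5 ^ DIM('a) * (s ^ DIM('a) / C)"
      using C0 by (simp add: power_mult_distrib power2_eq_square)
    also have "ennreal \<dots> = ennreal (C\<^sup>2 * 5 ^ DIM('a)) * ennreal (s ^ DIM('a) / C)"
      using C0 that by (intro ennreal_mult) auto
    also have "\<dots> \<le> ennreal (C\<^sup>2 * 5 ^ DIM('a)) * emeasure M (ball x s)"
      using that r0 by (intro mult_left_mono lower) auto
    finally show ?thesis .
  qed
qed (use C r0 M_compact in auto)

text \<open>The ratio defining the outer normal is the average of \<open>nu\<close> over the ball,
  which converges at a Lebesgue point.\<close>

lemma Lebesgue_point_reduced_boundary: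
  assumes x: "x \<in> S" and Leb: "\<forall>\<epsilon>>0. \<exists>d>0. \<forall>s. 0 < s \<and> s < d \<longrightarrow>
       (\<integral>\<^sup>+y\<in>ball x s. ennreal (norm (nu y - nu x)) \<partial>M) \<le> ennreal \<epsilon> * emeasure M (ball x s)"
  shows "x \<in> reduced_boundary E" "outer_normal E x = nu x"
proof -
  have lim: "(gauss_green_ratio E x \<longlongrightarrow> nu x) (at_right 0)"
  proof (rule tendstoI)
    fix e :: real assume e: "0 < e"
    have "\<exists>d>0. \<forall>s. 0 < s \<and> s < d \<longrightarrow>
       (\<integral>\<^sup>+y\<in>ball x s. ennreal (norm (nu y - nu x)) \<partial>M) \<le> ennreal (e/2) * emeasure M (ball x s)"
      using Leb half_gt_zero[OF e] by (elim allE impE)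
    then obtain d where d: "d > 0" "\<And>s. 0 < s \<Longrightarrow> s < d \<Longrightarrow>
       (\<integral>\<^sup>+y\<in>ball x s. ennreal (norm (nu y - nu x)) \<partial>M) \<le> ennreal (e/2) * emeasure M (ball x s)"
      by blast
    have "dist (gauss_green_ratio E x s) (nu x) < e" if s: "0 < s" "s < d" for s
    proof -
      define m where "m = measure M (ball x s)"
      have m: "emeasure M (ball x s) = ennreal m"
        unfolding m_def using M_bounded[of "ball x s"] by (intro emeasure_eq_ennreal_measure) auto
      have "0 < emeasure M (ball x s)" using x s(1) by (simp add: S_eq spt_perimeter_def)
      then have m0: "0 < m" by (simp add: m)
      have i1: "set_integrable M (ball x s) nu"
        unfolding set_integrable_def by (rule integrable_M[where A="ball x s" and B=1]) (auto simp: indicator_def)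
      have i2: "set_integrable M (ball x s) (\<lambda>_. nu x)"
        unfolding set_integrable_def by (rule integrable_M[where A="ball x s" and B=1]) (auto simp: indicator_def)
      note i3 = set_integral_diff(1)[OF i1 i2]
      have "gauss_green E (ball x s) = (LINT y:ball x s|M. nu y)"
        unfolding gauss_green_def set_lebesgue_integral_def
      proof (rule integral_cong_AE)
        show "AE y in M. indicator (ball x s) y *\<^sub>R snd (gauss_green_polar E) y = indicator (ball x s) y *\<^sub>R nu y"
          using AE_nu by eventually_elim simp
        have "snd (gauss_green_polar E) \<in> borel_measurable M"
          using pair by (simp add: gauss_green_pair_def measurable_cong_sets[OF sets_M refl])
        then show "(\<lambda>y. indicator (ball x s) y *\<^sub>R snd (gauss_green_polar E) y) \<in> borel_measurable M"
          by (intro borel_measurable_scaleR borel_measurable_indicator) auto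
        have "nu \<in> borel_measurable M" by measurable
        then show "(\<lambda>y. indicator (ball x s) y *\<^sub>R nu y) \<in> borel_measurable M"
          by (intro borel_measurable_scaleR borel_measurable_indicator) auto
      qed
      moreover have "(LINT y:ball x s|M. nu x) = m *\<^sub>R nu x"
        using M_bounded[of "ball x s"] by (simp add: set_lebesgue_integral_def m_def)
      ultimately have "gauss_green E (ball x s) - m *\<^sub>R nu x = (LINT y:ball x s|M. nu y - nu x)"
        using set_integral_diff(2)[OF i1 i2] by simp
      then have "norm (gauss_green E (ball x s) - m *\<^sub>R nu x) \<le> (LINT y:ball x s|M. norm (nu y - nu x))"
        using set_integral_norm_bound[OF i3] by simp
      also have "\<dots> \<le> e / 2 * m"
      proof -
        have "ennreal (LINT y:ball x s|M. norm (nu y - nu x)) =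
          (\<integral>\<^sup>+y. ennreal (indicator (ball x s) y *\<^sub>R norm (nu y - nu x)) \<partial>M)"
          unfolding set_lebesgue_integral_def
          using set_integrable_norm[OF i3]
          by (intro nn_integral_eq_integral[symmetric]) (auto simp: set_integrable_def)
        also have "\<dots> = (\<integral>\<^sup>+y\<in>ball x s. ennreal (norm (nu y - nu x)) \<partial>M)"
          by (intro nn_integral_cong) (auto simp: indicator_def)
        also have "\<dots> \<le> ennreal (e / 2) * ennreal m" using d(2)[OF s] by (simp only: m)
        also have "\<dots> = ennreal (e / 2 * m)" using e m0 by (intro ennreal_mult[symmetric]) auto
        finally show ?thesis using e m0 by (subst (asm) ennreal_le_iff) auto
      qed
      finally have *: "norm (gauss_green E (ball x s) - m *\<^sub>R nu x) / m \<le> e / 2" using m0 by (simp add: divide_le_eq)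
      have "gauss_green_ratio E x s - nu x = (gauss_green E (ball x s) - m *\<^sub>R nu x) /\<^sub>R m"
        using m0 by (simp add: gauss_green_ratio_def m_def[symmetric] scaleR_diff_right)
      then have "norm (gauss_green_ratio E x s - nu x) = norm (gauss_green E (ball x s) - m *\<^sub>R nu x) / m"
        using m0 by (simp add: divide_inverse mult.commute)
      then show ?thesis using * e unfolding dist_norm by linarith
    qed
    then show "\<forall>\<^sub>F s in at_right 0. dist (gauss_green_ratio E x s) (nu x) < e"
      unfolding eventually_at_right_field using d(1) by blast
  qed
  then show "x \<in> reduced_boundary E" using x norm_nu[of x] unfolding reduced_boundary_def S_eq by blast
  show "outer_normal E x = nu x" unfolding outer_normal_def by (intro tendsto_Lim lim) simp
qed

text \<open>Outside a Borel set N with |mu_E|(N) = 0 the normal \<open>nu\<close> is the outer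
  normal on the reduced boundary. Removing N before passing to Hausdorff measure keeps the smaller
  integrand measurable; the excess integrand then dominates it pointwise.\<close>

lemma kap_le_excess:
  assumes "0 < s"
  shows "ennreal (kap (cylinder x s)) \<le> ennreal (MH_const * s ^ DIM('a)) * excess E x s"
proof -
  interpret D: doubling_measure M S "C\<^sup>2 * 5 ^ DIM('a)" "r\<^sub>0 / 5" by (rule doubling_M)
  have "AE x in M. x \<in> S \<longrightarrow>
    (\<forall>\<epsilon>>0. \<exists>d>0. \<forall>s. 0 < s \<and> s < d \<longrightarrow>
       (\<integral>\<^sup>+y\<in>ball x s. ennreal (norm (nu y - nu x)) \<partial>M) \<le> ennreal \<epsilon> * emeasure M (ball x s))"
    by (rule D.Lebesgue_points[where B=1]) auto
  then have "AE x in M. x \<in> S \<and> x \<in> reduced_boundary E \<and> outer_normal E x = nu x"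
    using AE_S
  proof eventually_elim
    case (elim x)
    note L = elim(1)[THEN mp, OF elim(2)]
    show ?case using elim(2) Lebesgue_point_reduced_boundary[OF elim(2) L] by (intro conjI)
  qed
  then obtain N where N: "{x \<in> space M. \<not> (x \<in> S \<and> x \<in> reduced_boundary E \<and> outer_normal E x = nu x)} \<subseteq> N"
    "emeasure M N = 0" "N \<in> sets M" by (rule AE_E)
  have Nb[measurable]: "N \<in> sets borel" using N(3) by simp
  have N': "x \<in> reduced_boundary E" "outer_normal E x = nu x" if "x \<notin> N" for x using N(1) that by auto
  define I where "I = (\<integral>\<^sup>+ y \<in> cylinder x s \<inter> reduced_boundary E.
        ennreal ((norm (outer_normal E y - (0, 1)))\<^sup>2 / 2) \<partial>hausdorff_borel DIM('a))"
  have "ennreal (kap (cylinder x s)) = (\<integral>\<^sup>+x\<in>cylinder x s. ennreal (tilt x) \<partial>M)"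
    by (intro ennreal_kap) auto
  also have "\<dots> = (\<integral>\<^sup>+y. ennreal (tilt y) * indicator (cylinder x s - N) y \<partial>M)"
  proof (rule nn_integral_cong_AE)
    have "AE y in M. y \<notin> N" using N by (intro AE_not_in) (auto simp: null_sets_def)
    then show "AE y in M. ennreal (tilt y) * indicator (cylinder x s) y = ennreal (tilt y) * indicator (cylinder x s - N) y"
      by eventually_elim (auto simp: indicator_def)
  qed
  also have "\<dots> \<le> ennreal MH_const * (\<integral>\<^sup>+y. ennreal (tilt y) * indicator (cylinder x s - N) y \<partial>hausdorff_borel DIM('a))"
    by (intro nn_integral_M_le) measurable
  also have "\<dots> \<le> ennreal MH_const * I"
    unfolding I_def
  proof (intro mult_left_mono nn_integral_mono)
    fix y
    show "ennreal (tilt y) * indicator (cylinder x s - N) y \<le>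
      ennreal ((norm (outer_normal E y - (0, 1)))\<^sup>2 / 2) * indicator (cylinder x s \<inter> reduced_boundary E) y"
      using N'[of y] by (auto simp: indicator_def tilt_eq)
  qed simp
  also have "I = ennreal (s ^ DIM('a)) * excess E x s"
  proof -
    have "ennreal (s ^ DIM('a)) * (I / ennreal (s ^ DIM('a))) = I"
      using assms ennreal_mult_divide_eq[of "ennreal (s ^ DIM('a))" I]
      by (simp add: ennreal_times_divide mult.commute)
    then show ?thesis by (simp add: excess_def I_def)
  qed
  also have "ennreal MH_const * (ennreal (s ^ DIM('a)) * excess E x s) = ennreal (MH_const * s ^ DIM('a)) * excess E x s"
    using MH_const_pos assms by (simp add: ennreal_mult mult.assoc)
  finally show ?thesis .
qed

end

subsection \<open>Radial test functions\<close>

lemma DERIV_max_power: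
  "((\<lambda>t::real. max 0 t ^ Suc (Suc n)) has_real_derivative real (Suc (Suc n)) * max 0 t ^ Suc n) (at t)"
proof -
  consider "t > 0" | "t < 0" | "t = 0" by linarith
  then show ?thesis
  proof cases
    case 1
    have "((\<lambda>t::real. t ^ Suc (Suc n)) has_real_derivative real (Suc (Suc n)) * max 0 t ^ Suc n) (at t)"
      using 1 DERIV_pow[of "Suc (Suc n)" t UNIV] by (simp add: max_def)
    then show ?thesis
      by (rule has_field_derivative_transform_within_open[where S="{0<..}"]) (use 1 in auto)
  next
    case 2
    have "((\<lambda>t::real. 0) has_real_derivative real (Suc (Suc n)) * max 0 t ^ Suc n) (at t)"
      using 2 by auto
    then show ?thesis
      by (rule has_field_derivative_transform_within_open[where S="{..<0}"]) (use 2 in auto)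
  next
    case 3
    have "((\<lambda>h::real. max 0 h ^ Suc (Suc n) / h) \<longlongrightarrow> 0) (at 0)"
    proof (rule Lim_null_comparison)
      have "norm (max 0 h ^ Suc (Suc n) / h) \<le> \<bar>h\<bar> ^ Suc n" for h :: real
      proof (cases "h > 0")
        case False
        then have "max 0 h ^ Suc (Suc n) / h = 0" by (simp add: max_def)
        then show ?thesis using zero_le_power[of "\<bar>h\<bar>" "Suc n"] by (simp only: norm_zero abs_ge_zero)
      qed (auto simp: max_def)
      then show "\<forall>\<^sub>F h in at 0. norm (max 0 h ^ Suc (Suc n) / h) \<le> \<bar>h\<bar> ^ Suc n" for h :: real by simp
      have "((\<lambda>h::real. \<bar>h\<bar> ^ Suc n) \<longlongrightarrow> \<bar>0\<bar> ^ Suc n) (at 0)" by (intro tendsto_intros)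
      then show "((\<lambda>h::real. \<bar>h\<bar> ^ Suc n) \<longlongrightarrow> 0) (at 0)" by simp
    qed
    then show ?thesis using 3 by (simp add: DERIV_def)
  qed
qed

lemma DERIV_max_power2: "((\<lambda>t::real. (max 0 t)\<^sup>2) has_real_derivative 2 * max 0 t) (at t)"
  using DERIV_max_power[of 0 t] by (simp add: numeral_2_eq_2)

lemma DERIV_max_power3: "((\<lambda>t::real. max 0 t ^ 3) has_real_derivative 3 * (max 0 t)\<^sup>2) (at t)"
  using DERIV_max_power[of 1 t] by (simp add: numeral_3_eq_3 numeral_2_eq_2)

text \<open>A transition from 0 for t \<le> 0 to 1 for t \<ge> 1. The cubes make it twice
  continuously differentiable; \<open>step''\<close> enters the derivative of the divergence profile
  below.\<close>

definition step :: "real \<Rightarrow> real" where "step t = 1 - max 0 (1 - max 0 t ^ 3) ^ 3"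

definition step' :: "real \<Rightarrow> real" where "step' t = 9 * ((max 0 (1 - max 0 t ^ 3))\<^sup>2 * (max 0 t)\<^sup>2)"

definition step'' :: "real \<Rightarrow> real" where
  "step'' t = 9 * ((2 * max 0 (1 - max 0 t ^ 3) * (- (3 * (max 0 t)\<^sup>2))) * (max 0 t)\<^sup>2 + 2 * max 0 t * (max 0 (1 - max 0 t ^ 3))\<^sup>2)"

lemma DERIV_step: "(step has_real_derivative step' t) (at t)"
proof -
  have "((\<lambda>t. 1 - max 0 t ^ 3) has_real_derivative - (3 * (max 0 t)\<^sup>2)) (at t)"
    by (rule derivative_eq_intros DERIV_max_power3 refl)+ simp
  from DERIV_diff[OF DERIV_const[of 1] DERIV_chain2[OF DERIV_max_power3 this]]
  show ?thesis unfolding step_def[abs_def] by (rule DERIV_cong) (simp add: step'_def)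
qed

lemma DERIV_step': "(step' has_real_derivative step'' t) (at t)"
proof -
  have "((\<lambda>t. 1 - max 0 t ^ 3) has_real_derivative - (3 * (max 0 t)\<^sup>2)) (at t)"
    by (rule derivative_eq_intros DERIV_max_power3 refl)+ simp
  from DERIV_mult[OF DERIV_chain2[OF DERIV_max_power2 this] DERIV_max_power2]
  show ?thesis unfolding step'_def[abs_def] step''_def by (rule DERIV_cmult)
qed

lemma continuous_step: "continuous_on A step" "continuous_on A step'" "continuous_on A step''"
  unfolding step_def[abs_def] step'_def[abs_def] step''_def[abs_def] by (intro continuous_intros)+

lemma step_bounds: "0 \<le> step t" "step t \<le> 1"
proof -
  define u where "u = max 0 (1 - max 0 t ^ 3)"
  have "0 \<le> u" "u \<le> 1" by (auto simp: u_def)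
  then have "0 \<le> u ^ 3" "u ^ 3 \<le> 1" by (auto intro: power_le_one)
  then show "0 \<le> step t" "step t \<le> 1" by (auto simp: step_def u_def[symmetric])
qed

lemma step_low: "t \<le> 0 \<Longrightarrow> step t = 0" "t \<le> 0 \<Longrightarrow> step' t = 0"
  by (auto simp: step_def step'_def max_def)

lemma step_high: assumes "1 \<le> t" shows "step t = 1" "step' t = 0"
proof -
  have "1 \<le> t ^ 3" using assms by (rule one_le_power)
  then have "max 0 t = t" "max 0 (1 - t ^ 3) = 0" using assms by auto
  then show "step t = 1" "step' t = 0" by (auto simp: step_def step'_def)
qed

lemma step'_bounds: "0 \<le> step' t" "step' t \<le> 9"
proof -
  show "0 \<le> step' t" by (simp add: step'_def)
  show "step' t \<le> 9"
  proof (cases "1 \<le> t")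
    case False
    have "(max 0 (1 - max 0 t ^ 3))\<^sup>2 \<le> 1" "(max 0 t)\<^sup>2 \<le> 1"
      using False by (auto intro!: power_le_one)
    then show ?thesis using mult_mono[of "(max 0 (1 - max 0 t ^ 3))\<^sup>2" 1 "(max 0 t)\<^sup>2" 1] by (simp add: step'_def)
  qed (simp add: step_high)
qed

text \<open>Profiles are functions of the squared distance, which is smooth at the centre
  too.\<close>

lemma C1c_radial:
  fixes c :: "'b::euclidean_space"
  assumes s: "0 < s" and F: "\<And>w. 0 \<le> w \<Longrightarrow> (F has_real_derivative F' w) (at w)"
    and F': "continuous_on {0..} F'" and F0: "\<And>w. 1 \<le> w \<Longrightarrow> F w = 0"
  shows "C1c (\<lambda>z. F ((norm (z - c))\<^sup>2 / s\<^sup>2)) (\<lambda>z. (2 * F' ((norm (z - c))\<^sup>2 / s\<^sup>2) / s\<^sup>2) *\<^sub>R (z - c))"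
proof (rule C1cI[where R="norm c + s"])
  fix z :: 'b
  have "((\<lambda>z. (z - c) \<bullet> (z - c)) has_derivative (\<lambda>h. 2 * (h \<bullet> (z - c)))) (at z)"
    by (auto intro!: derivative_eq_intros simp: inner_commute)
  from has_derivative_mult_right[OF this, of "1 / s\<^sup>2"]
  have "((\<lambda>z. (norm (z - c))\<^sup>2 / s\<^sup>2) has_derivative (\<lambda>h. (2 / s\<^sup>2) * (h \<bullet> (z - c)))) (at z)"
    by (simp add: power2_norm_eq_inner)
  from DERIV_compose_FDERIV[OF F this]
  have "((\<lambda>z. F ((norm (z - c))\<^sup>2 / s\<^sup>2)) has_derivative (\<lambda>h. (2 / s\<^sup>2) * (h \<bullet> (z - c)) * F' ((norm (z - c))\<^sup>2 / s\<^sup>2))) (at z)"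
    by simp
  then show "GDERIV (\<lambda>z. F ((norm (z - c))\<^sup>2 / s\<^sup>2)) z :> (2 * F' ((norm (z - c))\<^sup>2 / s\<^sup>2) / s\<^sup>2) *\<^sub>R (z - c)"
    unfolding gderiv_def by (rule has_derivative_eq_rhs) (simp add: fun_eq_iff mult_ac)
next
  have "continuous_on UNIV (\<lambda>z::'b. F' ((norm (z - c))\<^sup>2 / s\<^sup>2))"
    using s by (intro continuous_on_compose2[OF F'] continuous_intros) auto
  then show "continuous_on UNIV (\<lambda>z. (2 * F' ((norm (z - c))\<^sup>2 / s\<^sup>2) / s\<^sup>2) *\<^sub>R (z - c))"
    using s by (intro continuous_intros) auto
next
  fix z :: 'b assume "norm c + s < norm z"
  then have "s \<le> norm (z - c)" using norm_triangle_ineq2[of z c] by linarith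
  then have "s\<^sup>2 \<le> (norm (z - c))\<^sup>2" using s by (intro power_mono) auto
  then show "F ((norm (z - c))\<^sup>2 / s\<^sup>2) = 0" using s by (intro F0) (simp add: le_divide_eq)
qed

lemma C1c_mult_inner:
  assumes "C1c f g"
  shows "C1c (\<lambda>z. f z * ((z - c) \<bullet> b)) (\<lambda>z. ((z - c) \<bullet> b) *\<^sub>R g z + f z *\<^sub>R b)"
proof -
  obtain R where R: "\<And>x. R < norm x \<Longrightarrow> f x = 0" using assms by (auto simp: C1c_def)
  show ?thesis
  proof (rule C1cI[where R=R])
    fix z
    have "((\<lambda>z. (z - c) \<bullet> b) has_derivative (\<lambda>h. h \<bullet> b)) (at z)"
      by (auto intro!: derivative_eq_intros)
    from has_derivative_mult[OF C1c_deriv[OF assms, of z] this]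
    show "GDERIV (\<lambda>z. f z * ((z - c) \<bullet> b)) z :> ((z - c) \<bullet> b) *\<^sub>R g z + f z *\<^sub>R b"
      unfolding gderiv_def by (rule has_derivative_eq_rhs) (auto simp: inner_add_right algebra_simps)
  next
    have "continuous_on UNIV g" using assms by (simp add: C1c_def)
    then show "continuous_on UNIV (\<lambda>z. ((z - c) \<bullet> b) *\<^sub>R g z + f z *\<^sub>R b)"
      using C1c_continuous[OF assms] by (intro continuous_intros)
  qed (simp add: R)
qed

text \<open>The third power leaves a derivative in reserve: in \<open>slab\<close> the derivative of
  a one-dimensional bump serves as a test function itself.\<close>

definition bump :: "'b::euclidean_space \<Rightarrow> real \<Rightarrow> 'b \<Rightarrow> real" where
  "bump c s z = max 0 (1 - (norm (z - c))\<^sup>2 / s\<^sup>2) ^ 3"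

definition bump_grad :: "'b::euclidean_space \<Rightarrow> real \<Rightarrow> 'b \<Rightarrow> 'b" where
  "bump_grad c s z = (2 * (- 3 * (max 0 (1 - (norm (z - c))\<^sup>2 / s\<^sup>2))\<^sup>2) / s\<^sup>2) *\<^sub>R (z - c)"

lemma DERIV_bump_profile: "((\<lambda>w. max 0 (1 - w) ^ 3) has_real_derivative - 3 * (max 0 (1 - w))\<^sup>2) (at w)"
proof -
  have "((\<lambda>w::real. 1 - w) has_real_derivative - 1) (at w)" by (auto intro!: derivative_eq_intros)
  from DERIV_chain2[OF DERIV_max_power3 this] show ?thesis by simp
qed

lemma C1c_bump: "0 < s \<Longrightarrow> C1c (bump c s) (bump_grad c s)"
  unfolding bump_def[abs_def] bump_grad_def[abs_def]
  by (intro C1c_radial[where F="\<lambda>w. max 0 (1 - w) ^ 3"] DERIV_bump_profile continuous_intros) auto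

lemma bump_bounds: "0 \<le> bump c s z" "bump c s z \<le> 1"
  by (auto simp: bump_def intro!: power_le_one)

lemma bump_outside: "0 < s \<Longrightarrow> s \<le> norm (z - c) \<Longrightarrow> bump c s z = 0"
  using power_mono[of s "norm (z - c)" 2] by (simp add: bump_def max_def)

lemma bump_grad_outside: "0 < s \<Longrightarrow> s \<le> norm (z - c) \<Longrightarrow> bump_grad c s z = 0"
  using power_mono[of s "norm (z - c)" 2] by (simp add: bump_grad_def max_def)

lemma bump_inside:
  assumes "0 < s" "norm (z - c) \<le> s / 2" shows "27 / 64 \<le> bump c s z"
proof -
  have "(norm (z - c))\<^sup>2 \<le> (s / 2)\<^sup>2" using assms by (intro power_mono) auto
  then have "(norm (z - c))\<^sup>2 / s\<^sup>2 \<le> 1 / 4" using assms by (simp add: divide_le_eq power_divide)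
  moreover have "3 / 4 \<le> max 0 (1 - w)" if "w \<le> 1 / 4" for w :: real using that by linarith
  ultimately have "3 / 4 \<le> max 0 (1 - (norm (z - c))\<^sup>2 / s\<^sup>2)" by blast
  then have "(3 / 4) ^ 3 \<le> max 0 (1 - (norm (z - c))\<^sup>2 / s\<^sup>2) ^ 3" by (rule power_mono) simp
  then have "(3 / 4) ^ 3 \<le> bump c s z" unfolding bump_def .
  then show ?thesis by (simp add: power_divide)
qed

lemma norm_bump_grad: assumes "0 < s" shows "norm (bump_grad c s z) \<le> 6 / s"
proof (cases "s \<le> norm (z - c)")
  case False
  have "(max 0 (1 - (norm (z - c))\<^sup>2 / s\<^sup>2))\<^sup>2 \<le> 1" by (auto intro!: power_le_one)
  then have "norm (bump_grad c s z) \<le> 6 / s\<^sup>2 * s"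
    unfolding bump_grad_def norm_scaleR using False assms
    by (intro mult_mono) (auto simp: abs_mult divide_right_mono)
  then show ?thesis using assms by (simp add: power2_eq_square)
qed (use assms in \<open>simp add: bump_grad_outside\<close>)

subsection \<open>Flux through a cylinder\<close>

text \<open>Rises on [a, a'] and falls on [b', b]. The derivative is kept as a difference of two
  nonnegative parts living on these intervals, so that each can be confronted with what E does
  there.\<close>

definition ramp :: "real \<Rightarrow> real \<Rightarrow> real \<Rightarrow> real \<Rightarrow> real \<Rightarrow> real" where
  "ramp a a' b' b t = step ((t - a) / (a' - a)) * step ((b - t) / (b - b'))"

definition ramp_up' :: "real \<Rightarrow> real \<Rightarrow> real \<Rightarrow> real \<Rightarrow> real \<Rightarrow> real" where
  "ramp_up' a a' b' b t = step' ((t - a) / (a' - a)) / (a' - a) * step ((b - t) / (b - b'))"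

definition ramp_down' :: "real \<Rightarrow> real \<Rightarrow> real \<Rightarrow> real \<Rightarrow> real \<Rightarrow> real" where
  "ramp_down' a a' b' b t = step ((t - a) / (a' - a)) * (step' ((b - t) / (b - b')) / (b - b'))"

lemma C1c_ramp:
  assumes "a < a'" "a' \<le> b'" "b' < b"
  shows "C1c (ramp a a' b' b) (\<lambda>t. ramp_up' a a' b' b t - ramp_down' a a' b' b t)"
proof (rule C1cI[where R="\<bar>a\<bar> + \<bar>b\<bar>"])
  fix t
  have "((\<lambda>t. (t - a) / (a' - a)) has_real_derivative 1 / (a' - a)) (at t)"
    "((\<lambda>t. (b - t) / (b - b')) has_real_derivative - 1 / (b - b')) (at t)"
    by (intro DERIV_cdivide; auto intro!: derivative_eq_intros)+
  from DERIV_mult[OF DERIV_chain2[OF DERIV_step this(1)] DERIV_chain2[OF DERIV_step this(2)]]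
  show "GDERIV (ramp a a' b' b) t :> ramp_up' a a' b' b t - ramp_down' a a' b' b t"
    by (simp add: ramp_def[abs_def] ramp_up'_def ramp_down'_def mult.commute)
  assume "\<bar>a\<bar> + \<bar>b\<bar> < norm t"
  then have "t \<le> a \<or> b \<le> t" by auto
  then show "ramp a a' b' b t = 0"
    using assms by (auto simp: ramp_def step_low divide_nonpos_pos)
next
  show "continuous_on UNIV (\<lambda>t. ramp_up' a a' b' b t - ramp_down' a a' b' b t)"
    unfolding ramp_up'_def ramp_down'_def using assms
    by (intro continuous_intros continuous_on_compose2[OF continuous_step(1)[of UNIV]]
        continuous_on_compose2[OF continuous_step(2)[of UNIV]]) auto
qed

lemma ramp_bounds: "0 \<le> ramp a a' b' b t" "ramp a a' b' b t \<le> 1"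
  using step_bounds by (auto simp: ramp_def intro!: mult_le_one)

lemma ramp_outside: "a < a' \<Longrightarrow> b' < b \<Longrightarrow> t \<le> a \<or> b \<le> t \<Longrightarrow> ramp a a' b' b t = 0"
  by (auto simp: ramp_def step_low divide_nonpos_pos)

lemma ramp_inside: "a < a' \<Longrightarrow> b' < b \<Longrightarrow> a' \<le> t \<Longrightarrow> t \<le> b' \<Longrightarrow> ramp a a' b' b t = 1"
  by (simp add: ramp_def step_high)

lemma ramp'_nonneg: "a < a' \<Longrightarrow> 0 \<le> ramp_up' a a' b' b t" "b' < b \<Longrightarrow> 0 \<le> ramp_down' a a' b' b t"
  using step_bounds step'_bounds by (auto simp: ramp_up'_def ramp_down'_def)

lemma ramp_up'_zero: "a < a' \<Longrightarrow> t \<le> a \<or> a' \<le> t \<Longrightarrow> ramp_up' a a' b' b t = 0"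
  by (auto simp: ramp_up'_def step_low step_high divide_nonpos_pos)

lemma ramp_down'_zero: "b' < b \<Longrightarrow> t \<le> b' \<or> b \<le> t \<Longrightarrow> ramp_down' a a' b' b t = 0"
  by (auto simp: ramp_down'_def step_low step_high divide_nonpos_pos)

context ahlfors
begin

lemma measure_ball_lower: "x \<in> S \<Longrightarrow> 0 < s \<Longrightarrow> s < r\<^sub>0 \<Longrightarrow> s ^ DIM('a) / C \<le> measure M (ball x s)"
  using lower[of x s] M_bounded[of "ball x s"] by (simp add: emeasure_eq_ennreal_measure less_top[symmetric])

lemma measure_ball_upper: "x \<in> S \<Longrightarrow> 0 < s \<Longrightarrow> s < r\<^sub>0 \<Longrightarrow> measure M (ball x s) \<le> C * s ^ DIM('a)"
  using upper[of x s] M_bounded[of "ball x s"] C by (simp add: emeasure_eq_ennreal_measure less_top[symmetric])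

text \<open>If the column over a ball has no mass of \<open>E\<close> where the test function increases, or is full where
  it decreases, then \<open>\<mu>\<^sub>E \<sqdot> e\<^sub>n\<close> cannot be positive on it, although \<open>y\<close> carries mass.\<close>

lemma flux:
  assumes y: "y \<in> S" and a: "0 < a" and t: "t1 < t1'" "t1' \<le> t2'" "t2' < t2"
    and b: "0 < b" "b \<le> a / 2" "b \<le> snd y - t1'" "b \<le> t2' - snd y" "b < r\<^sub>0"
    and Z: "bounded Z" "Z \<in> sets borel" "\<And>x. norm (fst x - fst y) < a \<Longrightarrow> t1 < snd x \<Longrightarrow> snd x < t2 \<Longrightarrow> x \<in> Z"
    and free: "(\<forall>x. norm (fst x - fst y) < a \<and> t1 < snd x \<and> snd x < t1' \<longrightarrow> x \<notin> interior E) \<or>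
               (\<forall>x. norm (fst x - fst y) < a \<and> t2' < snd x \<and> snd x < t2 \<longrightarrow> x \<in> interior E)"
  shows "27 / 64 * (b ^ DIM('a) / C) \<le> kap Z"
proof -
  define \<phi> where "\<phi> = bump (fst y) a"
  define \<psi> where "\<psi> = ramp t1 t1' t2' t2"
  define A where "A = ramp_up' t1 t1' t2' t2"
  define B where "B = ramp_down' t1 t1' t2' t2"
  have C1\<phi>: "C1c \<phi> (bump_grad (fst y) a)" unfolding \<phi>_def by (rule C1c_bump[OF a])
  have C1\<psi>: "C1c \<psi> (\<lambda>t. A t - B t)" unfolding \<psi>_def A_def B_def by (rule C1c_ramp[OF t])
  have AB: "0 \<le> A t" "0 \<le> B t" for t using t by (auto simp: A_def B_def ramp'_nonneg)
  have \<phi>0: "0 \<le> \<phi> z" "\<phi> z \<le> 1" for z by (auto simp: \<phi>_def bump_bounds)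
  have \<psi>0: "0 \<le> \<psi> t" "\<psi> t \<le> 1" for t by (auto simp: \<psi>_def ramp_bounds)
  define f where "f x = \<phi> (fst x) * \<psi> (snd x)" for x
  note C1f = C1c_prod[OF C1\<phi> C1\<psi>, folded f_def]
  have f_meas: "f \<in> borel_measurable borel" by (rule C1c_measurable(1)[OF C1f])
  have fb: "0 \<le> f x" "f x \<le> 1" for x using \<phi>0 \<psi>0 by (auto simp: f_def intro: mult_le_one)
  have fZ: "f x = 0" if "x \<notin> Z" for x
  proof -
    have "a \<le> norm (fst x - fst y) \<or> snd x \<le> t1 \<or> t2 \<le> snd x" using Z(3)[of x] that by linarith
    then show ?thesis using a t by (auto simp: f_def \<phi>_def \<psi>_def bump_outside ramp_outside)
  qed
  have g_int: "integrable lborel (\<lambda>x. \<phi> (fst x) * (A (snd x) - B (snd x)))"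
    and g_zero: "(LINT x|lborel. \<phi> (fst x) * (A (snd x) - B (snd x))) = 0"
  proof -
    show "(LINT x|lborel. \<phi> (fst x) * (A (snd x) - B (snd x))) = 0"
      using C1c_integral_0[OF C1f, of "(0, 1)"] by (simp add: inner_prod_def)
    have "(\<lambda>x. (\<psi> (snd x) *\<^sub>R bump_grad (fst y) a (fst x), \<phi> (fst x) * (A (snd x) - B (snd x))) \<bullet> (0, 1)) \<in> borel_measurable borel"
      using C1c_measurable(2)[OF C1f] by (intro borel_measurable_inner) auto
    then have m: "(\<lambda>x. \<phi> (fst x) * (A (snd x) - B (snd x))) \<in> borel_measurable lborel" by (simp add: inner_prod_def)
    obtain R B' where RB: "\<And>x. R < norm x \<Longrightarrow> (\<psi> (snd x) *\<^sub>R bump_grad (fst y) a (fst x), \<phi> (fst x) * (A (snd x) - B (snd x))) = 0"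
      "\<And>x. norm ((\<psi> (snd x) *\<^sub>R bump_grad (fst y) a (fst x), \<phi> (fst x) * (A (snd x) - B (snd x)))) \<le> B'"
      using C1c_support[OF C1f] by metis
    show "integrable lborel (\<lambda>x. \<phi> (fst x) * (A (snd x) - B (snd x)))"
    proof (rule integrable_bounded_support[OF m, where A="cball 0 R" and B=B'])
      show "norm (\<phi> (fst x) * (A (snd x) - B (snd x))) \<le> B'" for x
        using RB(2)[of x] norm_snd_le[of "\<phi> (fst x) * (A (snd x) - B (snd x))" "\<psi> (snd x) *\<^sub>R bump_grad (fst y) a (fst x)"] by linarith
      show "\<phi> (fst x) * (A (snd x) - B (snd x)) = 0" if "x \<notin> cball 0 R" for x
      proof -
        have "R < norm x" using that by (simp add: dist_norm not_le del: dist_prod_def)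
        then show ?thesis using RB(1)[of x] by (simp add: zero_prod_def)
      qed
    qed (use emeasure_lborel_cball_finite in auto)
  qed
  have "(LINT x|M. f x * snd (nu x)) = (LINT x|lborel. indicator (interior E) x * (\<phi> (fst x) * (A (snd x) - B (snd x))))"
    unfolding f_def using Gauss_Green_vertical[OF C1\<phi> C1\<psi>] by simp
  also have "\<dots> \<le> 0"
    using free
  proof
    \<comment> \<open>No part of E lies where the ramp rises, so only its falling part - B
      contributes.\<close>
    assume up: "\<forall>x. norm (fst x - fst y) < a \<and> t1 < snd x \<and> snd x < t1' \<longrightarrow> x \<notin> interior E"
    have "indicator (interior E) x * (\<phi> (fst x) * (A (snd x) - B (snd x))) \<le> 0" for x
    proof (cases "norm (fst x - fst y) < a \<and> t1 < snd x \<and> snd x < t1'")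
      case False
      then have "\<phi> (fst x) * A (snd x) = 0"
        using a t by (auto simp: \<phi>_def A_def bump_outside ramp_up'_zero not_less)
      then have "\<phi> (fst x) * (A (snd x) - B (snd x)) = - (\<phi> (fst x) * B (snd x))" unfolding right_diff_distrib by linarith
      then show ?thesis using mult_nonneg_nonneg[OF \<phi>0(1)[of "fst x"] AB(2)[of "snd x"]] by (simp add: indicator_def)
    next
      case True
      then have "x \<notin> interior E" using up by blast
      then show ?thesis by simp
    qed
    then have "0 \<le> (LINT x|lborel. - (indicator (interior E) x * (\<phi> (fst x) * (A (snd x) - B (snd x)))))"
      by (intro Bochner_Integration.integral_nonneg) simp
    then show ?thesis by simp
  next
    assume down: "\<forall>x. norm (fst x - fst y) < a \<and> t2' < snd x \<and> snd x < t2 \<longrightarrow> x \<in> interior E"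
    \<comment> \<open>The integral of the derivative over the whole space is 0, so it is enough that
      the part outside the interior of E is nonnegative.\<close>
    have pos: "0 \<le> \<phi> (fst x) * (A (snd x) - B (snd x)) - indicator (interior E) x * (\<phi> (fst x) * (A (snd x) - B (snd x)))" for x
    proof (cases "norm (fst x - fst y) < a \<and> t2' < snd x \<and> snd x < t2")
      case False
      then have "\<phi> (fst x) * B (snd x) = 0"
        using a t by (auto simp: \<phi>_def B_def bump_outside ramp_down'_zero not_less)
      then have eq: "\<phi> (fst x) * (A (snd x) - B (snd x)) = \<phi> (fst x) * A (snd x)" unfolding right_diff_distrib by linarith
      show ?thesis unfolding eq using mult_nonneg_nonneg[OF \<phi>0(1)[of "fst x"] AB(1)[of "snd x"]] by (simp add: indicator_def)
    next
      case True
      then have "x \<in> interior E" using down by blast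
      then show ?thesis by simp
    qed
    have i2: "integrable lborel (\<lambda>x. indicator (interior E) x * (\<phi> (fst x) * (A (snd x) - B (snd x))))"
      using integrable_mult_indicator[OF _ g_int, of "interior E"] by simp
    have "0 \<le> (LINT x|lborel. \<phi> (fst x) * (A (snd x) - B (snd x)) - indicator (interior E) x * (\<phi> (fst x) * (A (snd x) - B (snd x))))"
      by (intro Bochner_Integration.integral_nonneg pos)
    also have "\<dots> = 0 - (LINT x|lborel. indicator (interior E) x * (\<phi> (fst x) * (A (snd x) - B (snd x))))"
      by (subst Bochner_Integration.integral_diff[OF g_int i2]) (simp only: g_zero)
    finally show ?thesis by simp
  qed
  finally have le0: "(LINT x|M. f x * snd (nu x)) \<le> 0" .
  \<comment> \<open>On the ball of radius b about y the bump is at least 27/64 = (3/4)^3 and the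
    ramp is 1.\<close>
  have "27 / 64 * (b ^ DIM('a) / C) \<le> 27 / 64 * measure M (ball y b)"
    using measure_ball_lower[OF y b(1,5)] by simp
  also have "\<dots> = (LINT x|M. 27 / 64 * indicator (ball y b) x)" by simp
  also have "\<dots> \<le> (LINT x|M. f x)"
  proof (rule integral_mono)
    show "integrable M (\<lambda>x. 27 / 64 * (indicator (ball y b) x :: real))"
      using M_bounded[of "ball y b"] by simp
    show "integrable M f" by (rule integrable_M[where A=Z and B=1]) (use f_meas fb fZ Z in auto)
    fix x
    show "27 / 64 * indicator (ball y b) x \<le> f x"
    proof (cases "x \<in> ball y b")
      case True
      then have "norm (fst x - fst y) \<le> a / 2" "\<bar>snd x - snd y\<bar> \<le> b"
        using dist_fst_le[of x y] dist_snd_le[of x y] b(2) by (auto simp: dist_norm norm_minus_commute)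
      then have "27 / 64 \<le> \<phi> (fst x)" "\<psi> (snd x) = 1"
        unfolding \<phi>_def \<psi>_def using b(3,4) t by (intro bump_inside[OF a] ramp_inside; linarith)+
      then show ?thesis using True by (simp add: f_def)
    qed (simp add: fb)
  qed
  also have "\<dots> \<le> kap Z"
    using vertical_est[of f 1 Z] f_meas fb fZ Z le0 by (simp add: abs_le_iff)
  finally show ?thesis .
qed

end

subsection \<open>Slabs through boundary points carry a fixed amount of mass\<close>

text \<open>Profile of the horizontal field \<open>X z = h(|z|\<^sup>2) z\<close> with \<open>h w = (\<epsilon>\<^sup>2 + w)\<^sup>-\<^sup>k\<^sup>/\<^sup>2\<close> near \<open>0\<close>: its divergence
  \<open>k h + 2 w h'\<close> is positive and concentrated at scale \<open>\<epsilon>\<close> there, and bounded independently of \<open>\<epsilon>\<close> where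
  \<open>h\<close> is cut off.\<close>

context
  fixes k \<epsilon> :: real
begin

definition ker :: "real \<Rightarrow> real \<Rightarrow> real" where
  "ker j w = (\<epsilon>\<^sup>2 + w) powr (- k / 2 - j)"

text \<open>Equal to 1 up to w = 1/2 and to 0 from w = 1 on.\<close>

definition cut :: "real \<Rightarrow> real" where "cut w = 1 - step (2 * w - 1)"

definition cut' :: "real \<Rightarrow> real" where "cut' w = - (2 * step' (2 * w - 1))"

definition hprof :: "real \<Rightarrow> real" where "hprof w = cut w * ker 0 w"

definition hprof' :: "real \<Rightarrow> real" where
  "hprof' w = cut' w * ker 0 w - cut w * (k / 2 * ker 1 w)"

definition dprof :: "real \<Rightarrow> real" where
  "dprof w = cut w * (k * \<epsilon>\<^sup>2 * ker 1 w) + 2 * w * (cut' w * ker 0 w)"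

definition dprof' :: "real \<Rightarrow> real" where
  "dprof' w = cut' w * (k * \<epsilon>\<^sup>2 * ker 1 w) + k * \<epsilon>\<^sup>2 * ((- k / 2 - 1) * ker 2 w) * cut w +
     (2 * (cut' w * ker 0 w) + (- (4 * step'' (2 * w - 1)) * ker 0 w + (- k / 2 * ker 1 w) * cut' w) * (2 * w))"

context
  assumes eps: "0 < \<epsilon>" and k0: "0 \<le> k"
begin

lemma ker_pos: "0 \<le> w \<Longrightarrow> 0 < ker j w"
proof -
  assume "0 \<le> w"
  then have "0 < \<epsilon>\<^sup>2 + w" using eps by (simp add: add_pos_nonneg)
  then show ?thesis unfolding ker_def by simp
qed

lemma DERIV_ker: "0 \<le> w \<Longrightarrow> (ker j has_real_derivative (- k / 2 - j) * ker (j + 1) w) (at w)"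
proof -
  assume w: "0 \<le> w"
  have p: "0 < \<epsilon>\<^sup>2 + w" using eps w by (simp add: add_pos_nonneg)
  have "((\<lambda>w. \<epsilon>\<^sup>2 + w) has_real_derivative 1) (at w)" by (auto intro!: derivative_eq_intros)
  from DERIV_chain2[OF has_real_derivative_powr[OF p] this]
  show ?thesis unfolding ker_def[abs_def] by (rule DERIV_cong) (simp add: algebra_simps)
qed

lemma DERIV_cut: "(cut has_real_derivative cut' w) (at w)" "(cut' has_real_derivative - (4 * step'' (2 * w - 1))) (at w)"
proof -
  have 1: "((\<lambda>w::real. 2 * w - 1) has_real_derivative 2) (at w)" by (auto intro!: derivative_eq_intros)
  show "(cut has_real_derivative cut' w) (at w)"
    unfolding cut_def[abs_def] by (rule DERIV_cong[OF DERIV_diff[OF DERIV_const DERIV_chain2[OF DERIV_step 1]]]) (simp add: cut'_def)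
  show "(cut' has_real_derivative - (4 * step'' (2 * w - 1))) (at w)"
    unfolding cut'_def[abs_def] by (rule DERIV_cong[OF DERIV_minus[OF DERIV_cmult[OF DERIV_chain2[OF DERIV_step' 1]]]]) simp
qed

lemma DERIV_hprof: "0 \<le> w \<Longrightarrow> (hprof has_real_derivative hprof' w) (at w)"
  unfolding hprof_def[abs_def]
  by (rule DERIV_cong[OF DERIV_mult[OF DERIV_cut(1) DERIV_ker]]) (simp_all add: hprof'_def algebra_simps)

lemma DERIV_dprof: "0 \<le> w \<Longrightarrow> (dprof has_real_derivative dprof' w) (at w)"
  unfolding dprof_def[abs_def]
  by (rule DERIV_cong[OF DERIV_add[OF DERIV_mult[OF DERIV_cut(1) DERIV_cmult[OF DERIV_ker]]
        DERIV_mult[OF DERIV_cmult[OF DERIV_ident] DERIV_mult[OF DERIV_cut(2) DERIV_ker]]]])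
    (simp_all add: dprof'_def algebra_simps)

lemma continuous_cut: "continuous_on A cut" "continuous_on A cut'" "continuous_on A (\<lambda>w. step'' (2 * w - 1))"
  unfolding cut_def[abs_def] cut'_def[abs_def]
  by (intro continuous_intros continuous_on_compose2[OF continuous_step(1)[of UNIV]]
      continuous_on_compose2[OF continuous_step(2)[of UNIV]] continuous_on_compose2[OF continuous_step(3)[of UNIV]]; simp)+

lemma continuous_ker: "continuous_on {0..} (ker j)"
  using DERIV_ker by (intro continuous_at_imp_continuous_on) (auto intro: DERIV_isCont)

lemma continuous_hprof': "continuous_on {0..} hprof'" "continuous_on {0..} dprof'"
  unfolding hprof'_def[abs_def] dprof'_def[abs_def]
  by (intro continuous_intros continuous_cut continuous_ker)+

lemma prof_zero: "1 \<le> w \<Longrightarrow> hprof w = 0" "1 \<le> w \<Longrightarrow> dprof w = 0"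
  by (simp_all add: hprof_def dprof_def cut_def cut'_def step_high)

text \<open>Since ker 0 w = (\<epsilon>^2 + w) ker 1 w, the terms k h and 2 w h' cancel up to k
  \<epsilon>^2 ker 1 w, apart from the derivative of the cut-off. This cancellation is the reason
  for the exponent -k/2.\<close>

lemma dprof_eq: "0 \<le> w \<Longrightarrow> k * hprof w + 2 * w * hprof' w = dprof w"
proof -
  assume w: "0 \<le> w"
  have p: "0 < \<epsilon>\<^sup>2 + w" using eps w by (simp add: add_pos_nonneg)
  have "ker 0 w = (\<epsilon>\<^sup>2 + w) powr (1 + (- k / 2 - 1))" by (simp add: ker_def)
  also have "\<dots> = (\<epsilon>\<^sup>2 + w) * ker 1 w" unfolding powr_add ker_def using p by simp
  finally have "ker 0 w = (\<epsilon>\<^sup>2 + w) * ker 1 w" .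
  then show ?thesis by (simp add: hprof_def hprof'_def dprof_def algebra_simps)
qed

lemma cut_bounds: "0 \<le> cut w" "cut w \<le> 1" "\<bar>cut' w\<bar> \<le> 18" "cut' w \<le> 0"
  using step_bounds[of "2 * w - 1"] step'_bounds[of "2 * w - 1"] by (auto simp: cut_def cut'_def)

lemma ker_le: "0 \<le> w \<Longrightarrow> 0 \<le> j \<Longrightarrow> ker j w \<le> \<epsilon> powr (- k - 2 * j)"
proof -
  assume w: "0 \<le> w" "0 \<le> j"
  have "ker j w \<le> (\<epsilon>\<^sup>2) powr (- k / 2 - j)"
    unfolding ker_def using eps k0 w by (intro powr_mono2') auto
  also have "\<epsilon>\<^sup>2 = \<epsilon> powr 2" using eps by simp
  also have "(\<epsilon> powr 2) powr (- k / 2 - j) = \<epsilon> powr (- k - 2 * j)" by (simp add: powr_powr algebra_simps)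
  finally show ?thesis .
qed

lemma hprof_bound: "0 \<le> w \<Longrightarrow> \<bar>hprof w\<bar> \<le> \<epsilon> powr (- k)"
  using cut_bounds[of w] ker_le[of w 0] ker_pos[of w 0] mult_mono[of "cut w" 1 "ker 0 w" "\<epsilon> powr (- k)"]
  by (simp add: hprof_def abs_mult)

lemma eps_ker: "0 \<le> w \<Longrightarrow> 0 \<le> \<epsilon>\<^sup>2 * ker 1 w" "0 \<le> w \<Longrightarrow> \<epsilon>\<^sup>2 * ker 1 w \<le> \<epsilon> powr (- k)"
proof -
  assume w: "0 \<le> w"
  show "0 \<le> \<epsilon>\<^sup>2 * ker 1 w" using ker_pos[OF w, of 1] by simp
  have "\<epsilon>\<^sup>2 * ker 1 w \<le> \<epsilon>\<^sup>2 * \<epsilon> powr (- k - 2 * 1)" using ker_le[OF w, of 1] by (intro mult_left_mono) auto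
  also have "\<dots> = \<epsilon> powr 2 * \<epsilon> powr (- k - 2)" using eps by simp
  also have "\<dots> = \<epsilon> powr (- k)" unfolding powr_add[symmetric] by simp
  finally show "\<epsilon>\<^sup>2 * ker 1 w \<le> \<epsilon> powr (- k)" .
qed

text \<open>\<open>cut'\<close> vanishes for w \<le> 1/2, and beyond that the kernel is bounded
  independently of \<epsilon>.\<close>

lemma dprof_cut_term: "0 \<le> w \<Longrightarrow> w \<le> 1 \<Longrightarrow> \<bar>2 * w * (cut' w * ker 0 w)\<bar> \<le> 36 * 2 powr k"
proof -
  assume w: "0 \<le> w" "w \<le> 1"
  show ?thesis
  proof (cases "w \<le> 1 / 2")
    case True
    then show ?thesis by (simp add: cut'_def step_low)
  next
    case False
    have "ker 0 w \<le> (1 / 2) powr (- k / 2 - 0)"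
      unfolding ker_def using False k0 by (intro powr_mono2') (auto simp: add_increasing)
    also have "\<dots> = 2 powr (k / 2)" by (simp add: powr_divide powr_minus divide_simps)
    also have "\<dots> \<le> 2 powr k" using k0 by (intro powr_mono) auto
    finally have kk: "ker 0 w \<le> 2 powr k" .
    have "\<bar>2 * w * (cut' w * ker 0 w)\<bar> = (2 * w) * \<bar>cut' w\<bar> * ker 0 w"
      using w ker_pos[OF w(1), of 0] by (simp add: abs_mult)
    also have "\<dots> \<le> 2 * 18 * 2 powr k"
      using w cut_bounds[of w] kk ker_pos[OF w(1), of 0] by (intro mult_mono) auto
    finally show ?thesis by simp
  qed
qed

lemma dprof_bounds:
  assumes "0 \<le> w"
  shows "\<bar>dprof w\<bar> \<le> k * \<epsilon> powr (- k) + 36 * 2 powr k" "- (36 * 2 powr k) \<le> dprof w"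
proof -
  have 1: "0 \<le> cut w * (k * \<epsilon>\<^sup>2 * ker 1 w)" "cut w * (k * \<epsilon>\<^sup>2 * ker 1 w) \<le> k * \<epsilon> powr (- k)"
  proof -
    have "0 \<le> k * (\<epsilon>\<^sup>2 * ker 1 w)" using eps_ker(1)[OF assms] k0 by simp
    moreover have "k * (\<epsilon>\<^sup>2 * ker 1 w) \<le> k * \<epsilon> powr (- k)" using eps_ker(2)[OF assms] k0 by (intro mult_left_mono)
    ultimately show "0 \<le> cut w * (k * \<epsilon>\<^sup>2 * ker 1 w)" "cut w * (k * \<epsilon>\<^sup>2 * ker 1 w) \<le> k * \<epsilon> powr (- k)"
      using cut_bounds[of w] mult_mono[of "cut w" 1 "k * (\<epsilon>\<^sup>2 * ker 1 w)" "k * \<epsilon> powr (- k)"] by (auto simp: mult.assoc)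
  qed
  have 2: "\<bar>2 * w * (cut' w * ker 0 w)\<bar> \<le> 36 * 2 powr k"
  proof (cases "w \<le> 1")
    case False
    then show ?thesis by (simp add: cut'_def step_high)
  qed (rule dprof_cut_term[OF assms])
  show "\<bar>dprof w\<bar> \<le> k * \<epsilon> powr (- k) + 36 * 2 powr k" "- (36 * 2 powr k) \<le> dprof w"
    using 1 2 unfolding dprof_def by linarith+
qed

text \<open>For w \<le> \<epsilon>^2 the base \<epsilon>^2 + w is at most 2 \<epsilon>^2, so the
  peak has height of order \<epsilon>^(-k).\<close>

lemma dprof_near:
  assumes "0 \<le> w" "w \<le> \<epsilon>\<^sup>2" "w \<le> 1 / 2"
  shows "k * 2 powr (- k - 1) * \<epsilon> powr (- k) \<le> dprof w"
proof -
  have "(2 * \<epsilon>\<^sup>2) powr (- k / 2 - 1) \<le> ker 1 w"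
    unfolding ker_def using assms eps k0 by (intro powr_mono2') (auto simp: add_pos_nonneg)
  moreover have "(2 * \<epsilon>\<^sup>2) powr (- k / 2 - 1) = 2 powr (- k / 2 - 1) * \<epsilon> powr (- k - 2)"
  proof -
    have "(2 * \<epsilon>\<^sup>2) powr (- k / 2 - 1) = 2 powr (- k / 2 - 1) * (\<epsilon>\<^sup>2) powr (- k / 2 - 1)"
      by (simp add: powr_mult)
    moreover have "(\<epsilon>\<^sup>2) powr (- k / 2 - 1) = \<epsilon> powr (- k - 2)"
    proof -
      have "\<epsilon>\<^sup>2 = \<epsilon> powr 2" using eps by simp
      then show ?thesis by (simp add: powr_powr algebra_simps)
    qed
    ultimately show ?thesis by simp
  qed
  moreover have "2 powr (- k - 1) \<le> (2::real) powr (- k / 2 - 1)" using k0 by (intro powr_mono) auto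
  ultimately have "2 powr (- k - 1) * \<epsilon> powr (- k - 2) \<le> ker 1 w"
    using mult_right_mono[of "2 powr (- k - 1)" "2 powr (- k / 2 - 1)" "\<epsilon> powr (- k - 2)"] by simp
  then have le: "k * \<epsilon>\<^sup>2 * (2 powr (- k - 1) * \<epsilon> powr (- k - 2)) \<le> k * \<epsilon>\<^sup>2 * ker 1 w"
    using k0 by (intro mult_left_mono) auto
  have e: "k * \<epsilon>\<^sup>2 * (p * q) = k * p * (\<epsilon>\<^sup>2 * q)" for p q by (simp only: mult_ac)
  have "\<epsilon>\<^sup>2 * \<epsilon> powr (- k - 2) = \<epsilon> powr (- k)"
  proof -
    have "\<epsilon>\<^sup>2 * \<epsilon> powr (- k - 2) = \<epsilon> powr 2 * \<epsilon> powr (- k - 2)" using eps by simp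
    also have "\<dots> = \<epsilon> powr (- k)" unfolding powr_add[symmetric] by simp
    finally show ?thesis .
  qed
  moreover have "dprof w = k * \<epsilon>\<^sup>2 * ker 1 w"
    using assms by (simp add: dprof_def cut_def cut'_def step_low)
  ultimately show ?thesis using le unfolding e by simp
qed

end

end

text \<open>Constants: \<open>slab_low\<close> bounds the mass near the point, \<open>slab_up\<close> and \<open>slab_kap\<close> are the factors of the mass
  and of the excess of the slab.\<close>

definition slab_low :: "real \<Rightarrow> real \<Rightarrow> real" where
  "slab_low C k = k * 2 powr (- k - 1) * (27 / 64) * 2 powr (- k) / C"

definition slab_up :: "real \<Rightarrow> real" where
  "slab_up k = 36 * 2 powr k + 3"

definition slab_kap :: "real \<Rightarrow> real \<Rightarrow> real" where
  "slab_kap k \<epsilon> = k * \<epsilon> powr (- k) + 36 * 2 powr k + 6 * \<epsilon> powr (- 2 * k - 2)"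

context ahlfors
begin

text \<open>Let f be the divergence of the horizontal field h(z) (z - c). The field with horizontal
  part - \<psi>' h(z) (z - c) and vertical part f \<psi> is divergence free, so the flux of f \<psi>
  e_n equals that of \<psi>' h(z) (z - c). The first is nearly the integral of f \<psi>, which is
  large because f peaks at y; the second involves only the horizontal part of the normal.\<close>

lemma slab:
  assumes y: "y \<in> S" and s: "0 < s" and eps: "0 < \<epsilon>" "\<epsilon> \<le> 1" "\<epsilon> * s / 2 < r\<^sub>0"
    and Z: "Z = {x. norm (fst x - fst y) < s \<and> \<bar>snd x - snd y\<bar> < \<epsilon> * s}"
  shows "slab_low C (real DIM('a)) * s ^ DIM('a) \<le> slab_up (real DIM('a)) * measure M Z + slab_kap (real DIM('a)) \<epsilon> * kap Z"
proof -
  define k where "k = real DIM('a)"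
  have k0: "0 \<le> k" by (simp add: k_def)
  define c where "c = fst y"
  define \<rho> where "\<rho> = \<epsilon> * s"
  have \<rho>: "0 < \<rho>" using s eps by (simp add: \<rho>_def)
  define w where "w z = (norm (z - c))\<^sup>2 / s\<^sup>2" for z
  have w0: "0 \<le> w z" for z by (simp add: w_def)
  have w1: "1 \<le> w z" if "s \<le> norm (z - c)" for z
    using that s power_mono[of s "norm (z - c)" 2] by (simp add: w_def le_divide_eq)
  define \<psi> where "\<psi> = bump (snd y) \<rho>"
  define \<psi>' where "\<psi>' = bump_grad (snd y) \<rho>"
  have C1\<psi>: "C1c \<psi> \<psi>'" unfolding \<psi>_def \<psi>'_def by (rule C1c_bump[OF \<rho>])
  \<comment> \<open>The horizontal field has vertical factor \<psi>', which must therefore be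
    differentiable in turn.\<close>
  have C1\<psi>': "\<exists>\<psi>''. C1c \<psi>' \<psi>''"
  proof -
    have D: "((\<lambda>w::real. - 3 * (max 0 (1 - w))\<^sup>2) has_real_derivative - 3 * (2 * max 0 (1 - w) * - 1)) (at w)" for w :: real
    proof -
      have "((\<lambda>w::real. 1 - w) has_real_derivative - 1) (at w)" by (auto intro!: derivative_eq_intros)
      from DERIV_cmult[OF DERIV_chain2[OF DERIV_max_power2 this]] show ?thesis .
    qed
    have "C1c (\<lambda>t. - 3 * (max 0 (1 - (norm (t - snd y))\<^sup>2 / \<rho>\<^sup>2))\<^sup>2)
      (\<lambda>t. (2 * (- 3 * (2 * max 0 (1 - (norm (t - snd y))\<^sup>2 / \<rho>\<^sup>2) * - 1)) / \<rho>\<^sup>2) *\<^sub>R (t - snd y))"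
      by (rule C1c_radial[OF \<rho> D]) (auto intro!: continuous_intros)
    from C1c_mult_inner[OF this, of "snd y" "2 / \<rho>\<^sup>2"]
    have "\<exists>g. C1c (\<lambda>t. - 3 * (max 0 (1 - (norm (t - snd y))\<^sup>2 / \<rho>\<^sup>2))\<^sup>2 * ((t - snd y) \<bullet> (2 / \<rho>\<^sup>2))) g" by blast
    moreover have "(\<lambda>t. - 3 * (max 0 (1 - (norm (t - snd y))\<^sup>2 / \<rho>\<^sup>2))\<^sup>2 * ((t - snd y) \<bullet> (2 / \<rho>\<^sup>2))) = \<psi>'"
      by (simp add: fun_eq_iff \<psi>'_def bump_grad_def mult_ac)
    ultimately show ?thesis by simp
  qed
  then obtain \<psi>'' where C1\<psi>': "C1c \<psi>' \<psi>''" by blast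
  define h where "h z = hprof k \<epsilon> (w z)" for z
  define gh where "gh z = (2 * hprof' k \<epsilon> (w z) / s\<^sup>2) *\<^sub>R (z - c)" for z
  define f where "f z = dprof k \<epsilon> (w z)" for z
  have C1h: "C1c h gh"
    unfolding h_def[abs_def] gh_def[abs_def] w_def
    by (rule C1c_radial[OF s DERIV_hprof continuous_hprof'(1)]) (use eps k0 prof_zero in auto)
  have C1f: "\<exists>g. C1c f g"
    unfolding f_def[abs_def] w_def
    by (intro exI, rule C1c_radial[OF s DERIV_dprof continuous_hprof'(2)]) (use eps k0 prof_zero in auto)
  then obtain gf where C1f: "C1c f gf" by blast
  have f_eq: "(\<Sum>b\<in>Basis. (((z - c) \<bullet> b) *\<^sub>R gh z + h z *\<^sub>R b) \<bullet> b) = f z" for z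
  proof -
    have "(\<Sum>b\<in>Basis. (((z - c) \<bullet> b) *\<^sub>R gh z + h z *\<^sub>R b) \<bullet> b) =
      (\<Sum>b\<in>Basis. ((z - c) \<bullet> b) * (gh z \<bullet> b)) + (\<Sum>b\<in>(Basis::'a set). h z)"
      by (simp add: inner_add_left sum.distrib)
    also have "(\<Sum>b\<in>Basis. ((z - c) \<bullet> b) * (gh z \<bullet> b)) = (z - c) \<bullet> gh z"
      by (simp add: euclidean_inner[of "z - c" "gh z"])
    also have "(z - c) \<bullet> gh z = 2 * w z * hprof' k \<epsilon> (w z)"
      by (simp add: gh_def w_def power2_norm_eq_inner)
    also have "(\<Sum>b\<in>(Basis::'a set). h z) = k * hprof k \<epsilon> (w z)" by (simp add: k_def h_def)
    finally show ?thesis using dprof_eq[OF eps(1) k0 w0[of z]] by (simp add: f_def)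
  qed
  have C1b: "C1c (\<lambda>z. h z * ((z - c) \<bullet> b)) (\<lambda>z. ((z - c) \<bullet> b) *\<^sub>R gh z + h z *\<^sub>R b)" for b
    by (rule C1c_mult_inner[OF C1h])
  define X where "X x = (h (fst x) * \<psi>' (snd x)) *\<^sub>R (fst x - c)" for x :: "'a \<times> real"
  have Z_iff: "x \<in> Z \<longleftrightarrow> norm (fst x - c) < s \<and> \<bar>snd x - snd y\<bar> < \<rho>" for x by (simp add: Z c_def \<rho>_def)
  have openZ: "open Z" unfolding Z by (intro open_Collect_conj open_Collect_less continuous_intros)
  have Zc: "Z \<subseteq> ball y (s + \<rho>)"
  proof
    fix x assume "x \<in> Z"
    then have "norm (x - y) < s + \<rho>" using norm_le_fst_snd[of "x - y"] by (auto simp: Z_iff c_def)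
    then show "x \<in> ball y (s + \<rho>)" by (simp add: dist_norm norm_minus_commute)
  qed
  have Zb: "bounded Z" "Z \<in> sets borel" using bounded_subset[OF bounded_ball Zc] openZ by auto
  have off: "h (fst x) * \<psi>' (snd x) = 0" "f (fst x) * \<psi> (snd x) = 0" if "x \<notin> Z" for x
    using that w1[of "fst x"] \<rho> prof_zero[OF eps(1) k0, of "w (fst x)"]
    by (auto simp: Z_iff not_less h_def f_def \<psi>_def \<psi>'_def bump_outside bump_grad_outside)
  have contX: "continuous_on UNIV X"
    unfolding X_def
    by (intro continuous_intros continuous_on_compose2[OF C1c_continuous[OF C1h]] continuous_on_compose2[OF C1c_continuous[OF C1\<psi>']]) auto
  have Xm: "X \<in> borel_measurable borel" using contX by (rule borel_measurable_continuous_onI)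
  have fm: "(\<lambda>x. f (fst x) * \<psi> (snd x)) \<in> borel_measurable borel"
    using C1c_measurable(1)[OF C1c_prod[OF C1f C1\<psi>]] .
  have epsk: "\<epsilon> powr (- k - 1) * \<epsilon> powr (k + 1) = 1" unfolding powr_add[symmetric] using eps by simp
  have Xb: "norm (X x) \<le> 6 * \<epsilon> powr (- k - 1)" for x
  proof (cases "x \<in> Z")
    case True
    have "norm (X x) = \<bar>h (fst x)\<bar> * \<bar>\<psi>' (snd x)\<bar> * norm (fst x - c)" by (simp add: X_def abs_mult)
    also have "\<dots> \<le> \<epsilon> powr (- k) * (6 / \<rho>) * s"
      using hprof_bound[OF eps(1) k0 w0, of "fst x"] norm_bump_grad[OF \<rho>, of "snd y" "snd x"] True \<rho>
      by (intro mult_mono) (auto simp: h_def \<psi>'_def Z_iff)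
    also have "\<dots> = 6 * (\<epsilon> powr (- k) / \<epsilon>)" using s by (simp add: \<rho>_def)
    also have "\<epsilon> powr (- k) / \<epsilon> = \<epsilon> powr (- k - 1)" using eps by (simp add: powr_diff)
    finally show ?thesis .
  qed (simp add: X_def off)
  have X0: "X x = 0" if "x \<notin> Z" for x using off(1)[OF that] by (simp add: X_def)

  have "(LINT x|M. f (fst x) * \<psi> (snd x) * snd (nu x)) = (LINT x|lborel. indicator (interior E) x * (f (fst x) * \<psi>' (snd x)))"
    by (rule Gauss_Green_vertical[OF C1f C1\<psi>, symmetric])
  also have "\<dots> = (LINT x|lborel. (\<Sum>b\<in>Basis. indicator (interior E) x * (\<psi>' (snd x) * ((((fst x - c) \<bullet> b) *\<^sub>R gh (fst x) + h (fst x) *\<^sub>R b) \<bullet> b))))"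
    by (simp only: f_eq[symmetric] sum_distrib_left[symmetric]) (simp only: mult.commute)
  also have "\<dots> = (\<Sum>b\<in>Basis. LINT x|lborel. indicator (interior E) x * (\<psi>' (snd x) * ((((fst x - c) \<bullet> b) *\<^sub>R gh (fst x) + h (fst x) *\<^sub>R b) \<bullet> b)))"
  proof (rule Bochner_Integration.integral_sum)
    fix b :: 'a
    define G where "G x = (\<psi>' (snd x) *\<^sub>R (((fst x - c) \<bullet> b) *\<^sub>R gh (fst x) + h (fst x) *\<^sub>R b), h (fst x) * ((fst x - c) \<bullet> b) * \<psi>'' (snd x))" for x
    have CG: "C1c (\<lambda>x. h (fst x) * ((fst x - c) \<bullet> b) * \<psi>' (snd x)) G" unfolding G_def by (rule C1c_prod[OF C1b C1\<psi>'])
    obtain R B' where RB: "\<And>x. R < norm x \<Longrightarrow> G x = 0" "\<And>x. norm (G x) \<le> B'" using C1c_support[OF CG] by metis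
    have Gm: "G \<in> borel_measurable borel" by (rule C1c_measurable(2)[OF CG])
    have "integrable lborel (\<lambda>x. indicator (interior E) x *\<^sub>R (G x \<bullet> (b, 0)))"
    proof (rule integrable_bounded_support[where A="cball 0 R" and B="B' * norm (b, 0::real)"])
      have "(\<lambda>x. G x \<bullet> (b, 0)) \<in> borel_measurable borel" by (intro borel_measurable_inner Gm) simp
      then show "(\<lambda>x. indicator (interior E) x *\<^sub>R (G x \<bullet> (b, 0))) \<in> borel_measurable lborel" by simp
      show "norm (indicator (interior E) x *\<^sub>R (G x \<bullet> (b, 0))) \<le> B' * norm (b, 0::real)" for x
      proof -
        have "\<bar>G x \<bullet> (b, 0)\<bar> \<le> norm (G x) * norm (b, 0::real)" by (rule Cauchy_Schwarz_ineq2)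
        also have "\<dots> \<le> B' * norm (b, 0::real)" by (intro mult_right_mono RB(2)) simp
        finally show ?thesis by (auto simp: indicator_def intro: order_trans[OF abs_ge_zero])
      qed
      show "indicator (interior E) x *\<^sub>R (G x \<bullet> (b, 0)) = 0" if "x \<notin> cball 0 R" for x
      proof -
        have "R < norm x" using that by (simp add: dist_norm not_le del: dist_prod_def)
        then show ?thesis using RB(1)[of x] by simp
      qed
    qed (use emeasure_lborel_cball_finite in auto)
    then show "integrable lborel (\<lambda>x. indicator (interior E) x * (\<psi>' (snd x) * ((((fst x - c) \<bullet> b) *\<^sub>R gh (fst x) + h (fst x) *\<^sub>R b) \<bullet> b)))"
      by (simp add: G_def inner_prod_def)
  qed
  also have "\<dots> = (\<Sum>b\<in>Basis. LINT x|M. h (fst x) * ((fst x - c) \<bullet> b) * \<psi>' (snd x) * (b \<bullet> fst (nu x)))"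
    by (intro sum.cong refl Gauss_Green_horizontal[OF C1b C1\<psi>'])
  also have "\<dots> = (LINT x|M. (\<Sum>b\<in>Basis. h (fst x) * ((fst x - c) \<bullet> b) * \<psi>' (snd x) * (b \<bullet> fst (nu x))))"
  proof (rule Bochner_Integration.integral_sum[symmetric])
    fix b :: 'a assume b: "b \<in> Basis"
    have "integrable M (\<lambda>x. (X x \<bullet> b) * (b \<bullet> fst (nu x)))"
    proof (rule integrable_M[where A=Z and B="6 * \<epsilon> powr (- k - 1) * 1"])
      have "(\<lambda>x. X x \<bullet> b) \<in> borel_measurable borel" "(\<lambda>x. b \<bullet> fst (nu x)) \<in> borel_measurable borel"
        by (intro borel_measurable_inner Xm nu_components_measurable; simp)+
      then show "(\<lambda>x. (X x \<bullet> b) * (b \<bullet> fst (nu x))) \<in> borel_measurable borel" by (rule borel_measurable_times)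
      fix x
      have "\<bar>X x \<bullet> b\<bar> \<le> 6 * \<epsilon> powr (- k - 1)"
        using Cauchy_Schwarz_ineq2[of "X x" b] Xb[of x] b by simp
      moreover have "\<bar>b \<bullet> fst (nu x)\<bar> \<le> 1"
        using Cauchy_Schwarz_ineq2[of b "fst (nu x)"] norm_fst_le[of "fst (nu x)" "snd (nu x)"] b by simp
      ultimately show "norm ((X x \<bullet> b) * (b \<bullet> fst (nu x))) \<le> 6 * \<epsilon> powr (- k - 1) * 1"
        unfolding real_norm_def abs_mult by (rule mult_mono) auto
    qed (use X0 Zb in auto)
    then show "integrable M (\<lambda>x. h (fst x) * ((fst x - c) \<bullet> b) * \<psi>' (snd x) * (b \<bullet> fst (nu x)))"
      by (simp add: X_def mult_ac)
  qed
  also have "\<dots> = (LINT x|M. X x \<bullet> fst (nu x))"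
  proof (rule Bochner_Integration.integral_cong[OF refl])
    fix x
    have "X x \<bullet> fst (nu x) = (\<Sum>b\<in>Basis. (X x \<bullet> b) * (fst (nu x) \<bullet> b))" by (rule euclidean_inner)
    then show "(\<Sum>b\<in>Basis. h (fst x) * ((fst x - c) \<bullet> b) * \<psi>' (snd x) * (b \<bullet> fst (nu x))) = X x \<bullet> fst (nu x)"
      by (simp add: X_def mult_ac inner_commute)
  qed
  finally have flux_eq: "(LINT x|M. f (fst x) * \<psi> (snd x) * snd (nu x)) = (LINT x|M. X x \<bullet> fst (nu x))" .

  \<comment> \<open>Young's inequality with \<theta> = \<epsilon>^(k+1), which cancels the size
    \<epsilon>^(-k-1) of the field: the factor 3 of the mass does not depend on \<epsilon>, and the
    whole dependence goes to the tilt.\<close>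
  have up: "(LINT x|M. X x \<bullet> fst (nu x)) \<le> 3 * measure M Z + 6 * \<epsilon> powr (- 2 * k - 2) * kap Z"
  proof -
    have "\<bar>LINT x|M. X x \<bullet> fst (nu x)\<bar> \<le> 6 * \<epsilon> powr (- k - 1) * (\<epsilon> powr (k + 1) / 2 * measure M Z + kap Z / \<epsilon> powr (k + 1))"
      using eps by (intro horizontal_est[OF Xm Xb X0 Zb]) auto
    also have "\<dots> = 3 * (\<epsilon> powr (- k - 1) * \<epsilon> powr (k + 1)) * measure M Z + 6 * (\<epsilon> powr (- k - 1) / \<epsilon> powr (k + 1)) * kap Z"
      by (simp add: algebra_simps)
    also have "\<epsilon> powr (- k - 1) / \<epsilon> powr (k + 1) = \<epsilon> powr (- 2 * k - 2)" unfolding powr_diff[symmetric] by simp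
    finally show ?thesis unfolding epsk by (simp add: abs_le_iff)
  qed
  have fb: "\<bar>f (fst x) * \<psi> (snd x)\<bar> \<le> k * \<epsilon> powr (- k) + 36 * 2 powr k" for x
    using mult_mono[of "\<bar>f (fst x)\<bar>" "k * \<epsilon> powr (- k) + 36 * 2 powr k" "\<bar>\<psi> (snd x)\<bar>" 1]
      dprof_bounds(1)[OF eps(1) k0 w0, of "fst x"] bump_bounds[of "snd y" \<rho> "snd x"] k0
    by (auto simp: abs_mult f_def \<psi>_def)
  have vert: "(LINT x|M. f (fst x) * \<psi> (snd x)) \<le> (LINT x|M. f (fst x) * \<psi> (snd x) * snd (nu x)) + (k * \<epsilon> powr (- k) + 36 * 2 powr k) * kap Z"
    using vertical_est[OF fm fb off(2) Zb] by (simp add: abs_le_iff)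
  \<comment> \<open>Within half the slab height f has its peak and \<psi> is at least 27/64.\<close>
  define B where "B = ball y (\<rho> / 2)"
  have BZ: "x \<in> B \<Longrightarrow> norm (fst x - c) \<le> \<rho> / 2 \<and> \<bar>snd x - snd y\<bar> \<le> \<rho> / 2" for x
    using dist_fst_le[of x y] dist_snd_le[of x y] by (auto simp: B_def c_def dist_norm norm_minus_commute)
  define a where "a = k * 2 powr (- k - 1) * \<epsilon> powr (- k) * (27 / 64)"
  have low: "a * measure M B - 36 * 2 powr k * measure M Z \<le> (LINT x|M. f (fst x) * \<psi> (snd x))"
  proof -
    have Bb: "B \<in> sets borel" "emeasure M B < \<infinity>" "emeasure M Z < \<infinity>" using M_bounded[of B] M_bounded[OF Zb(1)] by (auto simp: B_def)
    have "(LINT x|M. a * indicator B x - 36 * 2 powr k * indicator Z x) \<le> (LINT x|M. f (fst x) * \<psi> (snd x))"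
    proof (rule integral_mono)
      show "integrable M (\<lambda>x. a * indicator B x - 36 * 2 powr k * indicator Z x)"
        using Bb Zb(2) by simp
      show "integrable M (\<lambda>x. f (fst x) * \<psi> (snd x))"
        by (rule integrable_M[OF fm _ off(2) Zb]) (use fb in auto)
      fix x
      show "a * indicator B x - 36 * 2 powr k * indicator Z x \<le> f (fst x) * \<psi> (snd x)"
      proof (cases "x \<in> B")
        case True
        have n: "norm (fst x - c) \<le> \<epsilon> * s / 2" using BZ[OF True] by (simp add: \<rho>_def)
        have "(norm (fst x - c))\<^sup>2 \<le> (\<epsilon> * s / 2)\<^sup>2" using n by (intro power_mono) auto
        then have wle: "w (fst x) \<le> \<epsilon>\<^sup>2 / 4" using s by (simp add: w_def divide_le_eq power_mult_distrib power_divide)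
        have e1: "\<epsilon>\<^sup>2 \<le> 1" using eps by (simp add: power_le_one)
        have f1: "k * 2 powr (- k - 1) * \<epsilon> powr (- k) \<le> f (fst x)"
        proof -
          have "w (fst x) \<le> \<epsilon>\<^sup>2" "w (fst x) \<le> 1 / 2" using wle e1 zero_le_power2[of \<epsilon>] by linarith+
          then show ?thesis unfolding f_def by (intro dprof_near eps k0 w0)
        qed
        have p1: "27 / 64 \<le> \<psi> (snd x)" unfolding \<psi>_def using BZ[OF True] by (intro bump_inside[OF \<rho>]) simp
        have "a \<le> f (fst x) * \<psi> (snd x)"
          unfolding a_def using k0 by (intro mult_mono f1 p1 order_trans[OF _ f1]) auto
        moreover have "0 \<le> 36 * 2 powr k * (indicator Z x :: real)" by simp
        ultimately have "a - 36 * 2 powr k * indicator Z x \<le> f (fst x) * \<psi> (snd x)" by linarith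
        then show ?thesis using True by simp
      next
        case False
        show ?thesis
        proof (cases "x \<in> Z")
          case True
          have "- (36 * 2 powr k) \<le> f (fst x)" unfolding f_def by (rule dprof_bounds(2)[OF eps(1) k0 w0])
          moreover have "0 \<le> \<psi> (snd x)" "\<psi> (snd x) \<le> 1" by (auto simp: \<psi>_def bump_bounds)
          ultimately have "- (36 * 2 powr k) * 1 \<le> f (fst x) * \<psi> (snd x)"
          proof (cases "0 \<le> f (fst x)")
            case True
            then have "0 \<le> f (fst x) * \<psi> (snd x)" using \<open>0 \<le> \<psi> (snd x)\<close> by simp
            then show ?thesis by (rule order_trans[rotated]) simp
          next
            case False
            then have "f (fst x) * 1 \<le> f (fst x) * \<psi> (snd x)"
              using \<open>\<psi> (snd x) \<le> 1\<close> by (intro mult_left_mono_neg) auto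
            then show ?thesis using \<open>- (36 * 2 powr k) \<le> f (fst x)\<close> by linarith
          qed
          then show ?thesis using False True by simp
        next
          case nZ: False
          show ?thesis unfolding off(2)[OF nZ] using False nZ by simp
        qed
      qed
    qed
    then show ?thesis using Bb Zb(2) by simp
  qed
  \<comment> \<open>The mass of the small ball is of order \<epsilon>^k s^k, and \<epsilon>^k
    cancels the peak height \<epsilon>^(-k): the gain is independent of \<epsilon>.\<close>
  have "(\<rho> / 2) ^ DIM('a) / C \<le> measure M B"
    unfolding B_def using y \<rho> eps(3) by (intro measure_ball_lower) (auto simp: \<rho>_def)
  then have "a * ((\<rho> / 2) ^ DIM('a) / C) \<le> a * measure M B" using k0 by (intro mult_left_mono) (auto simp: a_def)
  moreover have "a * ((\<rho> / 2) ^ DIM('a) / C) = slab_low C k * s ^ DIM('a)"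
  proof -
    have "(\<rho> / 2) ^ DIM('a) = (\<epsilon> ^ DIM('a)) * s ^ DIM('a) / 2 ^ DIM('a)"
      by (simp add: \<rho>_def power_mult_distrib power_divide)
    also have "\<epsilon> ^ DIM('a) = \<epsilon> powr k" using eps by (simp add: k_def powr_realpow)
    also have "(2::real) ^ DIM('a) = 2 powr k" by (simp add: k_def powr_realpow)
    finally have e: "(\<rho> / 2) ^ DIM('a) = \<epsilon> powr k * s ^ DIM('a) / 2 powr k" .
    have "\<epsilon> powr (- k) * \<epsilon> powr k = 1" unfolding powr_add[symmetric] using eps by simp
    then have "a * ((\<rho> / 2) ^ DIM('a) / C) = k * 2 powr (- k - 1) * (27 / 64) * s ^ DIM('a) / 2 powr k / C"
      unfolding e a_def by (simp add: mult_ac)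
    then show ?thesis by (simp add: slab_low_def powr_minus divide_simps mult_ac)
  qed
  ultimately show ?thesis
    using low vert flux_eq up unfolding k_def[symmetric] slab_up_def slab_kap_def by (simp add: algebra_simps)
qed

end

subsection \<open>Small excess forces a flat boundary\<close>

text \<open>So many disjoint slabs, each with half the mass from \<open>slab_low\<close>, exceed the
  mass C (6 s)^k available in the surrounding ball; the added 1 makes this strict.\<close>

definition slab_num :: "real \<Rightarrow> nat \<Rightarrow> nat" where
  "slab_num C k = nat \<lceil>2 * slab_up (real k) * C * 6 ^ k / slab_low C (real k)\<rceil> + 1"

text \<open>With N = \<open>slab_num\<close>, slabs of half-height \<epsilon> s at spacing 4
  \<epsilon> s fill a gap \<theta> s. The first bound lets the tilt absorb only half of
  \<open>slab_low\<close>; the second contradicts \<open>flux\<close>.\<close>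

definition pos_eta :: "real \<Rightarrow> nat \<Rightarrow> real \<Rightarrow> real" where
  "pos_eta C k \<theta> = (let \<epsilon> = \<theta> / (4 * real (slab_num C k)) in
     min (slab_low C (real k) / (2 * slab_kap (real k) \<epsilon>)) (27 / 64 * (\<epsilon> ^ k / C) / 2))"

lemma half_less_self: "0 < a \<Longrightarrow> a / 2 < (a::real)"
  by simp

lemma slab_low_pos: "0 < C \<Longrightarrow> 0 < k \<Longrightarrow> 0 < slab_low C k"
  by (simp add: slab_low_def)

lemma slab_up_pos: "0 < slab_up k"
  by (simp add: slab_up_def add_pos_pos)

lemma slab_kap_pos: "0 < k \<Longrightarrow> 0 < \<epsilon> \<Longrightarrow> 0 < slab_kap k \<epsilon>"
  by (simp add: slab_kap_def add_pos_pos)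

lemma pos_eta_pos:
  assumes "1 \<le> C" "0 < k" "0 < \<theta>" shows "0 < pos_eta C k \<theta>"
proof -
  have "0 < real (slab_num C k)" by (simp add: slab_num_def)
  then have e: "0 < \<theta> / (4 * real (slab_num C k))" using assms by simp
  then have "0 < slab_kap (real k) (\<theta> / (4 * real (slab_num C k)))" using assms by (intro slab_kap_pos) auto
  then show ?thesis using e assms slab_low_pos[of C "real k"] unfolding pos_eta_def Let_def by simp
qed

lemma frontier_free_dichotomy:
  fixes W E :: "'b::euclidean_space set"
  assumes "convex W" "open W" "W \<inter> frontier E = {}"
  shows "W \<subseteq> interior E \<or> W \<inter> closure E = {}"
proof -
  have "W \<inter> E = {} \<or> W \<subseteq> E"
    using connected_Int_frontier[OF convex_connected[OF assms(1)], of E] assms(3) by blast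
  then show ?thesis
  proof
    assume "W \<inter> E = {}"
    then show ?thesis using open_Int_closure_eq_empty[OF assms(2)] by blast
  next
    assume "W \<subseteq> E"
    then show ?thesis using assms(2) by (simp add: interior_maximal)
  qed
qed

lemma convex_open_box:
  fixes c :: "'a::euclidean_space"
  shows "convex {x::'a \<times> real. norm (fst x - c) < s \<and> a < snd x \<and> snd x < b}"
    and "open {x::'a \<times> real. norm (fst x - c) < s \<and> a < snd x \<and> snd x < b}"
proof -
  have eq: "{x::'a \<times> real. norm (fst x - c) < s \<and> a < snd x \<and> snd x < b} = ball c s \<times> {a<..<b}"
    by (auto simp: dist_norm norm_minus_commute)
  show "convex {x::'a \<times> real. norm (fst x - c) < s \<and> a < snd x \<and> snd x < b}"
    unfolding eq by (intro convex_Times) auto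
  show "open {x::'a \<times> real. norm (fst x - c) < s \<and> a < snd x \<and> snd x < b}"
    unfolding eq by (intro open_Times) auto
qed

lemma cylinder_iff: "y \<in> cylinder x s \<longleftrightarrow> norm (fst y - fst x) < s \<and> \<bar>snd y - snd x\<bar> < s"
  by (auto simp: cylinder_def norm_minus_commute abs_minus_commute)

lemma cylinder_subset_ball6: "0 < s \<Longrightarrow> cylinder x (4 * s) \<subseteq> ball x (6 * s)"
proof
  fix y assume s: "0 < s" and y: "y \<in> cylinder x (4 * s)"
  have "(norm (y - x))\<^sup>2 = (norm (fst y - fst x))\<^sup>2 + (snd y - snd x)\<^sup>2"
    by (simp add: norm_prod_def)
  also have "\<dots> \<le> (4 * s)\<^sup>2 + (4 * s)\<^sup>2"
  proof (rule add_mono)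
    show "(norm (fst y - fst x))\<^sup>2 \<le> (4 * s)\<^sup>2" using y by (intro power_mono) (auto simp: cylinder_iff)
    have "\<bar>snd y - snd x\<bar>\<^sup>2 \<le> (4 * s)\<^sup>2" using y by (intro power_mono) (auto simp: cylinder_iff)
    then show "(snd y - snd x)\<^sup>2 \<le> (4 * s)\<^sup>2" by simp
  qed
  also have "\<dots> < (6 * s)\<^sup>2" using s by (simp add: power_mult_distrib)
  finally have "norm (y - x) < 6 * s" by (rule power2_less_imp_less) (use s in simp)
  then show "y \<in> ball x (6 * s)" by (simp add: dist_norm norm_minus_commute)
qed

context ahlfors
begin

text \<open>Two boundary points with a vertical gap of \<theta> s leave room for N layers between
  them. They cannot all contain boundary, by mass; a layer free of boundary is inside or outside E,
  and then \<open>flux\<close> at the lower or at the upper point is violated.\<close>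

lemma position:
  assumes x: "x \<in> S" and s: "0 < s" "6 * s < r\<^sub>0" and \<theta>: "0 < \<theta>" "\<theta> \<le> 1"
    and kap: "kap (cylinder x (4 * s)) \<le> pos_eta C DIM('a) \<theta> * s ^ DIM('a)"
    and y: "y1 \<in> S \<inter> cylinder x s" "y2 \<in> S \<inter> cylinder x s"
  shows "snd y2 - snd y1 < \<theta> * s"
proof (rule ccontr)
  assume "\<not> ?thesis"
  then have gap: "\<theta> * s \<le> snd y2 - snd y1" by simp
  define k where "k = real DIM('a)"
  have k: "0 < k" by (simp add: k_def)
  have C0: "0 < C" using C by simp
  define N where "N = slab_num C DIM('a)"
  define \<epsilon> where "\<epsilon> = \<theta> / (4 * real N)"
  have N: "0 < N" "2 * slab_up k * C * 6 ^ DIM('a) < slab_low C k * real N"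
  proof -
    show "0 < N" by (simp add: N_def slab_num_def)
    have "2 * slab_up k * C * 6 ^ DIM('a) / slab_low C k < real N"
      unfolding N_def slab_num_def k_def by linarith
    then show "2 * slab_up k * C * 6 ^ DIM('a) < slab_low C k * real N"
      using slab_low_pos[OF C0 k] by (simp add: divide_less_eq mult.commute)
  qed
  have N1: "1 \<le> real N" using N(1) by simp
  have eps: "0 < \<epsilon>" "\<epsilon> \<le> 1 / 4"
  proof -
    show "0 < \<epsilon>" using \<theta> N(1) by (simp add: \<epsilon>_def)
    have "\<theta> / (4 * real N) \<le> 1 / (4 * 1)" using \<theta> N1 by (intro frac_le) auto
    then show "\<epsilon> \<le> 1 / 4" by (simp add: \<epsilon>_def)
  qed
  define \<rho> where "\<rho> = \<epsilon> * s"
  have \<rho>: "0 < \<rho>" "4 * real N * \<rho> = \<theta> * s" "\<rho> \<le> s / 4"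
  proof -
    show "0 < \<rho>" using eps s by (simp add: \<rho>_def)
    show "4 * real N * \<rho> = \<theta> * s" using N(1) by (simp add: \<rho>_def \<epsilon>_def)
    show "\<rho> \<le> s / 4" using mult_right_mono[OF eps(2), of s] s by (simp add: \<rho>_def)
  qed
  have \<rho>r: "\<rho> < r\<^sub>0" using \<rho> s by linarith
  define Z where "Z = cylinder x (4 * s)"
  have Zb: "bounded Z" "Z \<in> sets borel" by (auto simp: Z_def)
  have kap1: "slab_kap k \<epsilon> * kap Z \<le> slab_low C k / 2 * s ^ DIM('a)"
    and kap2: "kap Z < 27 / 64 * (\<rho> ^ DIM('a) / C)"
  proof -
    have kp: "0 < slab_kap k \<epsilon>" by (rule slab_kap_pos[OF k eps(1)])
    have sp: "0 < s ^ DIM('a)" using s by simp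
    have e1: "pos_eta C DIM('a) \<theta> \<le> slab_low C k / (2 * slab_kap k \<epsilon>)"
      and e2: "pos_eta C DIM('a) \<theta> \<le> 27 / 64 * (\<epsilon> ^ DIM('a) / C) / 2"
      by (auto simp: pos_eta_def Let_def \<epsilon>_def N_def k_def)
    have "kap Z \<le> slab_low C k / (2 * slab_kap k \<epsilon>) * s ^ DIM('a)"
      using kap mult_right_mono[OF e1, of "s ^ DIM('a)"] sp by (simp add: Z_def)
    then have "slab_kap k \<epsilon> * kap Z \<le> slab_kap k \<epsilon> * (slab_low C k / (2 * slab_kap k \<epsilon>) * s ^ DIM('a))"
      using kp by (intro mult_left_mono) auto
    then show "slab_kap k \<epsilon> * kap Z \<le> slab_low C k / 2 * s ^ DIM('a)" using kp by simp
    have "kap Z \<le> 27 / 64 * (\<epsilon> ^ DIM('a) / C) / 2 * s ^ DIM('a)"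
      using kap mult_right_mono[OF e2, of "s ^ DIM('a)"] sp by (simp add: Z_def)
    also have "\<dots> = (27 / 64 * (\<rho> ^ DIM('a) / C)) / 2" by (simp add: \<rho>_def power_mult_distrib)
    also have "\<dots> < 27 / 64 * (\<rho> ^ DIM('a) / C)"
    proof -
      have "0 < 27 / 64 * (\<rho> ^ DIM('a) / C)" using \<rho>(1) C0 by simp
      then show ?thesis by (rule half_less_self)
    qed
    finally show "kap Z < 27 / 64 * (\<rho> ^ DIM('a) / C)" .
  qed
  have y1: "y1 \<in> S" "norm (fst y1 - fst x) < s" "\<bar>snd y1 - snd x\<bar> < s" using y by (auto simp: cylinder_iff)
  have y2: "y2 \<in> S" "norm (fst y2 - fst x) < s" "\<bar>snd y2 - snd x\<bar> < s" using y by (auto simp: cylinder_iff)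
  \<comment> \<open>N heights at spacing 4 \<rho>, at least 2 \<rho> away from both points. Slabs of
    half-height \<rho> about points within \<rho> of these heights are disjoint.\<close>
  define \<tau> where "\<tau> j = snd y1 + (4 * real j + 2) * \<rho>" for j :: nat
  have \<tau>: "snd y1 + 2 * \<rho> \<le> \<tau> j" "\<tau> j + 2 * \<rho> \<le> snd y2" if "j < N" for j
  proof -
    show "snd y1 + 2 * \<rho> \<le> \<tau> j" using \<rho>(1) by (simp add: \<tau>_def mult_right_mono)
    have "(4 * real j + 4) * \<rho> \<le> (4 * real N) * \<rho>" using that \<rho>(1) by (intro mult_right_mono) auto
    also have "\<dots> \<le> snd y2 - snd y1" using gap \<rho>(2) by simp
    finally show "\<tau> j + 2 * \<rho> \<le> snd y2" by (simp add: \<tau>_def algebra_simps)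
  qed
  \<comment> \<open>Otherwise every height has a boundary point nearby over the ball of radius 2 s,
    and the N slabs through these points carry too much mass.\<close>
  have "\<exists>j<N. \<forall>y\<in>S. \<not> (norm (fst y - fst x) < 2 * s \<and> \<tau> j - \<rho> < snd y \<and> snd y < \<tau> j + \<rho>)"
  proof (rule ccontr)
    assume "\<not> ?thesis"
    then have "\<forall>j. \<exists>y. j < N \<longrightarrow> y \<in> S \<and> norm (fst y - fst x) < 2 * s \<and> \<tau> j - \<rho> < snd y \<and> snd y < \<tau> j + \<rho>" by blast
    then obtain v where v: "\<And>j. j < N \<Longrightarrow> v j \<in> S \<and> norm (fst (v j) - fst x) < 2 * s \<and> \<tau> j - \<rho> < snd (v j) \<and> snd (v j) < \<tau> j + \<rho>"
      by (elim choice[THEN exE]) blast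
    define B where "B j = {z. norm (fst z - fst (v j)) < s \<and> \<bar>snd z - snd (v j)\<bar> < \<epsilon> * s}" for j
    have openB: "open (B j)" for j unfolding B_def by (intro open_Collect_conj open_Collect_less continuous_intros)
    have BZ: "B j \<subseteq> Z" if j: "j < N" for j
    proof
      fix z assume z: "z \<in> B j"
      have "norm (fst z - fst x) \<le> norm (fst z - fst (v j)) + norm (fst (v j) - fst x)"
        using norm_triangle_ineq[of "fst z - fst (v j)" "fst (v j) - fst x"] by simp
      also have "\<dots> < 4 * s" using z v[OF j] s by (simp add: B_def)
      finally have 1: "norm (fst z - fst x) < 4 * s" .
      have "\<bar>snd z - snd (v j)\<bar> < \<rho>" using z by (simp add: B_def \<rho>_def)
      then have "\<bar>snd z - snd x\<bar> < 4 * s" using v[OF j] \<tau>[OF j] y1(3) y2(3) \<rho>(1,3) by linarith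
      then show "z \<in> Z" using 1 by (simp add: Z_def cylinder_iff)
    qed
    have low: "slab_low C k / 2 * s ^ DIM('a) \<le> slab_up k * measure M (B j)" if j: "j < N" for j
    proof -
      have "slab_low C k * s ^ DIM('a) \<le> slab_up k * measure M (B j) + slab_kap k \<epsilon> * kap (B j)"
        unfolding k_def
      proof (rule slab[OF _ s(1) eps(1) _ _ B_def])
        show "v j \<in> S" using v[OF j] by simp
        show "\<epsilon> \<le> 1" using eps(2) by simp
        show "\<epsilon> * s / 2 < r\<^sub>0" using \<rho>(1) \<rho>r by (simp add: \<rho>_def)
      qed
      also have "slab_kap k \<epsilon> * kap (B j) \<le> slab_kap k \<epsilon> * kap Z"
        using slab_kap_pos[OF k eps(1)] openB by (intro mult_left_mono kap_mono BZ[OF j] Zb) auto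
      also note kap1
      finally show ?thesis by linarith
    qed
    have disj: "disjoint_family_on B {..<N}"
      unfolding disjoint_family_on_def
    proof (intro ballI impI)
      fix i j assume ij: "i \<in> {..<N}" "j \<in> {..<N}" "i \<noteq> j"
      have far: "4 * \<rho> \<le> \<bar>\<tau> i - \<tau> j\<bar>"
      proof -
        have "\<tau> i - \<tau> j = 4 * \<rho> * (real i - real j)" by (simp add: \<tau>_def algebra_simps)
        moreover have "1 \<le> \<bar>real i - real j\<bar>" using ij(3) by linarith
        ultimately show ?thesis using \<rho>(1) by (simp add: abs_mult)
      qed
      show "B i \<inter> B j = {}"
      proof (rule ccontr)
        assume "B i \<inter> B j \<noteq> {}"
        then obtain z where "\<bar>snd z - snd (v i)\<bar> < \<rho>" "\<bar>snd z - snd (v j)\<bar> < \<rho>" by (auto simp: B_def \<rho>_def)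
        then show False using v[of i] v[of j] ij far by auto
      qed
    qed
    have fin: "emeasure M (B j) \<noteq> \<infinity>" if "j < N" for j
      using M_bounded[OF bounded_subset[OF Zb(1) BZ[OF that]]] by simp
    have "real N * (slab_low C k / 2 * s ^ DIM('a)) = (\<Sum>j<N. slab_low C k / 2 * s ^ DIM('a))" by simp
    also have "\<dots> \<le> (\<Sum>j<N. slab_up k * measure M (B j))" by (intro sum_mono low) auto
    also have "\<dots> = slab_up k * (\<Sum>j<N. measure M (B j))" by (simp add: sum_distrib_left)
    also have "(\<Sum>j<N. measure M (B j)) = measure M (\<Union>j<N. B j)"
      using disj openB fin by (intro measure_finite_Union[symmetric]) auto
    also have "\<dots> \<le> measure M (ball x (6 * s))"
    proof (rule measure_mono_fmeasurable)
      show "(\<Union>j<N. B j) \<subseteq> ball x (6 * s)" using BZ cylinder_subset_ball6[OF s(1), of x] by (auto simp: Z_def)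
      show "ball x (6 * s) \<in> fmeasurable M" using M_bounded[of "ball x (6 * s)"] by (intro fmeasurableI) auto
    qed (use openB in auto)
    also have "\<dots> \<le> C * (6 * s) ^ DIM('a)" using x s by (intro measure_ball_upper) auto
    finally have "real N * (slab_low C k / 2 * s ^ DIM('a)) \<le> slab_up k * (C * (6 * s) ^ DIM('a))"
      using slab_up_pos[of k] by (simp add: mult_left_mono)
    then have "(slab_low C k * real N) * s ^ DIM('a) \<le> (2 * slab_up k * C * 6 ^ DIM('a)) * s ^ DIM('a)"
      by (simp add: power_mult_distrib algebra_simps)
    then show False using N(2) s by (simp add: mult_le_cancel_right)
  qed
  then obtain j where j: "j < N" and free: "\<And>y. y \<in> S \<Longrightarrow> \<not> (norm (fst y - fst x) < 2 * s \<and> \<tau> j - \<rho> < snd y \<and> snd y < \<tau> j + \<rho>)"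
    by blast
  define W where "W = {z. norm (fst z - fst x) < 2 * s \<and> \<tau> j - \<rho> < snd z \<and> snd z < \<tau> j + \<rho>}"
  have W: "W \<subseteq> interior E \<or> W \<inter> closure E = {}"
    unfolding W_def by (rule frontier_free_dichotomy[OF convex_open_box]) (use free in auto)
  have near: "norm (fst z - fst x) < 2 * s" if "norm (fst z - fst v) < s" "norm (fst v - fst x) < s" for z v :: "'a \<times> real"
    using norm_triangle_ineq[of "fst z - fst v" "fst v - fst x"] that by simp
  show False
    using W
  proof
    \<comment> \<open>An empty layer below y2: E is absent where the test function rises.\<close>
    assume W: "W \<inter> closure E = {}"
    have "27 / 64 * (\<rho> ^ DIM('a) / C) \<le> kap Z"
    proof (rule flux[where a=s and ?t1.0="\<tau> j - \<rho>" and t1'="\<tau> j + \<rho>" and t2'="snd y2 + s" and ?t2.0="snd y2 + 2 * s" and y=y2])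
      show "z \<in> Z" if "norm (fst z - fst y2) < s" "\<tau> j - \<rho> < snd z" "snd z < snd y2 + 2 * s" for z
        using near[OF that(1) y2(2)] that \<tau>[OF j] y1(3) y2(3) \<rho> s by (auto simp: Z_def cylinder_iff)
      have "z \<notin> interior E" if "norm (fst z - fst y2) < s" "\<tau> j - \<rho> < snd z" "snd z < \<tau> j + \<rho>" for z
      proof -
        have "z \<in> W" using near[OF that(1) y2(2)] that by (simp add: W_def)
        then show ?thesis using W closure_subset[of E] interior_subset[of E] by blast
      qed
      then show "(\<forall>z. norm (fst z - fst y2) < s \<and> \<tau> j - \<rho> < snd z \<and> snd z < \<tau> j + \<rho> \<longrightarrow> z \<notin> interior E) \<or>
        (\<forall>z. norm (fst z - fst y2) < s \<and> snd y2 + s < snd z \<and> snd z < snd y2 + 2 * s \<longrightarrow> z \<in> interior E)" by blast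
    qed (use y2 s \<rho> \<rho>r \<tau>[OF j] Zb in auto)
    then show False using kap2 by simp
  next
    \<comment> \<open>A full layer above y1: E fills the region where the test function
      falls.\<close>
    assume W: "W \<subseteq> interior E"
    have "27 / 64 * (\<rho> ^ DIM('a) / C) \<le> kap Z"
    proof (rule flux[where a=s and ?t1.0="snd y1 - 2 * s" and t1'="snd y1 - s" and t2'="\<tau> j - \<rho>" and ?t2.0="\<tau> j + \<rho>" and y=y1])
      show "z \<in> Z" if "norm (fst z - fst y1) < s" "snd y1 - 2 * s < snd z" "snd z < \<tau> j + \<rho>" for z
        using near[OF that(1) y1(2)] that \<tau>[OF j] y1(3) y2(3) \<rho> s by (auto simp: Z_def cylinder_iff)
      have "z \<in> interior E" if "norm (fst z - fst y1) < s" "\<tau> j - \<rho> < snd z" "snd z < \<tau> j + \<rho>" for z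
        using W near[OF that(1) y1(2)] that by (auto simp: W_def)
      then show "(\<forall>z. norm (fst z - fst y1) < s \<and> snd y1 - 2 * s < snd z \<and> snd z < snd y1 - s \<longrightarrow> z \<notin> interior E) \<or>
        (\<forall>z. norm (fst z - fst y1) < s \<and> \<tau> j - \<rho> < snd z \<and> snd z < \<tau> j + \<rho> \<longrightarrow> z \<in> interior E)" by blast
    qed (use y1 s \<rho> \<rho>r \<tau>[OF j] Zb in auto)
    then show False using kap2 by simp
  qed
qed

text \<open>By \<open>position\<close> all boundary points near x have almost its height, so the
  boxes \<open>W1\<close> above and \<open>W2\<close> below meet no boundary and are each inside or
  outside E. A wrong choice in either contradicts \<open>flux\<close> at x.\<close>

lemma sides:
  assumes x: "x \<in> S" and s: "0 < s" "6 * s < r\<^sub>0" and \<theta>: "0 < \<theta>" "\<theta> < 1"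
    and kap: "kap (cylinder x (4 * s)) \<le> pos_eta C DIM('a) \<theta> * s ^ DIM('a)"
  shows "\<And>z. norm (fst z - fst x) < s \<Longrightarrow> \<theta> * s < snd z - snd x \<Longrightarrow> snd z - snd x < s \<Longrightarrow> z \<notin> closure E"
    and "\<And>z. norm (fst z - fst x) < s \<Longrightarrow> - s < snd z - snd x \<Longrightarrow> snd z - snd x < - (\<theta> * s) \<Longrightarrow> z \<in> interior E"
proof -
  have xx: "x \<in> S \<inter> cylinder x s" using x s by (simp add: cylinder_iff)
  have flat: "\<bar>snd y - snd x\<bar> < \<theta> * s" if "y \<in> S" "y \<in> cylinder x s" for y
    using position[OF x s \<theta>(1) _ kap xx, of y] position[OF x s \<theta>(1) _ kap _ xx, of y] that \<theta> by auto
  have C0: "0 < C" using C by simp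
  define Z where "Z = cylinder x (4 * s)"
  have Zb: "bounded Z" "Z \<in> sets borel" by (auto simp: Z_def)
  define N where "N = slab_num C DIM('a)"
  define b where "b = \<theta> / (4 * real N) * s"
  have N1: "1 \<le> real N" by (simp add: N_def slab_num_def)
  have \<theta>s: "0 < \<theta> * s" "\<theta> * s < s" using \<theta> s by auto
  have b: "0 < b" "b \<le> \<theta> * s / 4"
  proof -
    show "0 < b" using \<theta> s N1 by (simp add: b_def)
    have "\<theta> / (4 * real N) \<le> \<theta> / (4 * 1)" using \<theta> N1 by (intro divide_left_mono) auto
    then show "b \<le> \<theta> * s / 4" using s mult_right_mono[of "\<theta> / (4 * real N)" "\<theta> / 4" s] by (simp add: b_def)
  qed
  have kap2: "kap Z < 27 / 64 * (b ^ DIM('a) / C)"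
  proof -
    have e2: "pos_eta C DIM('a) \<theta> \<le> 27 / 64 * ((\<theta> / (4 * real N)) ^ DIM('a) / C) / 2"
      by (auto simp: pos_eta_def Let_def N_def)
    have "kap Z \<le> 27 / 64 * ((\<theta> / (4 * real N)) ^ DIM('a) / C) / 2 * s ^ DIM('a)"
      using kap mult_right_mono[OF e2, of "s ^ DIM('a)"] s by (simp add: Z_def)
    also have "\<dots> = (27 / 64 * (b ^ DIM('a) / C)) / 2" unfolding b_def power_mult_distrib by simp
    also have "\<dots> < 27 / 64 * (b ^ DIM('a) / C)"
    proof -
      have "0 < 27 / 64 * (b ^ DIM('a) / C)" using b C0 by simp
      then show ?thesis by (rule half_less_self)
    qed
    finally show ?thesis .
  qed
  define W1 where "W1 = {z. norm (fst z - fst x) < s \<and> snd x + \<theta> * s < snd z \<and> snd z < snd x + s}"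
  define W2 where "W2 = {z. norm (fst z - fst x) < s \<and> snd x - s < snd z \<and> snd z < snd x - \<theta> * s}"
  have W1: "W1 \<subseteq> interior E \<or> W1 \<inter> closure E = {}"
    unfolding W1_def by (rule frontier_free_dichotomy[OF convex_open_box]) (use flat \<theta>s in \<open>force simp: cylinder_iff\<close>)
  have W2: "W2 \<subseteq> interior E \<or> W2 \<inter> closure E = {}"
    unfolding W2_def by (rule frontier_free_dichotomy[OF convex_open_box]) (use flat \<theta>s in \<open>force simp: cylinder_iff\<close>)
  have "W1 \<inter> closure E = {}"
  proof (rule ccontr)
    assume "W1 \<inter> closure E \<noteq> {}"
    then have W: "W1 \<subseteq> interior E" using W1 by blast
    have "27 / 64 * (b ^ DIM('a) / C) \<le> kap Z"
    proof (rule flux[where a=s and ?t1.0="snd x - 2 * s" and t1'="snd x - s" and t2'="snd x + \<theta> * s" and ?t2.0="snd x + s" and y=x])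
      show "z \<in> Z" if "norm (fst z - fst x) < s" "snd x - 2 * s < snd z" "snd z < snd x + s" for z
        using that s by (auto simp: Z_def cylinder_iff)
      have "z \<in> interior E" if "norm (fst z - fst x) < s" "snd x + \<theta> * s < snd z" "snd z < snd x + s" for z
      proof -
        have "z \<in> W1" using that by (simp add: W1_def)
        then show ?thesis using W by blast
      qed
      then show "(\<forall>z. norm (fst z - fst x) < s \<and> snd x - 2 * s < snd z \<and> snd z < snd x - s \<longrightarrow> z \<notin> interior E) \<or>
        (\<forall>z. norm (fst z - fst x) < s \<and> snd x + \<theta> * s < snd z \<and> snd z < snd x + s \<longrightarrow> z \<in> interior E)"
        by blast
    qed (use x s \<theta>s b Zb in auto)
    then show False using kap2 by simp
  qed
  then show "\<And>z. norm (fst z - fst x) < s \<Longrightarrow> \<theta> * s < snd z - snd x \<Longrightarrow> snd z - snd x < s \<Longrightarrow> z \<notin> closure E"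
    by (auto simp: W1_def)
  have "W2 \<subseteq> interior E"
  proof (rule ccontr)
    assume "\<not> W2 \<subseteq> interior E"
    then have W: "W2 \<inter> closure E = {}" using W2 by blast
    have "27 / 64 * (b ^ DIM('a) / C) \<le> kap Z"
    proof (rule flux[where a=s and ?t1.0="snd x - s" and t1'="snd x - \<theta> * s" and t2'="snd x + s" and ?t2.0="snd x + 2 * s" and y=x])
      show "z \<in> Z" if "norm (fst z - fst x) < s" "snd x - s < snd z" "snd z < snd x + 2 * s" for z
        using that s by (auto simp: Z_def cylinder_iff)
      have "z \<notin> interior E" if "norm (fst z - fst x) < s" "snd x - s < snd z" "snd z < snd x - \<theta> * s" for z
      proof -
        have "z \<in> W2" using that by (simp add: W2_def)
        then show ?thesis using W closure_subset[of E] interior_subset[of E] by blast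
      qed
      then show "(\<forall>z. norm (fst z - fst x) < s \<and> snd x - s < snd z \<and> snd z < snd x - \<theta> * s \<longrightarrow> z \<notin> interior E) \<or>
        (\<forall>z. norm (fst z - fst x) < s \<and> snd x + s < snd z \<and> snd z < snd x + 2 * s \<longrightarrow> z \<in> interior E)" by blast
    qed (use x s \<theta>s b Zb in auto)
    then show False using kap2 by simp
  qed
  then show "\<And>z. norm (fst z - fst x) < s \<Longrightarrow> - s < snd z - snd x \<Longrightarrow> snd z - snd x < - (\<theta> * s) \<Longrightarrow> z \<in> interior E"
    by (auto simp: W2_def)
qed

end

section \<open>The Lipschitz approximation\<close>

subsection \<open>Lipschitz graphs\<close>

lemma McShane:
  fixes v :: "'b::real_normed_vector \<Rightarrow> real"
  assumes P: "P \<noteq> {}" and L: "0 \<le> L" and v: "\<And>y y'. y \<in> P \<Longrightarrow> y' \<in> P \<Longrightarrow> \<bar>v y - v y'\<bar> \<le> L * norm (y - y')"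
  shows "L-lipschitz_on UNIV (\<lambda>z. INF y\<in>P. v y + L * norm (z - y))"
    and "\<And>z. z \<in> P \<Longrightarrow> (INF y\<in>P. v y + L * norm (z - y)) = v z"
    and "\<And>y z. y \<in> P \<Longrightarrow> (INF y\<in>P. v y + L * norm (z - y)) \<le> v y + L * norm (z - y)"
proof -
  define I where "I z = (INF y\<in>P. v y + L * norm (z - y))" for z
  obtain y0 where y0: "y0 \<in> P" using P by blast
  have bdd: "bdd_below ((\<lambda>y. v y + L * norm (z - y)) ` P)" for z
  proof (rule bdd_belowI2)
    fix y assume y: "y \<in> P"
    have "L * norm (y0 - y) \<le> L * norm (z - y0) + L * norm (z - y)"
      using L norm_triangle_ineq4[of "z - y" "z - y0"] mult_left_mono[of "norm (y0 - y)" "norm (z - y0) + norm (z - y)" L]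
      by (simp add: norm_minus_commute algebra_simps)
    then show "v y0 - L * norm (z - y0) \<le> v y + L * norm (z - y)" using v[OF y0 y] by linarith
  qed
  show low: "I z \<le> v y + L * norm (z - y)" if "y \<in> P" for y z
    unfolding I_def by (rule cINF_lower[OF bdd that])
  have step: "I z \<le> I z' + L * norm (z - z')" for z z'
  proof -
    have "I z - L * norm (z - z') \<le> I z'"
      unfolding I_def[of z']
    proof (rule cINF_greatest[OF P])
      fix y assume y: "y \<in> P"
      have "L * norm (z - y) \<le> L * norm (z - z') + L * norm (z' - y)"
        using L norm_triangle_ineq[of "z - z'" "z' - y"] mult_left_mono[of "norm (z - y)" "norm (z - z') + norm (z' - y)" L]
        by (simp add: algebra_simps)
      then show "I z - L * norm (z - z') \<le> v y + L * norm (z' - y)" using low[OF y, of z] by linarith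
    qed
    then show ?thesis by linarith
  qed
  show "L-lipschitz_on UNIV I"
  proof (rule lipschitz_onI[OF _ L])
    fix z z'
    show "dist (I z) (I z') \<le> L * dist z z'"
      using step[of z z'] step[of z' z] by (simp add: dist_norm norm_minus_commute abs_le_iff)
  qed
  show "I z = v z" if "z \<in> P" for z
  proof (rule antisym)
    show "I z \<le> v z" using low[OF that, of z] by simp
    show "v z \<le> I z"
      unfolding I_def
    proof (rule cINF_greatest[OF P])
      fix y assume "y \<in> P"
      then show "v z \<le> v y + L * norm (z - y)" using v[OF that, of y] by linarith
    qed
  qed
qed

lemma McShane_upper:
  fixes v :: "'b::real_normed_vector \<Rightarrow> real"
  assumes P: "P \<noteq> {}" and L: "0 \<le> L" and v: "\<And>y y'. y \<in> P \<Longrightarrow> y' \<in> P \<Longrightarrow> \<bar>v y - v y'\<bar> \<le> L * norm (y - y')"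
  shows "L-lipschitz_on UNIV (\<lambda>z. SUP y\<in>P. v y - L * norm (z - y))"
    and "\<And>z. z \<in> P \<Longrightarrow> (SUP y\<in>P. v y - L * norm (z - y)) = v z"
proof -
  have v': "\<bar>- v y - - v y'\<bar> \<le> L * norm (y - y')" if "y \<in> P" "y' \<in> P" for y y' using v[OF that] by simp
  have eq: "(SUP y\<in>P. v y - L * norm (z - y)) = - (INF y\<in>P. - v y + L * norm (z - y))" for z
  proof -
    have "Inf (uminus ` ((\<lambda>y. v y - L * norm (z - y)) ` P)) = - Sup ((\<lambda>y. v y - L * norm (z - y)) ` P)"
      unfolding Inf_real_def image_image by simp
    then show ?thesis by (simp add: image_image algebra_simps)
  qed
  show "L-lipschitz_on UNIV (\<lambda>z. SUP y\<in>P. v y - L * norm (z - y))"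
    unfolding eq using McShane(1)[of P L "\<lambda>y. - v y", OF P L v'] by simp
  show "(SUP y\<in>P. v y - L * norm (z - y)) = v z" if "z \<in> P" for z
    unfolding eq using McShane(2)[of P L "\<lambda>y. - v y", OF P L v' that] by simp
qed

text \<open>A Vitali family of tiny disjoint balls inside A is used: the image of a 5-fold enlarged
  ball of radius \<rho> has diameter at most 20 \<rho>, hence weight at most 10^k times the volume
  of the original ball.\<close>

lemma hausdorff_graph_le:
  fixes G :: "'a::euclidean_space \<Rightarrow> 'b::metric_space"
  assumes A: "open A" and G: "\<And>z z'. dist (G z) (G z') \<le> 2 * dist z z'"
  shows "hausdorff DIM('a) (G ` A) \<le> ennreal (10 ^ DIM('a)) * emeasure lborel A"
proof (rule hausdorff_le)
  fix \<eta> :: real assume \<eta>: "0 < \<eta>"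
  have "\<exists>\<rho>. 0 < \<rho> \<and> \<rho> < \<eta> / 20 \<and> ball x \<rho> \<subseteq> A" if x: "x \<in> A" for x
  proof -
    obtain d where d: "0 < d" "ball x d \<subseteq> A" using A x open_contains_ball by blast
    define \<rho> where "\<rho> = min d (\<eta> / 40)"
    have "ball x \<rho> \<subseteq> ball x d" by (rule subset_ball) (simp add: \<rho>_def)
    then show ?thesis using d \<eta> by (intro exI[of _ \<rho>]) (auto simp: \<rho>_def)
  qed
  then obtain \<rho> where \<rho>: "\<And>x. x \<in> A \<Longrightarrow> 0 < \<rho> x \<and> \<rho> x < \<eta> / 20 \<and> ball x (\<rho> x) \<subseteq> A" by metis
  obtain c I where c: "\<And>n. n \<in> (I::nat set) \<Longrightarrow> c n \<in> A" "disjoint_family_on (\<lambda>n. ball (c n) (\<rho> (c n))) I"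
    "A \<subseteq> (\<Union>n\<in>I. ball (c n) (5 * \<rho> (c n)))"
  proof (rule Vitali_balls_sequence[where S=A and K=A and a="\<lambda>x. x" and r=\<rho> and B="\<eta> / 20"])
    show "A \<subseteq> (\<Union>i\<in>A. ball i (\<rho> i))" using \<rho> by force
  qed (use \<rho> in \<open>auto intro: less_imp_le\<close>)
  define F where "F n = (if n \<in> I then G ` ball (c n) (5 * \<rho> (c n)) else {})" for n
  define B where "B n = (if n \<in> I then ball (c n) (\<rho> (c n)) else {})" for n
  have diam: "bounded (F n) \<and> diameter (F n) \<le> 20 * \<rho> (c n)" if n: "n \<in> I" for n
  proof -
    have p: "0 < \<rho> (c n)" using \<rho>[OF c(1)[OF n]] by simp
    have d: "dist x y \<le> 20 * \<rho> (c n)" if xy: "x \<in> F n" "y \<in> F n" for x y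
    proof -
      obtain a b where ab: "x = G a" "y = G b" "a \<in> ball (c n) (5 * \<rho> (c n))" "b \<in> ball (c n) (5 * \<rho> (c n))"
        using xy n unfolding F_def by auto
      have "dist a b \<le> dist (c n) a + dist (c n) b" by (metis dist_commute dist_triangle)
      then have "dist a b \<le> 10 * \<rho> (c n)" using ab(3,4) by simp
      then show ?thesis using G[of a b] by (simp add: ab(1,2))
    qed
    have "F n \<noteq> {}" using n p by (simp add: F_def)
    moreover from d have "bounded (F n)" using bounded_any_center[of "F n"] unfolding bounded_def by blast
    moreover have "diameter (F n) \<le> 20 * \<rho> (c n)"
      using \<open>F n \<noteq> {}\<close> d unfolding diameter_def by (auto intro!: cSUP_least)
    ultimately show ?thesis by blast
  qed
  have "fine_cover \<eta> (G ` A) F"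
    unfolding fine_cover_def
  proof (intro conjI allI)
    show "G ` A \<subseteq> (\<Union>n. F n)"
    proof
      fix x assume "x \<in> G ` A"
      then obtain a n where "x = G a" "n \<in> I" "a \<in> ball (c n) (5 * \<rho> (c n))" using c(3) by blast
      then show "x \<in> (\<Union>n. F n)" by (intro UN_I[of n]) (auto simp: F_def)
    qed
    show "bounded (F n)" for n using diam[of n] by (cases "n \<in> I") (auto simp: F_def)
    show "diameter (F n) < \<eta>" for n
      using diam[of n] \<rho>[OF c(1)[of n]] \<eta> by (cases "n \<in> I") (auto simp: F_def)
  qed
  then have "hausdorff_pre DIM('a) \<eta> (G ` A) \<le> (\<Sum>n. hausdorff_weight DIM('a) (F n))" by (rule hausdorff_pre_le)
  also have "\<dots> \<le> (\<Sum>n. ennreal (10 ^ DIM('a)) * emeasure lborel (B n))"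
  proof (intro suminf_le)
    fix n
    show "hausdorff_weight DIM('a) (F n) \<le> ennreal (10 ^ DIM('a)) * emeasure lborel (B n)"
    proof (cases "n \<in> I")
      case True
      have p: "0 < \<rho> (c n)" using \<rho>[OF c(1)[OF True]] by simp
      have "hausdorff_weight DIM('a) (F n) \<le> ennreal (unit_ball_vol (real DIM('a)) * (10 * \<rho> (c n)) ^ DIM('a))"
      proof -
        have "(diameter (F n) / 2) ^ DIM('a) \<le> (10 * \<rho> (c n)) ^ DIM('a)"
          using diam[OF True] diameter_ge_0[of "F n"] by (intro power_mono) auto
        then have "unit_ball_vol (real DIM('a)) * (diameter (F n) / 2) ^ DIM('a) \<le> unit_ball_vol (real DIM('a)) * (10 * \<rho> (c n)) ^ DIM('a)"
          by (intro mult_left_mono) auto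
        then show ?thesis unfolding hausdorff_weight_def by (auto intro: ennreal_leI)
      qed
      also have "\<dots> = ennreal (10 ^ DIM('a)) * emeasure lborel (B n)"
        using True p by (simp add: B_def emeasure_ball ennreal_mult[symmetric] power_mult_distrib mult_ac)
      finally show ?thesis .
    qed (simp add: F_def hausdorff_weight_def)
  qed auto
  also have "\<dots> = ennreal (10 ^ DIM('a)) * (\<Sum>n. emeasure lborel (B n))" by simp
  also have "(\<Sum>n. emeasure lborel (B n)) = emeasure lborel (\<Union>n. B n)"
    using c(2) by (intro suminf_emeasure) (auto simp: B_def disjoint_family_on_def)
  also have "ennreal (10 ^ DIM('a)) * \<dots> \<le> ennreal (10 ^ DIM('a)) * emeasure lborel A"
  proof -
    have "B n \<subseteq> A" for n using \<rho>[OF c(1)[of n]] by (auto simp: B_def)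
    then show ?thesis using A by (intro mult_left_mono emeasure_mono) auto
  qed
  finally show "hausdorff_pre DIM('a) \<eta> (G ` A) \<le> ennreal (10 ^ DIM('a)) * emeasure lborel A" .
qed

subsection \<open>Good and bad points\<close>

text \<open>The divisor is MH_const 4^k, written out: excess below this value in the cylinder of
  radius 4 s makes the tilt small enough for \<open>position\<close> at scale s with \<theta> =
  1/2.\<close>

definition good_delta :: "real \<Rightarrow> nat \<Rightarrow> real" where
  "good_delta C k = pos_eta C k (1 / 2) / (C * 4 ^ k / unit_ball_vol (real k) * 4 ^ k)"

text \<open>The total excess e (13 r)^k is divided among bad cylinders whose own excess is at least
  half of \<open>good_delta\<close>.\<close>

definition shadow_const :: "real \<Rightarrow> nat \<Rightarrow> real" where
  "shadow_const C k = 2 * 13 ^ k / good_delta C k"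

text \<open>The bound 1 is for taking roots of the excess; the entry with 40^k keeps the bad radii
  below r/40 and the shadow smaller than D; the last entry allows \<open>position\<close> at x_0 and
  scale r.\<close>

definition small_eps :: "real \<Rightarrow> nat \<Rightarrow> real" where
  "small_eps C k = min (min 1 (inverse (2 * shadow_const C k * 40 ^ k)))
     (pos_eta C k (1 / 2) / (C * 4 ^ k / unit_ball_vol (real k) * 13 ^ k))"

lemma const_pos:
  assumes "1 \<le> C" "0 < k"
  shows "0 < good_delta C k" "0 < shadow_const C k" "0 < small_eps C k"
proof -
  have u: "0 < unit_ball_vol (real k)" by simp
  show 1: "0 < good_delta C k" using assms u pos_eta_pos[of C k "1/2"] by (simp add: good_delta_def)
  then show 2: "0 < shadow_const C k" by (simp add: shadow_const_def)
  then show "0 < small_eps C k" using assms u pos_eta_pos[of C k "1/2"] by (simp add: small_eps_def)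
qed

locale small_excess = ahlfors E C "13 * r" for E :: "('a::euclidean_space \<times> real) set" and C r +
  fixes x\<^sub>0 :: "'a \<times> real"
  assumes x0: "x\<^sub>0 \<in> frontier E" and small: "excess E x\<^sub>0 (13 * r) \<le> ennreal (small_eps C DIM('a))"
begin

definition gd :: real where "gd = good_delta C DIM('a)"

definition e :: real where "e = enn2real (excess E x\<^sub>0 (13 * r))"

definition MM :: "('a \<times> real) set" where "MM = cylinder x\<^sub>0 r \<inter> S"

definition M0 :: "('a \<times> real) set" where
  "M0 = {y \<in> MM. (SUP s \<in> {0<..<8 * r}. excess E y s) < ennreal gd}"

definition P :: "'a set" where "P = (\<lambda>y. fst (y - x\<^sub>0)) ` M0"

text \<open>The numerator of the excess as a set function; it is monotone, and superadditive on
  disjoint sets.\<close>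

definition tiltH :: "('a \<times> real) set \<Rightarrow> ennreal" where
  "tiltH X = (\<integral>\<^sup>+ y \<in> X \<inter> reduced_boundary E.
        ennreal ((norm (outer_normal E y - (0, 1)))\<^sup>2 / 2) \<partial>hausdorff_borel DIM('a))"

lemma r: "0 < r" using r0 by simp

lemma DIM_nat_pos: "0 < DIM('a)" by simp

lemmas kpos = const_pos[OF C DIM_nat_pos, folded gd_def]

lemma e_nonneg: "0 \<le> e" by (simp add: e_def)

lemma excess_e: "excess E x\<^sub>0 (13 * r) = ennreal e"
proof -
  have "excess E x\<^sub>0 (13 * r) \<noteq> top"
  proof
    assume "excess E x\<^sub>0 (13 * r) = top"
    with small show False by (simp add: top_unique)
  qed
  then show ?thesis by (simp add: e_def ennreal_enn2real_if)
qed

lemma e_small: "e \<le> small_eps C DIM('a)"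
  using small kpos(3) by (simp add: excess_e)

lemma excess_mult: "0 < s \<Longrightarrow> ennreal (s ^ DIM('a)) * excess E x s = tiltH (cylinder x s)"
  using ennreal_mult_divide_eq[of "ennreal (s ^ DIM('a))" "tiltH (cylinder x s)"]
  by (simp add: excess_def tiltH_def ennreal_times_divide mult.commute)

lemma tiltH_mono: "X \<subseteq> Y \<Longrightarrow> tiltH X \<le> tiltH Y"
  unfolding tiltH_def by (intro nn_integral_mono) (auto simp: indicator_def)

lemma tiltH_big: "tiltH (cylinder x\<^sub>0 (13 * r)) = ennreal (e * (13 * r) ^ DIM('a))"
proof -
  have "tiltH (cylinder x\<^sub>0 (13 * r)) = ennreal ((13 * r) ^ DIM('a)) * ennreal e"
    using excess_mult[of "13 * r" x\<^sub>0] r unfolding excess_e by simp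
  also have "\<dots> = ennreal (e * (13 * r) ^ DIM('a))"
    unfolding mult.commute[of "ennreal ((13 * r) ^ DIM('a))"] using e_nonneg r by (intro ennreal_mult[symmetric]) auto
  finally show ?thesis .
qed

lemma kap_big: "kap (cylinder x\<^sub>0 (13 * r)) \<le> MH_const * (13 * r) ^ DIM('a) * e"
proof -
  have "ennreal (kap (cylinder x\<^sub>0 (13 * r))) \<le> ennreal (MH_const * (13 * r) ^ DIM('a) * e)"
    using kap_le_excess[of "13 * r" x\<^sub>0] r e_nonneg MH_const_pos by (simp add: excess_e ennreal_mult)
  then show ?thesis using r e_nonneg MH_const_pos by (subst (asm) ennreal_le_iff) auto
qed

lemma cylinder_mono: "norm (fst y - fst x) + s \<le> t \<Longrightarrow> \<bar>snd y - snd x\<bar> + s \<le> t \<Longrightarrow> cylinder y s \<subseteq> cylinder x t"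
proof
  fix z assume a: "norm (fst y - fst x) + s \<le> t" "\<bar>snd y - snd x\<bar> + s \<le> t" and z: "z \<in> cylinder y s"
  have "norm (fst z - fst x) \<le> norm (fst z - fst y) + norm (fst y - fst x)"
    using norm_triangle_ineq[of "fst z - fst y" "fst y - fst x"] by simp
  then show "z \<in> cylinder x t" using z a by (auto simp: cylinder_iff)
qed

text \<open>\<open>position\<close> at the centre y applies at every scale s between the larger
  coordinate distance d and 2 r, since 4 s < 8 r is covered by the goodness of y and 6 s < 13 r by
  the regularity. Letting s decrease to d gives vertical distance at most d/2.\<close>

lemma cone:
  assumes x: "x \<in> MM" and y: "y \<in> M0"
  shows "\<bar>snd x - snd y\<bar> \<le> 1 / 2 * norm (fst x - fst y)"
proof -
  have yS: "y \<in> S" "y \<in> cylinder x\<^sub>0 r" and xS: "x \<in> S" "x \<in> cylinder x\<^sub>0 r" using x y by (auto simp: M0_def MM_def)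
  define d where "d = max (norm (fst x - fst y)) \<bar>snd x - snd y\<bar>"
  have d: "d < 2 * r"
  proof -
    have "norm (fst x - fst y) \<le> norm (fst x - fst x\<^sub>0) + norm (fst y - fst x\<^sub>0)"
      using norm_triangle_ineq4[of "fst x - fst x\<^sub>0" "fst y - fst x\<^sub>0"] by simp
    then show ?thesis using yS(2) xS(2) by (auto simp: d_def cylinder_iff)
  qed
  have "\<bar>snd x - snd y\<bar> < 1 / 2 * s" if s: "d < s" "s < 2 * r" for s
  proof -
    have "0 \<le> d" by (simp add: d_def le_max_iff_disj)
    then have s0: "0 < s" using s(1) by linarith
    have "excess E y (4 * s) \<le> ennreal gd"
    proof -
      have "excess E y (4 * s) \<le> (SUP s \<in> {0<..<8 * r}. excess E y s)" using s s0 by (intro SUP_upper) auto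
      also have "\<dots> < ennreal gd" using y by (simp add: M0_def)
      finally show ?thesis by simp
    qed
    then have "ennreal (kap (cylinder y (4 * s))) \<le> ennreal (MH_const * (4 * s) ^ DIM('a)) * ennreal gd"
      using kap_le_excess[of "4 * s" y] s0 by (meson mult_left_mono order_trans zero_le mult_pos_pos zero_less_numeral)
    then have "kap (cylinder y (4 * s)) \<le> MH_const * (4 * s) ^ DIM('a) * gd"
      using s0 MH_const_pos kpos(1) by (subst (asm) ennreal_mult[symmetric], simp, simp, subst (asm) ennreal_le_iff) auto
    also have "\<dots> = pos_eta C DIM('a) (1 / 2) * s ^ DIM('a)"
      using MH_const_pos by (simp add: gd_def good_delta_def MH_const_def[symmetric] power_mult_distrib)
    finally have kap: "kap (cylinder y (4 * s)) \<le> pos_eta C DIM('a) (1 / 2) * s ^ DIM('a)" .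
    have in1: "y \<in> S \<inter> cylinder y s" and in2: "x \<in> S \<inter> cylinder y s"
      using yS xS s s0 by (auto simp: cylinder_iff d_def)
    show ?thesis
    proof -
      have "6 * s < 13 * r" using s s0 r by linarith
      then have "snd x - snd y < 1 / 2 * s" "snd y - snd x < 1 / 2 * s"
        using position[OF yS(1) s0 _ _ _ kap in1 in2] position[OF yS(1) s0 _ _ _ kap in2 in1] by simp_all
      then show ?thesis by linarith
    qed
  qed
  then have "\<bar>snd x - snd y\<bar> \<le> 1 / 2 * d"
  proof -
    assume *: "\<And>s. d < s \<Longrightarrow> s < 2 * r \<Longrightarrow> \<bar>snd x - snd y\<bar> < 1 / 2 * s"
    have "2 * \<bar>snd x - snd y\<bar> \<le> d"
    proof (rule dense_ge_bounded[OF d])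
      fix s assume "d < s" "s < 2 * r"
      then show "2 * \<bar>snd x - snd y\<bar> \<le> s" using *[of s] by simp
    qed
    then show ?thesis by simp
  qed
  \<comment> \<open>If the maximum d is the vertical distance, it is at most half of itself and
    hence 0.\<close>
  then show ?thesis by (auto simp: d_def max_def split: if_splits)
qed

text \<open>Every bad point is the centre of a small cylinder with excess at least \<open>gd/2\<close>.\<close>

lemma bad_cover:
  "\<exists>c s I. (\<forall>n\<in>(I::nat set). c n \<in> MM \<and> 0 < s n \<and> s n < r / 40) \<and>
    MM - M0 \<subseteq> (\<Union>n\<in>I. ball (c n) (10 * s n)) \<and>
    (\<Sum>n. if n \<in> I then ennreal (s n ^ DIM('a)) else 0) \<le> ennreal (shadow_const C DIM('a) * e * r ^ DIM('a))"
proof -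
  have d0: "0 < gd" by (rule kpos(1))
  have "\<exists>s. 0 < s \<and> s < r / 40 \<and> ennreal (s ^ DIM('a)) * ennreal (gd / 2) \<le> tiltH (cylinder y s)" if y: "y \<in> MM - M0" for y
  proof -
    have yc: "y \<in> cylinder x\<^sub>0 r" using y by (auto simp: MM_def)
    have "ennreal (gd / 2) < ennreal gd" using d0 by (simp add: ennreal_less_iff)
    also have "\<dots> \<le> (SUP s \<in> {0<..<8 * r}. excess E y s)" using y by (auto simp: M0_def not_less)
    finally obtain s where s: "0 < s" "s < 8 * r" "ennreal (gd / 2) < excess E y s"
      unfolding less_SUP_iff by auto
    have low: "ennreal (s ^ DIM('a)) * ennreal (gd / 2) \<le> tiltH (cylinder y s)"
      using s by (subst excess_mult[symmetric]) (auto intro!: mult_left_mono)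
    also have "\<dots> \<le> tiltH (cylinder x\<^sub>0 (13 * r))"
      using yc s r by (intro tiltH_mono cylinder_mono) (auto simp: cylinder_iff)
    also have "\<dots> = ennreal (e * (13 * r) ^ DIM('a))" by (rule tiltH_big)
    finally have le: "s ^ DIM('a) * (gd / 2) \<le> e * (13 * r) ^ DIM('a)"
      using s d0 e_nonneg r by (simp add: ennreal_mult[symmetric])
    \<comment> \<open>A larger radius would carry more excess than the entry of
      \<open>small_eps\<close> with 40^k permits.\<close>
    have "s < r / 40"
    proof (rule ccontr)
      assume "\<not> s < r / 40"
      then have "(r / 40) ^ DIM('a) \<le> s ^ DIM('a)" using r by (intro power_mono) auto
      then have "(r / 40) ^ DIM('a) * (gd / 2) \<le> e * (13 * r) ^ DIM('a)" using le d0 by (smt (verit) mult_right_mono half_gt_zero)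
      then have "r ^ DIM('a) * gd \<le> r ^ DIM('a) * (e * 2 * 13 ^ DIM('a) * 40 ^ DIM('a))"
        by (simp add: power_divide power_mult_distrib field_simps)
      then have "gd \<le> e * 2 * 13 ^ DIM('a) * 40 ^ DIM('a)" using r by (simp only: mult_le_cancel_left_pos zero_less_power)
      then have "1 \<le> e * (shadow_const C DIM('a) * 40 ^ DIM('a))"
        using d0 by (simp add: shadow_const_def gd_def[symmetric] field_simps)
      moreover have "e * (shadow_const C DIM('a) * 40 ^ DIM('a)) \<le> 1 / 2"
      proof -
        have "e \<le> inverse (2 * shadow_const C DIM('a) * 40 ^ DIM('a))" using e_small by (simp add: small_eps_def)
        then have "e * (shadow_const C DIM('a) * 40 ^ DIM('a)) \<le> inverse (2 * shadow_const C DIM('a) * 40 ^ DIM('a)) * (shadow_const C DIM('a) * 40 ^ DIM('a))"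
          using kpos(2) by (intro mult_right_mono) auto
        also have "\<dots> = 1 / 2" using kpos(2) by (simp add: field_simps)
        finally show ?thesis .
      qed
      ultimately show False by linarith
    qed
    then show ?thesis using s low by blast
  qed
  then obtain s where s: "\<And>y. y \<in> MM - M0 \<Longrightarrow> 0 < s y \<and> s y < r / 40 \<and> ennreal (s y ^ DIM('a)) * ennreal (gd / 2) \<le> tiltH (cylinder y (s y))"
    by metis
  \<comment> \<open>A cylinder of radius s lies in the ball of radius 2 s, so disjoint balls give
    disjoint cylinders; the enlarged radius is 5 times 2 s.\<close>
  obtain c I where c: "\<And>n. n \<in> (I::nat set) \<Longrightarrow> c n \<in> MM - M0" "disjoint_family_on (\<lambda>n. ball (c n) (2 * s (c n))) I"
    "MM - M0 \<subseteq> (\<Union>n\<in>I. ball (c n) (5 * (2 * s (c n))))"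
  proof (rule Vitali_balls_sequence[where S="MM - M0" and K="MM - M0" and a="\<lambda>x. x" and r="\<lambda>y. 2 * s y" and B="r / 20"])
    show "MM - M0 \<subseteq> (\<Union>i\<in>MM - M0. ball i (2 * s i))" using s by force
    show "0 < 2 * s i \<and> 2 * s i \<le> r / 20" if "i \<in> MM - M0" for i using s[OF that] by linarith
  qed auto
  define X where "X n = (if n \<in> I then cylinder (c n) (s (c n)) else {})" for n
  have sub: "X n \<subseteq> cylinder x\<^sub>0 (13 * r)" for n
  proof (cases "n \<in> I")
    case True
    have "c n \<in> cylinder x\<^sub>0 r" using c(1)[OF True] by (auto simp: MM_def)
    then have "cylinder (c n) (s (c n)) \<subseteq> cylinder x\<^sub>0 (13 * r)"
      using s[OF c(1)[OF True]] r unfolding cylinder_iff by (intro cylinder_mono; linarith)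
    then show ?thesis using True by (simp add: X_def)
  qed (simp add: X_def)
  have disj: "disjoint_family (\<lambda>n. X n \<inter> reduced_boundary E)"
    unfolding disjoint_family_on_def
  proof (intro ballI impI)
    fix m n :: nat assume "m \<noteq> n"
    then have "X m \<inter> X n = {}"
    proof (cases "m \<in> I \<and> n \<in> I")
      case True
      then have "ball (c m) (2 * s (c m)) \<inter> ball (c n) (2 * s (c n)) = {}"
        using c(2) \<open>m \<noteq> n\<close> unfolding disjoint_family_on_def by blast
      moreover have "X m \<subseteq> ball (c m) (2 * s (c m))" "X n \<subseteq> ball (c n) (2 * s (c n))"
        unfolding X_def using True by (simp_all only: if_True cylinder_subset_ball)
      ultimately show ?thesis by blast
    qed (auto simp: X_def)
    then show "X m \<inter> reduced_boundary E \<inter> (X n \<inter> reduced_boundary E) = {}" by blast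
  qed
  have "ennreal (gd / 2) * (\<Sum>n. if n \<in> I then ennreal (s (c n) ^ DIM('a)) else 0) =
    (\<Sum>n. ennreal (gd / 2) * (if n \<in> I then ennreal (s (c n) ^ DIM('a)) else 0))" by simp
  also have "\<dots> \<le> (\<Sum>n. tiltH (X n))"
  proof (intro suminf_le)
    show "ennreal (gd / 2) * (if n \<in> I then ennreal (s (c n) ^ DIM('a)) else 0) \<le> tiltH (X n)" for n
      using s[OF c(1)[of n]] by (auto simp: X_def mult.commute)
  qed auto
  also have "\<dots> \<le> tiltH (cylinder x\<^sub>0 (13 * r))"
    unfolding tiltH_def by (rule nn_integral_disjoint_UN_le[OF disj]) (use sub in blast)
  also have "\<dots> = ennreal (e * (13 * r) ^ DIM('a))" by (rule tiltH_big)
  finally have "ennreal (2 / gd) * (ennreal (gd / 2) * (\<Sum>n. if n \<in> I then ennreal (s (c n) ^ DIM('a)) else 0)) \<le> ennreal (2 / gd) * ennreal (e * (13 * r) ^ DIM('a))"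
    by (rule mult_left_mono) simp
  moreover have "Y \<le> ennreal (2 / gd * (e * (13 * r) ^ DIM('a)))"
    if "ennreal (2 / gd) * (ennreal (gd / 2) * Y) \<le> ennreal (2 / gd) * ennreal (e * (13 * r) ^ DIM('a))" for Y
  proof -
    have "ennreal (2 / gd) * ennreal (gd / 2) = 1" using d0 by (simp add: ennreal_mult[symmetric])
    moreover have "ennreal (2 / gd) * ennreal (e * (13 * r) ^ DIM('a)) = ennreal (2 / gd * (e * (13 * r) ^ DIM('a)))"
      using d0 e_nonneg r by (intro ennreal_mult[symmetric]) auto
    ultimately show ?thesis using that by (simp only: mult.assoc[symmetric] mult_1)
  qed
  ultimately have sum: "(\<Sum>n. if n \<in> I then ennreal (s (c n) ^ DIM('a)) else 0) \<le> ennreal (2 / gd * (e * (13 * r) ^ DIM('a)))"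
    by blast
  have "2 / gd * (e * (13 * r) ^ DIM('a)) = shadow_const C DIM('a) * e * r ^ DIM('a)"
    by (simp add: shadow_const_def gd_def[symmetric] power_mult_distrib mult_ac)
  then show ?thesis
    using s c sum by (intro exI[of _ c] exI[of _ "\<lambda>n. s (c n)"] exI[of _ I]) auto
qed

lemma kap4: "kap (cylinder x\<^sub>0 (4 * r)) \<le> pos_eta C DIM('a) (1 / 2) * r ^ DIM('a)"
proof -
  have "kap (cylinder x\<^sub>0 (4 * r)) \<le> kap (cylinder x\<^sub>0 (13 * r))"
    using r by (intro kap_mono cylinder_mono) auto
  also have "\<dots> \<le> MH_const * (13 * r) ^ DIM('a) * e" by (rule kap_big)
  also have "\<dots> \<le> MH_const * (13 * r) ^ DIM('a) * (pos_eta C DIM('a) (1 / 2) / (MH_const * 13 ^ DIM('a)))"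
  proof (rule mult_left_mono)
    show "e \<le> pos_eta C DIM('a) (1 / 2) / (MH_const * 13 ^ DIM('a))" using e_small by (simp add: small_eps_def MH_const_def)
  qed (use r MH_const_pos in simp)
  also have "\<dots> = pos_eta C DIM('a) (1 / 2) * r ^ DIM('a)"
    using MH_const_pos by (simp add: power_mult_distrib)
  finally show ?thesis .
qed

lemma x0_flat: "y \<in> MM \<Longrightarrow> \<bar>snd y - snd x\<^sub>0\<bar> < 1 / 2 * r"
proof -
  assume "y \<in> MM"
  then have "y \<in> S \<inter> cylinder x\<^sub>0 r" by (simp add: MM_def)
  moreover have "x\<^sub>0 \<in> S \<inter> cylinder x\<^sub>0 r" using x0 r by (simp add: cylinder_iff)
  ultimately have "snd y - snd x\<^sub>0 < 1 / 2 * r" "snd x\<^sub>0 - snd y < 1 / 2 * r"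
    using position[OF x0 r _ _ _ kap4, of x\<^sub>0 y] position[OF x0 r _ _ _ kap4, of y x\<^sub>0] r by simp_all
  then show ?thesis by linarith
qed

text \<open>\<open>sides\<close> with \<theta> = 1/2 puts the column inside E at height -3/4 r and
  outside at 3/4 r, so the segment between them crosses the frontier.\<close>

lemma column_meets_frontier:
  assumes "norm z < r" shows "\<exists>t. \<bar>t\<bar> < r \<and> x\<^sub>0 + (z, t) \<in> MM"
proof -
  define J where "J = (\<lambda>t. x\<^sub>0 + (z, t)) ` {- (3 / 4 * r)..3 / 4 * r}"
  have "connected J" unfolding J_def
    by (intro connected_continuous_image continuous_intros connected_Icc)
  moreover have "x\<^sub>0 + (z, - (3 / 4 * r)) \<in> J \<inter> E"
  proof -
    have "x\<^sub>0 + (z, - (3 / 4 * r)) \<in> interior E"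
      using r assms by (intro sides(2)[OF x0 r _ _ _ kap4]) auto
    then show ?thesis using interior_subset[of E] r by (auto simp: J_def)
  qed
  moreover have "x\<^sub>0 + (z, 3 / 4 * r) \<in> J - E"
  proof -
    have "x\<^sub>0 + (z, 3 / 4 * r) \<notin> closure E"
      using r assms by (intro sides(1)[OF x0 r _ _ _ kap4]) auto
    then show ?thesis using closure_subset[of E] r by (auto simp: J_def)
  qed
  ultimately have "J \<inter> S \<noteq> {}" using connected_Int_frontier[of J E] by blast
  then obtain t where "t \<in> {- (3 / 4 * r)..3 / 4 * r}" "x\<^sub>0 + (z, t) \<in> S" unfolding J_def by blast
  then show ?thesis using r assms by (intro exI[of _ t]) (auto simp: MM_def cylinder_iff)
qed

end

section \<open>Size of the bad set and of its projection\<close>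

context small_excess
begin

definition shadow_vol :: real where
  "shadow_vol = unit_ball_vol (real DIM('a)) * 10 ^ DIM('a) * shadow_const C DIM('a)"

text \<open>One factor C comes from \<open>hausdorff_le_M\<close>, the other from the upper mass
  bound; 11 s is the radius 10 s of a bad ball plus the thickness s of its neighbourhood.\<close>

definition bad_const :: real where
  "bad_const = unit_ball_vol (real DIM('a)) * 5 ^ DIM('a) * C\<^sup>2 * 11 ^ DIM('a) * shadow_const C DIM('a)"

lemma bad_set:
  obtains A where "open A" "emeasure lborel A \<le> ennreal (shadow_vol * e * r ^ DIM('a))"
    "\<And>y. y \<in> MM - M0 \<Longrightarrow> fst y - fst x\<^sub>0 \<in> A"
    "hausdorff DIM('a) (MM - M0) \<le> ennreal (bad_const * e * r ^ DIM('a))"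
proof -
  define \<omega> where "\<omega> = unit_ball_vol (real DIM('a))"
  have \<omega>: "0 < \<omega>" by (simp add: \<omega>_def)
  have C0: "0 < C" using C by simp
  obtain c s I where c': "\<forall>n\<in>(I::nat set). c n \<in> MM \<and> 0 < s n \<and> s n < r / 40"
    and cov: "MM - M0 \<subseteq> (\<Union>n\<in>I. ball (c n) (10 * s n))"
    and sum: "(\<Sum>n. if n \<in> I then ennreal (s n ^ DIM('a)) else 0) \<le> ennreal (shadow_const C DIM('a) * e * r ^ DIM('a))"
    using bad_cover by blast
  have c: "c n \<in> MM \<and> 0 < s n \<and> s n < r / 40" if "n \<in> I" for n using c' that by blast
  define B where "B n = (if n \<in> I then ball (fst (c n) - fst x\<^sub>0) (10 * s n) else {})" for n
  define A where "A = (\<Union>n. B n)"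
  show ?thesis
  proof (rule that[of A])
    show "open A" by (auto simp: A_def B_def)
    have "emeasure lborel A \<le> (\<Sum>n. emeasure lborel (B n))"
      unfolding A_def by (intro emeasure_subadditive_countably) (auto simp: B_def)
    also have "\<dots> \<le> (\<Sum>n. ennreal (\<omega> * 10 ^ DIM('a)) * (if n \<in> I then ennreal (s n ^ DIM('a)) else 0))"
    proof (intro suminf_le)
      fix n
      show "emeasure lborel (B n) \<le> ennreal (\<omega> * 10 ^ DIM('a)) * (if n \<in> I then ennreal (s n ^ DIM('a)) else 0)"
        using c[of n] \<omega> by (auto simp: B_def emeasure_ball \<omega>_def[symmetric] ennreal_mult[symmetric] power_mult_distrib mult_ac)
    qed auto
    also have "\<dots> \<le> ennreal (\<omega> * 10 ^ DIM('a)) * ennreal (shadow_const C DIM('a) * e * r ^ DIM('a))"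
      using sum by (subst ennreal_suminf_cmult) (intro mult_left_mono, auto)
    also have "\<dots> = ennreal (shadow_vol * e * r ^ DIM('a))"
      using \<omega> kpos(2) e_nonneg r by (simp add: ennreal_mult[symmetric] shadow_vol_def \<omega>_def[symmetric] mult_ac)
    finally show "emeasure lborel A \<le> ennreal (shadow_vol * e * r ^ DIM('a))" .
    show "fst y - fst x\<^sub>0 \<in> A" if y: "y \<in> MM - M0" for y
    proof -
      obtain n where n: "n \<in> I" "y \<in> ball (c n) (10 * s n)" using cov y by blast
      then have "fst y - fst x\<^sub>0 \<in> B n" using dist_fst_le[of "c n" y] by (auto simp: B_def dist_norm)
      then show ?thesis by (auto simp: A_def)
    qed
    define X where "X n = (if n \<in> I then S \<inter> ball (c n) (10 * s n) else {})" for n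
    have X: "hausdorff DIM('a) (X n) \<le> ennreal (\<omega> * 5 ^ DIM('a) * C\<^sup>2 * 11 ^ DIM('a)) * (if n \<in> I then ennreal (s n ^ DIM('a)) else 0)" for n
    proof (cases "n \<in> I")
      case True
      have sn: "0 < s n" "s n < r / 40" "c n \<in> S" using c[OF True] by (auto simp: MM_def)
      have "hausdorff DIM('a) (X n) \<le> ennreal (unit_ball_vol (real DIM('a)) * 5 ^ DIM('a) * C) * emeasure M (ball (c n) (11 * s n))"
      proof (rule hausdorff_le_M)
        show "X n \<subseteq> S" by (simp add: X_def)
        show "0 < s n" by (rule sn(1))
        show "ball x (s n) \<subseteq> ball (c n) (11 * s n)" if "x \<in> X n" for x
        proof
          fix y assume "y \<in> ball x (s n)"
          moreover have "dist (c n) x < 10 * s n" using that True by (simp add: X_def)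
          ultimately show "y \<in> ball (c n) (11 * s n)" using dist_triangle[of "c n" y x] by simp
        qed
      qed simp
      also have "\<dots> \<le> ennreal (unit_ball_vol (real DIM('a)) * 5 ^ DIM('a) * C) * ennreal (C * (11 * s n) ^ DIM('a))"
        using sn r by (intro mult_left_mono upper) auto
      also have "\<dots> = ennreal (\<omega> * 5 ^ DIM('a) * C\<^sup>2 * 11 ^ DIM('a)) * ennreal (s n ^ DIM('a))"
        using \<omega> C0 sn by (simp add: ennreal_mult[symmetric] \<omega>_def[symmetric] power_mult_distrib power2_eq_square mult_ac)
      finally show ?thesis using True by simp
    qed (simp add: X_def hausdorff.empty)
    have "MM - M0 \<subseteq> (\<Union>n. X n)"
    proof
      fix y assume y: "y \<in> MM - M0"
      then obtain n where "n \<in> I" "y \<in> ball (c n) (10 * s n)" using cov by blast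
      then have "y \<in> X n" using y by (simp add: X_def MM_def)
      then show "y \<in> (\<Union>n. X n)" by blast
    qed
    then have "hausdorff DIM('a) (MM - M0) \<le> hausdorff DIM('a) (\<Union>n. X n)" by (rule hausdorff.mono)
    also have "\<dots> \<le> (\<Sum>n. hausdorff DIM('a) (X n))" by (rule hausdorff.subadd)
    also have "\<dots> \<le> (\<Sum>n. ennreal (\<omega> * 5 ^ DIM('a) * C\<^sup>2 * 11 ^ DIM('a)) * (if n \<in> I then ennreal (s n ^ DIM('a)) else 0))"
      by (intro suminf_le X) auto
    also have "\<dots> \<le> ennreal (\<omega> * 5 ^ DIM('a) * C\<^sup>2 * 11 ^ DIM('a)) * ennreal (shadow_const C DIM('a) * e * r ^ DIM('a))"
      using sum by (subst ennreal_suminf_cmult) (intro mult_left_mono, auto)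
    also have "\<dots> = ennreal (bad_const * e * r ^ DIM('a))"
      using \<omega> C0 kpos(2) e_nonneg r by (simp add: ennreal_mult[symmetric] bad_const_def \<omega>_def[symmetric] mult_ac)
    finally show "hausdorff DIM('a) (MM - M0) \<le> ennreal (bad_const * e * r ^ DIM('a))" .
  qed
qed

end

text \<open>A is an open set covering the projection of the bad points. It replaces that projection
  in all volume estimates, so measurability of the good set never enters.\<close>

locale approx = small_excess E C r x\<^sub>0 for E :: "('a::euclidean_space \<times> real) set" and C r x\<^sub>0 +
  fixes A :: "'a set"
  assumes A_open: "open A"
    and A_vol: "emeasure lborel A \<le> ennreal (shadow_vol * e * r ^ DIM('a))"
    and A_bad: "y \<in> MM - M0 \<Longrightarrow> fst y - fst x\<^sub>0 \<in> A"
begin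

definition D :: "'a set" where "D = ball 0 r"

text \<open>By \<open>cone\<close> two good points over the same z coincide, so the choice is
  immaterial.\<close>

definition hgt :: "'a \<Rightarrow> real" where
  "hgt z = snd ((SOME y. y \<in> M0 \<and> fst (y - x\<^sub>0) = z) - x\<^sub>0)"

definition u :: "'a \<Rightarrow> real" where "u z = (INF y\<in>P. hgt y + 1 / 2 * norm (z - y))"

lemma M0_MM: "M0 \<subseteq> MM" by (auto simp: M0_def)

lemma MM_D: "y \<in> MM \<Longrightarrow> fst (y - x\<^sub>0) \<in> D" by (auto simp: MM_def D_def cylinder_iff)

lemma P_D: "P \<subseteq> D" using M0_MM MM_D by (auto simp: P_def)

text \<open>The column over z contains a boundary point, and outside A that point must be
  good.\<close>

lemma D_A_P: "z \<in> D \<Longrightarrow> z \<notin> A \<Longrightarrow> z \<in> P"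
proof -
  assume z: "z \<in> D" "z \<notin> A"
  then obtain t where t: "x\<^sub>0 + (z, t) \<in> MM" using column_meets_frontier[of z] by (auto simp: D_def)
  then have "x\<^sub>0 + (z, t) \<in> M0" using A_bad[of "x\<^sub>0 + (z, t)"] z(2) by auto
  then show "z \<in> P" unfolding P_def by (rule rev_image_eqI) simp
qed

lemma shadow_vol_pos: "0 < shadow_vol" using kpos(2) by (simp add: shadow_vol_def)

text \<open>Secures that some column is free of bad points, hence that P is nonempty and the infimum
  in u is meaningful.\<close>

lemma A_small: "emeasure lborel A < emeasure lborel D"
proof -
  define \<omega> where "\<omega> = unit_ball_vol (real DIM('a))"
  have \<omega>: "0 < \<omega>" by (simp add: \<omega>_def)
  have "e \<le> inverse (2 * shadow_const C DIM('a) * 40 ^ DIM('a))" using e_small by (simp add: small_eps_def)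
  then have "shadow_vol * e * r ^ DIM('a) \<le> shadow_vol * inverse (2 * shadow_const C DIM('a) * 40 ^ DIM('a)) * r ^ DIM('a)"
    using r shadow_vol_pos by (intro mult_right_mono mult_left_mono) auto
  also have "\<dots> = \<omega> * r ^ DIM('a) * ((10 ^ DIM('a) / 40 ^ DIM('a)) / 2)"
    using kpos(2) by (simp add: shadow_vol_def \<omega>_def[symmetric] field_simps)
  also have "\<dots> < \<omega> * r ^ DIM('a) * 1"
  proof (rule mult_strict_left_mono)
    have "(10::real) ^ DIM('a) \<le> 40 ^ DIM('a)" by (rule power_mono) auto
    moreover have "(0::real) < 40 ^ DIM('a)" by simp
    ultimately have "(10::real) ^ DIM('a) < 40 ^ DIM('a) * 2" by linarith
    then show "(10::real) ^ DIM('a) / 40 ^ DIM('a) / 2 < 1" by (simp add: divide_less_eq)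
  qed (use \<omega> r in simp)
  finally have "ennreal (shadow_vol * e * r ^ DIM('a)) < emeasure lborel D"
    using shadow_vol_pos e_nonneg r by (simp add: D_def emeasure_ball \<omega>_def[symmetric] ennreal_less_iff)
  then show ?thesis using A_vol by (rule le_less_trans[rotated])
qed

lemma D_A_ne: "D - A \<noteq> {}"
proof
  assume "D - A = {}"
  then have "emeasure lborel D \<le> emeasure lborel A" using A_open by (intro emeasure_mono) auto
  then show False using A_small by simp
qed

lemma P_ne: "P \<noteq> {}" using D_A_ne D_A_P by blast

lemma hgt_eq: "y \<in> M0 \<Longrightarrow> hgt (fst (y - x\<^sub>0)) = snd (y - x\<^sub>0)"
proof -
  assume y: "y \<in> M0"
  define w where "w = (SOME y'. y' \<in> M0 \<and> fst (y' - x\<^sub>0) = fst (y - x\<^sub>0))"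
  have "w \<in> M0 \<and> fst (w - x\<^sub>0) = fst (y - x\<^sub>0)"
    unfolding w_def by (rule someI[of _ y]) (use y in simp)
  then have "\<bar>snd w - snd y\<bar> \<le> 0" using cone[of w y] y M0_MM by auto
  then have "snd (w - x\<^sub>0) = snd (y - x\<^sub>0)" by simp
  then show ?thesis by (simp only: hgt_def w_def)
qed

lemma hgt_cone: "x \<in> MM \<Longrightarrow> z \<in> P \<Longrightarrow> \<bar>snd (x - x\<^sub>0) - hgt z\<bar> \<le> 1 / 2 * norm (fst (x - x\<^sub>0) - z)"
proof -
  assume x: "x \<in> MM" and "z \<in> P"
  then obtain y where y: "y \<in> M0" "z = fst (y - x\<^sub>0)" by (auto simp: P_def)
  show ?thesis using cone[OF x y(1)] hgt_eq[OF y(1)] by (simp add: y(2))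
qed

lemma hgt_lip: "z \<in> P \<Longrightarrow> z' \<in> P \<Longrightarrow> \<bar>hgt z - hgt z'\<bar> \<le> 1 / 2 * norm (z - z')"
proof -
  assume z: "z \<in> P" "z' \<in> P"
  then obtain y where y: "y \<in> M0" "z = fst (y - x\<^sub>0)" by (auto simp: P_def)
  show ?thesis using hgt_cone[of y z'] z(2) y(1) M0_MM hgt_eq[OF y(1)] by (auto simp: y(2))
qed

lemma u_lip: "(1 / 2)-lipschitz_on UNIV u"
  unfolding u_def[abs_def] by (rule McShane(1)[OF P_ne _ hgt_lip]) auto

lemma u_hgt: "z \<in> P \<Longrightarrow> u z = hgt z"
  unfolding u_def by (rule McShane(2)[OF P_ne _ hgt_lip]) auto

sublocale lipschitz_fun u "1 / 2"
  by standard (rule u_lip)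

lemma u_cone: "x \<in> MM \<Longrightarrow> z \<in> P \<Longrightarrow> \<bar>snd (x - x\<^sub>0) - u z\<bar> \<le> 1 / 2 * norm (fst (x - x\<^sub>0) - z)"
  using hgt_cone u_hgt by simp

text \<open>Half of the distance comes from the cone condition, half from the slope of u.\<close>

lemma u_infdist: "x \<in> MM \<Longrightarrow> \<bar>snd (x - x\<^sub>0) - u (fst (x - x\<^sub>0))\<bar> \<le> infdist (fst (x - x\<^sub>0)) P"
proof -
  assume x: "x \<in> MM"
  have "\<bar>snd (x - x\<^sub>0) - u (fst (x - x\<^sub>0))\<bar> \<le> dist (fst (x - x\<^sub>0)) z" if z: "z \<in> P" for z
    using u_cone[OF x z] lipD[of z "fst (x - x\<^sub>0)"] unfolding dist_norm norm_minus_commute[of z] by linarith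
  then show ?thesis using P_ne by (simp add: infdist_def cINF_greatest)
qed

lemma M0_graph: "y \<in> M0 \<Longrightarrow> snd (y - x\<^sub>0) = u (fst (y - x\<^sub>0))"
  using hgt_eq[of y] u_hgt[of "fst (y - x\<^sub>0)"] by (auto simp: P_def)

lemma u_on_P: "z \<in> P \<Longrightarrow> \<bar>u z\<bar> < 1 / 2 * r"
  using M0_graph x0_flat M0_MM by (force simp: P_def)

text \<open>By \<open>u_infdist\<close> the column over z has no boundary point lower than u z -
  infdist z P within the cylinder. Low down the column is inside E by \<open>sides\<close>, and it
  stays inside up to height t.\<close>

lemma column_below:
  assumes z: "z \<in> D" and t: "- r < t" "t < r" "t < u z - infdist z P"
  shows "x\<^sub>0 + (z, t) \<in> interior E"
proof (rule ccontr)
  assume nin: "x\<^sub>0 + (z, t) \<notin> interior E"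
  \<comment> \<open>A height at or below t, still above -r but below -r/2, where
    \<open>sides\<close> applies.\<close>
  define b where "b = min t (- (3 / 4 * r))"
  define J where "J = (\<lambda>\<tau>. x\<^sub>0 + (z, \<tau>)) ` {b..t}"
  have bt: "b \<le> t" "- r < b" "b < - (1 / 2 * r)" using t r by (auto simp: b_def)
  have con: "connected J" unfolding J_def
    by (intro connected_continuous_image continuous_intros connected_Icc)
  have free: "J \<inter> S = {}"
  proof (rule ccontr)
    assume "J \<inter> S \<noteq> {}"
    then obtain \<tau> where \<tau>: "b \<le> \<tau>" "\<tau> \<le> t" "x\<^sub>0 + (z, \<tau>) \<in> S" unfolding J_def by auto
    then have "x\<^sub>0 + (z, \<tau>) \<in> MM" using z bt t by (simp add: MM_def cylinder_iff D_def)
    from u_infdist[OF this] show False using \<tau> t by simp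
  qed
  have "x\<^sub>0 + (z, b) \<in> interior E"
    using z bt r by (intro sides(2)[OF x0 r _ _ _ kap4]) (auto simp: D_def)
  moreover have "x\<^sub>0 + (z, b) \<in> J" unfolding J_def using bt by (intro imageI) simp
  ultimately have "J \<inter> E \<noteq> {}" using interior_subset[of E] by blast
  then have "J - E = {}" using connected_Int_frontier[OF con, of E] free by blast
  moreover have "x\<^sub>0 + (z, t) \<in> J" using bt by (auto simp: J_def)
  ultimately have "x\<^sub>0 + (z, t) \<in> closure E - interior E" using nin closure_subset[of E] by blast
  then show False using free \<open>x\<^sub>0 + (z, t) \<in> J\<close> by (auto simp: frontier_def)
qed

lemma column_above:
  assumes z: "z \<in> D" and t: "- r < t" "t < r" "u z + infdist z P < t"
  shows "x\<^sub>0 + (z, t) \<notin> interior E"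
proof
  assume inn: "x\<^sub>0 + (z, t) \<in> interior E"
  define b where "b = max t (3 / 4 * r)"
  define J where "J = (\<lambda>\<tau>. x\<^sub>0 + (z, \<tau>)) ` {t..b}"
  have bt: "t \<le> b" "b < r" "1 / 2 * r < b" using t r by (auto simp: b_def)
  have con: "connected J" unfolding J_def
    by (intro connected_continuous_image continuous_intros connected_Icc)
  have free: "J \<inter> S = {}"
  proof (rule ccontr)
    assume "J \<inter> S \<noteq> {}"
    then obtain \<tau> where \<tau>: "t \<le> \<tau>" "\<tau> \<le> b" "x\<^sub>0 + (z, \<tau>) \<in> S" unfolding J_def by auto
    then have "x\<^sub>0 + (z, \<tau>) \<in> MM" using z bt t by (simp add: MM_def cylinder_iff D_def)
    from u_infdist[OF this] show False using \<tau> t by simp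
  qed
  have "x\<^sub>0 + (z, b) \<notin> closure E"
    using z bt r by (intro sides(1)[OF x0 r _ _ _ kap4]) (auto simp: D_def)
  moreover have "x\<^sub>0 + (z, b) \<in> J" unfolding J_def using bt by (intro imageI) simp
  ultimately have "J - E \<noteq> {}" using closure_subset[of E] by blast
  moreover have "x\<^sub>0 + (z, t) \<in> J \<inter> E" using inn interior_subset[of E] bt by (auto simp: J_def)
  ultimately show False using connected_Int_frontier[OF con, of E] free by blast
qed

text \<open>Boundary points off the graph are bad, and graph points off the boundary lie over A,
  where the graph map is 2-Lipschitz.\<close>

lemma hausdorff_symdiff:
  assumes bad: "hausdorff DIM('a) (MM - M0) \<le> ennreal (bad_const * e * r ^ DIM('a))"
    and \<Gamma>: "\<Gamma> = (\<lambda>z. x\<^sub>0 + (z, u z)) ` D"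
  shows "hausdorff DIM('a) (sym_diff MM \<Gamma>) \<le> ennreal ((bad_const + 10 ^ DIM('a) * shadow_vol) * e * r ^ DIM('a))"
proof -
  define G where "G z = x\<^sub>0 + (z, u z)" for z
  have G2: "dist (G z) (G z') \<le> 2 * dist z z'" for z z'
  proof -
    have "norm (G z - G z') \<le> norm (z - z') + \<bar>u z - u z'\<bar>"
      using norm_le_fst_snd[of "G z - G z'"] by (simp add: G_def)
    also have "\<dots> \<le> 2 * norm (z - z')" using lipD[of z z'] by linarith
    finally show ?thesis by (simp add: dist_norm)
  qed
  have sub: "sym_diff MM \<Gamma> \<subseteq> (MM - M0) \<union> G ` A"
  proof
    fix y assume y: "y \<in> sym_diff MM \<Gamma>"
    show "y \<in> (MM - M0) \<union> G ` A"
    proof (cases "y \<in> MM")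
      case True
      have "y \<notin> M0"
      proof
        assume y0: "y \<in> M0"
        have "y = G (fst (y - x\<^sub>0))" using M0_graph[OF y0] by (auto simp: G_def prod_eq_iff)
        then have "y \<in> \<Gamma>" unfolding \<Gamma> using MM_D[OF True] by (auto simp: G_def)
        then show False using y True by blast
      qed
      then show ?thesis using True by blast
    next
      case False
      then obtain z where z: "z \<in> D" "y = G z" using y by (auto simp: \<Gamma> G_def)
      have "z \<in> A"
      proof (rule ccontr)
        assume "z \<notin> A"
        then obtain w where w: "w \<in> M0" "z = fst (w - x\<^sub>0)" using D_A_P[OF z(1)] by (auto simp: P_def)
        then have "w = G z" using M0_graph[OF w(1)] by (auto simp: G_def prod_eq_iff)
        then show False using w(1) False z(2) M0_MM by blast
      qed
      then show ?thesis using z(2) by blast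
    qed
  qed
  have "hausdorff DIM('a) (sym_diff MM \<Gamma>) \<le> hausdorff DIM('a) ((MM - M0) \<union> G ` A)"
    by (rule hausdorff.mono[OF sub])
  also have "\<dots> \<le> hausdorff DIM('a) (MM - M0) + hausdorff DIM('a) (G ` A)" by (rule hausdorff.subadd_Un)
  also have "\<dots> \<le> ennreal (bad_const * e * r ^ DIM('a)) + ennreal (10 ^ DIM('a)) * ennreal (shadow_vol * e * r ^ DIM('a))"
    by (intro add_mono bad order_trans[OF hausdorff_graph_le[OF A_open G2]] mult_left_mono A_vol) auto
  also have "\<dots> = ennreal ((bad_const + 10 ^ DIM('a) * shadow_vol) * e * r ^ DIM('a))"
  proof -
    have "0 \<le> bad_const" using kpos(2) by (simp add: bad_const_def)
    then show ?thesis using shadow_vol_pos e_nonneg r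
      by (simp add: ennreal_mult[symmetric] ennreal_plus[symmetric] algebra_simps del: ennreal_plus)
  qed
  finally show ?thesis .
qed

end

subsection \<open>The gradient estimate\<close>

lemma GDERIV_has_dir_deriv:
  assumes "GDERIV f x :> G" shows "has_dir_deriv f v x (v \<bullet> G)"
proof -
  have "(f has_derivative (\<lambda>h. h \<bullet> G)) (at (x + 0 *\<^sub>R v))" using assms by (simp add: gderiv_def)
  moreover have "((\<lambda>t. x + t *\<^sub>R v) has_derivative (\<lambda>t. t *\<^sub>R v)) (at 0)"
    by (auto intro!: derivative_eq_intros)
  ultimately have "((\<lambda>t. f (x + t *\<^sub>R v)) has_derivative (\<lambda>t. (t *\<^sub>R v) \<bullet> G)) (at 0)"
    by (rule has_derivative_compose[rotated])
  then have "((\<lambda>t. f (x + t *\<^sub>R v)) has_real_derivative (v \<bullet> G)) (at 0)"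
    unfolding has_field_derivative_def by (rule has_derivative_eq_rhs) auto
  then have "has_dir_deriv f v (x + 0 *\<^sub>R v) (v \<bullet> G)" by (simp only: has_dir_deriv_iff_DERIV)
  then show ?thesis by simp
qed

lemma (in lipschitz_fun) norm_gradient_le:
  assumes "GDERIV f x :> G" shows "norm G \<le> L"
proof -
  have "\<bar>G \<bullet> G\<bar> \<le> L * norm G" by (rule dir_deriv_bound[OF GDERIV_has_dir_deriv[OF assms]])
  then have "norm G * norm G \<le> L * norm G" by (simp add: power2_norm_eq_inner[symmetric] power2_eq_square)
  then show ?thesis using L_nonneg by (cases "G = 0") auto
qed

lemma (in ahlfors) sigma_finite_M: "sigma_finite_measure M"
proof
  show "\<exists>F. countable F \<and> F \<subseteq> sets M \<and> \<Union>F = space M \<and> (\<forall>a\<in>F. emeasure M a \<noteq> \<infinity>)"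
  proof (intro exI[of _ "range (\<lambda>n. ball 0 (real n))"] conjI ballI)
    show "\<Union>(range (\<lambda>n. ball (0::'a \<times> real) (real n))) = space M"
      using reals_Archimedean2 by (auto simp: dist_norm)
    fix X assume "X \<in> range (\<lambda>n. ball (0::'a \<times> real) (real n))"
    then have "bounded X" by auto
    then show "emeasure M X \<noteq> \<infinity>" using M_bounded[of X] by simp
  qed auto
qed

context approx
begin

text \<open>A Borel part of P that exhausts D up to the shadow; density points are taken with
  respect to it.\<close>

definition K :: "'a set" where "K = D - A"

lemma K_borel [measurable]: "K \<in> sets borel" using A_open by (simp add: K_def D_def)

lemma K_P: "K \<subseteq> P" using D_A_P by (auto simp: K_def)

definition Zset :: "'a \<Rightarrow> real \<Rightarrow> ('a \<times> real) set" where
  "Zset z s = {x. norm (fst x - (fst x\<^sub>0 + z)) < s \<and> \<bar>snd x - snd x\<^sub>0\<bar> < r}"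

text \<open>A point z' near z farther than \<zeta> s from P has a K-free ball of radius \<zeta> s,
  which is a fraction (\<zeta>/2)^k of the ball of radius 2 s about z: twice what the density
  permits.\<close>

lemma density_infdist:
  assumes dens: "\<forall>\<epsilon>>0. \<exists>d>0. \<forall>s. 0 < s \<and> s < d \<longrightarrow> emeasure lborel ((- K) \<inter> ball z s) \<le> ennreal \<epsilon> * emeasure lborel (ball z s)"
    and \<eta>: "0 < \<eta>"
  shows "\<exists>d>0. \<forall>s z'. 0 < s \<and> s < d \<and> norm (z' - z) \<le> s \<longrightarrow> infdist z' P \<le> \<eta> * s"
proof -
  define \<omega> where "\<omega> = unit_ball_vol (real DIM('a))"
  have \<omega>: "0 < \<omega>" by (simp add: \<omega>_def)
  define \<zeta> where "\<zeta> = min \<eta> 1"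
  have \<zeta>: "0 < \<zeta>" "\<zeta> \<le> 1" "\<zeta> \<le> \<eta>" using \<eta> by (auto simp: \<zeta>_def)
  have "0 < (\<zeta> / 2) ^ DIM('a) / 2" using \<zeta> by simp
  then obtain d where d: "0 < d" "\<forall>s. 0 < s \<and> s < d \<longrightarrow> emeasure lborel ((- K) \<inter> ball z s) \<le> ennreal ((\<zeta> / 2) ^ DIM('a) / 2) * emeasure lborel (ball z s)"
    using dens by blast
  have "infdist z' P \<le> \<eta> * s" if s: "0 < s" "s < d / 2" "norm (z' - z) \<le> s" for s z'
  proof (rule ccontr)
    assume "\<not> infdist z' P \<le> \<eta> * s"
    then have far: "\<zeta> * s < infdist z' P" using mult_right_mono[OF \<zeta>(3), of s] s by linarith
    have "ball z' (\<zeta> * s) \<subseteq> (- K) \<inter> ball z (2 * s)"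
    proof
      fix w assume w: "w \<in> ball z' (\<zeta> * s)"
      have "w \<notin> K"
      proof
        assume "w \<in> K"
        then have "infdist z' P \<le> dist z' w" using K_P by (intro infdist_le) auto
        then show False using far w by simp
      qed
      moreover have "dist z w < 2 * s"
      proof -
        have "dist z w \<le> dist z z' + dist z' w" by (rule dist_triangle)
        also have "\<dots> < s + \<zeta> * s" using w s(3) by (simp add: dist_norm norm_minus_commute add_le_less_mono)
        also have "\<dots> \<le> 2 * s" using mult_right_mono[OF \<zeta>(2), of s] s by linarith
        finally show ?thesis .
      qed
      ultimately show "w \<in> (- K) \<inter> ball z (2 * s)" by simp
    qed
    then have "emeasure lborel (ball z' (\<zeta> * s)) \<le> emeasure lborel ((- K) \<inter> ball z (2 * s))"
      by (intro emeasure_mono) auto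
    also have "\<dots> \<le> ennreal ((\<zeta> / 2) ^ DIM('a) / 2) * emeasure lborel (ball z (2 * s))" using d(2) s by simp
    finally have "\<omega> * (\<zeta> * s) ^ DIM('a) \<le> (\<zeta> / 2) ^ DIM('a) / 2 * (\<omega> * (2 * s) ^ DIM('a))"
      using \<zeta> s \<omega> by (simp add: emeasure_ball \<omega>_def[symmetric] ennreal_mult[symmetric])
    also have "\<dots> = \<omega> * (\<zeta> * s) ^ DIM('a) / 2" by (simp add: power_divide power_mult_distrib)
    finally show False using \<omega> \<zeta> s by (simp add: power_mult_distrib)
  qed
  then show ?thesis using d(1) by (intro exI[of _ "d / 2"]) auto
qed

definition prof :: "real \<Rightarrow> real" where
  "prof = ramp (snd x\<^sub>0 - r) (snd x\<^sub>0 - 3 / 4 * r) (snd x\<^sub>0 + 3 / 4 * r) (snd x\<^sub>0 + r)"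

definition G :: "real \<Rightarrow> real" where
  "G \<tau> = (LINT t|lborel. indicator {..snd x\<^sub>0 + \<tau>} t * prof t)"

text \<open>The length of the column of E over p, weighted by \<open>prof\<close>; G is the same for
  the half-line below height \<tau>. Where E is exactly the subgraph of u within the cylinder, W is
  u plus a constant as long as u stays within 3/4 r.\<close>

definition W :: "'a \<Rightarrow> real" where
  "W p = (LINT t|lborel. indicator (interior E) (p, t) * prof t)"

lemma C1c_prof: "\<exists>g. C1c prof g"
proof -
  have "C1c prof (\<lambda>t. ramp_up' (snd x\<^sub>0 - r) (snd x\<^sub>0 - 3 / 4 * r) (snd x\<^sub>0 + 3 / 4 * r) (snd x\<^sub>0 + r) t
    - ramp_down' (snd x\<^sub>0 - r) (snd x\<^sub>0 - 3 / 4 * r) (snd x\<^sub>0 + 3 / 4 * r) (snd x\<^sub>0 + r) t)"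
    unfolding prof_def using r by (intro C1c_ramp) auto
  then show ?thesis by blast
qed

lemma prof_measurable [measurable]: "prof \<in> borel_measurable borel"
  using C1c_prof C1c_measurable(1) by blast

lemma prof_bounds: "0 \<le> prof t" "prof t \<le> 1" by (auto simp: prof_def ramp_bounds)

lemma prof_out: "r \<le> \<bar>t - snd x\<^sub>0\<bar> \<Longrightarrow> prof t = 0"
  unfolding prof_def using r by (intro ramp_outside) (auto simp: abs_if split: if_splits)

lemma prof_in: "\<bar>t - snd x\<^sub>0\<bar> \<le> 3 / 4 * r \<Longrightarrow> prof t = 1"
  unfolding prof_def using r by (intro ramp_inside) linarith+

lemma integrable_prof:
  assumes "X \<in> sets borel" shows "integrable lborel (\<lambda>t. indicator X t * prof t)"
proof (rule integrable_bounded_support[where A="cball (snd x\<^sub>0) r" and B=1])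
  show "(\<lambda>t. indicator X t * prof t) \<in> borel_measurable lborel" using assms by simp
  show "norm (indicator X t * prof t) \<le> 1" for t using prof_bounds[of t] by (simp add: indicator_def)
  show "indicator X t * prof t = 0" if "t \<notin> cball (snd x\<^sub>0) r" for t
    using that prof_out[of t] by (simp add: dist_real_def abs_minus_commute)
qed (use emeasure_lborel_cball_finite in auto)

lemma G_affine:
  assumes "\<bar>\<tau>\<bar> \<le> 3 / 4 * r" shows "G \<tau> = G 0 + \<tau>"
proof -
  have diff: "G b - G a = b - a" if ab: "- (3 / 4 * r) \<le> a" "a \<le> b" "b \<le> 3 / 4 * r" for a b
  proof -
    have "G b - G a = (LINT t|lborel. indicator {..snd x\<^sub>0 + b} t * prof t - indicator {..snd x\<^sub>0 + a} t * prof t)"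
      unfolding G_def by (intro Bochner_Integration.integral_diff[symmetric] integrable_prof) auto
    also have "\<dots> = (LINT t|lborel. indicator {snd x\<^sub>0 + a<..snd x\<^sub>0 + b} t)"
    proof (rule Bochner_Integration.integral_cong[OF refl])
      fix t
      show "indicator {..snd x\<^sub>0 + b} t * prof t - indicator {..snd x\<^sub>0 + a} t * prof t = (indicator {snd x\<^sub>0 + a<..snd x\<^sub>0 + b} t :: real)"
      proof (cases "t \<in> {snd x\<^sub>0 + a<..snd x\<^sub>0 + b}")
        case True
        then have "prof t = 1" using ab by (intro prof_in) (unfold greaterThanAtMost_iff, linarith)
        then show ?thesis using True by (simp add: indicator_def)
      qed (use ab in \<open>auto simp: indicator_def\<close>)
    qed
    also have "\<dots> = b - a" using ab by simp
    finally show ?thesis .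
  qed
  show ?thesis
  proof (cases "0 \<le> \<tau>")
    case True then show ?thesis using diff[of 0 \<tau>] assms r by simp
  next
    case False then show ?thesis using diff[of \<tau> 0] assms r by simp
  qed
qed

lemma section_measurable: "{t. (p, t) \<in> interior E} \<in> sets borel"
proof -
  have "open ((\<lambda>t. (p, t)) -` interior E)" by (intro open_vimage open_interior continuous_intros)
  then show ?thesis by (simp add: vimage_def borel_open)
qed

text \<open>Up to d the column is full below u z and empty above it, so W lies between G (u z - d)
  and G (u z + d), and G has slope 1 there.\<close>

lemma W_est:
  assumes z: "z \<in> D" and d: "infdist z P < d" "\<bar>u z\<bar> + d \<le> 3 / 4 * r"
  shows "\<bar>W (fst x\<^sub>0 + z) - (G 0 + u z)\<bar> \<le> d"
proof -
  have d0: "0 \<le> infdist z P" by (rule infdist_nonneg)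
  define X where "X = {t. (fst x\<^sub>0 + z, t) \<in> interior E}"
  have Xb: "X \<in> sets borel" unfolding X_def by (rule section_measurable)
  have W: "W (fst x\<^sub>0 + z) = (LINT t|lborel. indicator X t * prof t)"
    by (simp add: W_def X_def indicator_def)
  have low: "indicator {..snd x\<^sub>0 + (u z - d)} t * prof t \<le> indicator X t * prof t" for t
  proof (cases "\<bar>t - snd x\<^sub>0\<bar> < r \<and> t \<le> snd x\<^sub>0 + (u z - d)")
    case True
    then have "x\<^sub>0 + (z, t - snd x\<^sub>0) \<in> interior E" using d by (intro column_below[OF z]) auto
    moreover have "x\<^sub>0 + (z, t - snd x\<^sub>0) = (fst x\<^sub>0 + z, t)" by (simp add: prod_eq_iff)
    ultimately have "t \<in> X" by (simp add: X_def)
    then show ?thesis using prof_bounds by (simp add: indicator_def)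
  next
    case False
    then have z: "indicator {..snd x\<^sub>0 + (u z - d)} t * prof t = 0" using prof_out[of t] by (auto simp: indicator_def)
    show ?thesis unfolding z using prof_bounds by simp
  qed
  have up: "indicator X t * prof t \<le> indicator {..snd x\<^sub>0 + (u z + d)} t * prof t" for t
  proof (cases "\<bar>t - snd x\<^sub>0\<bar> < r \<and> snd x\<^sub>0 + (u z + d) < t")
    case True
    then have "x\<^sub>0 + (z, t - snd x\<^sub>0) \<notin> interior E" using d by (intro column_above[OF z]) auto
    moreover have "x\<^sub>0 + (z, t - snd x\<^sub>0) = (fst x\<^sub>0 + z, t)" by (simp add: prod_eq_iff)
    ultimately have "t \<notin> X" by (simp add: X_def)
    then show ?thesis using prof_bounds by simp
  next
    case False
    then show ?thesis using prof_out[of t] prof_bounds[of t] by (auto simp: indicator_def)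
  qed
  have "G (u z - d) \<le> W (fst x\<^sub>0 + z)" unfolding G_def W
    by (intro integral_mono integrable_prof Xb low) auto
  moreover have "W (fst x\<^sub>0 + z) \<le> G (u z + d)" unfolding G_def W
    by (intro integral_mono integrable_prof Xb up) auto
  moreover have "G (u z - d) = G 0 + (u z - d)" "G (u z + d) = G 0 + (u z + d)"
    using d d0 by (intro G_affine; linarith)+
  ultimately show ?thesis by linarith
qed

text \<open>A lower bound for the integral of the bump at s = 1: the value 27/64 on the ball of half
  the radius.\<close>

definition bump_mass :: real where
  "bump_mass = 27 / 64 * unit_ball_vol (real DIM('a)) / 2 ^ DIM('a)"

definition grad_const :: real where
  "grad_const = 4 * C * 2 ^ DIM('a) / bump_mass\<^sup>2"

lemma bump_mass_pos: "0 < bump_mass" by (simp add: bump_mass_def)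

lemma bump_integral:
  assumes "0 < s" shows "bump_mass * s ^ DIM('a) \<le> (LINT p|lborel. bump c s (p::'a))" "integrable lborel (bump c s :: 'a \<Rightarrow> real)"
proof -
  have m: "bump c s \<in> borel_measurable borel" using C1c_measurable(1)[OF C1c_bump[OF assms]] .
  show int: "integrable lborel (bump c s :: 'a \<Rightarrow> real)"
  proof (rule integrable_bounded_support[where A="ball c s" and B=1])
    show "norm (bump c s p) \<le> 1" for p using bump_bounds[of c s p] by simp
    show "bump c s p = 0" if "p \<notin> ball c s" for p
      using that bump_outside[OF assms, of p c] by (simp add: dist_norm norm_minus_commute)
  qed (use m emeasure_lborel_ball_finite in auto)
  have fin: "emeasure lborel (ball c (s / 2)) < \<infinity>" by (rule emeasure_lborel_ball_finite)
  have "bump_mass * s ^ DIM('a) = 27 / 64 * measure lborel (ball c (s / 2))"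
    using assms by (simp add: bump_mass_def measure_def emeasure_ball power_divide)
  also have "\<dots> = (LINT p|lborel. 27 / 64 * (indicator (ball c (s / 2)) p :: real))" by simp
  also have "\<dots> \<le> (LINT p|lborel. bump c s p)"
  proof (rule integral_mono[OF _ int])
    show "integrable lborel (\<lambda>p. 27 / 64 * (indicator (ball c (s / 2)) p :: real))" using fin by simp
    show "27 / 64 * indicator (ball c (s / 2)) p \<le> bump c s p" for p
      using bump_inside[OF assms, of p c] bump_bounds(1)[of c s p]
      by (cases "p \<in> ball c (s / 2)") (auto simp: dist_norm norm_minus_commute)
  qed
  finally show "bump_mass * s ^ DIM('a) \<le> (LINT p|lborel. bump c s (p::'a))" .
qed

text \<open>Gauss--Green with a horizontal field becomes, column by column, an integral against W.
  The last two facts serve the affine model of W: the constant drops out since the gradient of the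
  bump has integral 0, and the linear part integrates by parts.\<close>

lemma gradient_identity:
  assumes s: "0 < s"
  shows "(LINT p|lborel. (bump_grad c s p \<bullet> a) * W p) = (LINT x|M. (bump c s (fst x) * prof (snd x)) * (a \<bullet> fst (nu x)))"
    and "integrable lborel (\<lambda>p. (bump_grad c s p \<bullet> a) * W p)"
    and "(LINT p|lborel. (bump_grad c s p \<bullet> a) * (\<beta> + a \<bullet> (p - c))) = - ((norm a)\<^sup>2 * (LINT p|lborel. bump c s p))"
    and "integrable lborel (\<lambda>p. (bump_grad c s p \<bullet> a) * (\<beta> + a \<bullet> (p - c)))"
proof -
  obtain prof' where C1p: "C1c prof prof'" using C1c_prof by blast
  note C1b = C1c_bump[OF s, of c]
  have gm: "bump_grad c s \<in> borel_measurable borel" using C1c_measurable(2)[OF C1b] .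
  have gam[measurable]: "(\<lambda>p. bump_grad c s p \<bullet> a) \<in> borel_measurable borel" by (intro borel_measurable_inner gm) simp
  have gab: "\<bar>bump_grad c s p \<bullet> a\<bar> \<le> 6 / s * norm a" for p
    using Cauchy_Schwarz_ineq2[of "bump_grad c s p" a] mult_right_mono[OF norm_bump_grad[OF s, of c p], of "norm a"] by simp
  have ga0: "bump_grad c s p \<bullet> a = 0" if "p \<notin> ball c s" for p
    using bump_grad_outside[OF s, of p c] that by (simp add: dist_norm norm_minus_commute)
  define F where "F x = indicator (interior E) x * (prof (snd x) * (bump_grad c s (fst x) \<bullet> a))" for x
  have Fm: "F \<in> borel_measurable borel"
  proof -
    have "(\<lambda>x::'a \<times> real. prof (snd x)) \<in> borel_measurable borel" "(\<lambda>x::'a \<times> real. bump_grad c s (fst x) \<bullet> a) \<in> borel_measurable borel"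
      by (rule measurable_compose[OF _ prof_measurable] measurable_compose[OF _ gam],
          intro borel_measurable_continuous_onI continuous_intros)+
    then show ?thesis unfolding F_def by (intro borel_measurable_times borel_measurable_indicator) auto
  qed
  have Fint: "integrable lborel F"
  proof (rule integrable_bounded_support[where A="ball (c, snd x\<^sub>0) (s + r)" and B="6 / s * norm a"])
    show "F \<in> borel_measurable lborel" using Fm by simp
    show "norm (F x) \<le> 6 / s * norm a" for x
    proof -
      have "\<bar>prof (snd x)\<bar> * \<bar>bump_grad c s (fst x) \<bullet> a\<bar> \<le> 1 * (6 / s * norm a)"
        using prof_bounds gab by (intro mult_mono) (auto simp: abs_le_iff)
      moreover have "0 \<le> 6 / s * norm a" using s by simp
      ultimately show ?thesis by (simp add: F_def abs_mult indicator_def)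
    qed
    show "F x = 0" if "x \<notin> ball (c, snd x\<^sub>0) (s + r)" for x
    proof -
      have "s + r \<le> norm (x - (c, snd x\<^sub>0))" using that by (simp only: mem_ball dist_norm norm_minus_commute not_less)
      also have "\<dots> \<le> norm (fst x - c) + \<bar>snd x - snd x\<^sub>0\<bar>" using norm_le_fst_snd[of "x - (c, snd x\<^sub>0)"] by simp
      finally have "s \<le> norm (fst x - c) \<or> r \<le> \<bar>snd x - snd x\<^sub>0\<bar>" by linarith
      then show ?thesis using prof_out[of "snd x"] bump_grad_outside[OF s, of "fst x" c] by (auto simp: F_def)
    qed
  qed (use emeasure_lborel_ball_finite in auto)
  then have Fint2: "integrable (lborel \<Otimes>\<^sub>M lborel) F" by (simp add: lborel_prod)
  have inner: "(LINT t|lborel. F (p, t)) = (bump_grad c s p \<bullet> a) * W p" for p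
  proof -
    have "(LINT t|lborel. F (p, t)) = (LINT t|lborel. (bump_grad c s p \<bullet> a) * (indicator (interior E) (p, t) * prof t))"
      by (intro Bochner_Integration.integral_cong) (auto simp: F_def)
    then show ?thesis by (simp add: W_def)
  qed
  have "(LINT p|lborel. (bump_grad c s p \<bullet> a) * W p) = (LINT p|lborel. (LINT t|lborel. F (p, t)))"
    by (simp only: inner)
  also have "\<dots> = (LINT x|lborel. F x)"
    using lborel_pair.integral_fst'[OF Fint2] by (simp add: lborel_prod)
  also have "\<dots> = (LINT x|M. (bump c s (fst x) * prof (snd x)) * (a \<bullet> fst (nu x)))"
    unfolding F_def by (rule Gauss_Green_horizontal[OF C1b C1p])
  finally show "(LINT p|lborel. (bump_grad c s p \<bullet> a) * W p) = (LINT x|M. (bump c s (fst x) * prof (snd x)) * (a \<bullet> fst (nu x)))" .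
  show "integrable lborel (\<lambda>p. (bump_grad c s p \<bullet> a) * W p)"
    using lborel_pair.integrable_fst'[OF Fint2] by (simp only: inner)
  have i1: "integrable lborel (\<lambda>p. bump_grad c s p \<bullet> a)"
    by (rule integrable_bounded_support[where A="ball c s" and B="6 / s * norm a"])
      (use gab ga0 emeasure_lborel_ball_finite in auto)
  have i2: "integrable lborel (\<lambda>p. (bump_grad c s p \<bullet> a) * (a \<bullet> (p - c)))"
  proof (rule integrable_bounded_support[where A="ball c s" and B="6 / s * norm a * (norm a * s)"])
    show "(\<lambda>p. (bump_grad c s p \<bullet> a) * (a \<bullet> (p - c))) \<in> borel_measurable lborel" by measurable
    show "norm ((bump_grad c s p \<bullet> a) * (a \<bullet> (p - c))) \<le> 6 / s * norm a * (norm a * s)" for p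
    proof (cases "p \<in> ball c s")
      case True
      have "\<bar>a \<bullet> (p - c)\<bar> \<le> norm a * norm (p - c)" by (rule Cauchy_Schwarz_ineq2)
      also have "\<dots> \<le> norm a * s" using True by (intro mult_left_mono) (auto simp: dist_norm norm_minus_commute)
      finally show ?thesis unfolding real_norm_def abs_mult using gab[of p] s by (intro mult_mono) auto
    qed (use ga0 s in simp)
  qed (use ga0 emeasure_lborel_ball_finite in auto)
  have eqf: "(bump_grad c s p \<bullet> a) * (\<beta> + a \<bullet> (p - c)) = \<beta> * (bump_grad c s p \<bullet> a) + (bump_grad c s p \<bullet> a) * (a \<bullet> (p - c))" for p
    by (simp add: algebra_simps)
  show "integrable lborel (\<lambda>p. (bump_grad c s p \<bullet> a) * (\<beta> + a \<bullet> (p - c)))"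
    unfolding eqf using i1 i2 by simp
  have z1: "(LINT p|lborel. bump_grad c s p \<bullet> a) = 0" by (rule C1c_integral_0[OF C1b])
  have "0 = (LINT p|lborel. (((p - c) \<bullet> a) *\<^sub>R bump_grad c s p + bump c s p *\<^sub>R a) \<bullet> a)"
    by (rule C1c_integral_0[OF C1c_mult_inner[OF C1b], symmetric])
  also have "\<dots> = (LINT p|lborel. (bump_grad c s p \<bullet> a) * (a \<bullet> (p - c)) + bump c s p * (norm a)\<^sup>2)"
    by (intro Bochner_Integration.integral_cong) (auto simp: inner_add_left inner_add_right inner_commute power2_norm_eq_inner)
  also have "\<dots> = (LINT p|lborel. (bump_grad c s p \<bullet> a) * (a \<bullet> (p - c))) + (norm a)\<^sup>2 * (LINT p|lborel. bump c s p)"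
    using i2 bump_integral(2)[OF s, of c] by (simp add: mult.commute)
  finally have z2: "(LINT p|lborel. (bump_grad c s p \<bullet> a) * (a \<bullet> (p - c))) = - ((norm a)\<^sup>2 * (LINT p|lborel. bump c s p))" by simp
  show "(LINT p|lborel. (bump_grad c s p \<bullet> a) * (\<beta> + a \<bullet> (p - c))) = - ((norm a)\<^sup>2 * (LINT p|lborel. bump c s p))"
    unfolding eqf using i1 i2 z1 z2 by simp
qed

lemma Zset_borel [measurable]: "Zset z s \<in> sets borel"
  unfolding Zset_def by (intro borel_open open_Collect_conj open_Collect_less continuous_intros)

lemma Zset_bounded: "bounded (Zset z s)"
proof (rule bounded_subset[of "ball (fst x\<^sub>0 + z, snd x\<^sub>0) (s + r)"])
  show "Zset z s \<subseteq> ball (fst x\<^sub>0 + z, snd x\<^sub>0) (s + r)"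
  proof
    fix x assume "x \<in> Zset z s"
    then have "norm (x - (fst x\<^sub>0 + z, snd x\<^sub>0)) < s + r"
      using norm_le_fst_snd[of "x - (fst x\<^sub>0 + z, snd x\<^sub>0)"] by (auto simp: Zset_def)
    then show "x \<in> ball (fst x\<^sub>0 + z, snd x\<^sub>0) (s + r)" by (simp only: mem_ball dist_norm norm_minus_commute)
  qed
qed simp

text \<open>The cone condition at the good point over z confines the boundary in the column to a
  ball of radius 2 s.\<close>

lemma Zset_mass:
  assumes z: "z \<in> P" and s: "0 < s" "s \<le> r" "ball z s \<subseteq> D"
  shows "measure M (Zset z s) \<le> C * 2 ^ DIM('a) * s ^ DIM('a)"
proof -
  obtain y where y: "y \<in> M0" "z = fst (y - x\<^sub>0)" using z by (auto simp: P_def)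
  have yS: "y \<in> S" using y(1) M0_MM by (auto simp: MM_def)
  have sub: "Zset z s \<inter> S \<subseteq> ball y (2 * s)"
  proof
    fix x assume x: "x \<in> Zset z s \<inter> S"
    then have n: "norm (fst x - fst y) < s" by (simp add: Zset_def y(2))
    then have "fst (x - x\<^sub>0) \<in> ball z s" by (simp add: y(2) dist_norm norm_minus_commute)
    then have "fst (x - x\<^sub>0) \<in> D" using s(3) by blast
    then have "x \<in> MM" using x by (simp add: MM_def cylinder_iff D_def Zset_def)
    from cone[OF this y(1)] have "norm (x - y) < 2 * s" using n s(1) norm_le_fst_snd[of "x - y"] by simp
    then show "x \<in> ball y (2 * s)" by (simp add: dist_norm norm_minus_commute)
  qed
  have "measure M (Zset z s) = measure M (Zset z s \<inter> S)"
    using AE_S by (intro measure_eq_AE) auto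
  also have "\<dots> \<le> measure M (ball y (2 * s))"
    using M_bounded[of "ball y (2 * s)"] by (intro measure_mono_fmeasurable sub fmeasurableI) auto
  also have "\<dots> \<le> C * (2 * s) ^ DIM('a)" using yS s r by (intro measure_ball_upper) auto
  finally show ?thesis by (simp add: power_mult_distrib mult.assoc)
qed

text \<open>Near a density point W is affine with slope a up to o(s). The linearisation error and
  the mass term in Young's inequality are both multiples of |a|^2 s^k, each made a quarter of the
  main term, so the constant is independent of a; only the range of s depends on z.\<close>

lemma gradient_point:
  assumes z: "z \<in> K" and G': "GDERIV u z :> a"
    and dens: "\<forall>\<epsilon>>0. \<exists>d>0. \<forall>s. 0 < s \<and> s < d \<longrightarrow> emeasure lborel ((- K) \<inter> ball z s) \<le> ennreal \<epsilon> * emeasure lborel (ball z s)"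
  shows "\<exists>d>0. \<forall>s. 0 < s \<and> s < d \<longrightarrow> s ^ DIM('a) * (norm a)\<^sup>2 \<le> grad_const * kap (Zset z s)"
proof (cases "a = 0")
  case True
  then show ?thesis using C bump_mass_pos kap_nonneg by (intro exI[of _ 1]) (simp add: grad_const_def)
next
  case False
  then have a: "0 < norm a" by simp
  define \<omega> where "\<omega> = unit_ball_vol (real DIM('a))"
  have \<omega>: "0 < \<omega>" by (simp add: \<omega>_def)
  have C0: "0 < C" using C by simp
  \<comment> \<open>Makes the linearisation error 18 \<eta> |a| \<omega> s^k a quarter of |a|^2
    \<open>bump_mass\<close> s^k.\<close>
  define \<eta> where "\<eta> = norm a * bump_mass / (72 * \<omega>)"
  have \<eta>: "0 < \<eta>" using a \<omega> bump_mass_pos by (simp add: \<eta>_def)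
  have zP: "z \<in> P" and zD: "norm z < r" using z K_P by (auto simp: K_def D_def)
  obtain d1 where d1: "0 < d1" "\<And>z'. norm (z' - z) < d1 \<Longrightarrow> norm (u z' - u z - (z' - z) \<bullet> a) \<le> \<eta> * norm (z' - z)"
    using G' \<eta> unfolding gderiv_def has_derivative_at_alt by blast
  obtain d2 where d2: "0 < d2" "\<And>s z'. 0 < s \<Longrightarrow> s < d2 \<Longrightarrow> norm (z' - z) \<le> s \<Longrightarrow> infdist z' P \<le> \<eta> * s"
    using density_infdist[OF dens \<eta>] by blast
  \<comment> \<open>In turn: differentiability, density, the ball inside D, and the vertical margin
    asked for by \<open>W_est\<close>.\<close>
  define d where "d = min (min d1 d2) (min (r - norm z) (r / (4 * (1 / 2 + 2 * \<eta>))))"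
  have d: "0 < d" using d1(1) d2(1) zD r \<eta> by (simp add: d_def)
  have "s ^ DIM('a) * (norm a)\<^sup>2 \<le> grad_const * kap (Zset z s)" if s: "0 < s" "s < d" for s
  proof -
    have s': "s < d1" "s < d2" "s < r - norm z" "s * (1 / 2 + 2 * \<eta>) \<le> r / 4"
      using s \<eta> by (auto simp: d_def less_divide_eq mult_ac)
    have sr: "s \<le> r" using s'(3) norm_ge_zero[of z] by linarith
    have ballD: "ball z s \<subseteq> D"
    proof
      fix w assume "w \<in> ball z s"
      then show "w \<in> D" using s'(3) norm_triangle_ineq2[of w z] by (simp add: D_def dist_norm norm_minus_commute)
    qed
    define c where "c = fst x\<^sub>0 + z"
    define sk where "sk = s ^ DIM('a)"
    have sk: "0 < sk" using s by (simp add: sk_def)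
    define \<beta> where "\<beta> = G 0 + u z"
    \<comment> \<open>2 \<eta> s from the uncertainty of the column, \<eta> s from the
      differentiability of u.\<close>
    have Werr: "\<bar>W p - (\<beta> + a \<bullet> (p - c))\<bar> \<le> 3 * \<eta> * s" if p: "p \<in> ball c s" for p
    proof -
      define z' where "z' = p - fst x\<^sub>0"
      have zz: "norm (z' - z) < s" using p by (simp add: z'_def c_def dist_norm norm_minus_commute algebra_simps)
      have z'D: "z' \<in> D" using ballD zz by (auto simp: dist_norm norm_minus_commute)
      have i: "infdist z' P < 2 * \<eta> * s"
      proof -
        have "0 < \<eta> * s" using \<eta> s by simp
        moreover have "infdist z' P \<le> \<eta> * s" using d2(2)[OF s(1) s'(2), of z'] zz by simp
        ultimately show ?thesis by simp
      qed
      have lin: "\<bar>u z' - u z - (z' - z) \<bullet> a\<bar> \<le> \<eta> * s"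
      proof -
        have "\<eta> * norm (z' - z) \<le> \<eta> * s" using zz \<eta> by (intro mult_left_mono) auto
        moreover have "\<bar>u z' - u z - (z' - z) \<bullet> a\<bar> \<le> \<eta> * norm (z' - z)" using d1(2)[of z'] zz s'(1) by simp
        ultimately show ?thesis by linarith
      qed
      have "\<bar>u z'\<bar> \<le> 1 / 2 * r + 1 / 2 * s"
        using lipD[of z' z] u_on_P[OF zP] zz by linarith
      then have "\<bar>u z'\<bar> + 2 * \<eta> * s \<le> 3 / 4 * r" using s'(4) by (simp add: algebra_simps)
      from W_est[OF z'D i this] have "\<bar>W p - (G 0 + u z')\<bar> \<le> 2 * \<eta> * s" by (simp add: z'_def)
      moreover have "(z' - z) \<bullet> a = a \<bullet> (p - c)" by (simp add: z'_def c_def inner_commute diff_diff_eq)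
      ultimately show ?thesis using lin by (simp add: \<beta>_def abs_le_iff)
    qed
    note id = gradient_identity[OF s(1), of c a]
    have vol: "measure lborel (ball c s) = \<omega> * sk"
      using s by (simp add: measure_def emeasure_ball \<omega>_def sk_def)
    have E1: "\<bar>(LINT p|lborel. (bump_grad c s p \<bullet> a) * W p) - (LINT p|lborel. (bump_grad c s p \<bullet> a) * (\<beta> + a \<bullet> (p - c)))\<bar> \<le> 18 * \<eta> * norm a * \<omega> * sk"
    proof -
      have "\<bar>(LINT p|lborel. (bump_grad c s p \<bullet> a) * W p) - (LINT p|lborel. (bump_grad c s p \<bullet> a) * (\<beta> + a \<bullet> (p - c)))\<bar>
        = \<bar>LINT p|lborel. (bump_grad c s p \<bullet> a) * W p - (bump_grad c s p \<bullet> a) * (\<beta> + a \<bullet> (p - c))\<bar>"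
        by (simp only: Bochner_Integration.integral_diff[OF id(2) id(4)])
      also have "\<dots> \<le> (LINT p|lborel. \<bar>(bump_grad c s p \<bullet> a) * W p - (bump_grad c s p \<bullet> a) * (\<beta> + a \<bullet> (p - c))\<bar>)" by simp
      also have "\<dots> \<le> (LINT p|lborel. 18 * \<eta> * norm a * indicator (ball c s) p)"
      proof (rule integral_mono)
        show "integrable lborel (\<lambda>p. \<bar>(bump_grad c s p \<bullet> a) * W p - (bump_grad c s p \<bullet> a) * (\<beta> + a \<bullet> (p - c))\<bar>)"
          by (rule integrable_abs[OF Bochner_Integration.integrable_diff[OF id(2) id(4)]])
        show "integrable lborel (\<lambda>p. 18 * \<eta> * norm a * indicator (ball c s) p)"
          by (intro integrable_mult_right integrable_real_indicator emeasure_lborel_ball_finite) simp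
        fix p
        show "\<bar>(bump_grad c s p \<bullet> a) * W p - (bump_grad c s p \<bullet> a) * (\<beta> + a \<bullet> (p - c))\<bar> \<le> 18 * \<eta> * norm a * indicator (ball c s) p"
        proof (cases "p \<in> ball c s")
          case True
          have "\<bar>bump_grad c s p \<bullet> a\<bar> \<le> 6 / s * norm a"
            using Cauchy_Schwarz_ineq2[of "bump_grad c s p" a] mult_right_mono[OF norm_bump_grad[OF s(1), of c p], of "norm a"] by simp
          then have "\<bar>bump_grad c s p \<bullet> a\<bar> * \<bar>W p - (\<beta> + a \<bullet> (p - c))\<bar> \<le> 6 / s * norm a * (3 * \<eta> * s)"
            using Werr[OF True] s by (intro mult_mono) auto
          also have "\<dots> = 18 * \<eta> * norm a" using s by simp
          finally show ?thesis using True by (simp add: abs_mult right_diff_distrib[symmetric])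
        next
          case False
          then have "bump_grad c s p = 0" using bump_grad_outside[OF s(1), of p c] by (simp add: dist_norm norm_minus_commute)
          then show ?thesis using False by simp
        qed
      qed
      also have "\<dots> = 18 * \<eta> * norm a * \<omega> * sk" by (simp add: vol)
      finally show ?thesis .
    qed
    \<comment> \<open>Proportional to |a|, so that the mass term is another quarter of the main
      term.\<close>
    define \<theta> where "\<theta> = norm a * bump_mass / (2 * C * 2 ^ DIM('a))"
    have \<theta>: "0 < \<theta>" using a bump_mass_pos C0 by (simp add: \<theta>_def)
    have E2: "\<bar>LINT p|lborel. (bump_grad c s p \<bullet> a) * W p\<bar> \<le> norm a * (\<theta> / 2 * (C * 2 ^ DIM('a) * sk) + kap (Zset z s) / \<theta>)"
    proof -
      define f where "f x = (bump c s (fst x) * prof (snd x)) *\<^sub>R a" for x :: "'a \<times> real"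
      obtain prof' where "C1c prof prof'" using C1c_prof by blast
      from C1c_measurable(1)[OF C1c_prod[OF C1c_bump[OF s(1), of c] this]]
      have fm: "f \<in> borel_measurable borel" unfolding f_def by (intro borel_measurable_scaleR) auto
      have "\<bar>LINT p|lborel. (bump_grad c s p \<bullet> a) * W p\<bar> = \<bar>LINT x|M. f x \<bullet> fst (nu x)\<bar>"
        unfolding id(1) by (intro arg_cong[where f=abs] Bochner_Integration.integral_cong) (auto simp: f_def)
      also have "\<dots> \<le> norm a * (\<theta> / 2 * measure M (Zset z s) + kap (Zset z s) / \<theta>)"
      proof (rule horizontal_est[OF fm])
        show "norm (f x) \<le> norm a" for x
        proof -
          have "0 \<le> bump c s (fst x) * prof (snd x)" "bump c s (fst x) * prof (snd x) \<le> 1"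
            using bump_bounds[of c s "fst x"] prof_bounds[of "snd x"] by (auto intro: mult_le_one)
          then have "\<bar>bump c s (fst x) * prof (snd x)\<bar> * norm a \<le> 1 * norm a" by (intro mult_right_mono) auto
          then show ?thesis by (simp add: f_def)
        qed
        show "f x = 0" if "x \<notin> Zset z s" for x
          using that bump_outside[OF s(1), of "fst x" c] prof_out[of "snd x"]
          by (auto simp: f_def Zset_def c_def not_less)
      qed (use Zset_bounded \<theta> in auto)
      also have "\<dots> \<le> norm a * (\<theta> / 2 * (C * 2 ^ DIM('a) * sk) + kap (Zset z s) / \<theta>)"
        using Zset_mass[OF zP s(1) sr ballD] \<theta> by (intro mult_left_mono add_right_mono) (auto simp: sk_def)
      finally show ?thesis .
    qed
    have "(norm a)\<^sup>2 * (bump_mass * sk) \<le> (norm a)\<^sup>2 * (LINT p|lborel. bump c s p)"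
      using bump_integral(1)[OF s(1), of c] by (intro mult_left_mono) (auto simp: sk_def)
    also have "\<dots> = - (LINT p|lborel. (bump_grad c s p \<bullet> a) * (\<beta> + a \<bullet> (p - c)))" by (simp add: id(3))
    also have "\<dots> \<le> 18 * \<eta> * norm a * \<omega> * sk + norm a * (\<theta> / 2 * (C * 2 ^ DIM('a) * sk) + kap (Zset z s) / \<theta>)"
      using E1 E2 by linarith
    finally have main: "norm a * (norm a * (bump_mass * sk)) \<le> norm a * (18 * \<eta> * \<omega> * sk + \<theta> / 2 * (C * 2 ^ DIM('a) * sk) + kap (Zset z s) / \<theta>)"
      by (simp add: power2_eq_square algebra_simps)
    have t1: "18 * \<eta> * \<omega> * sk = norm a * bump_mass * sk / 4" using \<omega> by (simp add: \<eta>_def)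
    have t2: "\<theta> / 2 * (C * 2 ^ DIM('a) * sk) = norm a * bump_mass * sk / 4" using C0 by (simp add: \<theta>_def)
    have "norm a * (bump_mass * sk) \<le> norm a * bump_mass * sk / 4 + norm a * bump_mass * sk / 4 + kap (Zset z s) / \<theta>"
      using main a unfolding t1 t2 by (simp only: mult_le_cancel_left_pos)
    then have "norm a * bump_mass * sk / 2 \<le> kap (Zset z s) / \<theta>" unfolding mult.assoc by linarith
    then have "norm a * bump_mass * sk / 2 * \<theta> \<le> kap (Zset z s)" using \<theta> by (simp add: le_divide_eq)
    then have "sk * (norm a)\<^sup>2 * (bump_mass\<^sup>2 / (4 * C * 2 ^ DIM('a))) \<le> kap (Zset z s)"
      using C0 by (simp add: \<theta>_def power2_eq_square mult_ac)
    then have "grad_const * (sk * (norm a)\<^sup>2 * (bump_mass\<^sup>2 / (4 * C * 2 ^ DIM('a)))) \<le> grad_const * kap (Zset z s)"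
      using C0 by (intro mult_left_mono) (auto simp: grad_const_def)
    moreover have "grad_const * (bump_mass\<^sup>2 / (4 * C * 2 ^ DIM('a))) = 1"
      using C0 bump_mass_pos by (simp add: grad_const_def)
    ultimately have "sk * (norm a)\<^sup>2 \<le> grad_const * kap (Zset z s)"
      by (simp only: mult.left_commute[of grad_const] mult_1_right)
    then show ?thesis by (simp add: sk_def)
  qed
  then show ?thesis using d by blast
qed

end

section \<open>Integrating the pointwise gradient bound\<close>

context approx
begin

definition grad_total :: real where
  "grad_total = grad_const * unit_ball_vol (real DIM('a)) * MH_const * 13 ^ DIM('a) + shadow_vol"

lemma grad_const_pos: "0 < grad_const"
  using C bump_mass_pos by (simp add: grad_const_def)

lemma grad_total_pos: "0 < grad_total"
  using grad_const_pos MH_const_pos shadow_vol_pos by (simp add: grad_total_def add_nonneg_pos)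

text \<open>The tilt over the column at z as a function on the product space; the indicator of the
  large cylinder keeps its integral over z bounded by the excess.\<close>

definition slice :: "real \<Rightarrow> 'a \<times> ('a \<times> real) \<Rightarrow> ennreal" where
  "slice s w = indicator {w. norm (fst (snd w) - (fst x\<^sub>0 + fst w)) < s \<and> \<bar>snd (snd w) - snd x\<^sub>0\<bar> < r} w
     * (indicator (cylinder x\<^sub>0 (13 * r)) (snd w) * ennreal (tilt (snd w)))"

lemma slice_measurable: "slice s \<in> borel_measurable (lborel \<Otimes>\<^sub>M M)"
proof -
  have eq: "borel_measurable (lborel \<Otimes>\<^sub>M M) = borel_measurable (borel :: ('a \<times> ('a \<times> real)) measure)"
  proof (rule measurable_cong_sets)
    have "sets (lborel \<Otimes>\<^sub>M M) = sets ((borel :: 'a measure) \<Otimes>\<^sub>M (borel :: ('a \<times> real) measure))"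
      by (rule sets_pair_measure_cong) (simp_all add: sets_M)
    then show "sets (lborel \<Otimes>\<^sub>M M) = sets (borel :: ('a \<times> ('a \<times> real)) measure)" by (simp only: borel_prod)
  qed simp
  have o: "open {w :: 'a \<times> ('a \<times> real). norm (fst (snd w) - (fst x\<^sub>0 + fst w)) < s \<and> \<bar>snd (snd w) - snd x\<^sub>0\<bar> < r}"
    by (intro open_Collect_conj open_Collect_less continuous_intros)
  have m: "(snd :: 'a \<times> ('a \<times> real) \<Rightarrow> _) \<in> borel_measurable borel"
    by (intro borel_measurable_continuous_onI continuous_intros)
  have t: "(\<lambda>x. indicator (cylinder x\<^sub>0 (13 * r)) x * ennreal (tilt x)) \<in> borel_measurable borel"
    using cylinder_borel by (intro borel_measurable_times_ennreal borel_measurable_indicator) auto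
  show ?thesis unfolding eq slice_def
    by (intro borel_measurable_times_ennreal borel_measurable_indicator borel_open o measurable_compose[OF m t])
qed

definition slice_avg :: "real \<Rightarrow> 'a \<Rightarrow> ennreal" where
  "slice_avg s z = ennreal (grad_const / s ^ DIM('a)) * (\<integral>\<^sup>+x. slice s (z, x) \<partial>M)"

lemma slice_avg_measurable: "slice_avg s \<in> borel_measurable lborel"
  unfolding slice_avg_def
  by (intro borel_measurable_times_ennreal borel_measurable_const
      sigma_finite_measure.borel_measurable_nn_integral_fst[OF sigma_finite_M slice_measurable])

lemma slice_avg_eq:
  assumes "z \<in> D" "0 < s" "s \<le> r"
  shows "slice_avg s z = ennreal (grad_const / s ^ DIM('a)) * ennreal (kap (Zset z s))"
proof -
  have "slice s (z, x) = ennreal (tilt x) * indicator (Zset z s) x" for x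
  proof (cases "x \<in> Zset z s")
    case True
    have "norm (fst x - fst x\<^sub>0) < 13 * r"
    proof -
      have "norm (fst x - fst x\<^sub>0) \<le> norm (fst x - (fst x\<^sub>0 + z)) + norm z"
        using norm_triangle_ineq[of "fst x - (fst x\<^sub>0 + z)" z] by (simp add: algebra_simps)
      then show ?thesis using True assms r by (simp add: Zset_def D_def)
    qed
    then have "x \<in> cylinder x\<^sub>0 (13 * r)" using True r by (simp add: cylinder_iff Zset_def)
    then show ?thesis using True by (simp add: slice_def Zset_def)
  qed (auto simp: slice_def Zset_def indicator_def)
  then have "(\<integral>\<^sup>+x. slice s (z, x) \<partial>M) = ennreal (kap (Zset z s))"
    by (simp only: ennreal_kap[OF Zset_bounded Zset_borel])
  then show ?thesis by (simp only: slice_avg_def)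
qed

text \<open>By Fubini each boundary point is counted by the z in a ball of radius s, whose volume
  \<omega> s^k cancels the normalisation s^(-k).\<close>

lemma slice_avg_integral:
  assumes "0 < s"
  shows "(\<integral>\<^sup>+z. slice_avg s z \<partial>lborel)
    \<le> ennreal (grad_const * unit_ball_vol (real DIM('a)) * MH_const * 13 ^ DIM('a) * e * r ^ DIM('a))"
proof -
  interpret sM: sigma_finite_measure M by (rule sigma_finite_M)
  interpret PP: pair_sigma_finite lborel M ..
  define \<omega> where "\<omega> = unit_ball_vol (real DIM('a))"
  have \<omega>: "0 < \<omega>" by (simp add: \<omega>_def)
  have inner: "(\<integral>\<^sup>+z. slice s (z, x) \<partial>lborel)
    \<le> ennreal (\<omega> * s ^ DIM('a)) * (ennreal (tilt x) * indicator (cylinder x\<^sub>0 (13 * r)) x)" for x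
  proof -
    have "(\<integral>\<^sup>+z. slice s (z, x) \<partial>lborel)
      \<le> (\<integral>\<^sup>+z. (ennreal (tilt x) * indicator (cylinder x\<^sub>0 (13 * r)) x) * indicator (ball (fst x - fst x\<^sub>0) s) z \<partial>lborel)"
    proof (rule nn_integral_mono)
      fix z
      show "slice s (z, x) \<le> (ennreal (tilt x) * indicator (cylinder x\<^sub>0 (13 * r)) x) * indicator (ball (fst x - fst x\<^sub>0) s) z"
        by (auto simp: slice_def indicator_def dist_norm diff_diff_eq)
    qed
    also have "\<dots> = (ennreal (tilt x) * indicator (cylinder x\<^sub>0 (13 * r)) x) * emeasure lborel (ball (fst x - fst x\<^sub>0) s)"
      by (rule nn_integral_cmult_indicator) simp
    also have "emeasure lborel (ball (fst x - fst x\<^sub>0) s) = ennreal (\<omega> * s ^ DIM('a))"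
      using assms by (simp add: emeasure_ball \<omega>_def)
    finally show ?thesis by (simp only: mult.commute)
  qed
  have "(\<integral>\<^sup>+z. (\<integral>\<^sup>+x. slice s (z, x) \<partial>M) \<partial>lborel) = (\<integral>\<^sup>+x. (\<integral>\<^sup>+z. slice s (z, x) \<partial>lborel) \<partial>M)"
    by (rule PP.Fubini'[symmetric]) (simp add: slice_measurable)
  also have "\<dots> \<le> (\<integral>\<^sup>+x. ennreal (\<omega> * s ^ DIM('a)) * (ennreal (tilt x) * indicator (cylinder x\<^sub>0 (13 * r)) x) \<partial>M)"
    by (intro nn_integral_mono inner)
  also have "\<dots> = ennreal (\<omega> * s ^ DIM('a)) * (\<integral>\<^sup>+x\<in>cylinder x\<^sub>0 (13 * r). ennreal (tilt x) \<partial>M)"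
    by (rule nn_integral_cmult, intro borel_measurable_times_ennreal borel_measurable_indicator)
      (auto simp: measurable_cong_sets[OF sets_M refl] sets_M cylinder_borel)
  also have "\<dots> = ennreal (\<omega> * s ^ DIM('a)) * ennreal (kap (cylinder x\<^sub>0 (13 * r)))"
    by (simp only: ennreal_kap[OF bounded_cylinder cylinder_borel])
  finally have Q: "(\<integral>\<^sup>+z. (\<integral>\<^sup>+x. slice s (z, x) \<partial>M) \<partial>lborel)
    \<le> ennreal (\<omega> * s ^ DIM('a)) * ennreal (kap (cylinder x\<^sub>0 (13 * r)))" .
  have "(\<integral>\<^sup>+z. slice_avg s z \<partial>lborel) = ennreal (grad_const / s ^ DIM('a)) * (\<integral>\<^sup>+z. (\<integral>\<^sup>+x. slice s (z, x) \<partial>M) \<partial>lborel)"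
    unfolding slice_avg_def
    by (intro nn_integral_cmult sM.borel_measurable_nn_integral_fst slice_measurable)
  also have "\<dots> \<le> ennreal (grad_const / s ^ DIM('a)) * (ennreal (\<omega> * s ^ DIM('a)) * ennreal (kap (cylinder x\<^sub>0 (13 * r))))"
    by (rule mult_left_mono[OF Q]) simp
  also have "\<dots> = ennreal (grad_const * \<omega> * kap (cylinder x\<^sub>0 (13 * r)))"
    using assms grad_const_pos \<omega> kap_nonneg by (simp add: ennreal_mult[symmetric])
  also have "\<dots> \<le> ennreal (grad_const * \<omega> * (MH_const * (13 * r) ^ DIM('a) * e))"
    using grad_const_pos \<omega> kap_big by (intro ennreal_leI mult_left_mono) auto
  finally show ?thesis by (simp add: \<omega>_def power_mult_distrib mult_ac)
qed

text \<open>The pointwise bound holds only for s below a threshold depending on z, so it is stated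
  as a lower limit, ready for Fatou's lemma.\<close>

lemma gradient_AE: "AE z in lborel. z \<in> K \<longrightarrow>
  ennreal ((norm (gradient u z))\<^sup>2) \<le> liminf (\<lambda>n. slice_avg (1 / real (Suc n)) z)"
proof -
  have "- K \<in> sets borel" using K_borel by (simp add: borel_comp)
  from lborel_doubling.density_zero_outside[OF this] Rademacher
  show ?thesis
  proof eventually_elim
    fix z
    assume dens: "z \<in> UNIV - - K \<longrightarrow> (\<forall>\<epsilon>>0. \<exists>d>0. \<forall>s. 0 < s \<and> s < d \<longrightarrow>
      emeasure lborel (- K \<inter> ball z s) \<le> ennreal \<epsilon> * emeasure lborel (ball z s))"
    assume "\<exists>G. GDERIV u z :> G"
    then obtain a where a: "GDERIV u z :> a" by blast
    show "z \<in> K \<longrightarrow> ennreal ((norm (gradient u z))\<^sup>2) \<le> liminf (\<lambda>n. slice_avg (1 / real (Suc n)) z)"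
    proof
      assume z: "z \<in> K"
      have "z \<in> UNIV - - K" using z by simp
      from gradient_point[OF z a mp[OF dens this]]
      obtain d where d: "0 < d" "\<And>s. 0 < s \<Longrightarrow> s < d \<Longrightarrow> s ^ DIM('a) * (norm a)\<^sup>2 \<le> grad_const * kap (Zset z s)"
        by auto
      have "eventually (\<lambda>n. 1 / real (Suc n) < min d r) sequentially"
        using d(1) r by (intro order_tendstoD(2)[OF LIMSEQ_Suc[OF lim_const_over_n]]) auto
      then have "eventually (\<lambda>n. ennreal ((norm a)\<^sup>2) \<le> slice_avg (1 / real (Suc n)) z) sequentially"
      proof eventually_elim
        fix n assume n: "1 / real (Suc n) < min d r"
        define s where "s = 1 / real (Suc n)"
        have s: "0 < s" "s < d" "s \<le> r" using n by (auto simp: s_def)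
        have "(norm a)\<^sup>2 \<le> grad_const / s ^ DIM('a) * kap (Zset z s)"
          using d(2)[OF s(1,2)] s(1) by (simp add: field_simps)
        then have "ennreal ((norm a)\<^sup>2) \<le> ennreal (grad_const / s ^ DIM('a) * kap (Zset z s))" by (rule ennreal_leI)
        also have "\<dots> = slice_avg s z"
          using slice_avg_eq[of z s] z s grad_const_pos kap_nonneg by (simp add: K_def ennreal_mult[symmetric])
        finally show "ennreal ((norm a)\<^sup>2) \<le> slice_avg (1 / real (Suc n)) z" by (simp only: s_def)
      qed
      then have "ennreal ((norm a)\<^sup>2) \<le> liminf (\<lambda>n. slice_avg (1 / real (Suc n)) z)" by (rule Liminf_bounded)
      then show "ennreal ((norm (gradient u z))\<^sup>2) \<le> liminf (\<lambda>n. slice_avg (1 / real (Suc n)) z)"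
        by (simp only: gradient_unique[OF a])
    qed
  qed
qed

text \<open>Outside the shadow A Fatou applies; over A the integrand is at most 1 and the volume is
  of order e r^k.\<close>

lemma gradient_L2: "(\<integral>\<^sup>+z\<in>D. ennreal ((norm (gradient u z))\<^sup>2) \<partial>lborel) \<le> ennreal (grad_total * e * r ^ DIM('a))"
proof -
  define F where "F z = liminf (\<lambda>n. slice_avg (1 / real (Suc n)) z)" for z
  have Fm: "F \<in> borel_measurable lborel"
    unfolding F_def by (intro borel_measurable_liminf slice_avg_measurable)
  define c where "c = grad_const * unit_ball_vol (real DIM('a)) * MH_const * 13 ^ DIM('a) * e * r ^ DIM('a)"
  have c: "0 \<le> c" using grad_const_pos MH_const_pos e_nonneg r by (simp add: c_def)
  have "(\<integral>\<^sup>+z. F z \<partial>lborel) \<le> liminf (\<lambda>n. \<integral>\<^sup>+z. slice_avg (1 / real (Suc n)) z \<partial>lborel)"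
    unfolding F_def by (intro nn_integral_liminf slice_avg_measurable)
  also have "\<dots> \<le> liminf (\<lambda>n::nat. ennreal c)"
    unfolding c_def by (intro Liminf_mono always_eventually allI slice_avg_integral) simp
  also have "\<dots> = ennreal c" by (simp add: Liminf_const)
  finally have F: "(\<integral>\<^sup>+z. F z \<partial>lborel) \<le> ennreal c" .
  have AE2: "AE z in lborel. norm (gradient u z) \<le> 1 / 2"
    using Rademacher
  proof eventually_elim
    fix z assume "\<exists>G. GDERIV u z :> G"
    then show "norm (gradient u z) \<le> 1 / 2" using norm_gradient_le gradient_unique by auto
  qed
  have "(\<integral>\<^sup>+z\<in>D. ennreal ((norm (gradient u z))\<^sup>2) \<partial>lborel) \<le> (\<integral>\<^sup>+z. F z + indicator A z \<partial>lborel)"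
  proof (rule nn_integral_mono_AE)
    show "AE z in lborel. ennreal ((norm (gradient u z))\<^sup>2) * indicator D z \<le> F z + indicator A z"
      using gradient_AE AE2
    proof eventually_elim
      fix z
      assume K: "z \<in> K \<longrightarrow> ennreal ((norm (gradient u z))\<^sup>2) \<le> liminf (\<lambda>n. slice_avg (1 / real (Suc n)) z)"
        and g: "norm (gradient u z) \<le> 1 / 2"
      show "ennreal ((norm (gradient u z))\<^sup>2) * indicator D z \<le> F z + indicator A z"
      proof (cases "z \<in> A")
        case True
        have "(norm (gradient u z))\<^sup>2 \<le> 1" using g by (intro power_le_one) auto
        then have "ennreal ((norm (gradient u z))\<^sup>2) * indicator D z \<le> 1"
          by (simp add: indicator_def ennreal_le_1)
        also have "\<dots> \<le> F z + indicator A z" using True by simp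
        finally show ?thesis .
      next
        case False
        then show ?thesis using K by (simp add: K_def F_def indicator_def)
      qed
    qed
  qed
  also have "\<dots> = (\<integral>\<^sup>+z. F z \<partial>lborel) + emeasure lborel A"
    using Fm A_open by (subst nn_integral_add) auto
  also have "\<dots> \<le> ennreal c + ennreal (shadow_vol * e * r ^ DIM('a))" using F A_vol by (rule add_mono)
  also have "\<dots> = ennreal (grad_total * e * r ^ DIM('a))"
    using c shadow_vol_pos e_nonneg r by (simp add: ennreal_plus[symmetric] c_def grad_total_def algebra_simps del: ennreal_plus)
  finally show ?thesis .
qed

end

subsection \<open>The height bound\<close>

context lipschitz_fun
begin

lemma AE_dir_deriv_translate: "AE y in lborel. has_dir_deriv f v (y + c) (dir_deriv f v (y + c))"
proof -
  obtain N where N: "N \<in> null_sets lborel" "\<And>y. y \<in> space lborel - N \<Longrightarrow> has_dir_deriv f v y (dir_deriv f v y)"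
    using AE_E3[OF AE_has_dir_deriv] by blast
  have "{y. y - - c \<in> N} \<in> null_sets lborel" by (rule null_sets_translation[OF N(1)])
  then show ?thesis by (rule AE_I') (use N(2) in auto)
qed

text \<open>The derivative in direction v exists only almost everywhere, so a single segment may
  miss it. After integration over B the function of t is differentiable everywhere by dominated
  convergence, and the mean value theorem applies.\<close>

lemma integral_segment:
  assumes B: "bounded B" and Bm[measurable]: "B \<in> sets borel"
  shows "\<exists>\<tau>. 0 < \<tau> \<and> \<tau> < 1 \<and> (LINT y|lborel. indicator B y * (f (y + v) - f y))
    = (LINT y|lborel. indicator B y * dir_deriv f v (y + \<tau> *\<^sub>R v))"
proof -
  have fin: "emeasure lborel B < \<infinity>" by (rule emeasure_bounded_finite[OF B])
  define H where "H t = (LINT y|lborel. indicator B y * (f (y + t *\<^sub>R v) - f y))" for t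
  have int: "integrable lborel (\<lambda>y. indicator B y * (f (y + t *\<^sub>R v) - f y))" for t
  proof (rule integrable_bounded_support[where A=B and B="L * norm (t *\<^sub>R v)"])
    show "(\<lambda>y. indicator B y * (f (y + t *\<^sub>R v) - f y)) \<in> borel_measurable lborel" by measurable
    show "norm (indicator B y * (f (y + t *\<^sub>R v) - f y)) \<le> L * norm (t *\<^sub>R v)" for y
      using lipD[of "y + t *\<^sub>R v" y] L_nonneg by (auto simp: indicator_def)
  qed (use fin in auto)
  have "DERIV H t :> (LINT y|lborel. indicator B y * dir_deriv f v (y + t *\<^sub>R v))" for t
    unfolding DERIV_def tendsto_at_iff_sequentially
  proof (intro allI impI)
    fix X :: "nat \<Rightarrow> real" assume X: "\<forall>i. X i \<in> UNIV - {0}" "X \<longlonglongrightarrow> 0"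
    have eq: "(H (t + X n) - H t) / X n = (LINT y|lborel. indicator B y * dir_quot f v (X n) (y + t *\<^sub>R v))" for n
    proof -
      have "H (t + X n) - H t = (LINT y|lborel. indicator B y * (f (y + (t + X n) *\<^sub>R v) - f y) - indicator B y * (f (y + t *\<^sub>R v) - f y))"
        unfolding H_def by (rule Bochner_Integration.integral_diff[OF int int, symmetric])
      also have "\<dots> = (LINT y|lborel. X n * (indicator B y * dir_quot f v (X n) (y + t *\<^sub>R v)))"
        using X(1) by (intro Bochner_Integration.integral_cong) (auto simp: dir_quot_def indicator_def scaleR_add_left add.assoc)
      finally show ?thesis using X(1) by simp
    qed
    have "(\<lambda>n. LINT y|lborel. indicator B y * dir_quot f v (X n) (y + t *\<^sub>R v))
      \<longlonglongrightarrow> (LINT y|lborel. indicator B y * dir_deriv f v (y + t *\<^sub>R v))"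
    proof (rule integral_dominated_convergence[where w="\<lambda>y. indicator B y * (L * norm v)"])
      show "integrable lborel (\<lambda>y. indicator B y * (L * norm v))" using fin by simp
      show "AE y in lborel. norm (indicator B y * dir_quot f v (X n) (y + t *\<^sub>R v)) \<le> indicator B y * (L * norm v)" for n
        using dir_quot_bound by (simp add: abs_mult indicator_def)
      show "AE y in lborel. (\<lambda>n. indicator B y * dir_quot f v (X n) (y + t *\<^sub>R v)) \<longlonglongrightarrow> indicator B y * dir_deriv f v (y + t *\<^sub>R v)"
        using AE_dir_deriv_translate[of v "t *\<^sub>R v"]
      proof eventually_elim
        fix y assume "has_dir_deriv f v (y + t *\<^sub>R v) (dir_deriv f v (y + t *\<^sub>R v))"
        then have "((\<lambda>s. dir_quot f v s (y + t *\<^sub>R v)) \<circ> X) \<longlonglongrightarrow> dir_deriv f v (y + t *\<^sub>R v)"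
          using X unfolding has_dir_deriv_def tendsto_at_iff_sequentially by blast
        then show "(\<lambda>n. indicator B y * dir_quot f v (X n) (y + t *\<^sub>R v)) \<longlonglongrightarrow> indicator B y * dir_deriv f v (y + t *\<^sub>R v)"
          unfolding o_def by (rule tendsto_mult_left)
      qed
    qed measurable
    then show "((\<lambda>h. (H (t + h) - H t) / h) \<circ> X) \<longlonglongrightarrow> (LINT y|lborel. indicator B y * dir_deriv f v (y + t *\<^sub>R v))"
      by (simp only: o_def eq)
  qed
  then obtain \<tau> where \<tau>: "0 < \<tau>" "\<tau> < 1" "H 1 - H 0 = (1 - 0) * (LINT y|lborel. indicator B y * dir_deriv f v (y + \<tau> *\<^sub>R v))"
    using MVT2[of 0 1 H "\<lambda>t. LINT y|lborel. indicator B y * dir_deriv f v (y + t *\<^sub>R v)"] by auto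
  moreover have "H 0 = 0" by (simp add: H_def)
  moreover have "H 1 = (LINT y|lborel. indicator B y * (f (y + v) - f y))" by (simp add: H_def)
  ultimately show ?thesis by (intro exI[of _ \<tau>]) simp
qed

end

context approx
begin

lemma dir_deriv_L2:
  assumes v: "v \<noteq> 0"
  shows "(\<integral>\<^sup>+y\<in>D. ennreal ((dir_deriv u v y)\<^sup>2) \<partial>lborel) \<le> ennreal ((norm v)\<^sup>2 * (grad_total * e * r ^ DIM('a)))"
proof -
  have [measurable]: "D \<in> sets borel" by (simp add: D_def)
  have "(\<integral>\<^sup>+y. ennreal ((dir_deriv u v y / norm v)\<^sup>2) * indicator D y \<partial>lborel)
    \<le> (\<integral>\<^sup>+y\<in>D. ennreal ((norm (gradient u y))\<^sup>2) \<partial>lborel)"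
  proof (rule nn_integral_mono_AE)
    show "AE y in lborel. ennreal ((dir_deriv u v y / norm v)\<^sup>2) * indicator D y
      \<le> ennreal ((norm (gradient u y))\<^sup>2) * indicator D y"
      using Rademacher
    proof eventually_elim
      fix y assume "\<exists>G. GDERIV u y :> G"
      then obtain a where a: "GDERIV u y :> a" by blast
      have "\<bar>v \<bullet> a\<bar> \<le> norm v * norm a" by (rule Cauchy_Schwarz_ineq2)
      then have "\<bar>dir_deriv u v y / norm v\<bar> \<le> norm (gradient u y)"
        using v by (simp add: has_dir_deriv_dir_deriv[OF GDERIV_has_dir_deriv[OF a]] gradient_unique[OF a]
          divide_le_eq mult.commute)
      then have "(dir_deriv u v y / norm v)\<^sup>2 \<le> (norm (gradient u y))\<^sup>2" by (rule abs_le_square_iff[THEN iffD1, OF order_trans]) simp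
      then show "ennreal ((dir_deriv u v y / norm v)\<^sup>2) * indicator D y
        \<le> ennreal ((norm (gradient u y))\<^sup>2) * indicator D y"
        by (intro mult_right_mono ennreal_leI) simp_all
    qed
  qed
  also note gradient_L2
  finally have L2: "(\<integral>\<^sup>+y. ennreal ((dir_deriv u v y / norm v)\<^sup>2) * indicator D y \<partial>lborel) \<le> ennreal (grad_total * e * r ^ DIM('a))" .
  have "(\<integral>\<^sup>+y\<in>D. ennreal ((dir_deriv u v y)\<^sup>2) \<partial>lborel)
    = (\<integral>\<^sup>+y. ennreal ((norm v)\<^sup>2) * (ennreal ((dir_deriv u v y / norm v)\<^sup>2) * indicator D y) \<partial>lborel)"
    using v by (intro nn_integral_cong) (auto simp: indicator_def ennreal_mult[symmetric] power_divide)
  also have "\<dots> = ennreal ((norm v)\<^sup>2) * (\<integral>\<^sup>+y. ennreal ((dir_deriv u v y / norm v)\<^sup>2) * indicator D y \<partial>lborel)"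
    by (rule nn_integral_cmult) measurable
  also have "\<dots> \<le> ennreal ((norm v)\<^sup>2) * ennreal (grad_total * e * r ^ DIM('a))"
    by (rule mult_left_mono[OF L2]) simp
  also have "\<dots> = ennreal ((norm v)\<^sup>2 * (grad_total * e * r ^ DIM('a)))" by (simp only: ennreal_mult' zero_le_power2)
  finally show ?thesis .
qed

text \<open>Of the power k + 2 of h, k comes from the volume of a ball of radius h/4 and 2 from the
  squared gain; the length at most 2 r of the translation v supplies r^2.\<close>

lemma oscillation_wlog:
  assumes z: "z1 \<in> D" "z2 \<in> D" and h: "h = u z2 - u z1" "0 < h"
  shows "unit_ball_vol (real DIM('a)) * h ^ (DIM('a) + 2) \<le> 16 * 4 ^ DIM('a) * grad_total * e * r ^ (DIM('a) + 2)"
proof -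
  define \<omega> where "\<omega> = unit_ball_vol (real DIM('a))"
  have \<omega>: "0 < \<omega>" by (simp add: \<omega>_def)
  have zn: "norm z1 \<le> r" "norm z2 \<le> r" using z by (auto simp: D_def)
  have hr: "h \<le> r"
    using lipD[of z2 z1] norm_triangle_ineq4[of z2 z1] zn h by linarith
  define \<rho> where "\<rho> = h / 4"
  have \<rho>: "0 < \<rho>" "\<rho> < r" using h(2) hr by (auto simp: \<rho>_def)
  \<comment> \<open>Shrinking towards 0 moves points of D by at most \<rho> and makes room in D for
    the ball of radius \<rho> about them.\<close>
  define c where "c z = (1 - \<rho> / r) *\<^sub>R z" for z :: 'a
  have c: "norm (c z) \<le> r - \<rho>" "norm (c z - z) \<le> \<rho>" if "norm z \<le> r" for z
  proof -
    have f: "0 \<le> 1 - \<rho> / r" using \<rho> by simp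
    have "norm (c z) = (1 - \<rho> / r) * norm z" using f by (simp add: c_def)
    also have "\<dots> \<le> (1 - \<rho> / r) * r" using that f by (rule mult_left_mono)
    also have "\<dots> = r - \<rho>" using r by (simp add: left_diff_distrib)
    finally show "norm (c z) \<le> r - \<rho>" .
    have "c z - z = - (\<rho> / r) *\<^sub>R z" by (simp add: c_def algebra_simps)
    then have "norm (c z - z) = \<rho> / r * norm z" using \<rho> by simp
    also have "\<dots> \<le> \<rho> / r * r" using that \<rho> by (intro mult_left_mono) auto
    finally show "norm (c z - z) \<le> \<rho>" using r by simp
  qed
  define v where "v = c z2 - c z1"
  define B where "B = ball (c z1) \<rho>"
  have Bm[measurable]: "B \<in> sets borel" by (simp add: B_def)
  have [measurable]: "D \<in> sets borel" by (simp add: D_def)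
  have fin: "emeasure lborel B < \<infinity>" unfolding B_def by (rule emeasure_lborel_ball_finite)
  define m where "m = measure lborel B"
  have m: "m = \<omega> * \<rho> ^ DIM('a)" using \<rho> by (simp add: m_def B_def measure_def emeasure_ball \<omega>_def)
  have v: "norm v \<le> 2 * r"
    using norm_triangle_ineq4[of "c z2" "c z1"] c(1)[OF zn(1)] c(1)[OF zn(2)] \<rho> by (simp add: v_def)
  \<comment> \<open>y is within 2 \<rho> = h/2 of z1 and y + v within h/2 of z2; slope 1/2 costs h/4
    at either end.\<close>
  have gain: "h / 2 \<le> u (y + v) - u y" if "y \<in> B" for y
  proof -
    have y: "norm (y - c z1) < \<rho>" using that by (simp add: B_def dist_norm norm_minus_commute)
    have "norm (y - z1) \<le> norm (y - c z1) + norm (c z1 - z1)" using norm_triangle_ineq[of "y - c z1" "c z1 - z1"] by simp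
    moreover have "norm (y + v - z2) \<le> norm (y - c z1) + norm (c z2 - z2)"
      using norm_triangle_ineq[of "y - c z1" "c z2 - z2"] by (simp add: v_def algebra_simps)
    ultimately show ?thesis
      using lipD[of y z1] lipD[of "y + v" z2] y c(2)[OF zn(1)] c(2)[OF zn(2)] h(1) unfolding \<rho>_def by linarith
  qed
  have v0: "v \<noteq> 0" using gain[of "c z1"] h(2) \<rho> by (auto simp: B_def)
  obtain \<tau> where \<tau>: "0 < \<tau>" "\<tau> < 1" "(LINT y|lborel. indicator B y * (u (y + v) - u y))
    = (LINT y|lborel. indicator B y * dir_deriv u v (y + \<tau> *\<^sub>R v))"
    using integral_segment[of B v] by (auto simp: B_def)
  have inD: "y + \<tau> *\<^sub>R v \<in> D" if "y \<in> B" for y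
  proof -
    have "norm ((1 - \<tau>) *\<^sub>R c z1 + \<tau> *\<^sub>R c z2) \<le> (1 - \<tau>) * norm (c z1) + \<tau> * norm (c z2)"
      using norm_triangle_ineq[of "(1 - \<tau>) *\<^sub>R c z1" "\<tau> *\<^sub>R c z2"] \<tau> by simp
    also have "\<dots> \<le> (1 - \<tau>) * (r - \<rho>) + \<tau> * (r - \<rho>)"
      using \<tau> c(1) zn by (intro add_mono mult_left_mono) auto
    also have "\<dots> = r - \<rho>" by (simp add: algebra_simps)
    finally have "norm ((1 - \<tau>) *\<^sub>R c z1 + \<tau> *\<^sub>R c z2) \<le> r - \<rho>" .
    moreover have eq: "y + \<tau> *\<^sub>R v = (y - c z1) + ((1 - \<tau>) *\<^sub>R c z1 + \<tau> *\<^sub>R c z2)" by (simp add: v_def algebra_simps)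
    moreover have "norm (y - c z1) < \<rho>" using that by (simp add: B_def dist_norm norm_minus_commute)
    ultimately have "norm (y + \<tau> *\<^sub>R v) < r"
      using norm_triangle_ineq[of "y - c z1" "(1 - \<tau>) *\<^sub>R c z1 + \<tau> *\<^sub>R c z2"] unfolding eq by linarith
    then show ?thesis by (simp add: D_def)
  qed
  define \<phi> where "\<phi> y = dir_deriv u v (y + \<tau> *\<^sub>R v)" for y
  have \<phi>m[measurable]: "\<phi> \<in> borel_measurable borel" unfolding \<phi>_def by measurable
  have \<phi>b: "AE y in lborel. \<bar>\<phi> y\<bar> \<le> 1 / 2 * norm v"
    using AE_dir_deriv_translate[of v "\<tau> *\<^sub>R v"] by eventually_elim (unfold \<phi>_def, rule dir_deriv_bound)
  have i1: "integrable lborel (\<lambda>y. indicator B y * \<phi> y)"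
  proof (rule integrableI_bounded_set[where A=B and B="1 / 2 * norm v"])
    show "AE y in lborel. y \<in> B \<longrightarrow> norm (indicator B y * \<phi> y) \<le> 1 / 2 * norm v"
      using \<phi>b by eventually_elim simp
  qed (use fin in auto)
  have i2: "integrable lborel (\<lambda>y. indicator B y * (\<phi> y)\<^sup>2)"
  proof (rule integrableI_bounded_set[where A=B and B="(1 / 2 * norm v)\<^sup>2"])
    show "AE y in lborel. y \<in> B \<longrightarrow> norm (indicator B y * (\<phi> y)\<^sup>2) \<le> (1 / 2 * norm v)\<^sup>2"
      using \<phi>b by eventually_elim (simp add: abs_le_square_iff[symmetric])
  qed (use fin in auto)
  have "h / 2 * m = (LINT y|lborel. h / 2 * indicator B y)" by (simp add: m_def)
  also have "\<dots> \<le> (LINT y|lborel. indicator B y * (u (y + v) - u y))"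
  proof (rule integral_mono)
    show "integrable lborel (\<lambda>y. h / 2 * indicator B y)" using fin by simp
    show "integrable lborel (\<lambda>y. indicator B y * (u (y + v) - u y))"
    proof (rule integrable_bounded_support[where A=B and B="1 / 2 * norm v"])
      show "(\<lambda>y. indicator B y * (u (y + v) - u y)) \<in> borel_measurable lborel" by measurable
      show "norm (indicator B y * (u (y + v) - u y)) \<le> 1 / 2 * norm v" for y
        using lipD[of "y + v" y] by (auto simp: indicator_def)
    qed (use fin in auto)
    show "h / 2 * indicator B y \<le> indicator B y * (u (y + v) - u y)" for y
      using gain[of y] by (simp add: indicator_def)
  qed
  also have "\<dots> = (LINT y|lborel. indicator B y * \<phi> y)" unfolding \<tau>(3) \<phi>_def ..
  \<comment> \<open>Young's inequality; the term h/4 is absorbed by the gain h/2 on the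
    left.\<close>
  also have "\<dots> \<le> (LINT y|lborel. h / 4 * indicator B y + 1 / h * (indicator B y * (\<phi> y)\<^sup>2))"
  proof (rule integral_mono[OF i1])
    show "integrable lborel (\<lambda>y. h / 4 * indicator B y + 1 / h * (indicator B y * (\<phi> y)\<^sup>2))"
      using fin i2 by simp
    show "indicator B y * \<phi> y \<le> h / 4 * indicator B y + 1 / h * (indicator B y * (\<phi> y)\<^sup>2)" for y
    proof -
      have "h * \<phi> y \<le> h * (h / 4) + (\<phi> y)\<^sup>2"
        using zero_le_power2[of "\<phi> y - h / 2"] by (simp add: power2_eq_square algebra_simps)
      then have "\<phi> y \<le> h / 4 + 1 / h * (\<phi> y)\<^sup>2" using h(2) by (simp add: field_simps)
      then show ?thesis by (simp add: indicator_def)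
    qed
  qed
  also have "\<dots> = h / 4 * m + 1 / h * (LINT y|lborel. indicator B y * (\<phi> y)\<^sup>2)"
    using fin i2 by (simp add: m_def)
  also have "(LINT y|lborel. indicator B y * (\<phi> y)\<^sup>2) \<le> (2 * r)\<^sup>2 * (grad_total * e * r ^ DIM('a))"
  proof -
    have "ennreal (LINT y|lborel. indicator B y * (\<phi> y)\<^sup>2) = (\<integral>\<^sup>+y. ennreal (indicator B y * (\<phi> y)\<^sup>2) \<partial>lborel)"
      by (rule nn_integral_eq_integral[symmetric, OF i2]) simp
    also have "\<dots> \<le> (\<integral>\<^sup>+y. ennreal ((dir_deriv u v (\<tau> *\<^sub>R v + y))\<^sup>2) * indicator D (\<tau> *\<^sub>R v + y) \<partial>lborel)"
      using inD by (intro nn_integral_mono) (auto simp: indicator_def \<phi>_def add.commute)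
    also have "\<dots> = (\<integral>\<^sup>+y. ennreal ((dir_deriv u v y)\<^sup>2) * indicator D y \<partial>distr lborel borel ((+) (\<tau> *\<^sub>R v)))"
      by (rule nn_integral_distr[symmetric]) measurable
    also have "\<dots> = (\<integral>\<^sup>+y\<in>D. ennreal ((dir_deriv u v y)\<^sup>2) \<partial>lborel)" by (simp only: lborel_distr_plus)
    also have "\<dots> \<le> ennreal ((norm v)\<^sup>2 * (grad_total * e * r ^ DIM('a)))" by (rule dir_deriv_L2[OF v0])
    also have "\<dots> \<le> ennreal ((2 * r)\<^sup>2 * (grad_total * e * r ^ DIM('a)))"
      using v r e_nonneg grad_total_pos by (intro ennreal_leI mult_right_mono power_mono) auto
    finally show ?thesis using r e_nonneg grad_total_pos by (subst (asm) ennreal_le_iff) auto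
  qed
  finally have "h / 2 * m \<le> h / 4 * m + 1 / h * ((2 * r)\<^sup>2 * (grad_total * e * r ^ DIM('a)))"
    using h(2) by (simp add: divide_right_mono)
  then have "h / 4 * m \<le> 1 / h * ((2 * r)\<^sup>2 * (grad_total * e * r ^ DIM('a)))" by linarith
  then have "h\<^sup>2 * m \<le> 16 * grad_total * e * r ^ (DIM('a) + 2)"
    using h(2) by (simp add: field_simps power2_eq_square power_add)
  then show ?thesis using h(2)
    by (simp add: m \<rho>_def power_divide power_add divide_le_eq \<omega>_def mult_ac power2_eq_square)
qed

lemma oscillation:
  assumes z: "z1 \<in> D" "z2 \<in> D"
  shows "unit_ball_vol (real DIM('a)) * \<bar>u z2 - u z1\<bar> ^ (DIM('a) + 2) \<le> 16 * 4 ^ DIM('a) * grad_total * e * r ^ (DIM('a) + 2)"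
proof (cases "u z2 = u z1")
  case True
  then show ?thesis using grad_total_pos e_nonneg r by simp
next
  case False
  then show ?thesis
    using oscillation_wlog[OF z refl] oscillation_wlog[OF z(2) z(1) refl] by (cases "u z1 < u z2") auto
qed

text \<open>x_0 lies over 0 at height 0, so |u 0| is at most the distance d from 0 to P. The ball of
  radius d misses P and therefore lies in A.\<close>

lemma u_centre: "unit_ball_vol (real DIM('a)) * \<bar>u 0\<bar> ^ DIM('a) \<le> shadow_vol * e * r ^ DIM('a)"
proof -
  define \<omega> where "\<omega> = unit_ball_vol (real DIM('a))"
  have x0: "x\<^sub>0 \<in> MM" using x0 r by (simp add: MM_def cylinder_iff)
  define d where "d = infdist 0 P"
  have ud: "\<bar>u 0\<bar> \<le> d" using u_infdist[OF x0] by (simp add: d_def)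
  have d0: "0 \<le> d" by (simp add: d_def infdist_nonneg)
  obtain z where "z \<in> P" using P_ne by blast
  then have "d \<le> r" unfolding d_def using infdist_le[of z P 0] P_D by (force simp: D_def)
  have "ball 0 d \<subseteq> A"
  proof
    fix w :: 'a assume w: "w \<in> ball 0 d"
    then have "w \<in> D" using \<open>d \<le> r\<close> by (simp add: D_def)
    moreover have "w \<notin> P" using infdist_le[of w P 0] w by (auto simp: d_def)
    ultimately show "w \<in> A" using D_A_P by blast
  qed
  then have "emeasure lborel (ball (0::'a) d) \<le> emeasure lborel A" using A_open by (intro emeasure_mono) simp_all
  also note A_vol
  finally have "\<omega> * d ^ DIM('a) \<le> shadow_vol * e * r ^ DIM('a)"
    using d0 shadow_vol_pos e_nonneg r by (simp add: emeasure_ball \<omega>_def)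
  moreover have "\<omega> * \<bar>u 0\<bar> ^ DIM('a) \<le> \<omega> * d ^ DIM('a)"
    using ud by (intro mult_left_mono power_mono) (auto simp: \<omega>_def)
  ultimately show ?thesis unfolding \<omega>_def by (rule order_trans[rotated])
qed

end

text \<open>Since \<open>e \<le> 1\<close>, every root of order at most \<open>2 * k\<close> is dominated by the root of order \<open>2 * k\<close>.\<close>

lemma root_bound:
  fixes e h r K :: real
  assumes e: "0 \<le> e" "e \<le> 1" and k: "1 \<le> k" and m: "1 \<le> m" "m \<le> 2 * k" and K: "1 \<le> K" and hr: "0 \<le> h" "0 < r"
    and le: "h ^ m \<le> K * e * r ^ m"
  shows "h \<le> K * e powr (1 / (2 * real k)) * r"
proof -
  \<comment> \<open>With t in [0, 1] and t^(2 k) = e, lowering the exponent to m only increases the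
    power, and K \<ge> 1 gives K \<le> K^m.\<close>
  define t where "t = e powr (1 / (2 * real k))"
  have t: "0 \<le> t" "t \<le> 1"
    using e k by (auto simp: t_def intro: powr_le1)
  have "t ^ (2 * k) = e"
  proof (cases "e = 0")
    case True then show ?thesis using k by (simp add: t_def)
  next
    case False
    then have "t ^ (2 * k) = t powr (real (2 * k))" using e by (intro powr_realpow[symmetric]) (simp add: t_def)
    also have "\<dots> = e powr (1 / (2 * real k) * real (2 * k))" by (simp only: t_def powr_powr)
    also have "1 / (2 * real k) * real (2 * k) = 1" using k by simp
    finally show ?thesis using False e by simp
  qed
  then have "h ^ m \<le> K * t ^ (2 * k) * r ^ m" using le by simp
  also have "\<dots> \<le> K ^ m * t ^ m * r ^ m"
    using t m K hr by (intro mult_right_mono mult_mono power_decreasing self_le_power) auto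
  also have "\<dots> = (K * t * r) ^ m" by (simp add: power_mult_distrib)
  finally show ?thesis
    using t K hr m power_le_imp_le_base[of h "m - 1" "K * t * r"] by (simp add: t_def)
qed

context approx
begin

text \<open>The sum of a factor for the oscillation and one for the centre, each increased by 1
  because \<open>root_bound\<close> asks for factors at least 1.\<close>

definition height_const :: real where
  "height_const = 2 + (16 * 4 ^ DIM('a) * grad_total + shadow_vol) / unit_ball_vol (real DIM('a))"

lemma height_const_pos: "0 < height_const"
  using grad_total_pos shadow_vol_pos by (simp add: height_const_def add_pos_nonneg)

text \<open>The oscillation is taken relative to the centre. Its order k + 2 is admissible in
  \<open>root_bound\<close> because k is at least 2.\<close>

lemma u_sup:
  assumes k: "2 \<le> DIM('a)" and z: "z \<in> D"
  shows "\<bar>u z\<bar> \<le> height_const * e powr (1 / (2 * real DIM('a))) * r"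
proof -
  define \<omega> where "\<omega> = unit_ball_vol (real DIM('a))"
  have \<omega>: "0 < \<omega>" by (simp add: \<omega>_def)
  have e1: "e \<le> 1" using e_small by (simp add: small_eps_def)
  define K1 where "K1 = 1 + 16 * 4 ^ DIM('a) * grad_total / \<omega>"
  define K2 where "K2 = 1 + shadow_vol / \<omega>"
  have K: "1 \<le> K1" "1 \<le> K2" using grad_total_pos shadow_vol_pos \<omega> by (auto simp: K1_def K2_def)
  have er: "0 \<le> e * r ^ j" for j using e_nonneg r by simp
  have "\<bar>u z - u 0\<bar> \<le> K1 * e powr (1 / (2 * real DIM('a))) * r"
  proof (rule root_bound[where m="DIM('a) + 2"])
    have "\<bar>u z - u 0\<bar> ^ (DIM('a) + 2) \<le> 16 * 4 ^ DIM('a) * grad_total / \<omega> * (e * r ^ (DIM('a) + 2))"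
      using oscillation[of 0 z] z r \<omega> by (simp add: D_def \<omega>_def field_simps)
    also have "\<dots> \<le> K1 * (e * r ^ (DIM('a) + 2))" by (intro mult_right_mono er) (simp add: K1_def)
    finally show "\<bar>u z - u 0\<bar> ^ (DIM('a) + 2) \<le> K1 * e * r ^ (DIM('a) + 2)" by (simp add: mult.assoc)
  qed (use k e1 e_nonneg r K in auto)
  moreover have "\<bar>u 0\<bar> \<le> K2 * e powr (1 / (2 * real DIM('a))) * r"
  proof (rule root_bound[where m="DIM('a)"])
    have "\<bar>u 0\<bar> ^ DIM('a) \<le> shadow_vol / \<omega> * (e * r ^ DIM('a))"
      using u_centre \<omega> by (simp add: \<omega>_def field_simps)
    also have "\<dots> \<le> K2 * (e * r ^ DIM('a))" using er by (intro mult_right_mono) (auto simp: K2_def)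
    finally show "\<bar>u 0\<bar> ^ DIM('a) \<le> K2 * e * r ^ DIM('a)" by (simp add: mult.assoc)
  qed (use k e1 e_nonneg r K in auto)
  moreover have "height_const = K1 + K2" by (simp add: height_const_def K1_def K2_def \<omega>_def add_divide_distrib)
  ultimately show ?thesis by (simp add: distrib_right)
qed

end

text \<open>The final function agrees with u only on the open set D, which determines the gradient
  there.\<close>

lemma gradient_cong:
  assumes "open D" "z \<in> D" "\<And>y. y \<in> D \<Longrightarrow> f y = g y"
  shows "gradient f z = gradient g z"
proof -
  have "GDERIV f z :> G \<longleftrightarrow> GDERIV g z :> G" for G
    unfolding gderiv_def using assms
    by (intro iffI; elim has_derivative_transform_within_open) auto
  then show ?thesis by (simp only: gradient_def)
qed

section \<open>Assembling the approximation\<close>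

context approx
begin

lemma excess_quotient:
  assumes "X \<le> ennreal (B * e * r ^ DIM('a))" "B \<le> C3" "0 \<le> C3"
  shows "X / ennreal (r ^ DIM('a)) \<le> ennreal C3 * excess E x\<^sub>0 (13 * r)"
proof -
  have "B * e * r ^ DIM('a) \<le> C3 * e * r ^ DIM('a)"
    using assms(2) e_nonneg r by (intro mult_right_mono) auto
  then have "X \<le> ennreal (C3 * e * r ^ DIM('a))" using assms(1) by (meson ennreal_leI order_trans)
  then have "X / ennreal (r ^ DIM('a)) \<le> ennreal (C3 * e * r ^ DIM('a)) / ennreal (r ^ DIM('a))"
    by (rule divide_right_mono_ennreal)
  also have "\<dots> = ennreal C3 * ennreal e"
    using assms(3) e_nonneg r by (simp add: divide_ennreal ennreal_mult[symmetric])
  finally show ?thesis by (simp only: excess_e)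
qed

lemma Lipschitz_approximation:
  assumes k: "2 \<le> DIM('a)"
    and bad: "hausdorff DIM('a) (MM - M0) \<le> ennreal (bad_const * e * r ^ DIM('a))"
    and C3: "height_const \<le> C3" "bad_const + 10 ^ DIM('a) * shadow_vol \<le> C3" "grad_total \<le> C3"
  shows "\<exists>v. (1 / 2)-lipschitz_on UNIV v \<and>
    (\<forall>z. \<bar>v z\<bar> / r \<le> C3 * e powr (1 / (2 * real DIM('a)))) \<and>
    M0 \<subseteq> MM \<inter> (\<lambda>z. x\<^sub>0 + (z, v z)) ` D \<and>
    hausdorff DIM('a) (sym_diff MM ((\<lambda>z. x\<^sub>0 + (z, v z)) ` D)) / ennreal (r ^ DIM('a))
      \<le> ennreal C3 * excess E x\<^sub>0 (13 * r) \<and>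
    (\<integral>\<^sup>+ z \<in> D. ennreal ((norm (gradient v z))\<^sup>2) \<partial>lborel) / ennreal (r ^ DIM('a))
      \<le> ennreal C3 * excess E x\<^sub>0 (13 * r) \<and>
    (\<forall>x\<in>MM. \<bar>snd (x - x\<^sub>0) - v (fst (x - x\<^sub>0))\<bar> \<le> 2 * (1 / 2) * infdist (fst (x - x\<^sub>0)) P) \<and>
    (\<exists>K. K-lipschitz_on D (\<lambda>z. if z \<in> P then v z else (INF y\<in>P. v y + 1 / 2 * norm (z - y)))) \<and>
    (\<exists>K. K-lipschitz_on D (\<lambda>z. if z \<in> P then v z else (SUP y\<in>P. v y - 1 / 2 * norm (z - y)))) \<and>
    (\<forall>x\<in>MM.
      (if fst (x - x\<^sub>0) \<in> P then v (fst (x - x\<^sub>0))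
        else (SUP y\<in>P. v y - 1 / 2 * norm (fst (x - x\<^sub>0) - y))) \<le> snd (x - x\<^sub>0) \<and>
      snd (x - x\<^sub>0) \<le> (if fst (x - x\<^sub>0) \<in> P then v (fst (x - x\<^sub>0))
        else (INF y\<in>P. v y + 1 / 2 * norm (fst (x - x\<^sub>0) - y))))"
proof -
  define s where "s = height_const * e powr (1 / (2 * real DIM('a))) * r"
  have s: "0 \<le> s" using height_const_pos r by (simp add: s_def)
  have C30: "0 \<le> C3" using C3(1) height_const_pos by linarith
  \<comment> \<open>The height bound holds only on D. Clipping at it changes nothing there, keeps
    the slope, and gives the bound on the whole space.\<close>
  define v where "v z = max (- s) (min s (u z))" for z
  have vu: "v z = u z" if "z \<in> D" for z using u_sup[OF k that] by (simp add: v_def s_def[symmetric] abs_le_iff)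
  have v_lip: "\<bar>v z - v z'\<bar> \<le> 1 / 2 * norm (z - z')" for z z'
    using lipD[of z z'] unfolding v_def by linarith
  have vP: "v z = u z" if "z \<in> P" for z using vu P_D that by blast
  \<comment> \<open>On P the envelope already takes the value v z, so the case distinction
    disappears.\<close>
  have upper: "(if z \<in> P then v z else (INF y\<in>P. v y + 1 / 2 * norm (z - y))) = (INF y\<in>P. v y + 1 / 2 * norm (z - y))" for z
    using McShane(2)[OF P_ne _ v_lip] by simp
  have lower: "(if z \<in> P then v z else (SUP y\<in>P. v y - 1 / 2 * norm (z - y))) = (SUP y\<in>P. v y - 1 / 2 * norm (z - y))" for z
    using McShane_upper(2)[OF P_ne _ v_lip] by simp
  have graph: "(\<lambda>z. x\<^sub>0 + (z, v z)) ` D = (\<lambda>z. x\<^sub>0 + (z, u z)) ` D" by (intro image_cong) (auto simp: vu)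
  show ?thesis
  proof (intro exI[of _ v], unfold upper lower graph, intro conjI allI ballI)
    show "(1 / 2)-lipschitz_on UNIV v" using v_lip by (intro lipschitz_onI) (auto simp: dist_norm)
    show "\<bar>v z\<bar> / r \<le> C3 * e powr (1 / (2 * real DIM('a)))" for z
    proof -
      have "\<bar>v z\<bar> / r \<le> s / r" using s r by (intro divide_right_mono) (auto simp: v_def)
      also have "\<dots> = height_const * e powr (1 / (2 * real DIM('a)))" using r by (simp add: s_def)
      also have "\<dots> \<le> C3 * e powr (1 / (2 * real DIM('a)))" using C3(1) by (intro mult_right_mono) auto
      finally show ?thesis .
    qed
    show "M0 \<subseteq> MM \<inter> (\<lambda>z. x\<^sub>0 + (z, u z)) ` D"
    proof
      fix y assume y: "y \<in> M0"
      have "y = x\<^sub>0 + (fst (y - x\<^sub>0), u (fst (y - x\<^sub>0)))" using M0_graph[OF y] by (simp add: prod_eq_iff)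
      then show "y \<in> MM \<inter> (\<lambda>z. x\<^sub>0 + (z, u z)) ` D" using y M0_MM MM_D by blast
    qed
    show "hausdorff DIM('a) (sym_diff MM ((\<lambda>z. x\<^sub>0 + (z, u z)) ` D)) / ennreal (r ^ DIM('a))
      \<le> ennreal C3 * excess E x\<^sub>0 (13 * r)"
      using hausdorff_symdiff[OF bad refl] C3(2) C30 by (rule excess_quotient)
    have "(\<integral>\<^sup>+ z \<in> D. ennreal ((norm (gradient v z))\<^sup>2) \<partial>lborel) = (\<integral>\<^sup>+ z \<in> D. ennreal ((norm (gradient u z))\<^sup>2) \<partial>lborel)"
    proof (rule nn_integral_cong)
      fix z
      have "gradient v z = gradient u z" if "z \<in> D"
        using that vu by (intro gradient_cong[of D]) (auto simp: D_def)
      then show "ennreal ((norm (gradient v z))\<^sup>2) * indicator D z = ennreal ((norm (gradient u z))\<^sup>2) * indicator D z"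
        by (simp add: indicator_def)
    qed
    then show "(\<integral>\<^sup>+ z \<in> D. ennreal ((norm (gradient v z))\<^sup>2) \<partial>lborel) / ennreal (r ^ DIM('a))
      \<le> ennreal C3 * excess E x\<^sub>0 (13 * r)"
      using excess_quotient[OF gradient_L2 C3(3) C30] by simp
    show "\<bar>snd (x - x\<^sub>0) - v (fst (x - x\<^sub>0))\<bar> \<le> 2 * (1 / 2) * infdist (fst (x - x\<^sub>0)) P" if "x \<in> MM" for x
      using u_infdist[OF that] unfolding vu[OF MM_D[OF that]] by linarith
    show "\<exists>K. K-lipschitz_on D (\<lambda>z. INF y\<in>P. v y + 1 / 2 * norm (z - y))"
      using lipschitz_on_subset[OF McShane(1)[OF P_ne _ v_lip]] by (intro exI[of _ "1 / 2"]) simp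
    show "\<exists>K. K-lipschitz_on D (\<lambda>z. SUP y\<in>P. v y - 1 / 2 * norm (z - y))"
      using lipschitz_on_subset[OF McShane_upper(1)[OF P_ne _ v_lip]] by (intro exI[of _ "1 / 2"]) simp
    fix x assume x: "x \<in> MM"
    show "(SUP y\<in>P. v y - 1 / 2 * norm (fst (x - x\<^sub>0) - y)) \<le> snd (x - x\<^sub>0)"
    proof (rule cSUP_least[OF P_ne])
      fix y assume "y \<in> P"
      then show "v y - 1 / 2 * norm (fst (x - x\<^sub>0) - y) \<le> snd (x - x\<^sub>0)"
        using u_cone[OF x, of y] vP[of y] by linarith
    qed
    show "snd (x - x\<^sub>0) \<le> (INF y\<in>P. v y + 1 / 2 * norm (fst (x - x\<^sub>0) - y))"
    proof (rule cINF_greatest[OF P_ne])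
      fix y assume "y \<in> P"
      then show "snd (x - x\<^sub>0) \<le> v y + 1 / 2 * norm (fst (x - x\<^sub>0) - y)"
        using u_cone[OF x, of y] vP[of y] by linarith
    qed
  qed
qed

end

theorem theoremA3:
  fixes n :: nat and C\<^sub>A :: real
  assumes "n \<ge> 3" and "CARD('m::finite) = n - 1" and "C\<^sub>A \<ge> 1"
  shows "\<exists>C\<^sub>3 \<epsilon>\<^sub>3 \<delta>\<^sub>0 L :: real. C\<^sub>3 > 0 \<and> \<epsilon>\<^sub>3 > 0 \<and> \<delta>\<^sub>0 > 0 \<and> L > 0 \<and> L < 1 \<and>
    (\<forall>(r::real) (E :: ((real ^ 'm) \<times> real) set) x\<^sub>0.
       r > 0 \<and> E \<in> ahlfors_class C\<^sub>A (13 * r) \<and> x\<^sub>0 \<in> frontier E \<and>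
       excess E x\<^sub>0 (13 * r) \<le> ennreal \<epsilon>\<^sub>3 \<longrightarrow>
       (let e = excess E x\<^sub>0 (13 * r);
            M = cylinder x\<^sub>0 r \<inter> frontier E;
            M\<^sub>0 = {y \<in> M. (SUP s \<in> {0<..<8 * r}. excess E y s) < ennreal \<delta>\<^sub>0};
            D = ball (0 :: real ^ 'm) r;
            P = (\<lambda>y. fst (y - x\<^sub>0)) ` M\<^sub>0
        in \<exists>u :: real ^ 'm \<Rightarrow> real.
             L-lipschitz_on UNIV u \<and>
             (\<forall>z. \<bar>u z\<bar> / r \<le> C\<^sub>3 * enn2real e powr (1 / (2 * (real n - 1)))) \<and>
             (let \<Gamma> = (\<lambda>z. x\<^sub>0 + (z, u z)) ` D;
                  u_plus = (\<lambda>z. if z \<in> P then u z else (INF y\<in>P. u y + L * norm (z - y)));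
                  u_minus = (\<lambda>z. if z \<in> P then u z else (SUP y\<in>P. u y - L * norm (z - y)))
              in M\<^sub>0 \<subseteq> M \<inter> \<Gamma> \<and>
                 hausdorff (n - 1) (sym_diff M \<Gamma>) / ennreal (r ^ (n - 1)) \<le> ennreal C\<^sub>3 * e \<and>
                 (\<integral>\<^sup>+ z \<in> D. ennreal ((norm (gradient u z))\<^sup>2) \<partial>lborel) / ennreal (r ^ (n - 1))
                   \<le> ennreal C\<^sub>3 * e \<and>
                 (\<forall>x\<in>M. \<bar>snd (x - x\<^sub>0) - u (fst (x - x\<^sub>0))\<bar> \<le> 2 * L * infdist (fst (x - x\<^sub>0)) P) \<and>
                 (\<exists>K. K-lipschitz_on D u_plus) \<and>
                 (\<exists>K. K-lipschitz_on D u_minus) \<and>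
                 (\<forall>x\<in>M. u_minus (fst (x - x\<^sub>0)) \<le> snd (x - x\<^sub>0) \<and>
                         snd (x - x\<^sub>0) \<le> u_plus (fst (x - x\<^sub>0))))))"
proof -
  \<comment> \<open>Outside their locales the constants are functions of a type token and C_A alone,
    so \<open>C3\<close> is fixed before r, E and x_0.\<close>
  define T where "T = TYPE(real ^ 'm)"
  have k: "n - 1 = DIM(real ^ 'm)" and k': "real n - 1 = real DIM(real ^ 'm)" and k2: "2 \<le> DIM(real ^ 'm)"
    using assms(1,2) by auto
  define C3 where "C3 = max (max 1 (approx.height_const T C\<^sub>A))
    (max (small_excess.bad_const T C\<^sub>A + 10 ^ DIM(real ^ 'm) * small_excess.shadow_vol T C\<^sub>A) (approx.grad_total T C\<^sub>A))"
  note pos = const_pos[OF assms(3), of "DIM(real ^ 'm)"]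
  show ?thesis unfolding Let_def k k'
  proof (rule exI[of _ C3], rule exI[of _ "small_eps C\<^sub>A DIM(real ^ 'm)"], rule exI[of _ "good_delta C\<^sub>A DIM(real ^ 'm)"],
      rule exI[of _ "1 / 2"], intro conjI allI impI, goal_cases)
    case (6 r E x\<^sub>0)
    interpret small_excess E C\<^sub>A r x\<^sub>0
      by unfold_locales (use 6 assms(3) in auto)
    obtain A where A: "open A" "emeasure lborel A \<le> ennreal (shadow_vol * e * r ^ DIM(real ^ 'm))"
      "\<And>y. y \<in> MM - M0 \<Longrightarrow> fst y - fst x\<^sub>0 \<in> A"
      "hausdorff DIM(real ^ 'm) (MM - M0) \<le> ennreal (bad_const * e * r ^ DIM(real ^ 'm))"
      by (rule bad_set) (rule that)
    interpret approx E C\<^sub>A r x\<^sub>0 A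
      by unfold_locales (use A in auto)
    have "height_const \<le> C3" "bad_const + 10 ^ DIM(real ^ 'm) * shadow_vol \<le> C3" "grad_total \<le> C3"
      by (auto simp: C3_def T_def)
    from Lipschitz_approximation[OF k2 A(4) this, unfolded MM_def M0_def P_def D_def e_def gd_def]
    show ?case .
  qed (use pos in \<open>auto simp: C3_def\<close>)
qed

end
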